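(* Let $\varphi$ be a nonnegative function in $L^1(0,\infty)$, and let $\mathcal H_\varphi$ be the Hausdorff operator generated by $\varphi$, $\mathcal H_\varphi f(x)=\int_0^\infty f\left(\frac{x}{t}\right)\frac{\varphi(t)}{t}\,dt$. Let $\|\cdot\|_*$ be any one of the following four norms on $H^1(\mathbb R)$: (1) $\|f\|_*=\|M_\Phi f\|_{L^1(\mathbb R)}$; (2) $\|f\|_*=\|\mathcal M_\psi f\|_{L^1(\mathbb R)}$; (3) $\|f\|_*=\|f\|_{H^1_{\rm at}(\mathbb R)}$; (4) $\|f\|_*=\|f\|_{L^1(\mathbb R)}+\|H(f)\|_{L^1(\mathbb R)}$. Then $$\|\mathcal H_\varphi\|_{(H^1(\mathbb R),\|\cdot\|_* )\to(H^1(\mathbb R),\|\cdot\|_* )}=\int_0^\infty\varphi(t)\,dt.$$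
   Context: Functions are allowed to be complex-valued. For a function $\eta$ on $\mathbb R$ and $t>0$, $\eta_t(x)=t^{-1}\eta(x/t)$. Fix an arbitrary $\Phi$ in the Schwartz space $\mathcal S(\mathbb R)$ with $\int_{\mathbb R}\Phi(x)\,dx\ne0$. For $f\in L^1(\mathbb R)$, the smooth maximal function is $M_\Phi f(x)=\sup_{t>0}|f*\Phi_t(x)|$. The real Hardy space $H^1(\mathbb R)$ is the space of $f\in L^1(\mathbb R)$ with $\|M_\Phi f\|_{L^1(\mathbb R)}<\infty$; it does not depend on the choice of $\Phi$. Let $\psi$ be either an arbitrary fixed function in $\mathcal S(\mathbb R)$ with $\int_{\mathbb R}\psi(x)\,dx\neq0$, or the Poisson kernel $\psi(x)=P(x)=\frac{1}{x^2+1}$. For $f\in L^1(\mathbb R)$ the nontangential maximal function is $\mathcal M_\psi f(x)=\sup_{|x-y|<t}|\psi_t*f(y)|$, $x\in\mathbb R$ (supremum over all $y\in\mathbb R$, $t>0$ with $|x-y|<t$). An $H^1$-atom related to a (bounded) interval $B$ is a function $a$ with $\operatorname{supp} a\subset B$, $\|a\|_{L^\infty(\mathbb R)}\le|B|^{-1}$ and $\int_{\mathbb R}a(x)\,dx=0$. $H^1_{\rm at}(\mathbb R)$ is the space of $f\in L^1(\mathbb R)$ that can be written as $f=\sum_{j=1}^\infty\lambda_ja_j$ with $a_j$ $H^1$-atoms (each related to some interval) and $\lambda_j$ complex numbers with $\sum_{j=1}^\infty|\lambda_j|<\infty$; its norm is $\|f\|_{H^1_{\rm at}(\mathbb R)}=\inf\{\sum_{j=1}^\infty|\lambda_j|: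 f=\sum_{j=1}^\infty\lambda_ja_j\}$, the infimum being over all such representations. The Hilbert transform of $f\in L^1(\mathbb R)$ is $H(f)(x)=\frac1\pi\,{\rm p.v.}\int_{-\infty}^\infty\frac{f(x-y)}{y}\,dy$ for a.e. $x\in\mathbb R$. It is classical that, for $f\in L^1(\mathbb R)$, the conditions $f\in H^1(\mathbb R)$, $\mathcal M_\psi f\in L^1(\mathbb R)$, $f\in H^1_{\rm at}(\mathbb R)$ and $H(f)\in L^1(\mathbb R)$ are equivalent, and that the four norms in the claim are equivalent norms on $H^1(\mathbb R)$. $\|T\|_{(H^1(\mathbb R),\|\cdot\|_* )\to(H^1(\mathbb R),\|\cdot\|_* )}$ denotes the operator norm of $T$ with respect to $\|\cdot\|_*$. *)

theory Defs
  imports "HOL-Analysis.Analysis"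
begin

text \<open>
  Elements of \<open>L\<^sup>1(\<real>)\<close> are represented by Lebesgue integrable functions \<open>real \<Rightarrow> complex\<close>. Norms and
  maximal functions take values in \<^typ>\<open>ennreal\<close>, so that no value is lost when a supremum or an
  integral is infinite.
\<close>

definition dilate :: "real \<Rightarrow> (real \<Rightarrow> complex) \<Rightarrow> real \<Rightarrow> complex" where
  "dilate t \<eta> x = \<eta> (x / t) / of_real t"

definition conv :: "(real \<Rightarrow> complex) \<Rightarrow> (real \<Rightarrow> complex) \<Rightarrow> real \<Rightarrow> complex" where
  "conv f g x = (LINT y|lebesgue. f y * g (x - y))"

definition nderiv :: "nat \<Rightarrow> (real \<Rightarrow> complex) \<Rightarrow> real \<Rightarrow> complex" where
  "nderiv n = (\<lambda>g x. vector_derivative g (at x)) ^^ n"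

definition schwartz :: "(real \<Rightarrow> complex) \<Rightarrow> bool" where
  "schwartz f \<longleftrightarrow>
     (\<forall>n x. nderiv n f differentiable (at x)) \<and>
     (\<forall>m n. bounded (range (\<lambda>x. x ^ m *\<^sub>R nderiv n f x)))"

definition poisson_kernel :: "real \<Rightarrow> complex" where
  "poisson_kernel x = of_real (1 / (x\<^sup>2 + 1))"

definition smooth_maximal :: "(real \<Rightarrow> complex) \<Rightarrow> (real \<Rightarrow> complex) \<Rightarrow> real \<Rightarrow> ennreal" where
  "smooth_maximal \<Phi> f x = (SUP t\<in>{0<..}. ennreal (norm (conv f (dilate t \<Phi>) x)))"

definition nontangential_maximal :: "(real \<Rightarrow> complex) \<Rightarrow> (real \<Rightarrow> complex) \<Rightarrow> real \<Rightarrow> ennreal" where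
  "nontangential_maximal \<psi> f x =
     (SUP (y, t)\<in>{(y, t). \<bar>x - y\<bar> < t}. ennreal (norm (conv (dilate t \<psi>) f y)))"

definition L1_norm :: "(real \<Rightarrow> complex) \<Rightarrow> ennreal" where
  "L1_norm f = (\<integral>\<^sup>+x. ennreal (norm (f x)) \<partial>lebesgue)"

definition smooth_maximal_norm :: "(real \<Rightarrow> complex) \<Rightarrow> (real \<Rightarrow> complex) \<Rightarrow> ennreal" where
  "smooth_maximal_norm \<Phi> f = (\<integral>\<^sup>+x. smooth_maximal \<Phi> f x \<partial>lebesgue)"

definition nontangential_maximal_norm :: "(real \<Rightarrow> complex) \<Rightarrow> (real \<Rightarrow> complex) \<Rightarrow> ennreal" where
  "nontangential_maximal_norm \<psi> f = (\<integral>\<^sup>+x. nontangential_maximal \<psi> f x \<partial>lebesgue)"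

definition hardy_H1 :: "(real \<Rightarrow> complex) \<Rightarrow> (real \<Rightarrow> complex) set" where
  "hardy_H1 \<Phi> = {f. integrable lebesgue f \<and> smooth_maximal_norm \<Phi> f < \<infinity>}"

text \<open>
  The support and the supremum norm of an atom are understood modulo null sets. Requiring positive
  length excludes degenerate intervals, where \<open>|B|\<^sup>-\<^sup>1\<close> is meaningless (and would be 0 here).
\<close>

definition H1_atom :: "real set \<Rightarrow> (real \<Rightarrow> complex) \<Rightarrow> bool" where
  "H1_atom B a \<longleftrightarrow>
     is_interval B \<and> bounded B \<and> 0 < measure lebesgue B \<and>
     a \<in> borel_measurable lebesgue \<and>
     (AE x in lebesgue. x \<notin> B \<longrightarrow> a x = 0) \<and>
     (AE x in lebesgue. norm (a x) \<le> 1 / measure lebesgue B) \<and>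
     (LINT x|lebesgue. a x) = 0"

text \<open>
  Atoms have \<open>L\<^sup>1\<close> norm at most 1, so \<open>\<Sum>\<^sub>j \<lambda>\<^sub>j a\<^sub>j\<close> converges absolutely in \<open>L\<^sup>1(\<real>)\<close>; the identity
  \<open>f = \<Sum>\<^sub>j \<lambda>\<^sub>j a\<^sub>j\<close> is an identity in that space.
\<close>

definition atomic_decomp :: "(nat \<Rightarrow> complex) \<Rightarrow> (nat \<Rightarrow> real \<Rightarrow> complex) \<Rightarrow> (real \<Rightarrow> complex) \<Rightarrow> bool" where
  "atomic_decomp c a f \<longleftrightarrow>
     (\<forall>j. \<exists>B. H1_atom B (a j)) \<and>
     summable (\<lambda>j. norm (c j)) \<and>
     (\<lambda>n. L1_norm (\<lambda>x. f x - (\<Sum>j<n. c j * a j x))) \<longlonglongrightarrow> 0"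

definition atomic_norm :: "(real \<Rightarrow> complex) \<Rightarrow> ennreal" where
  "atomic_norm f = Inf {ennreal (\<Sum>j. norm (c j)) | c a. atomic_decomp c a f}"

text \<open>
  For \<open>f \<in> L\<^sup>1(\<real>)\<close> the truncated integrals converge absolutely, and the limit exists for almost every
  \<open>x\<close>; on the exceptional null set the value of \<^const>\<open>Lim\<close> is unspecified.
\<close>

definition hilbert_transform :: "(real \<Rightarrow> complex) \<Rightarrow> real \<Rightarrow> complex" where
  "hilbert_transform f x =
     of_real (1 / pi) *
     Lim (at_right 0) (\<lambda>\<epsilon>. LINT y:{y. \<epsilon> < \<bar>y\<bar>}|lebesgue. f (x - y) / of_real y)"

definition hilbert_norm :: "(real \<Rightarrow> complex) \<Rightarrow> ennreal" where
  "hilbert_norm f = L1_norm f + L1_norm (hilbert_transform f)"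

text \<open>
  For \<open>f \<in> L\<^sup>1(\<real>)\<close> and \<open>\<phi> \<in> L\<^sup>1(0,\<infinity>)\<close> the integrand below is integrable for almost every \<open>x\<close> by
  Tonelli's theorem, so the value 0 of a divergent integral matters only on a null set.
\<close>

definition hausdorff_op :: "(real \<Rightarrow> real) \<Rightarrow> (real \<Rightarrow> complex) \<Rightarrow> real \<Rightarrow> complex" where
  "hausdorff_op \<phi> f x = (LINT t:{0<..}|lebesgue. f (x / t) * of_real (\<phi> t / t))"

definition operator_norm ::
  "(real \<Rightarrow> complex) set \<Rightarrow> ((real \<Rightarrow> complex) \<Rightarrow> ennreal) \<Rightarrow>
   ((real \<Rightarrow> complex) \<Rightarrow> real \<Rightarrow> complex) \<Rightarrow> ennreal" where
  "operator_norm X N T = (SUP f\<in>{f \<in> X. N f \<le> 1}. N (T f))"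

end

theory Submission
  imports Defs
begin

text \<open>
Write \<open>D\<^sub>t f(x) = f(x/t)/t\<close>, so that the Hausdorff operator is the average
\<open>\<integral> \<phi>(t) D\<^sub>t f dt\<close>. All four norms are invariant under every \<open>D\<^sub>t\<close>, and each of them obeys
Minkowski's inequality for such averages; hence the operator norm is at most \<open>\<integral> \<phi>\<close>.

For the reverse inequality one needs functions that are almost invariant under dilations. Fix an
odd bump \<open>b\<close> and put \<open>g\<^sub>T = \<integral>\<^sub>1\<^sup>T D\<^sub>t b dt/t\<close>. Since \<open>D\<^sub>s g\<^sub>T - g\<^sub>T\<close> only sees the ends of the
window \<open>[1,T]\<close>, its norm is bounded by \<open>2 \<bar>ln s\<bar>\<close> times the norm of \<open>b\<close>, uniformly in \<open>T\<close>, whereas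
the norm of \<open>g\<^sub>T\<close> grows at least like \<open>ln T\<close>: every one of the norms dominates a multiple of the
\<open>L\<^sup>1\<close> norm on bounded continuous functions, and \<open>g\<^sub>T\<close> times the sign function has integral
proportional to \<open>ln T\<close>. It is essential here that \<open>b\<close> does not have mean zero on the half-line.
By dominated convergence in \<open>s\<close>, applying the Hausdorff operator to \<open>g\<^sub>T\<close> yields \<open>(\<integral> \<phi>) g\<^sub>T\<close> up
to an error that is small compared with the norm of \<open>g\<^sub>T\<close>. This argument is carried out once, in
\<open>operator_norm_hausdorff_op\<close>, from a list of properties of the norm; the error is itself the average
of dilations of \<open>b\<close> with a kernel of variable sign, which is why Minkowski's inequality is needed
for signed kernels.

It remains to verify the properties for each norm. For the maximal norms, Fubini's theorem under the
supremum is enough (\<open>cone_maximal_norm_dilation_average_le\<close>). For the atomic norm, the average of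
the dilations of one atom is cut into pieces along a geometric progression of ratio close to 1; each
piece is supported in an interval hardly longer than a dilate of the original one, so that it is
almost exactly an atom times its share of \<open>\<integral> \<bar>k\<bar>\<close> (\<open>atomic_norm_dilation_average_le\<close>).

The Hilbert transform is the delicate case, because the truncated integrals converge only almost
everywhere, without domination. What makes it work is the weak type (1,1) of the maximal truncated
Hilbert transform. It is obtained along the lines of Boole and Loomis: for a finite sum of point
masses the level sets of \<open>\<Sum> a\<^sub>i/(x - x\<^sub>i)\<close> have an explicitly known measure, the passage to the
maximal function rests on the monotonicity of \<open>1/(x - x\<^sub>i)\<close>, and integrable functions are limits of
point masses. It follows that principal values exist almost everywhere and depend continuously, in
measure, on the function in \<open>L\<^sup>1\<close>. Since an average of dilations is an \<open>L\<^sup>1\<close> limit of finite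
combinations of dilations, which commute with the Hilbert transform, the Hilbert transform commutes
with the average as soon as the transform of the function is integrable
(\<open>pv_dilation_average_AE\<close>).
\<close>

section \<open>Boole's identity\<close>

lemma linear_factors_degree:
  fixes g :: "'a \<Rightarrow> real"
  assumes "finite S"
  shows "degree (\<Prod>s\<in>S. [:- g s, 1:]) = card S"
    and "coeff (\<Prod>s\<in>S. [:- g s, 1:]) (card S) = 1"
proof -
  have "degree (\<Prod>s\<in>S. [:- g s, 1:]) = (\<Sum>s\<in>S. degree [:- g s, 1:])"
    by (rule degree_prod_eq_sum_degree) auto
  then show d: "degree (\<Prod>s\<in>S. [:- g s, 1:]) = card S" by simp
  have "lead_coeff (\<Prod>s\<in>S. [:- g s, 1:]) = 1" by (simp add: lead_coeff_prod)
  with d show "coeff (\<Prod>s\<in>S. [:- g s, 1:]) (card S) = 1" by simp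
qed

lemma linear_factors_second_coeff:
  fixes g :: "'a \<Rightarrow> real"
  assumes "finite S" "S \<noteq> {}"
  shows "coeff (\<Prod>s\<in>S. [:- g s, 1:]) (card S - 1) = - (\<Sum>s\<in>S. g s)"
  using assms
proof (induction S rule: finite_ne_induct)
  case (singleton x)
  then show ?case by simp
next
  case (insert x F)
  let ?p = "\<Prod>s\<in>F. [:- g s, 1:]"
  obtain m where m: "card F = Suc m"
    using insert by (metis card_gt_0_iff gr0_implies_Suc)
  have "coeff (\<Prod>s\<in>insert x F. [:- g s, 1:]) (card (insert x F) - 1)
      = coeff ([:- g x, 1:] * ?p) (Suc m)"
    using insert m by simp
  also have "\<dots> = - g x * coeff ?p (Suc m) + coeff ?p m" by simp
  also have "\<dots> = - g x - (\<Sum>s\<in>F. g s)"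
    using insert.IH linear_factors_degree(2)[of F g] insert.hyps m by simp
  finally show ?case using insert by simp
qed

text \<open>
Between two consecutive poles the function \<open>\<Sum> a\<^sub>s/(x - s)\<close> takes every value, and to the right of
the last pole every positive one. Multiplying by \<open>\<Prod>(x - s)\<close> turns this into a sign change of a
polynomial, which behaves well at the poles.
\<close>

lemma boole_root:
  fixes S :: "real set" and a :: "real \<Rightarrow> real"
  assumes S: "finite S" and a: "\<And>s. s \<in> S \<Longrightarrow> 0 < a s" and l: "0 < l" and s: "s \<in> S"
  defines "h \<equiv> \<lambda>x. \<Sum>s\<in>S. a s / (x - s)"
  obtains r where "s < r" "h r = l" "\<And>t. t \<in> S \<Longrightarrow> s < t \<Longrightarrow> r < t"
proof -
  note main = that
  define P where "P = (\<lambda>x. l * (\<Prod>s\<in>S. x - s) - (\<Sum>s\<in>S. a s * (\<Prod>t\<in>S-{s}. x - t)))"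
  have Ph: "P x = (\<Prod>s\<in>S. x - s) * (l - h x)" if "x \<notin> S" for x
  proof -
    have "(\<Prod>t\<in>S-{s}. x - t) = (\<Prod>s\<in>S. x - s) / (x - s)" if "s \<in> S" for s
      using prod.remove[OF S that, of "\<lambda>s. x - s"] that \<open>x \<notin> S\<close>
      by (metis nonzero_mult_div_cancel_left right_minus_eq)
    then have "(\<Sum>s\<in>S. a s * (\<Prod>t\<in>S-{s}. x - t)) = (\<Prod>s\<in>S. x - s) * h x"
      unfolding h_def sum_distrib_left by (intro sum.cong) auto
    then show ?thesis unfolding P_def by (simp add: algebra_simps)
  qed
  have Ps: "P s = - a s * (\<Prod>t\<in>S-{s}. s - t)" if "s \<in> S" for s
  proof -
    have "(\<Prod>t\<in>S. s - t) = 0" using S that by (auto simp: prod_zero_iff)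
    moreover have "(\<Sum>u\<in>S. a u * (\<Prod>t\<in>S-{u}. s - t)) = (\<Sum>u\<in>S. if u = s then a s * (\<Prod>t\<in>S-{s}. s - t) else 0)"
      using S that by (intro sum.cong) (auto simp: prod_zero_iff)
    ultimately show ?thesis using S that unfolding P_def by simp
  qed
  have cont: "continuous_on A P" for A
    unfolding P_def by (intro continuous_intros)
  have root: thesis if "s < b" "P s * P b < 0" "\<And>t. t \<in> S \<Longrightarrow> s < t \<Longrightarrow> b \<le> t" for b
  proof -
    have "\<exists>r. s < r \<and> r < b \<and> P r = 0"
    proof -
      have ne: "P s \<noteq> 0" "P b \<noteq> 0" using that(2) by auto
      have "\<exists>r\<ge>s. r \<le> b \<and> P r = 0"
      proof (cases "P s < 0")
        case True
        then have "0 < P b" using that(2) by (simp add: mult_less_0_iff)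
        with True show ?thesis using IVT'[of P s 0 b] cont that(1) by auto
      next
        case False
        then have "P b < 0" "0 < P s" using that(2) by (auto simp: mult_less_0_iff)
        then show ?thesis using IVT2'[of P b 0 s] cont that(1) by auto
      qed
      then show ?thesis using ne by (metis order_le_less)
    qed
    then obtain r where r: "s < r" "r < b" "P r = 0" by auto
    have "r \<notin> S" using r that(3) by force
    with r Ph[of r] S have "h r = l" by (auto simp: prod_zero_iff)
    then show thesis by (rule main[OF r(1)]) (use r that(3) in force)
  qed
  show thesis
  proof (cases "{t\<in>S. s < t} = {}")
    case True
    then have le: "\<And>t. t \<in> S \<Longrightarrow> t \<le> s" by auto
    define A where "A = (\<Sum>s\<in>S. a s)"
    \<comment> \<open>Beyond \<open>s + A / l\<close> every denominator exceeds \<open>A / l\<close>, so the sum is below l.\<close>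
    define b where "b = s + A / l + 1"
    have A0: "A \<ge> 0" unfolding A_def using a by (intro sum_nonneg) (auto intro: less_imp_le)
    have sb: "A / l + 1 \<le> b - t" "s < b" if "t \<in> S" for t
      using le[OF that] l A0 unfolding b_def by (auto simp: add_nonneg_pos)
    have pos: "0 < A / l + 1" using A0 l by (simp add: add_nonneg_pos)
    have "h b \<le> (\<Sum>s\<in>S. a s / (A / l + 1))"
      unfolding h_def
    proof (intro sum_mono divide_left_mono)
      fix i assume i: "i \<in> S"
      show "A / l + 1 \<le> b - i" using sb(1)[OF i] .
      show "0 \<le> a i" using a[OF i] by simp
      show "0 < (b - i) * (A / l + 1)" using sb(1)[OF i] pos by (simp)
    qed
    also have "\<dots> = A / (A / l + 1)" unfolding A_def by (simp add: sum_divide_distrib)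
    also have "\<dots> < l" using pos l by (simp add: field_simps)
    finally have "h b < l" .
    moreover have bS: "b \<notin> S" using le[of b] sb(2)[OF s] by auto
    moreover have "0 < (\<Prod>s\<in>S. b - s)" using sb(1) pos by (intro prod_pos) force
    ultimately have "0 < P b" using Ph[of b] by simp
    moreover have "P s < 0"
    proof -
      have "0 < (\<Prod>t\<in>S-{s}. s - t)" using le by (intro prod_pos) (force simp: less_le)
      then show ?thesis using Ps[OF s] a[OF s] by simp
    qed
    ultimately show thesis using root[of b] sb(2)[OF s] True by (auto simp: mult_less_0_iff)
  next
    case False
    define b where "b = Min {t\<in>S. s < t}"
    have fin: "finite {t\<in>S. s < t}" using S by auto
    have b: "b \<in> S" "s < b" using Min_in[OF fin False] unfolding b_def by auto
    have le: "\<And>t. t \<in> S \<Longrightarrow> s < t \<Longrightarrow> b \<le> t" unfolding b_def using fin by (auto intro: Min_le)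
    \<comment> \<open>A pole outside \<open>{s, b}\<close> does not separate s from b, so it contributes factors of equal sign to
      \<open>P s\<close> and \<open>P b\<close>; only the factor \<open>(s - b) (b - s)\<close> is negative.\<close>
    have "(\<Prod>t\<in>S-{s}. s - t) = (s - b) * (\<Prod>t\<in>S-{s}-{b}. s - t)"
      using S b by (intro prod.remove) auto
    moreover have "(\<Prod>t\<in>S-{b}. b - t) = (b - s) * (\<Prod>t\<in>S-{b}-{s}. b - t)"
      using S b s by (intro prod.remove) auto
    moreover have "S-{b}-{s} = S-{s}-{b}" by auto
    moreover have "0 < (\<Prod>t\<in>S-{s}-{b}. (s - t) * (b - t))"
    proof (intro prod_pos)
      fix t assume "t \<in> S-{s}-{b}"
      then show "0 < (s - t) * (b - t)" using le[of t] b by (cases "s < t") (auto simp: zero_less_mult_iff)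
    qed
    ultimately have "P s * P b = a s * a b * ((s - b) * (b - s)) * (\<Prod>t\<in>S-{s}-{b}. (s - t) * (b - t))"
      using Ps[OF s] Ps[OF b(1)] by (simp add: prod.distrib)
    moreover have "(s - b) * (b - s) < 0" using b by (simp add: mult_less_0_iff)
    ultimately have "P s * P b < 0"
      using a[OF s] a[OF b(1)] \<open>0 < (\<Prod>t\<in>S-{s}-{b}. (s - t) * (b - t))\<close>
      by (simp add: mult_less_0_iff zero_less_mult_iff)
    then show thesis using root[of b] b le by auto
  qed
qed

text \<open>
Boole's identity: the set is the disjoint union of the intervals from a pole to the next root, and
by Vieta's formula the sum of the roots exceeds the sum of the poles by \<open>\<Sum> a\<^sub>s / l\<close>.
\<close>

lemma boole_weak_type:
  fixes S :: "real set" and a :: "real \<Rightarrow> real"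
  assumes S: "finite S" and a: "\<And>s. s \<in> S \<Longrightarrow> 0 < a s" and l: "0 < l"
  shows "emeasure lborel {x. l < (\<Sum>s\<in>S. a s / (x - s))} \<le> ennreal ((\<Sum>s\<in>S. a s) / l)"
proof (cases "S = {}")
  case True
  then show ?thesis using l by simp
next
  case ne: False
  define h where "h = (\<lambda>x. \<Sum>s\<in>S. a s / (x - s))"
  have "\<forall>s\<in>S. \<exists>r. s < r \<and> h r = l \<and> (\<forall>t\<in>S. s < t \<longrightarrow> r < t)"
  proof
    fix s assume "s \<in> S"
    show "\<exists>r. s < r \<and> h r = l \<and> (\<forall>t\<in>S. s < t \<longrightarrow> r < t)"
    proof (rule boole_root[of S a l s])
      show "finite S" "0 < l" "s \<in> S" by fact+
      show "0 < a t" if "t \<in> S" for t using that by (rule a)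
      show ?thesis if "s < r" "(\<Sum>s\<in>S. a s / (r - s)) = l" "\<And>t. t \<in> S \<Longrightarrow> s < t \<Longrightarrow> r < t" for r
        using that unfolding h_def by auto
    qed
  qed
  then obtain r where r: "\<And>s. s \<in> S \<Longrightarrow> s < r s" "\<And>s. s \<in> S \<Longrightarrow> h (r s) = l"
      "\<And>s t. s \<in> S \<Longrightarrow> t \<in> S \<Longrightarrow> s < t \<Longrightarrow> r s < t"
    by metis
  have inj: "inj_on r S"
    proof (rule inj_onI)
    fix s t assume "s \<in> S" "t \<in> S" "r s = r t"
    then show "s = t" using r(1)[of s] r(1)[of t] r(3)[of s t] r(3)[of t s] by linarith
  qed
  have rS: "r s \<notin> S" if "s \<in> S" for s
    using r(3)[OF that, of "r s"] r(1)[OF that] by blast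
  \<comment> \<open>The polynomial \<open>l p - e\<close> has the n roots r, so it equals \<open>l q\<close>; comparing the coefficients of
    degree \<open>n - 1\<close> yields the sum of the roots.\<close>
  define p where "p = (\<Prod>s\<in>S. [:- s, 1::real:])"
  define q where "q = (\<Prod>s\<in>S. [:- r s, 1::real:])"
  define e where "e = (\<Sum>s\<in>S. smult (a s) (\<Prod>t\<in>S-{s}. [:- t, 1::real:]))"
  define D where "D = smult l p - e - smult l q"
  define n where "n = card S"
  have n: "0 < n" unfolding n_def using S ne by (simp add: card_gt_0_iff)
  have ee: "degree e \<le> n - 1"
    unfolding e_def
  proof (intro degree_sum_le S)
    fix s assume "s \<in> S"
    then show "degree (smult (a s) (\<Prod>t\<in>S - {s}. [:- t, 1::real:])) \<le> n - 1"
      using linear_factors_degree(1)[of "S-{s}" "\<lambda>s. s"] S degree_smult_le[of "a s" "\<Prod>t\<in>S - {s}. [:- t, 1::real:]"]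
      by (simp add: n_def)
  qed
  have ce: "coeff e (n - 1) = (\<Sum>s\<in>S. a s)"
    unfolding e_def coeff_sum
  proof (intro sum.cong refl)
    fix s assume "s \<in> S"
    then show "coeff (smult (a s) (\<Prod>t\<in>S - {s}. [:- t, 1::real:])) (n - 1) = a s"
      using linear_factors_degree(2)[of "S-{s}" "\<lambda>s. s"] S by (simp add: n_def)
  qed
  have D0: "poly D (r s) = 0" if "s \<in> S" for s
  proof -
    have "poly q (r s) = 0" unfolding q_def poly_prod using S that by (auto simp: prod_zero_iff)
    moreover have "poly e (r s) = poly p (r s) * h (r s)"
    proof -
      have "(\<Prod>t\<in>S-{u}. r s - t) = (\<Prod>t\<in>S. r s - t) / (r s - u)" if "u \<in> S" for u
        using prod.remove[OF S \<open>u \<in> S\<close>, of "\<lambda>t. r s - t"] that rS[OF \<open>s \<in> S\<close>]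
        by (metis nonzero_mult_div_cancel_left right_minus_eq \<open>u \<in> S\<close>)
      then show ?thesis
        unfolding e_def p_def h_def poly_sum poly_smult poly_prod sum_distrib_left
        by (intro sum.cong) auto
    qed
    ultimately show ?thesis unfolding D_def using r(2)[OF that] by simp
  qed
  have dp: "degree p = n" "coeff p n = 1" and dq: "degree q = n" "coeff q n = 1"
    using linear_factors_degree[OF S, of "\<lambda>s. s"] linear_factors_degree[OF S, of r]
    unfolding p_def q_def n_def by auto
  have degD: "degree D < n"
  proof -
    have "coeff D k = 0" if "k > n - 1" for k
    proof (cases "k = n")
      case True
      then show ?thesis using dp dq ee that unfolding D_def by (simp add: coeff_eq_0)
    next
      case False
      then have "n < k" using that by auto
      then show ?thesis using dp dq ee that unfolding D_def by (simp add: coeff_eq_0)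
    qed
    then have "degree D \<le> n - 1" by (intro degree_le) auto
    then show ?thesis using n by simp
  qed
  have "D = 0"
  proof (rule ccontr)
    assume "D \<noteq> 0"
    then have "card (r ` S) \<le> card {x. poly D x = 0}"
      using D0 by (intro card_mono poly_roots_finite) auto
    also have "\<dots> \<le> degree D" using \<open>D \<noteq> 0\<close> by (rule card_poly_roots_bound)
    finally show False using degD card_image[OF inj] n_def by simp
  qed
  then have "coeff D (n - 1) = 0" by simp
  moreover have "coeff p (n - 1) = - (\<Sum>s\<in>S. s)" "coeff q (n - 1) = - (\<Sum>s\<in>S. r s)"
    using linear_factors_second_coeff[OF S ne, of "\<lambda>s. s"] linear_factors_second_coeff[OF S ne, of r]
    unfolding p_def q_def n_def by auto
  ultimately have "l * (\<Sum>s\<in>S. r s - s) = (\<Sum>s\<in>S. a s)"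
    unfolding D_def using ce by (simp add: algebra_simps sum_subtractf)
  then have vieta: "(\<Sum>s\<in>S. r s - s) = (\<Sum>s\<in>S. a s) / l"
    using l by (simp add: field_simps)
  have "{x. l < h x} \<subseteq> S \<union> (\<Union>s\<in>S. {s<..<r s})"
  proof
    fix x assume "x \<in> {x. l < h x}"
    then have x: "l < h x" by simp
    show "x \<in> S \<union> (\<Union>s\<in>S. {s<..<r s})"
    proof (cases "x \<in> S")
      case False
      have "{t\<in>S. t < x} \<noteq> {}"
      proof
        assume "{t\<in>S. t < x} = {}"
        then have "h x \<le> 0" unfolding h_def using a False
          by (intro sum_nonpos divide_nonneg_nonpos) (force intro: less_imp_le)+
        then show False using x l by simp
      qed
      moreover define s where "s = Max {t\<in>S. t < x}"
      ultimately have s: "s \<in> S" "s < x" using Max_in[of "{t\<in>S. t < x}"] S by auto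
      have mx: "t \<le> s" if "t \<in> S" "t < x" for t unfolding s_def using S that by (auto intro: Max_ge)
      have "x < r s"
      proof (rule ccontr)
        assume "\<not> x < r s"
        then have le: "r s \<le> x" by simp
        have "h x \<le> h (r s)" unfolding h_def
        proof (rule sum_mono)
          fix t assume t: "t \<in> S"
          show "a t / (x - t) \<le> a t / (r s - t)"
          proof (cases "t < x")
            case True
            then have "t < r s" using mx[OF t] r(1)[OF s(1)] by simp
            then show ?thesis using a[OF t] le by (intro divide_left_mono) auto
          next
            case False
            then have "x < t" using t \<open>x \<notin> S\<close> by (metis linorder_cases)
            then show ?thesis using a[OF t] le by (intro divide_left_mono mult_neg_neg) auto
          qed
        qed
        then show False using x r(2)[OF s(1)] by simp
      qed
      then show ?thesis using s by auto
    qed simp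
  qed
  then have "emeasure lborel {x. l < h x} \<le> emeasure lborel (S \<union> (\<Union>s\<in>S. {s<..<r s}))"
    using S by (intro emeasure_mono) (auto intro!: sets.finite_UN simp: finite_imp_closed borel_closed)
  also have "\<dots> \<le> emeasure lborel S + emeasure lborel (\<Union>s\<in>S. {s<..<r s})"
    using S by (intro emeasure_subadditive) (auto intro!: sets.finite_UN simp: finite_imp_closed borel_closed)
  also have "\<dots> \<le> 0 + (\<Sum>s\<in>S. emeasure lborel {s<..<r s})"
    using S by (intro add_mono emeasure_subadditive_finite) (auto simp: emeasure_lborel_countable countable_finite)
  also have "\<dots> = (\<Sum>s\<in>S. ennreal (r s - s))"
    using r(1) by (auto intro!: sum.cong simp: less_imp_le)
  also have "\<dots> = ennreal (\<Sum>s\<in>S. r s - s)"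
    using r(1) by (intro sum_ennreal) (auto simp: less_imp_le)
  finally show ?thesis unfolding vieta h_def .
qed

lemma boole_weak_type_nonneg:
  fixes S :: "real set" and a :: "real \<Rightarrow> real"
  assumes S: "finite S" and a: "\<And>s. s \<in> S \<Longrightarrow> 0 \<le> a s" and l: "0 < l"
  shows "emeasure lborel {x. l < (\<Sum>s\<in>S. a s / (x - s))} \<le> ennreal ((\<Sum>s\<in>S. a s) / l)"
    and "emeasure lborel {x. (\<Sum>s\<in>S. a s / (x - s)) < - l} \<le> ennreal ((\<Sum>s\<in>S. a s) / l)"
proof -
  have main: "emeasure lborel {x. l < (\<Sum>s\<in>S. a s / (x - s))} \<le> ennreal ((\<Sum>s\<in>S. a s) / l)"
    if S: "finite S" and a: "\<And>s. s \<in> S \<Longrightarrow> 0 \<le> a s" for S and a :: "real \<Rightarrow> real"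
  proof -
    let ?S = "{s\<in>S. a s \<noteq> 0}"
    have "(\<Sum>s\<in>S. a s / (x - s)) = (\<Sum>s\<in>?S. a s / (x - s))" for x
      using S by (intro sum.mono_neutral_right) auto
    moreover have "(\<Sum>s\<in>S. a s) = (\<Sum>s\<in>?S. a s)"
      using S by (intro sum.mono_neutral_right) auto
    moreover have "0 < a s" if "s \<in> ?S" for s using a[of s] that by auto
    ultimately show ?thesis using boole_weak_type[of ?S a l] S l by auto
  qed
  show "emeasure lborel {x. l < (\<Sum>s\<in>S. a s / (x - s))} \<le> ennreal ((\<Sum>s\<in>S. a s) / l)"
    by (rule main[OF S a])
  let ?T = "uminus ` S" and ?b = "\<lambda>s. a (- s)"
  have inj: "inj_on uminus S" by simp
  have eq: "(\<Sum>s\<in>?T. ?b s / (x - s)) = - (\<Sum>s\<in>S. a s / (- x - s))" for x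
  proof -
    have "a s / (x + s) = - (a s / (- x - s))" for s
      by (metis (no_types) add.commute diff_minus_eq_add minus_diff_eq minus_divide_right uminus_add_conv_diff)
    then show ?thesis by (simp add: sum.reindex[OF inj] sum_negf)
  qed
  have eq2: "(\<Sum>s\<in>?T. ?b s) = (\<Sum>s\<in>S. a s)" by (simp add: sum.reindex[OF inj])
  have "{x. (\<Sum>s\<in>S. a s / (x - s)) < - l} = uminus -` {x. l < (\<Sum>s\<in>?T. ?b s / (x - s))}"
    unfolding vimage_def eq by (auto simp: algebra_simps)
  also have "emeasure lborel \<dots> = emeasure (distr lborel borel uminus) {x. l < (\<Sum>s\<in>?T. ?b s / (x - s))}"
    by (subst emeasure_distr) auto
  also have "\<dots> = emeasure lborel {x. l < (\<Sum>s\<in>?T. ?b s / (x - s))}"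
    by (simp add: lborel_distr_uminus)
  also have "\<dots> \<le> ennreal ((\<Sum>s\<in>?T. ?b s) / l)"
    by (rule main) (use S a in auto)
  finally show "emeasure lborel {x. (\<Sum>s\<in>S. a s / (x - s)) < - l} \<le> ennreal ((\<Sum>s\<in>S. a s) / l)"
    unfolding eq2 .
qed

lemma emeasure_UN_countable_le:
  assumes sets[measurable]: "\<And>i. i \<in> I \<Longrightarrow> X i \<in> sets M" and I[simp]: "countable I"
  shows "emeasure M (\<Union>(X ` I)) \<le> (\<integral>\<^sup>+i. emeasure M (X i) \<partial>count_space I)"
proof -
  have le: "indicator (\<Union>(X ` I)) x \<le> (\<integral>\<^sup>+ i. indicator (X i) x \<partial>count_space I :: ennreal)" for x
  proof (cases "\<exists>i\<in>I. x \<in> X i")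
    case True
    then obtain j where j: "j \<in> I" "x \<in> X j" by auto
    have "(1::ennreal) = (\<integral>\<^sup>+i. indicator {j} i \<partial>count_space I)" using j by simp
    also have "\<dots> \<le> (\<integral>\<^sup>+ i. indicator (X i) x \<partial>count_space I)"
      using j by (intro nn_integral_mono) (auto simp: indicator_def)
    finally show ?thesis by (simp add: indicator_def)
  qed (auto simp: indicator_def)
  note sets.countable_UN'[unfolded subset_eq, measurable]
  have "emeasure M (\<Union>(X ` I)) = (\<integral>\<^sup>+x. indicator (\<Union>(X ` I)) x \<partial>M)" by simp
  also have "\<dots> \<le> (\<integral>\<^sup>+x. \<integral>\<^sup>+ i. indicator (X i) x \<partial>count_space I \<partial>M)"
    by (intro nn_integral_mono le)
  also have "\<dots> = (\<integral>\<^sup>+i. \<integral>\<^sup>+x. indicator (X i) x \<partial>M \<partial>count_space I)"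
    by (simp add: nn_integral_count_space_nn_integral)
  finally show ?thesis by (simp cong: nn_integral_cong_simp)
qed

section \<open>The maximal truncated Hilbert transform is of weak type (1,1)\<close>

text \<open>
The kernel of the truncated Hilbert transform, up to the factor \<open>1/\<pi>\<close>.
\<close>

definition inv_cut :: "real \<Rightarrow> real \<Rightarrow> real" where
  "inv_cut \<epsilon> u = (if \<epsilon> < \<bar>u\<bar> then 1 / u else 0)"

lemma inv_cut_measurable [measurable]: "inv_cut \<epsilon> \<in> borel_measurable borel"
  unfolding inv_cut_def by measurable

lemma inv_cut_bound: "0 < \<epsilon> \<Longrightarrow> \<bar>inv_cut \<epsilon> u\<bar> \<le> 1 / \<epsilon>"
  unfolding inv_cut_def by (auto simp: field_simps)

text \<open>
If the sum over the points farther than \<open>r\<close> from \<open>x\<close> exceeds \<open>l\<close> at \<open>x\<close>, it does so on all of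
\<open>[x - r, x]\<close>, because each of its terms decreases there. So this half of the ball is covered by a
level set of the full sum and a level set of the sum over the points in the ball, and Boole's
identity bounds both. Disjoint balls chosen by Vitali's covering lemma have disjoint shares of the
total mass.
\<close>

lemma discrete_maximal_one_sided:
  fixes S :: "real set" and a :: "real \<Rightarrow> real"
  assumes S: "finite S" and a: "\<And>s. s \<in> S \<Longrightarrow> 0 \<le> a s" and l: "0 < l"
    and E: "E \<in> sets lborel" "\<And>x. x \<in> E \<Longrightarrow> \<exists>\<epsilon>>0. l < (\<Sum>s\<in>S. a s * inv_cut \<epsilon> (x - s))"
  shows "emeasure lborel E \<le> ennreal (40 * (\<Sum>s\<in>S. a s) / l)"
proof -
  define A where "A = (\<Sum>s\<in>S. a s)"
  have A0: "0 \<le> A" unfolding A_def using a by (rule sum_nonneg)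
  obtain r where r: "\<And>x. x \<in> E \<Longrightarrow> 0 < r x" "\<And>x. x \<in> E \<Longrightarrow> l < (\<Sum>s\<in>S. a s * inv_cut (r x) (x - s))"
    using E(2) by metis
  have rb: "0 < r x \<and> r x \<le> A / l" if x: "x \<in> E" for x
  proof -
    have "l < (\<Sum>s\<in>S. a s * inv_cut (r x) (x - s))" using r x by auto
    also have "\<dots> \<le> (\<Sum>s\<in>S. a s * (1 / r x))"
      using a inv_cut_bound[OF r(1)[OF x]] by (intro sum_mono mult_left_mono) (auto simp: abs_le_iff)
    also have "\<dots> = A / r x" unfolding A_def by (simp add: sum_divide_distrib)
    finally show ?thesis using r(1)[OF x] l by (simp add: field_simps)
  qed
  obtain C where C: "countable C" "C \<subseteq> E"
     "pairwise (\<lambda>i j. disjnt (cball i (r i)) (cball j (r j))) C"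
     "E \<subseteq> (\<Union>i\<in>C. cball i (5 * r i))"
  proof (rule Vitali_covering_lemma_cballs[of E "\<lambda>x. x" r E "A / l"])
    show "E \<subseteq> (\<Union>x\<in>E. cball x (r x))" using rb by (force simp: less_imp_le)
  qed (use rb in auto)
  define I where "I = (\<lambda>x. cball x (r x) :: real set)"
  have disj: "disjoint_family_on I C"
    using C(3) unfolding I_def pairwise_def disjoint_family_on_def disjnt_def by auto
  define G where "G = {x. l / 2 < (\<Sum>s\<in>S. a s / (x - s))}"
  have G: "emeasure lborel G \<le> ennreal (A / (l / 2))"
    unfolding G_def A_def by (rule boole_weak_type_nonneg(1)) (use S a l in auto)
  have Gm[measurable, simp]: "G \<in> sets borel" unfolding G_def by measurable
  have Im[measurable, simp]: "I x \<in> sets borel" for x unfolding I_def by simp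
  \<comment> \<open>The two terms account for the level \<open>l / 2\<close> of the full sum and of the sum over the ball.\<close>
  have key: "ennreal (r x) \<le> emeasure lborel (G \<inter> I x) + ennreal (2 * (\<Sum>s\<in>S \<inter> I x. a s) / l)" if x: "x \<in> E" for x
  proof -
    define B where "B = {y. (\<Sum>s\<in>S \<inter> I x. a s / (y - s)) < - (l / 2)}"
    have Bm[measurable, simp]: "B \<in> sets borel" unfolding B_def by measurable
    have B: "emeasure lborel B \<le> ennreal ((\<Sum>s\<in>S \<inter> I x. a s) / (l / 2))"
      unfolding B_def by (rule boole_weak_type_nonneg(2)) (use S a l in auto)
    have sub: "{x - r x..x} \<subseteq> (G \<inter> I x) \<union> B"
    proof
      fix y assume y: "y \<in> {x - r x..x}"
      then have yI: "y \<in> I x" unfolding I_def by (auto simp: dist_real_def)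
      have "l < (\<Sum>s\<in>S. a s * inv_cut (r x) (x - s))" using r x by auto
      also have "\<dots> = (\<Sum>s\<in>S - I x. a s * inv_cut (r x) (x - s))"
        using S by (intro sum.mono_neutral_right) (auto simp: I_def inv_cut_def dist_real_def)
      also have "\<dots> \<le> (\<Sum>s\<in>S - I x. a s / (y - s))"
      proof (rule sum_mono)
        fix s assume s: "s \<in> S - I x"
        then have s': "r x < \<bar>x - s\<bar>" by (auto simp: I_def dist_real_def)
        have "1 / (x - s) \<le> 1 / (y - s)"
        proof (cases "s < x")
          case True
          then have "s < x - r x" using s' by auto
          then show ?thesis using y by (intro divide_left_mono) auto
        next
          case False
          then have "x < s" using s' r(1)[OF x] by auto
          then show ?thesis using y by (intro divide_left_mono mult_neg_neg) auto
        qed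
        then show "a s * inv_cut (r x) (x - s) \<le> a s / (y - s)"
          using mult_left_mono[of _ _ "a s"] a s s' by (force simp: inv_cut_def)
      qed
      finally have "l < (\<Sum>s\<in>S - I x. a s / (y - s))" .
      moreover have "(\<Sum>s\<in>S. a s / (y - s)) = (\<Sum>s\<in>S \<inter> I x. a s / (y - s)) + (\<Sum>s\<in>S - I x. a s / (y - s))"
        using S by (rule sum.Int_Diff)
      ultimately show "y \<in> (G \<inter> I x) \<union> B"
        using yI l unfolding G_def B_def by auto
    qed
    have "ennreal (r x) = emeasure lborel {x - r x..x}" using r(1)[OF x] by simp
    also have "\<dots> \<le> emeasure lborel ((G \<inter> I x) \<union> B)" using sub by (intro emeasure_mono) auto
    also have "\<dots> \<le> emeasure lborel (G \<inter> I x) + emeasure lborel B"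
      by (intro emeasure_subadditive) auto
    also have "\<dots> \<le> emeasure lborel (G \<inter> I x) + ennreal (2 * (\<Sum>s\<in>S \<inter> I x. a s) / l)"
      using B by (intro add_mono) (auto simp: field_simps)
    finally show ?thesis .
  qed
  have s1: "(\<integral>\<^sup>+x. emeasure lborel (G \<inter> I x) \<partial>count_space C) \<le> ennreal (2 * A / l)"
  proof -
    have "(\<integral>\<^sup>+x. emeasure lborel (G \<inter> I x) \<partial>count_space C) = emeasure lborel (\<Union>x\<in>C. G \<inter> I x)"
      using C(1) disj by (intro emeasure_UN_countable[symmetric]) (auto simp: disjoint_family_on_def)
    also have "\<dots> \<le> emeasure lborel G" by (intro emeasure_mono) auto
    also have "\<dots> \<le> ennreal (2 * A / l)" using G by (simp add: field_simps)
    finally show ?thesis .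
  qed
  have s2: "(\<integral>\<^sup>+x. ennreal (2 * (\<Sum>s\<in>S \<inter> I x. a s) / l) \<partial>count_space C) \<le> ennreal (2 * A / l)"
  proof -
    have "ennreal (2 * (\<Sum>s\<in>S \<inter> I x. a s) / l) = (\<Sum>s\<in>S. ennreal (2 * a s / l) * indicator (I x) s)" for x
    proof -
      have "2 * (\<Sum>s\<in>S \<inter> I x. a s) / l = (\<Sum>s\<in>S. (2 * a s / l) * indicator (I x) s)"
      proof -
        have "(\<Sum>s\<in>S \<inter> I x. a s) = (\<Sum>s\<in>S. a s * indicator (I x) s)"
          unfolding sum.inter_restrict[OF S] by (intro sum.cong) (auto simp: indicator_def)
        then show ?thesis by (simp add: sum_distrib_left sum_divide_distrib mult_ac)
      qed
      also have "ennreal \<dots> = (\<Sum>s\<in>S. ennreal ((2 * a s / l) * indicator (I x) s))"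
        using a l by (intro sum_ennreal[symmetric]) auto
      also have "\<dots> = (\<Sum>s\<in>S. ennreal (2 * a s / l) * indicator (I x) s)"
        by (intro sum.cong) (auto simp: indicator_def)
      finally show ?thesis .
    qed
    then have "(\<integral>\<^sup>+x. ennreal (2 * (\<Sum>s\<in>S \<inter> I x. a s) / l) \<partial>count_space C)
        = (\<Sum>s\<in>S. ennreal (2 * a s / l) * (\<integral>\<^sup>+x. indicator (I x) s \<partial>count_space C))"
      by (simp add: nn_integral_sum nn_integral_cmult)
    also have "\<dots> \<le> (\<Sum>s\<in>S. ennreal (2 * a s / l) * 1)"
    proof (intro sum_mono mult_left_mono)
      fix s assume "s \<in> S"
      show "(\<integral>\<^sup>+x. indicator (I x) s \<partial>count_space C) \<le> (1::ennreal)"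
      proof (cases "\<exists>x\<in>C. s \<in> I x")
        case True
        then obtain x where x: "x \<in> C" "s \<in> I x" by auto
        then have "(\<integral>\<^sup>+y. indicator (I y) s \<partial>count_space C) = (\<integral>\<^sup>+y. indicator {x} y \<partial>count_space C)"
          using disj by (intro nn_integral_cong) (auto simp: indicator_def disjoint_family_on_def)
        also have "\<dots> = 1" using x by simp
        finally show ?thesis by simp
      next
        case False
        then have "(\<integral>\<^sup>+y. indicator (I y) s \<partial>count_space C) = (\<integral>\<^sup>+y. 0 \<partial>count_space C)"
          by (intro nn_integral_cong) (auto simp: indicator_def)
        then show ?thesis by simp
      qed
    qed simp
    also have "\<dots> = ennreal (2 * A / l)"
      unfolding A_def using a l by (subst sum_ennreal[symmetric] | simp add: sum_distrib_left sum_divide_distrib)+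
    finally show ?thesis .
  qed
  \<comment> \<open>The constant 40 is \<open>10 (2 + 2)\<close>: a ball of radius \<open>5 r\<close> has length \<open>10 r\<close>.\<close>
  have "emeasure lborel E \<le> emeasure lborel (\<Union>i\<in>C. cball i (5 * r i))"
    using C E by (intro emeasure_mono sets.countable_UN') auto
  also have "\<dots> \<le> (\<integral>\<^sup>+x. emeasure lborel (cball x (5 * r x)) \<partial>count_space C)"
    using C(1) by (intro emeasure_UN_countable_le) auto
  also have "\<dots> = (\<integral>\<^sup>+x. 10 * ennreal (r x) \<partial>count_space C)"
  proof (intro nn_integral_cong)
    fix x assume "x \<in> space (count_space C)"
    then have "0 < r x" using C(2) r(1) by auto
    then show "emeasure lborel (cball x (5 * r x)) = 10 * ennreal (r x)"
      by (simp add: cball_eq_atLeastAtMost ennreal_mult')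
  qed
  also have "\<dots> = 10 * (\<integral>\<^sup>+x. ennreal (r x) \<partial>count_space C)" by (simp add: nn_integral_cmult)
  also have "(\<integral>\<^sup>+x. ennreal (r x) \<partial>count_space C)
      \<le> (\<integral>\<^sup>+x. emeasure lborel (G \<inter> I x) + ennreal (2 * (\<Sum>s\<in>S \<inter> I x. a s) / l) \<partial>count_space C)"
    using C(2) key by (intro nn_integral_mono) auto
  also have "\<dots> \<le> ennreal (2 * A / l) + ennreal (2 * A / l)"
    by (subst nn_integral_add) (auto intro!: add_mono s1 s2)
  also have "10 * (ennreal (2 * A / l) + ennreal (2 * A / l)) = ennreal (40 * A / l)"
    using A0 l by (simp flip: ennreal_plus ennreal_mult'' ennreal_numeral)
  finally show ?thesis unfolding A_def by (simp add: mult_left_mono)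
qed

lemma isCont_inv_cut:
  assumes "0 < \<epsilon>" "\<bar>u\<bar> \<noteq> \<epsilon>"
  shows "isCont (inv_cut \<epsilon>) u"
proof (cases "\<epsilon> < \<bar>u\<bar>")
  case True
  then have "u \<in> {v. \<epsilon> < \<bar>v\<bar>}" "open {v::real. \<epsilon> < \<bar>v\<bar>}"
    by (auto intro!: open_Collect_less continuous_intros)
  moreover have "continuous_on {v. \<epsilon> < \<bar>v\<bar>} (\<lambda>v. 1 / v)"
    using assms by (intro continuous_intros) auto
  then have "continuous_on {v. \<epsilon> < \<bar>v\<bar>} (inv_cut \<epsilon>)"
    by (rule continuous_on_eq) (simp add: inv_cut_def)
  ultimately show ?thesis using continuous_on_eq_continuous_at by blast
next
  case False
  then have "u \<in> {v. \<bar>v\<bar> < \<epsilon>}" "open {v::real. \<bar>v\<bar> < \<epsilon>}"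
    using assms by (auto intro!: open_Collect_less continuous_intros)
  moreover have "continuous_on {v. \<bar>v\<bar> < \<epsilon>} (inv_cut \<epsilon>)"
    by (rule continuous_on_eq[of _ "\<lambda>_. 0"]) (auto simp: inv_cut_def)
  ultimately show ?thesis using continuous_on_eq_continuous_at by blast
qed

definition trunc :: "real \<Rightarrow> (real \<Rightarrow> 'a::{banach, second_countable_topology}) \<Rightarrow> real \<Rightarrow> 'a" where
  "trunc \<epsilon> f x = (LINT z|lborel. inv_cut \<epsilon> (x - z) *\<^sub>R f z)"

lemma inv_cut_scaleR_integrable:
  fixes f :: "real \<Rightarrow> 'a::{banach, second_countable_topology}"
  assumes f: "integrable lborel f" and e: "0 < \<epsilon>" and d: "d \<in> borel_measurable borel"
  shows "integrable lborel (\<lambda>z. inv_cut \<epsilon> (d z) *\<^sub>R f z)"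
proof (rule Bochner_Integration.integrable_bound)
  show "integrable lborel (\<lambda>z. (1 / \<epsilon>) *\<^sub>R norm (f z))" using f by simp
  have [measurable]: "f \<in> borel_measurable borel" "d \<in> borel_measurable borel"
    using f d by auto
  show "(\<lambda>z. inv_cut \<epsilon> (d z) *\<^sub>R f z) \<in> borel_measurable lborel" by measurable
  show "AE z in lborel. norm (inv_cut \<epsilon> (d z) *\<^sub>R f z) \<le> norm ((1 / \<epsilon>) *\<^sub>R norm (f z))"
    using mult_right_mono[OF inv_cut_bound[OF e]] e by (auto intro!: AE_I2)
qed

lemma AE_lborel_not_in_finite: "finite S \<Longrightarrow> AE x::real in lborel. x \<notin> S"
  by (intro AE_I'[of S] countable_imp_null_set_lborel) (auto simp: countable_finite)

lemma trunc_continuous: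
  fixes f :: "real \<Rightarrow> 'a::{banach, second_countable_topology}"
  assumes f: "integrable lborel f" and e: "0 < \<epsilon>"
  shows "continuous_on UNIV (trunc \<epsilon> f)"
proof -
  have "isCont (trunc \<epsilon> f) x" for x
    unfolding continuous_at_sequentially
  proof (intro allI impI)
    fix X assume X: "X \<longlonglongrightarrow> x"
    have [measurable]: "f \<in> borel_measurable borel" using f by auto
    show "(trunc \<epsilon> f \<circ> X) \<longlonglongrightarrow> trunc \<epsilon> f x"
      unfolding comp_def trunc_def
    proof (rule integral_dominated_convergence)
      show "integrable lborel (\<lambda>z. (1 / \<epsilon>) *\<^sub>R norm (f z))" using f by simp
      show "AE z in lborel. norm (inv_cut \<epsilon> (X i - z) *\<^sub>R f z) \<le> (1 / \<epsilon>) *\<^sub>R norm (f z)" for i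
        using mult_right_mono[OF inv_cut_bound[OF e]] e by (auto intro!: AE_I2)
      show "AE z in lborel. (\<lambda>i. inv_cut \<epsilon> (X i - z) *\<^sub>R f z) \<longlonglongrightarrow> inv_cut \<epsilon> (x - z) *\<^sub>R f z"
      proof (rule eventually_mono)
        show "AE z in lborel. z \<notin> {x - \<epsilon>, x + \<epsilon>}" by (rule AE_lborel_not_in_finite) simp
        fix z assume "z \<notin> {x - \<epsilon>, x + \<epsilon>}"
        then have "isCont (inv_cut \<epsilon>) (x - z)" using e by (intro isCont_inv_cut) auto
        moreover have "(\<lambda>i. X i - z) \<longlonglongrightarrow> x - z" using X by (intro tendsto_intros)
        ultimately have "(\<lambda>i. inv_cut \<epsilon> (X i - z)) \<longlonglongrightarrow> inv_cut \<epsilon> (x - z)"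
          by (rule isCont_tendsto_compose)
        then show "(\<lambda>i. inv_cut \<epsilon> (X i - z) *\<^sub>R f z) \<longlonglongrightarrow> inv_cut \<epsilon> (x - z) *\<^sub>R f z"
          by (intro tendsto_intros)
      qed
    qed (auto intro!: borel_measurable_scaleR measurable_compose[OF _ inv_cut_measurable])
  qed
  then show ?thesis by (simp add: continuous_on_eq_continuous_at)
qed

lemma floor_discretisation_tendsto:
  "(\<lambda>n. of_int \<lfloor>real (Suc n) * z\<rfloor> / real (Suc n)) \<longlonglongrightarrow> z"
proof (rule LIMSEQ_I)
  fix r :: real assume "0 < r"
  then obtain N where N: "inverse (real (Suc N)) < r" using reals_Archimedean by blast
  have "\<bar>of_int \<lfloor>real (Suc n) * z\<rfloor> / real (Suc n) - z\<bar> < r" if "N \<le> n" for n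
  proof -
    have "\<bar>of_int \<lfloor>real (Suc n) * z\<rfloor> / real (Suc n) - z\<bar> = \<bar>of_int \<lfloor>real (Suc n) * z\<rfloor> - real (Suc n) * z\<bar> / real (Suc n)"
    proof -
      have "c / real (Suc n) - z = (c - real (Suc n) * z) / real (Suc n)" for c
        by (simp add: diff_divide_distrib del: of_nat_Suc)
      then show ?thesis by (simp only: abs_divide abs_of_nat)
    qed
    also have "\<dots> \<le> 1 / real (Suc n)" by (intro divide_right_mono) linarith+
    also have "\<dots> \<le> inverse (real (Suc N))" using that by (simp add: field_simps)
    finally show ?thesis using N by simp
  qed
  then show "\<exists>no. \<forall>n\<ge>no. norm (of_int \<lfloor>real (Suc n) * z\<rfloor> / real (Suc n) - z) < r" by auto
qed

text \<open>
The masses of \<open>f\<close> over the intervals \<open>[k/n, (k+1)/n)\<close>, moved to their left end points, form finite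
sums of point masses whose truncated transforms converge to those of \<open>f\<close>; the bound for point
masses passes to the limit by Fatou's lemma. Restricting to rational truncations keeps the exceptional
sets of the approximations measurable.
\<close>

lemma maximal_trunc_one_sided:
  fixes f :: "real \<Rightarrow> real"
  assumes f: "integrable lborel f" and f0: "\<And>x. 0 \<le> f x" and l: "0 < l"
  shows "emeasure lborel {x. \<exists>\<epsilon>\<in>\<rat> \<inter> {0<..}. l < trunc \<epsilon> f x} \<le> ennreal (40 * (LINT x|lborel. f x) / l)"
proof -
  define d where "d n z = of_int \<lfloor>real (Suc n) * z\<rfloor> / real (Suc n)" for n z
  define S where "S n = (\<lambda>k::int. of_int k / real (Suc n)) ` {- (int (Suc n))\<^sup>2..(int (Suc n))\<^sup>2}" for n
  define b where "b n s = (LINT z|lborel. f z * indicator {z. d n z = s} z)" for n s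
  have fm[measurable]: "f \<in> borel_measurable borel" using f by auto
  have dm[measurable]: "d n \<in> borel_measurable borel" for n unfolding d_def by measurable
  have finS: "finite (S n)" for n unfolding S_def by auto
  have int_b: "integrable lborel (\<lambda>z. f z * indicator {z. d n z = s} z)" for n s
    by (rule Bochner_Integration.integrable_bound[OF f]) (auto simp: indicator_def)
  have b0: "0 \<le> b n s" for n s unfolding b_def using f0 by (intro integral_nonneg_AE) auto
  have sums: "(\<Sum>s\<in>S n. b n s * g s) = (LINT z|lborel. f z * (if d n z \<in> S n then g (d n z) else 0))" for n g
  proof -
    have "(\<Sum>s\<in>S n. b n s * g s) = (LINT z|lborel. (\<Sum>s\<in>S n. f z * indicator {z. d n z = s} z * g s))"
      unfolding b_def using int_b by (subst Bochner_Integration.integral_sum) auto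
    also have "(\<lambda>z. \<Sum>s\<in>S n. f z * indicator {z. d n z = s} z * g s) = (\<lambda>z. f z * (if d n z \<in> S n then g (d n z) else 0))"
    proof
      fix z
      have "(\<Sum>s\<in>S n. f z * indicator {z. d n z = s} z * g s) = (\<Sum>s\<in>S n. if s = d n z then f z * g s else 0)"
        by (intro sum.cong) (auto simp: indicator_def)
      then show "(\<Sum>s\<in>S n. f z * indicator {z. d n z = s} z * g s) = f z * (if d n z \<in> S n then g (d n z) else 0)"
        using finS[of n] by simp
    qed
    finally show ?thesis .
  qed
  have mass: "(\<Sum>s\<in>S n. b n s) \<le> (LINT x|lborel. f x)" for n
  proof -
    have [measurable]: "S n \<in> sets borel" using finS by (simp add: borel_closed finite_imp_closed)
    have "(\<Sum>s\<in>S n. b n s) = (LINT z|lborel. f z * (if d n z \<in> S n then 1 else 0))"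
      using sums[of n "\<lambda>_. 1"] by simp
    also have "\<dots> \<le> (LINT x|lborel. f x)"
      using f0 by (intro integral_mono Bochner_Integration.integrable_bound[OF f] AE_I2) auto
    finally show ?thesis .
  qed
  define E where "E = {x. \<exists>\<epsilon>\<in>\<rat> \<inter> {0<..}. l < trunc \<epsilon> f x}"
  define En where "En n = {x. \<exists>\<epsilon>\<in>\<rat> \<inter> {0<..}. l < (\<Sum>s\<in>S n. b n s * inv_cut \<epsilon> (x - s))}" for n
  have cnt: "countable (\<rat> \<inter> {0<..} :: real set)" using countable_rat by (rule countable_Int1)
  have Enm[measurable]: "En n \<in> sets borel" for n
  proof -
    have "En n = (\<Union>\<epsilon>\<in>\<rat> \<inter> {0<..}. {x. l < (\<Sum>s\<in>S n. b n s * inv_cut \<epsilon> (x - s))})"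
      unfolding En_def by auto
    also have "\<dots> \<in> sets borel" using cnt by (intro sets.countable_UN') auto
    finally show ?thesis .
  qed
  have Em[measurable]: "E \<in> sets borel"
  proof -
    have "E = (\<Union>\<epsilon>\<in>\<rat> \<inter> {0<..}. {x. l < trunc \<epsilon> f x})" unfolding E_def by auto
    also have "open \<dots>" using trunc_continuous[OF f]
      by (intro open_UN ballI open_Collect_less continuous_intros) auto
    finally show ?thesis by (rule borel_open)
  qed
  have lim: "eventually (\<lambda>n. x \<in> En n) sequentially" if x: "x \<in> E" for x
  proof -
    obtain \<epsilon> where e: "\<epsilon> \<in> \<rat> \<inter> {0<..}" "l < trunc \<epsilon> f x" using x unfolding E_def by auto
    then have e0: "0 < \<epsilon>" by auto
    have "(\<lambda>n. LINT z|lborel. f z * (if d n z \<in> S n then inv_cut \<epsilon> (x - d n z) else 0)) \<longlonglongrightarrow> trunc \<epsilon> f x"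
      unfolding trunc_def
    proof (rule integral_dominated_convergence)
      have [measurable]: "S n \<in> sets borel" for n using finS by (simp add: borel_closed finite_imp_closed)
      show "(\<lambda>z. f z * (if d i z \<in> S i then inv_cut \<epsilon> (x - d i z) else 0)) \<in> borel_measurable lborel" for i
        by measurable
      show "(\<lambda>z. inv_cut \<epsilon> (x - z) *\<^sub>R f z) \<in> borel_measurable lborel" by measurable
      show "integrable lborel (\<lambda>z. (1 / \<epsilon>) * f z)" using f by simp
      show "AE z in lborel. norm (f z * (if d i z \<in> S i then inv_cut \<epsilon> (x - d i z) else 0)) \<le> (1 / \<epsilon>) * f z" for i
      proof (rule AE_I2)
        fix z
        have "\<bar>if d i z \<in> S i then inv_cut \<epsilon> (x - d i z) else 0\<bar> \<le> 1 / \<epsilon>"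
          using inv_cut_bound[OF e0, of "x - d i z"] e0 by auto
        from mult_right_mono[OF this f0[of z]]
        show "norm (f z * (if d i z \<in> S i then inv_cut \<epsilon> (x - d i z) else 0)) \<le> (1 / \<epsilon>) * f z"
          using f0[of z] by (simp add: abs_mult mult.commute)
      qed
      show "AE z in lborel. (\<lambda>i. f z * (if d i z \<in> S i then inv_cut \<epsilon> (x - d i z) else 0)) \<longlonglongrightarrow> inv_cut \<epsilon> (x - z) *\<^sub>R f z"
      proof (rule eventually_mono)
        show "AE z in lborel. z \<notin> {x - \<epsilon>, x + \<epsilon>}" by (rule AE_lborel_not_in_finite) simp
        fix z assume "z \<notin> {x - \<epsilon>, x + \<epsilon>}"
        then have "isCont (inv_cut \<epsilon>) (x - z)" using e0 by (intro isCont_inv_cut) auto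
        moreover have "(\<lambda>i. x - d i z) \<longlonglongrightarrow> x - z"
          unfolding d_def by (intro tendsto_intros floor_discretisation_tendsto)
        ultimately have *: "(\<lambda>i. inv_cut \<epsilon> (x - d i z)) \<longlonglongrightarrow> inv_cut \<epsilon> (x - z)"
          by (rule isCont_tendsto_compose)
        have "eventually (\<lambda>i. d i z \<in> S i) sequentially"
        proof -
          obtain N :: nat where N: "\<bar>z\<bar> + 1 \<le> real N" using real_arch_simple by blast
          have "d i z \<in> S i" if "N \<le> i" for i
          proof -
            have i1: "1 \<le> real (Suc i)" "\<bar>z\<bar> + 1 \<le> real (Suc i)" using N that by auto
            have "\<bar>real_of_int \<lfloor>real (Suc i) * z\<rfloor>\<bar> \<le> \<bar>real (Suc i) * z\<bar> + 1" by linarith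
            also have "\<dots> \<le> real (Suc i) * \<bar>z\<bar> + real (Suc i)" using i1(1) by (simp add: abs_mult)
            also have "\<dots> = real (Suc i) * (\<bar>z\<bar> + 1)" by (simp add: algebra_simps)
            also have "\<dots> \<le> real (Suc i) * real (Suc i)" using i1 by (intro mult_left_mono) auto
            finally have "real_of_int \<bar>\<lfloor>real (Suc i) * z\<rfloor>\<bar> \<le> real_of_int ((int (Suc i))\<^sup>2)"
              by (simp add: power2_eq_square)
            then have "\<bar>\<lfloor>real (Suc i) * z\<rfloor>\<bar> \<le> (int (Suc i))\<^sup>2" by (simp only: of_int_le_iff)
            then show ?thesis unfolding S_def d_def by (intro imageI) (auto simp: abs_le_iff)
          qed
          then show ?thesis by (auto simp: eventually_sequentially)
        qed
        then have "eventually (\<lambda>i. f z * (if d i z \<in> S i then inv_cut \<epsilon> (x - d i z) else 0) = f z * inv_cut \<epsilon> (x - d i z)) sequentially"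
          by eventually_elim simp
        moreover have "(\<lambda>i. f z * inv_cut \<epsilon> (x - d i z)) \<longlonglongrightarrow> inv_cut \<epsilon> (x - z) *\<^sub>R f z"
          using tendsto_mult_left[OF *, of "f z"] by (simp add: mult.commute)
        ultimately show "(\<lambda>i. f z * (if d i z \<in> S i then inv_cut \<epsilon> (x - d i z) else 0)) \<longlonglongrightarrow> inv_cut \<epsilon> (x - z) *\<^sub>R f z"
          by (rule iffD2[OF tendsto_cong])
      qed
    qed
    then have "(\<lambda>n. \<Sum>s\<in>S n. b n s * inv_cut \<epsilon> (x - s)) \<longlonglongrightarrow> trunc \<epsilon> f x"
      unfolding sums .
    then have "eventually (\<lambda>n. l < (\<Sum>s\<in>S n. b n s * inv_cut \<epsilon> (x - s))) sequentially"
      using e(2) by (rule order_tendstoD)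
    then show ?thesis using e unfolding En_def by (auto elim!: eventually_mono)
  qed
  have bound: "emeasure lborel (En n) \<le> ennreal (40 * (LINT x|lborel. f x) / l)" for n
  proof -
    have "emeasure lborel (En n) \<le> ennreal (40 * (\<Sum>s\<in>S n. b n s) / l)"
      by (rule discrete_maximal_one_sided) (use finS b0 l Enm in \<open>auto simp: En_def\<close>)
    also have "\<dots> \<le> ennreal (40 * (LINT x|lborel. f x) / l)"
      using mass[of n] l by (intro ennreal_leI divide_right_mono) auto
    finally show ?thesis .
  qed
  have "emeasure lborel E = (\<integral>\<^sup>+x. indicator E x \<partial>lborel)" by simp
  also have "\<dots> \<le> (\<integral>\<^sup>+x. liminf (\<lambda>n. indicator (En n) x) \<partial>lborel)"
  proof (intro nn_integral_mono)
    fix x show "indicator E x \<le> liminf (\<lambda>n. indicator (En n) x :: ennreal)"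
    proof (cases "x \<in> E")
      case True
      have "1 \<le> liminf (\<lambda>n. indicator (En n) x :: ennreal)"
        using lim[OF True] by (intro Liminf_bounded) (auto elim!: eventually_mono)
      then show ?thesis using True by simp
    qed simp
  qed
  also have "\<dots> \<le> liminf (\<lambda>n. \<integral>\<^sup>+x. indicator (En n) x \<partial>lborel)"
    by (intro nn_integral_liminf) measurable
  also have "\<dots> \<le> ennreal (40 * (LINT x|lborel. f x) / l)"
    using bound by (intro Liminf_le) (auto intro!: always_eventually)
  finally show ?thesis unfolding E_def .
qed

section \<open>Almost everywhere existence of principal values\<close>

lemma L1_tendsto_by_dominated_convergence:
  fixes f :: "'b \<Rightarrow> 'a::{banach, second_countable_topology}"
  assumes "f \<in> borel_measurable M" "\<And>n. s n \<in> borel_measurable M" "integrable M w"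
    and "AE x in M. (\<lambda>n. s n x) \<longlonglongrightarrow> f x" "\<And>n. AE x in M. norm (s n x - f x) \<le> w x"
  shows "(\<lambda>n. LINT x|M. norm (s n x - f x)) \<longlonglongrightarrow> 0"
proof -
  have "(\<lambda>n. LINT x|M. norm (s n x - f x)) \<longlonglongrightarrow> (LINT x|M. 0)"
  proof (rule integral_dominated_convergence[where w = w])
    show "AE x in M. (\<lambda>n. norm (s n x - f x)) \<longlonglongrightarrow> 0"
      using assms(4) by eventually_elim (simp add: LIM_zero tendsto_norm_zero)
  qed (use assms in auto)
  then show ?thesis by simp
qed

text \<open>
A property of integrable functions on the line that is closed under sums and \<open>L\<^sup>1\<close> limits need only
be verified for multiples of indicators of half-open intervals, by Dynkin's lemma.
\<close>

lemma L1_interval_induct [consumes 1, case_names interval add lim]: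
  fixes f :: "real \<Rightarrow> 'a::{banach, second_countable_topology}"
  assumes f: "integrable lborel f"
    and interval: "\<And>a b c. P (\<lambda>x. indicator {a<..b} x *\<^sub>R c)"
    and add: "\<And>f g. integrable lborel f \<Longrightarrow> integrable lborel g \<Longrightarrow> P f \<Longrightarrow> P g \<Longrightarrow> P (\<lambda>x. f x + g x)"
    and lim: "\<And>f s. integrable lborel f \<Longrightarrow> (\<And>n. integrable lborel (s n)) \<Longrightarrow> (\<And>n. P (s n)) \<Longrightarrow>
        (\<lambda>n. LINT x|lborel. norm (s n x - f x)) \<longlonglongrightarrow> 0 \<Longrightarrow> P f"
  shows "P f"
proof -
  have bounded: "P (\<lambda>x. indicator (A \<inter> {-r<..r}) x *\<^sub>R c)" if A: "A \<in> sets borel" for A r c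
  proof -
    define G where "G = (range (\<lambda>(a, b). {a<..b}) :: real set set)"
    have bG: "sets borel = sigma_sets UNIV G"
      unfolding G_def by (subst borel_sigma_sets_Ioc) (rule sets_measure_of, simp)
    have int: "integrable lborel (\<lambda>x. indicator (A \<inter> {-r<..r}) x *\<^sub>R c)" if "A \<in> sets borel" for A c
      using that emeasure_bounded_finite[of "A \<inter> {-r<..r}"] bounded_subset[OF bounded_Ioc[of "-r" r]]
      by (intro integrable_scaleR_left integrable_real_indicator) auto
    have stable: "Int_stable G" "G \<subseteq> Pow UNIV"
      unfolding G_def by (auto simp: Int_stable_def)
    have "A \<in> sigma_sets UNIV G" using A bG by simp
    then have "\<forall>c. P (\<lambda>x. indicator (A \<inter> {-r<..r}) x *\<^sub>R c)"
    proof (induction rule: sigma_sets_induct_disjoint[OF stable, consumes 1])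
      fix A assume "A \<in> G"
      then obtain a b where "A = {a<..b}" unfolding G_def by auto
      then have "A \<inter> {-r<..r} = {max a (-r)<..min b r}" by auto
      then show "\<forall>c. P (\<lambda>x. indicator (A \<inter> {-r<..r}) x *\<^sub>R c)" using interval by simp
    next
      show "\<forall>c. P (\<lambda>x. indicator ({} \<inter> {-r<..r}) x *\<^sub>R c)" using interval[of 0 0] by simp
    next
      fix A assume A: "A \<in> sigma_sets UNIV G" and IH: "\<forall>c. P (\<lambda>x. indicator (A \<inter> {-r<..r}) x *\<^sub>R c)"
      show "\<forall>c. P (\<lambda>x. indicator ((UNIV - A) \<inter> {-r<..r}) x *\<^sub>R c)"
      proof
        fix c :: 'a
        have "P (\<lambda>x. indicator (UNIV \<inter> {-r<..r}) x *\<^sub>R c + indicator (A \<inter> {-r<..r}) x *\<^sub>R (- c))"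
        proof (rule add)
          show "integrable lborel (\<lambda>x. indicator (UNIV \<inter> {-r<..r}) x *\<^sub>R c)" by (rule int) simp
          show "integrable lborel (\<lambda>x. indicator (A \<inter> {-r<..r}) x *\<^sub>R (- c))" by (rule int) (use A bG in simp)
          show "P (\<lambda>x. indicator (UNIV \<inter> {-r<..r}) x *\<^sub>R c)" using interval[of "-r" r c] by simp
          show "P (\<lambda>x. indicator (A \<inter> {-r<..r}) x *\<^sub>R (- c))" using IH by blast
        qed
        moreover have "(\<lambda>x. indicator (UNIV \<inter> {-r<..r}) x *\<^sub>R c + indicator (A \<inter> {-r<..r}) x *\<^sub>R (- c))
            = (\<lambda>x. indicator ((UNIV - A) \<inter> {-r<..r}) x *\<^sub>R c)"
          by (auto simp: indicator_def fun_eq_iff)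
        ultimately show "P (\<lambda>x. indicator ((UNIV - A) \<inter> {-r<..r}) x *\<^sub>R c)" by simp
      qed
    next
      fix A :: "nat \<Rightarrow> real set"
      assume disj: "disjoint_family A" and rA: "range A \<subseteq> sigma_sets UNIV G"
        and IH: "\<And>i. \<forall>c. P (\<lambda>x. indicator (A i \<inter> {-r<..r}) x *\<^sub>R c)"
      have Am[measurable]: "A i \<in> sets borel" for i using rA bG by auto
      show "\<forall>c. P (\<lambda>x. indicator ((\<Union>i. A i) \<inter> {-r<..r}) x *\<^sub>R c)"
      proof
        fix c :: 'a
        define s where "s n x = (indicator ((\<Union>i<n. A i) \<inter> {-r<..r}) x :: real) *\<^sub>R c" for n x
        have s_int: "integrable lborel (s n)" for n unfolding s_def by (intro int) measurable
        have Ps: "P (s n)" for n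
        proof (induction n)
          case 0
          then show ?case using interval[of 0 0] unfolding s_def by simp
        next
          case (Suc n)
          have "s (Suc n) = (\<lambda>x. s n x + indicator (A n \<inter> {-r<..r}) x *\<^sub>R c)"
          proof
            fix x
            have "x \<notin> A n" if "x \<in> A i" "i < n" for i
              using disj that unfolding disjoint_family_on_def by (metis IntI UNIV_I empty_iff less_irrefl)
            then show "s (Suc n) x = s n x + indicator (A n \<inter> {-r<..r}) x *\<^sub>R c"
              unfolding s_def by (auto simp: indicator_def less_Suc_eq)
          qed
          then show ?case using add[OF s_int int[OF Am]] Suc IH[of n] by simp
        qed
        show "P (\<lambda>x. indicator ((\<Union>i. A i) \<inter> {-r<..r}) x *\<^sub>R c)"
        proof (rule lim[OF _ s_int Ps])
          show "integrable lborel (\<lambda>x. indicator ((\<Union>i. A i) \<inter> {-r<..r}) x *\<^sub>R c)"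
            by (rule int) measurable
          show "(\<lambda>n. LINT x|lborel. norm (s n x - indicator ((\<Union>i. A i) \<inter> {-r<..r}) x *\<^sub>R c)) \<longlonglongrightarrow> 0"
          proof (rule L1_tendsto_by_dominated_convergence[where w = "\<lambda>x. norm (indicator (UNIV \<inter> {-r<..r}) x *\<^sub>R c)"])
            show "integrable lborel (\<lambda>x. norm (indicator (UNIV \<inter> {-r<..r}) x *\<^sub>R c))"
              by (intro integrable_norm int) auto
            show "AE x in lborel. (\<lambda>n. s n x) \<longlonglongrightarrow> indicator ((\<Union>i. A i) \<inter> {-r<..r}) x *\<^sub>R c"
            proof (rule AE_I2)
              fix x
              show "(\<lambda>n. s n x) \<longlonglongrightarrow> indicator ((\<Union>i. A i) \<inter> {-r<..r}) x *\<^sub>R c"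
              proof (cases "x \<in> (\<Union>i. A i)")
                case True
                then obtain i where i: "x \<in> A i" by auto
                have "eventually (\<lambda>n. s n x = indicator ((\<Union>i. A i) \<inter> {-r<..r}) x *\<^sub>R c) sequentially"
                  unfolding eventually_sequentially
                  by (rule exI[of _ "Suc i"]) (use i in \<open>auto simp: s_def indicator_def\<close>)
                then show ?thesis by (rule tendsto_eventually)
              next
                case False
                then show ?thesis unfolding s_def by (auto simp: indicator_def)
              qed
            qed
            show "AE x in lborel. norm (s n x - indicator ((\<Union>i. A i) \<inter> {-r<..r}) x *\<^sub>R c)
                \<le> norm (indicator (UNIV \<inter> {-r<..r}) x *\<^sub>R c)" for n
              unfolding s_def by (auto simp: indicator_def intro!: AE_I2)
          qed (auto simp: s_def)
        qed
      qed
    qed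
    then show ?thesis by blast
  qed
  show ?thesis
    using f
  proof (induction rule: integrable_induct)
    case (base A c)
    show ?case
    proof (rule lim)
      show "integrable lborel (\<lambda>x. indicator A x *\<^sub>R c)"
        using base by (intro integrable_scaleR_left integrable_real_indicator) auto
      define s where "s n x = (indicator (A \<inter> {-real n<..real n}) x :: real) *\<^sub>R c" for n x
      have [measurable]: "A \<in> sets borel" using base by simp
      have fin: "emeasure lborel (A \<inter> {-real n<..real n}) < \<infinity>" for n
        using base(2) emeasure_mono[of "A \<inter> {-real n<..real n}" A lborel] base(1) by (auto intro: le_less_trans)
      show "integrable lborel (s n)" for n
        unfolding s_def using base fin by (intro integrable_scaleR_left integrable_real_indicator) auto
      show "P (s n)" for n unfolding s_def by (rule bounded) (use base in simp)
      show "(\<lambda>n. LINT x|lborel. norm (s n x - indicator A x *\<^sub>R c)) \<longlonglongrightarrow> 0"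
      proof (rule L1_tendsto_by_dominated_convergence[where w = "\<lambda>x. norm (indicator A x *\<^sub>R c)"])
        show "integrable lborel (\<lambda>x. norm (indicator A x *\<^sub>R c))"
          using base by (intro integrable_norm integrable_scaleR_left integrable_real_indicator) auto
        show "AE x in lborel. (\<lambda>n. s n x) \<longlonglongrightarrow> indicator A x *\<^sub>R c"
        proof (rule AE_I2)
          fix x :: real
          obtain N :: nat where N: "\<bar>x\<bar> < real N" using reals_Archimedean2 by blast
          have "eventually (\<lambda>n. s n x = indicator A x *\<^sub>R c) sequentially"
            unfolding eventually_sequentially
            by (rule exI[of _ N]) (use N in \<open>auto simp: s_def indicator_def\<close>)
          then show "(\<lambda>n. s n x) \<longlonglongrightarrow> indicator A x *\<^sub>R c" by (rule tendsto_eventually)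
        qed
        show "AE x in lborel. norm (s n x - indicator A x *\<^sub>R c) \<le> norm (indicator A x *\<^sub>R c)" for n
          unfolding s_def by (auto simp: indicator_def intro!: AE_I2)
      qed (auto simp: s_def)
    qed
  next
    case (add f g)
    then show ?case by (intro assms(3))
  next
    case (lim f s)
    show ?case
    proof (rule assms(4)[of f s])
      show "(\<lambda>n. LINT x|lborel. norm (s n x - f x)) \<longlonglongrightarrow> 0"
      proof (rule L1_tendsto_by_dominated_convergence[where w = "\<lambda>x. 3 * norm (f x)"])
        show "AE x in lborel. norm (s n x - f x) \<le> 3 * norm (f x)" for n
        proof (rule AE_I2)
          fix x
          have "norm (s n x - f x) \<le> norm (s n x) + norm (f x)" by (rule norm_triangle_ineq4)
          then show "norm (s n x - f x) \<le> 3 * norm (f x)" using lim.hyps(3)[of x n] by simp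
        qed
      qed (use lim.hyps in auto)
    qed (use lim in auto)
  qed
qed

lemma AE_from_small_exceptional_sets:
  assumes "\<And>e. 0 < e \<Longrightarrow> \<exists>A\<in>sets M. emeasure M A \<le> ennreal e \<and> (AE x in M. x \<notin> A \<longrightarrow> P x)"
  shows "AE x in M. P x"
proof -
  have "\<forall>n::nat. \<exists>A\<in>sets M. emeasure M A \<le> ennreal (1 / real (Suc n)) \<and> (AE x in M. x \<notin> A \<longrightarrow> P x)"
    using assms by auto
  then obtain A where A: "\<And>n::nat. A n \<in> sets M" "\<And>n. emeasure M (A n) \<le> ennreal (1 / real (Suc n))"
      "\<And>n. AE x in M. x \<notin> A n \<longrightarrow> P x"
    by metis
  have "emeasure M (\<Inter>n. A n) \<le> 0"
  proof (rule LIMSEQ_le_const)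
    show "(\<lambda>n. ennreal (1 / real (Suc n))) \<longlonglongrightarrow> 0"
      using LIMSEQ_inverse_real_of_nat by (intro tendsto_ennrealI[where x=0, simplified]) (simp add: inverse_eq_divide)
    have "emeasure M (\<Inter>n. A n) \<le> ennreal (1 / real (Suc n))" for n
      using A(1) by (intro order_trans[OF emeasure_mono A(2)]) auto
    then show "\<exists>N. \<forall>n\<ge>N. emeasure M (\<Inter>n. A n) \<le> ennreal (1 / real (Suc n))" by auto
  qed
  then have "(\<Inter>n. A n) \<in> null_sets M" using A(1) by (intro null_setsI) auto
  then have "AE x in M. x \<notin> (\<Inter>n. A n)" by (rule AE_not_in)
  moreover have "AE x in M. \<forall>n. x \<notin> A n \<longrightarrow> P x" using A(3) by (subst AE_all_countable) blast
  ultimately show ?thesis by eventually_elim auto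
qed

lemma convergent_at_right_0I:
  fixes F :: "real \<Rightarrow> 'a::complete_space"
  assumes "\<And>e. 0 < e \<Longrightarrow> \<exists>\<eta>>0. \<forall>a b. 0 < a \<and> a < \<eta> \<and> 0 < b \<and> b < \<eta> \<longrightarrow> dist (F a) (F b) \<le> e"
  shows "\<exists>L. (F \<longlongrightarrow> L) (at_right 0)"
proof -
  let ?X = "\<lambda>n. F (inverse (real (Suc n)))"
  have lim0: "(\<lambda>n. inverse (real (Suc n))) \<longlonglongrightarrow> 0" by (rule LIMSEQ_inverse_real_of_nat)
  have ev: "\<exists>N. \<forall>n\<ge>N. inverse (real (Suc n)) < \<eta>" if "0 < \<eta>" for \<eta>
    using order_tendstoD(2)[OF lim0 that] by (simp add: eventually_sequentially)
  have "Cauchy ?X"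
  proof (rule metric_CauchyI)
    fix e :: real assume "0 < e"
    then obtain \<eta> where eta: "0 < \<eta>" "\<And>a b. 0 < a \<Longrightarrow> a < \<eta> \<Longrightarrow> 0 < b \<Longrightarrow> b < \<eta> \<Longrightarrow> dist (F a) (F b) \<le> e / 2"
      using assms[of "e / 2"] by auto
    obtain N where N: "\<forall>n\<ge>N. inverse (real (Suc n)) < \<eta>" using ev[OF eta(1)] by auto
    show "\<exists>M. \<forall>m\<ge>M. \<forall>n\<ge>M. dist (?X m) (?X n) < e"
    proof (intro exI allI impI)
      fix m n assume "N \<le> m" "N \<le> n"
      then have "dist (?X m) (?X n) \<le> e / 2" using N by (intro eta(2)) auto
      then show "dist (?X m) (?X n) < e" using \<open>0 < e\<close> by simp
    qed
  qed
  then obtain L where L: "?X \<longlonglongrightarrow> L" using Cauchy_convergent convergent_def by blast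
  have "(F \<longlongrightarrow> L) (at_right 0)"
  proof (rule tendstoI)
    fix e :: real assume e: "0 < e"
    then obtain \<eta> where eta: "0 < \<eta>" "\<And>a b. 0 < a \<Longrightarrow> a < \<eta> \<Longrightarrow> 0 < b \<Longrightarrow> b < \<eta> \<Longrightarrow> dist (F a) (F b) \<le> e / 2"
      using assms[of "e / 2"] by auto
    have "eventually (\<lambda>n. inverse (real (Suc n)) < \<eta>) sequentially" by (rule order_tendstoD(2)[OF lim0 eta(1)])
    moreover have "eventually (\<lambda>n. dist (?X n) L < e / 2) sequentially" using L e by (intro tendstoD) auto
    ultimately have "eventually (\<lambda>n. inverse (real (Suc n)) < \<eta> \<and> dist (?X n) L < e / 2) sequentially"
      by eventually_elim simp
    then obtain n where n: "inverse (real (Suc n)) < \<eta>" "dist (?X n) L < e / 2"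
      by (auto simp: eventually_sequentially)
    have "dist (F a) L < e" if "0 < a" "a < \<eta>" for a
    proof -
      have "dist (F a) L \<le> dist (F a) (?X n) + dist (?X n) L" by (rule dist_triangle)
      also have "dist (F a) (?X n) \<le> e / 2" using that n(1) by (intro eta(2)) auto
      finally show ?thesis using n(2) by simp
    qed
    then show "eventually (\<lambda>a. dist (F a) L < e) (at_right 0)"
      using eta(1) by (auto simp: eventually_at_right_field)
  qed
  then show ?thesis by blast
qed

lemma inv_cut_minus [simp]: "inv_cut \<epsilon> (- u) = - inv_cut \<epsilon> u"
  unfolding inv_cut_def by auto

lemma trunc_reflect:
  fixes f :: "real \<Rightarrow> 'a::{banach, second_countable_topology}"
  shows "trunc \<epsilon> (\<lambda>z. f (- z)) x = - trunc \<epsilon> f (- x)"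
proof -
  have "trunc \<epsilon> (\<lambda>z. f (- z)) x = (LINT z|lborel. inv_cut \<epsilon> (x + z) *\<^sub>R f z)"
    unfolding trunc_def
    by (subst lborel_integral_real_affine[where c = "-1" and t = 0]) auto
  also have "\<dots> = (LINT z|lborel. - (inv_cut \<epsilon> (- x - z) *\<^sub>R f z))"
  proof (rule Bochner_Integration.integral_cong)
    show "inv_cut \<epsilon> (x + z) *\<^sub>R f z = - (inv_cut \<epsilon> (- x - z) *\<^sub>R f z)" for z
      using inv_cut_minus[of \<epsilon> "x + z"] by simp
  qed simp
  also have "\<dots> = - trunc \<epsilon> f (- x)" unfolding trunc_def by simp
  finally show ?thesis .
qed

lemma trunc_add:
  fixes f g :: "real \<Rightarrow> 'a::{banach, second_countable_topology}"
  assumes "integrable lborel f" "integrable lborel g" "0 < \<epsilon>"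
  shows "trunc \<epsilon> (\<lambda>x. f x + g x) x = trunc \<epsilon> f x + trunc \<epsilon> g x"
  unfolding trunc_def scaleR_add_right
  using assms by (intro Bochner_Integration.integral_add inv_cut_scaleR_integrable) auto

lemma trunc_diff:
  fixes f g :: "real \<Rightarrow> 'a::{banach, second_countable_topology}"
  assumes "integrable lborel f" "integrable lborel g" "0 < \<epsilon>"
  shows "trunc \<epsilon> (\<lambda>x. f x - g x) x = trunc \<epsilon> f x - trunc \<epsilon> g x"
  unfolding trunc_def scaleR_diff_right
  using assms by (intro Bochner_Integration.integral_diff inv_cut_scaleR_integrable) auto

lemma trunc_bounded_linear:
  fixes f :: "real \<Rightarrow> 'a::{banach, second_countable_topology}"
    and T :: "'a \<Rightarrow> 'b::{banach, second_countable_topology}"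
  assumes "integrable lborel f" "0 < \<epsilon>" "bounded_linear T"
  shows "trunc \<epsilon> (\<lambda>x. T (f x)) x = T (trunc \<epsilon> f x)"
proof -
  have "(LINT z|lborel. inv_cut \<epsilon> (x - z) *\<^sub>R T (f z)) = (LINT z|lborel. T (inv_cut \<epsilon> (x - z) *\<^sub>R f z))"
    by (simp add: linear_simps(5)[OF assms(3)])
  also have "\<dots> = T (LINT z|lborel. inv_cut \<epsilon> (x - z) *\<^sub>R f z)"
    using assms by (intro integral_bounded_linear inv_cut_scaleR_integrable) auto
  finally show ?thesis unfolding trunc_def .
qed

text \<open>
Truncations are continuous from the right in \<open>\<epsilon>\<close>, so the suprema over real and over rational
\<open>\<epsilon>\<close> agree.
\<close>

lemma trunc_exceed_rational:
  fixes f :: "real \<Rightarrow> 'a::{banach, second_countable_topology}"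
  assumes f: "integrable lborel f" and e: "0 < \<epsilon>" and l: "l < norm (trunc \<epsilon> f x)"
  shows "\<exists>\<epsilon>\<in>\<rat> \<inter> {0<..}. l < norm (trunc \<epsilon> f x)"
proof -
  have "\<exists>q\<in>\<rat>. \<epsilon> < q \<and> q < \<epsilon> + inverse (real (Suc n))" for n
    by (rule Rats_dense_in_real) simp
  then obtain q where q: "\<And>n. q n \<in> \<rat>" "\<And>n. \<epsilon> < q n" "\<And>n. q n < \<epsilon> + inverse (real (Suc n))"
    by metis
  have [measurable]: "f \<in> borel_measurable borel" using f by auto
  have ql: "q \<longlonglongrightarrow> \<epsilon>"
  proof (rule real_tendsto_sandwich[of "\<lambda>_. \<epsilon>" q sequentially "\<lambda>n. \<epsilon> + inverse (real (Suc n))" \<epsilon>])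
    show "(\<lambda>n. \<epsilon> + inverse (real (Suc n))) \<longlonglongrightarrow> \<epsilon>"
      using tendsto_add[OF tendsto_const LIMSEQ_inverse_real_of_nat, of \<epsilon>] by simp
    show "eventually (\<lambda>n. \<epsilon> \<le> q n) sequentially"
      using q(2) by (intro always_eventually allI less_imp_le)
    show "eventually (\<lambda>n. q n \<le> \<epsilon> + inverse (real (Suc n))) sequentially"
      using q(3) by (intro always_eventually allI less_imp_le)
  qed simp
  have "(\<lambda>n. trunc (q n) f x) \<longlonglongrightarrow> trunc \<epsilon> f x"
    unfolding trunc_def
  proof (rule integral_dominated_convergence)
    show "integrable lborel (\<lambda>z. (1 / \<epsilon>) *\<^sub>R norm (f z))" using f by simp
    show "AE z in lborel. norm (inv_cut (q i) (x - z) *\<^sub>R f z) \<le> (1 / \<epsilon>) *\<^sub>R norm (f z)" for i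
    proof (rule AE_I2)
      fix z
      have "0 < q i" using e q(2)[of i] by simp
      then have "\<bar>inv_cut (q i) (x - z)\<bar> \<le> 1 / q i" by (rule inv_cut_bound)
      also have "\<dots> \<le> 1 / \<epsilon>" using e q(2)[of i] by (intro divide_left_mono) auto
      finally show "norm (inv_cut (q i) (x - z) *\<^sub>R f z) \<le> (1 / \<epsilon>) *\<^sub>R norm (f z)"
        using mult_right_mono[of _ "1 / \<epsilon>" "norm (f z)"] by simp
    qed
    show "AE z in lborel. (\<lambda>i. inv_cut (q i) (x - z) *\<^sub>R f z) \<longlonglongrightarrow> inv_cut \<epsilon> (x - z) *\<^sub>R f z"
    proof (rule AE_I2, intro tendsto_intros)
      fix z
      have "eventually (\<lambda>i. inv_cut (q i) (x - z) = inv_cut \<epsilon> (x - z)) sequentially"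
      proof (cases "\<epsilon> < \<bar>x - z\<bar>")
        case True
        from order_tendstoD(2)[OF ql True] show ?thesis
          by eventually_elim (use True in \<open>auto simp: inv_cut_def\<close>)
      next
        case False
        have "inv_cut (q i) (x - z) = inv_cut \<epsilon> (x - z)" for i using False q(2)[of i] by (auto simp: inv_cut_def)
        then show ?thesis by simp
      qed
      then show "(\<lambda>i. inv_cut (q i) (x - z)) \<longlonglongrightarrow> inv_cut \<epsilon> (x - z)" by (rule tendsto_eventually)
    qed
  qed (auto intro!: borel_measurable_scaleR measurable_compose[OF _ inv_cut_measurable])
  then have "(\<lambda>n. norm (trunc (q n) f x)) \<longlonglongrightarrow> norm (trunc \<epsilon> f x)" by (rule tendsto_norm)
  then have "eventually (\<lambda>n. l < norm (trunc (q n) f x)) sequentially" using l by (rule order_tendstoD)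
  then obtain n where "l < norm (trunc (q n) f x)" by (auto simp: eventually_sequentially)
  moreover have "q n \<in> \<rat> \<inter> {0<..}" using q(1,2)[of n] e by auto
  ultimately show ?thesis by blast
qed

lemma maximal_trunc_open:
  fixes f :: "real \<Rightarrow> 'a::{banach, second_countable_topology}"
  assumes f: "integrable lborel f"
  shows "open {x. \<exists>\<epsilon>>0. l < norm (trunc \<epsilon> f x)}"
proof -
  have "{x. \<exists>\<epsilon>>0. l < norm (trunc \<epsilon> f x)} = (\<Union>\<epsilon>\<in>{0<..}. {x. l < norm (trunc \<epsilon> f x)})" by auto
  also have "open \<dots>" using trunc_continuous[OF f]
    by (intro open_UN ballI open_Collect_less continuous_intros) auto
  finally show ?thesis .
qed

lemma maximal_trunc_nonneg:
  fixes f :: "real \<Rightarrow> real"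
  assumes f: "integrable lborel f" and f0: "\<And>x. 0 \<le> f x" and l: "0 < l"
  shows "emeasure lborel {x. \<exists>\<epsilon>>0. l < norm (trunc \<epsilon> f x)} \<le> ennreal (80 * (LINT x|lborel. f x) / l)"
proof -
  define E where "E f = {x. \<exists>\<epsilon>\<in>\<rat> \<inter> {0<..}. l < trunc \<epsilon> f x}" for f
  have fr: "integrable lborel (\<lambda>z. f (- z))"
    using lborel_integrable_real_affine[OF f, of "-1" 0] by simp
  have Em: "E g \<in> sets borel" if "integrable lborel g" for g
  proof -
    have "E g = (\<Union>\<epsilon>\<in>\<rat> \<inter> {0<..}. {x. l < trunc \<epsilon> g x})" unfolding E_def by auto
    also have "open \<dots>" using trunc_continuous[OF that]
      by (intro open_UN ballI open_Collect_less continuous_intros) auto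
    finally show ?thesis by (rule borel_open)
  qed
  note [measurable] = Em[OF f] Em[OF fr]
  have sub: "{x. \<exists>\<epsilon>>0. l < norm (trunc \<epsilon> f x)} \<subseteq> E f \<union> uminus -` E (\<lambda>z. f (- z))"
  proof
    fix x assume "x \<in> {x. \<exists>\<epsilon>>0. l < norm (trunc \<epsilon> f x)}"
    then have "\<exists>\<epsilon>\<in>\<rat> \<inter> {0<..}. l < norm (trunc \<epsilon> f x)"
      using trunc_exceed_rational[OF f] by blast
    then obtain \<epsilon> where "\<epsilon> \<in> \<rat> \<inter> {0<..}" "l < norm (trunc \<epsilon> f x)" by blast
    then show "x \<in> E f \<union> uminus -` E (\<lambda>z. f (- z))"
      unfolding E_def by (auto simp: trunc_reflect abs_if split: if_splits)
  qed
  have m2: "emeasure lborel (uminus -` E (\<lambda>z. f (- z))) = emeasure lborel (E (\<lambda>z. f (- z)))"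
  proof -
    have "emeasure lborel (uminus -` E (\<lambda>z. f (- z))) = emeasure (distr lborel borel uminus) (E (\<lambda>z. f (- z)))"
      by (subst emeasure_distr) (auto simp: Em[OF fr])
    then show ?thesis by (simp add: lborel_distr_uminus)
  qed
  have im: "uminus -` E (\<lambda>z. f (- z)) \<in> sets borel"
    using measurable_sets[OF borel_measurable_uminus[OF measurable_ident] Em[OF fr]] by simp
  have "emeasure lborel {x. \<exists>\<epsilon>>0. l < norm (trunc \<epsilon> f x)} \<le> emeasure lborel (E f \<union> uminus -` E (\<lambda>z. f (- z)))"
    using sub im Em[OF f] by (intro emeasure_mono) auto
  also have "\<dots> \<le> emeasure lborel (E f) + emeasure lborel (uminus -` E (\<lambda>z. f (- z)))"
    using im Em[OF f] by (intro emeasure_subadditive) auto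
  also have "\<dots> \<le> ennreal (40 * (LINT x|lborel. f x) / l) + ennreal (40 * (LINT x|lborel. f (- x)) / l)"
    unfolding m2 unfolding E_def using f0 by (intro add_mono maximal_trunc_one_sided f fr l) auto
  also have "(LINT x|lborel. f (- x)) = (LINT x|lborel. f x)"
    by (subst lborel_integral_real_affine[where c = "-1" and t = 0]) auto
  also have "ennreal (40 * (LINT x|lborel. f x) / l) + ennreal (40 * (LINT x|lborel. f x) / l) = ennreal (80 * (LINT x|lborel. f x) / l)"
    using f0 l by (subst ennreal_plus[symmetric]) (auto intro!: divide_nonneg_pos)
  finally show ?thesis .
qed

theorem maximal_trunc_weak_type:
  fixes f :: "real \<Rightarrow> complex"
  assumes f: "integrable lborel f" and l: "0 < l"
  shows "emeasure lborel {x. \<exists>\<epsilon>>0. l < norm (trunc \<epsilon> f x)} \<le> ennreal (1280 * (LINT x|lborel. norm (f x)) / l)"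
proof -
  define g :: "nat \<Rightarrow> real \<Rightarrow> real" where
    "g i x = (if i = 0 then max (Re (f x)) 0 else if i = 1 then max (- Re (f x)) 0
       else if i = 2 then max (Im (f x)) 0 else max (- Im (f x)) 0)" for i x
  have fm[measurable]: "f \<in> borel_measurable borel" using f by auto
  have gm[measurable]: "g i \<in> borel_measurable borel" for i unfolding g_def by measurable
  have g_le: "g i x \<le> norm (f x)" and g0: "0 \<le> g i x" for i x
    unfolding g_def using abs_Re_le_cmod[of "f x"] abs_Im_le_cmod[of "f x"] by auto
  have gi: "integrable lborel (g i)" for i
    by (rule Bochner_Integration.integrable_bound[OF f]) (use g_le g0 in auto)
  \<comment> \<open>Four nonnegative parts, each at level \<open>l / 4\<close> with constant 80, give \<open>1280 = 4 * 4 * 80\<close>.\<close>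
  define M where "M i = {x. \<exists>\<epsilon>>0. l / 4 < norm (trunc \<epsilon> (g i) x)}" for i
  have Mm: "M i \<in> sets borel" for i
    unfolding M_def by (intro borel_open maximal_trunc_open gi)
  have sub: "{x. \<exists>\<epsilon>>0. l < norm (trunc \<epsilon> f x)} \<subseteq> (\<Union>i\<in>{..<4}. M i)"
  proof
    fix x assume "x \<in> {x. \<exists>\<epsilon>>0. l < norm (trunc \<epsilon> f x)}"
    then obtain \<epsilon> where e: "0 < \<epsilon>" "l < norm (trunc \<epsilon> f x)" by auto
    have Re: "Re (trunc \<epsilon> f x) = trunc \<epsilon> (g 0) x - trunc \<epsilon> (g 1) x"
      by (subst trunc_bounded_linear[symmetric, OF f e(1) bounded_linear_Re],
          subst trunc_diff[symmetric, OF gi gi e(1)]) (auto simp: g_def max_def intro!: arg_cong[where f = "\<lambda>h. trunc \<epsilon> h x"])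
    have Im: "Im (trunc \<epsilon> f x) = trunc \<epsilon> (g 2) x - trunc \<epsilon> (g 3) x"
      by (subst trunc_bounded_linear[symmetric, OF f e(1) bounded_linear_Im],
          subst trunc_diff[symmetric, OF gi gi e(1)]) (auto simp: g_def max_def intro!: arg_cong[where f = "\<lambda>h. trunc \<epsilon> h x"])
    have "norm (trunc \<epsilon> f x) \<le> \<bar>trunc \<epsilon> (g 0) x\<bar> + \<bar>trunc \<epsilon> (g 1) x\<bar> + (\<bar>trunc \<epsilon> (g 2) x\<bar> + \<bar>trunc \<epsilon> (g 3) x\<bar>)"
      using cmod_le[of "trunc \<epsilon> f x"] unfolding Re Im by linarith
    then have "l / 4 < \<bar>trunc \<epsilon> (g 0) x\<bar> \<or> l / 4 < \<bar>trunc \<epsilon> (g 1) x\<bar> \<or> l / 4 < \<bar>trunc \<epsilon> (g 2) x\<bar> \<or> l / 4 < \<bar>trunc \<epsilon> (g 3) x\<bar>"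
      using e(2) by linarith
    then have "x \<in> M 0 \<or> x \<in> M 1 \<or> x \<in> M 2 \<or> x \<in> M 3" using e(1) unfolding M_def by auto
    then show "x \<in> (\<Union>i\<in>{..<4}. M i)" by (force simp: lessThan_iff)
  qed
  have "emeasure lborel {x. \<exists>\<epsilon>>0. l < norm (trunc \<epsilon> f x)} \<le> emeasure lborel (\<Union>i\<in>{..<4}. M i)"
    using sub Mm by (intro emeasure_mono) auto
  also have "\<dots> \<le> (\<Sum>i\<in>{..<4}. emeasure lborel (M i))"
    using Mm by (intro emeasure_subadditive_finite) auto
  also have "\<dots> \<le> (\<Sum>i\<in>{..<4::nat}. ennreal (320 * (LINT x|lborel. norm (f x)) / l))"
  proof (rule sum_mono)
    fix i :: nat
    have "emeasure lborel (M i) \<le> ennreal (80 * (LINT x|lborel. g i x) / (l / 4))"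
      unfolding M_def by (rule maximal_trunc_nonneg) (use gi g0 l in auto)
    also have "\<dots> \<le> ennreal (320 * (LINT x|lborel. norm (f x)) / l)"
    proof (rule ennreal_leI)
      have "(LINT x|lborel. g i x) \<le> (LINT x|lborel. norm (f x))"
        using gi f g_le by (intro integral_mono) auto
      then show "80 * (LINT x|lborel. g i x) / (l / 4) \<le> 320 * (LINT x|lborel. norm (f x)) / l"
        using l by (simp add: field_simps)
    qed
    finally show "emeasure lborel (M i) \<le> ennreal (320 * (LINT x|lborel. norm (f x)) / l)" .
  qed
  also have "\<dots> = ennreal (1280 * (LINT x|lborel. norm (f x)) / l)"
    using l by (subst sum_ennreal) auto
  finally show ?thesis .
qed

text \<open>
Where the function is constant, the difference of two truncations integrates an odd kernel.
\<close>

lemma trunc_locally_constant: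
  fixes f :: "real \<Rightarrow> 'a::{banach, second_countable_topology}"
  assumes f: "integrable lborel f" and e: "0 < \<epsilon>" "0 < \<delta>"
    and c: "\<And>z. \<bar>x - z\<bar> \<le> \<epsilon> \<Longrightarrow> f z = f x" "\<And>z. \<bar>x - z\<bar> \<le> \<delta> \<Longrightarrow> f z = f x"
  shows "trunc \<epsilon> f x = trunc \<delta> f x"
proof -
  let ?d = "\<lambda>u. inv_cut \<epsilon> u - inv_cut \<delta> u"
  have "trunc \<epsilon> f x - trunc \<delta> f x = (LINT z|lborel. ?d (x - z) *\<^sub>R f z)"
    using inv_cut_scaleR_integrable[OF f e(1), of "\<lambda>z. x - z"] inv_cut_scaleR_integrable[OF f e(2), of "\<lambda>z. x - z"]
    unfolding trunc_def by (simp add: scaleR_diff_left)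
  also have "\<dots> = (LINT z|lborel. ?d (x - z) *\<^sub>R f x)"
  proof (rule Bochner_Integration.integral_cong)
    fix z
    show "?d (x - z) *\<^sub>R f z = ?d (x - z) *\<^sub>R f x"
    proof (cases "\<bar>x - z\<bar> \<le> \<epsilon> \<or> \<bar>x - z\<bar> \<le> \<delta>")
      case True
      then have "f z = f x" using c(1)[of z] c(2)[of z] by blast
      then show ?thesis by simp
    qed (simp add: inv_cut_def)
  qed simp
  also have "\<dots> = (LINT z|lborel. ?d z *\<^sub>R f x)"
    by (subst lborel_integral_real_affine[where c = "-1" and t = x]) auto
  also have "\<dots> = 0"
  proof -
    have "(LINT z|lborel. ?d z *\<^sub>R f x) = (LINT z|lborel. - (?d z *\<^sub>R f x))"
      by (subst lborel_integral_real_affine[where c = "-1" and t = 0])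
         (auto simp: algebra_simps)
    then have "(LINT z|lborel. ?d z *\<^sub>R f x) = - (LINT z|lborel. ?d z *\<^sub>R f x)" by simp
    then show ?thesis by (simp add: eq_neg_iff_add_eq_0 flip: scaleR_2)
  qed
  finally show ?thesis by simp
qed

text \<open>
For indicators of intervals the truncations are eventually constant away from the end points. The
oscillation of the truncations of a limit is controlled by the maximal function of the difference,
which is small outside a small set.
\<close>

theorem trunc_convergent_AE:
  fixes f :: "real \<Rightarrow> complex"
  assumes "integrable lborel f"
  shows "AE x in lborel. \<exists>L. ((\<lambda>\<epsilon>. trunc \<epsilon> f x) \<longlongrightarrow> L) (at_right 0)"
  using assms
proof (induct rule: L1_interval_induct)
  case (interval a b c)
  have "AE x in lborel. x \<notin> {a, b}" by (rule AE_lborel_not_in_finite) simp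
  then show ?case
  proof eventually_elim
    fix x :: real assume x: "x \<notin> {a, b}"
    let ?f = "\<lambda>x. indicator {a<..b} x *\<^sub>R c"
    define \<eta> where "\<eta> = min \<bar>x - a\<bar> \<bar>x - b\<bar> / 2"
    have \<eta>: "0 < \<eta>" using x unfolding \<eta>_def by auto
    have const: "?f z = ?f x" if "\<bar>x - z\<bar> \<le> \<eta>" for z
    proof -
      have "\<bar>x - z\<bar> \<le> \<bar>x - a\<bar> / 2" "\<bar>x - z\<bar> \<le> \<bar>x - b\<bar> / 2" using that unfolding \<eta>_def by auto
      then have "a < z \<longleftrightarrow> a < x" "z \<le> b \<longleftrightarrow> x \<le> b" using x by (auto simp: abs_if split: if_splits)
      then have "z \<in> {a<..b} \<longleftrightarrow> x \<in> {a<..b}" by simp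
      then show ?thesis by (simp add: indicator_def)
    qed
    have "emeasure lborel {a<..b} < \<infinity>" by (cases "a \<le> b") auto
    then have int: "integrable lborel ?f"
      by (intro integrable_scaleR_left integrable_real_indicator) auto
    have "trunc \<epsilon> ?f x = trunc \<eta> ?f x" if "0 < \<epsilon>" "\<epsilon> < \<eta>" for \<epsilon>
      using that \<eta> const by (intro trunc_locally_constant int) auto
    then have "eventually (\<lambda>\<epsilon>. trunc \<epsilon> ?f x = trunc \<eta> ?f x) (at_right 0)"
      using \<eta> by (auto simp: eventually_at_right_field)
    then have "((\<lambda>\<epsilon>. trunc \<epsilon> ?f x) \<longlongrightarrow> trunc \<eta> ?f x) (at_right 0)" by (rule tendsto_eventually)
    then show "\<exists>L. ((\<lambda>\<epsilon>. trunc \<epsilon> ?f x) \<longlongrightarrow> L) (at_right 0)" by blast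
  qed
next
  case (add f g)
  from add(3,4) show ?case
  proof eventually_elim
    fix x assume "\<exists>L. ((\<lambda>\<epsilon>. trunc \<epsilon> f x) \<longlongrightarrow> L) (at_right 0)" "\<exists>L. ((\<lambda>\<epsilon>. trunc \<epsilon> g x) \<longlongrightarrow> L) (at_right 0)"
    then obtain L M where "((\<lambda>\<epsilon>. trunc \<epsilon> f x) \<longlongrightarrow> L) (at_right 0)" "((\<lambda>\<epsilon>. trunc \<epsilon> g x) \<longlongrightarrow> M) (at_right 0)"
      by auto
    then have "((\<lambda>\<epsilon>. trunc \<epsilon> f x + trunc \<epsilon> g x) \<longlongrightarrow> L + M) (at_right 0)" by (rule tendsto_add)
    moreover have "eventually (\<lambda>\<epsilon>. trunc \<epsilon> f x + trunc \<epsilon> g x = trunc \<epsilon> (\<lambda>x. f x + g x) x) (at_right 0)"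
      using add(1,2) by (auto simp: eventually_at_right_field trunc_add intro!: exI[of _ 1])
    ultimately show "\<exists>L. ((\<lambda>\<epsilon>. trunc \<epsilon> (\<lambda>x. f x + g x) x) \<longlongrightarrow> L) (at_right 0)"
      by (blast intro: Lim_transform_eventually)
  qed
next
  case (lim f s)
  define Q where "Q e x \<longleftrightarrow> (\<exists>\<eta>>0. \<forall>a b. 0 < a \<and> a < \<eta> \<and> 0 < b \<and> b < \<eta> \<longrightarrow> dist (trunc a f x) (trunc b f x) \<le> e)" for e x
  have "AE x in lborel. Q e x" if e: "0 < e" for e
  proof (rule AE_from_small_exceptional_sets)
    fix \<delta> :: real assume \<delta>: "0 < \<delta>"
    have "(\<lambda>n. 1280 * (LINT x|lborel. norm (s n x - f x)) / (e / 3)) \<longlonglongrightarrow> 1280 * 0 / (e / 3)"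
      by (intro tendsto_intros lim) (use e in auto)
    then have "eventually (\<lambda>n. 1280 * (LINT x|lborel. norm (s n x - f x)) / (e / 3) < \<delta>) sequentially"
      using \<delta> by (intro order_tendstoD) auto
    then obtain n where n: "1280 * (LINT x|lborel. norm (s n x - f x)) / (e / 3) < \<delta>"
      by (auto simp: eventually_sequentially)
    have int: "integrable lborel (\<lambda>x. s n x - f x)" using lim by auto
    define A where "A = {x. \<exists>\<epsilon>>0. e / 3 < norm (trunc \<epsilon> (\<lambda>x. s n x - f x) x)}"
    have "A \<in> sets borel" unfolding A_def by (rule borel_open[OF maximal_trunc_open[OF int]])
    then have "A \<in> sets lborel" by simp
    moreover have "emeasure lborel A \<le> ennreal \<delta>"
      unfolding A_def
      by (rule order_trans[OF maximal_trunc_weak_type[OF int]]) (use e n in \<open>auto intro!: ennreal_leI\<close>)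
    moreover have "AE x in lborel. x \<notin> A \<longrightarrow> Q e x"
      using lim(3)[of n]
    proof eventually_elim
      fix x assume "\<exists>L. ((\<lambda>\<epsilon>. trunc \<epsilon> (s n) x) \<longlongrightarrow> L) (at_right 0)"
      then obtain L where "((\<lambda>\<epsilon>. trunc \<epsilon> (s n) x) \<longlongrightarrow> L) (at_right 0)" by auto
      then have "eventually (\<lambda>\<epsilon>. dist (trunc \<epsilon> (s n) x) L < e / 6) (at_right 0)"
        using e by (intro tendstoD) auto
      then obtain \<eta> where \<eta>: "0 < \<eta>" "\<And>a. 0 < a \<Longrightarrow> a < \<eta> \<Longrightarrow> dist (trunc a (s n) x) L < e / 6"
        by (auto simp: eventually_at_right_field)
      show "x \<notin> A \<longrightarrow> Q e x"
      proof
        assume "x \<notin> A"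
        have near: "dist (trunc a f x) (trunc a (s n) x) \<le> e / 3" if "0 < a" for a
        proof (rule ccontr)
          assume "\<not> ?thesis"
          then have "x \<in> A" unfolding A_def using that lim(1) lim(2)[of n]
            by (auto simp: trunc_diff not_le dist_norm norm_minus_commute intro!: exI[of _ a])
          then show False using \<open>x \<notin> A\<close> by simp
        qed
        have "dist (trunc a f x) (trunc b f x) \<le> e" if "0 < a" "a < \<eta>" "0 < b" "b < \<eta>" for a b
        proof -
          have "dist (trunc a f x) (trunc b f x) \<le> dist (trunc a f x) (trunc a (s n) x)
              + dist (trunc a (s n) x) L + (dist (trunc b (s n) x) L + dist (trunc b f x) (trunc b (s n) x))"
            by (smt (verit) dist_commute dist_triangle)
          also have "\<dots> \<le> e / 3 + e / 6 + (e / 6 + e / 3)"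
            using near[OF that(1)] near[OF that(3)] \<eta>(2)[OF that(1,2)] \<eta>(2)[OF that(3,4)]
            by (intro add_mono) auto
          finally show ?thesis by simp
        qed
        then show "Q e x" unfolding Q_def using \<eta>(1) by blast
      qed
    qed
    ultimately show "\<exists>A\<in>sets lborel. emeasure lborel A \<le> ennreal \<delta> \<and> (AE x in lborel. x \<notin> A \<longrightarrow> Q e x)"
      by blast
  qed
  then have "AE x in lborel. \<forall>k. Q (1 / real (Suc k)) x" by (subst AE_all_countable) auto
  then show ?case
  proof eventually_elim
    fix x assume Qx: "\<forall>k. Q (1 / real (Suc k)) x"
    show "\<exists>L. ((\<lambda>\<epsilon>. trunc \<epsilon> f x) \<longlongrightarrow> L) (at_right 0)"
    proof (rule convergent_at_right_0I)
      fix e :: real assume "0 < e"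
      then obtain k where "1 / real (Suc k) < e" using nat_approx_posE by blast
      with Qx[rule_format, of k] show "\<exists>\<eta>>0. \<forall>a b. 0 < a \<and> a < \<eta> \<and> 0 < b \<and> b < \<eta> \<longrightarrow> dist (trunc a f x) (trunc b f x) \<le> e"
        unfolding Q_def by (meson less_imp_le order_trans)
    qed
  qed
qed

definition pv :: "(real \<Rightarrow> complex) \<Rightarrow> real \<Rightarrow> complex" where
  "pv f x = Lim (at_right 0) (\<lambda>\<epsilon>. trunc \<epsilon> f x)"

lemma pv_tendsto_AE:
  assumes "integrable lborel f"
  shows "AE x in lborel. ((\<lambda>\<epsilon>. trunc \<epsilon> f x) \<longlongrightarrow> pv f x) (at_right 0)"
  using trunc_convergent_AE[OF assms]
proof eventually_elim
  fix x assume "\<exists>L. ((\<lambda>\<epsilon>. trunc \<epsilon> f x) \<longlongrightarrow> L) (at_right 0)"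
  then show "((\<lambda>\<epsilon>. trunc \<epsilon> f x) \<longlongrightarrow> pv f x) (at_right 0)"
    unfolding pv_def by (metis tendsto_Lim trivial_limit_at_right_real)
qed

lemma pv_linear_AE:
  assumes f: "integrable lborel f" and g: "integrable lborel g"
  shows "AE x in lborel. pv (\<lambda>x. f x + g x) x = pv f x + pv g x"
  using pv_tendsto_AE[OF f] pv_tendsto_AE[OF g]
proof eventually_elim
  fix x assume "((\<lambda>\<epsilon>. trunc \<epsilon> f x) \<longlongrightarrow> pv f x) (at_right 0)" "((\<lambda>\<epsilon>. trunc \<epsilon> g x) \<longlongrightarrow> pv g x) (at_right 0)"
  then have "((\<lambda>\<epsilon>. trunc \<epsilon> f x + trunc \<epsilon> g x) \<longlongrightarrow> pv f x + pv g x) (at_right 0)" by (rule tendsto_add)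
  moreover have "eventually (\<lambda>\<epsilon>. trunc \<epsilon> f x + trunc \<epsilon> g x = trunc \<epsilon> (\<lambda>x. f x + g x) x) (at_right 0)"
    using f g by (auto simp: eventually_at_right_field trunc_add intro!: exI[of _ 1])
  ultimately have "((\<lambda>\<epsilon>. trunc \<epsilon> (\<lambda>x. f x + g x) x) \<longlongrightarrow> pv f x + pv g x) (at_right 0)"
    by (rule Lim_transform_eventually)
  then show "pv (\<lambda>x. f x + g x) x = pv f x + pv g x"
    unfolding pv_def[of "\<lambda>x. f x + g x"] by (intro tendsto_Lim) auto
qed

text \<open>
Principal values are continuous from \<open>L\<^sup>1\<close> to convergence in measure; in particular they form a
closed operator on \<open>L\<^sup>1\<close>.
\<close>

theorem pv_eq_AE_of_L1_limit:
  assumes f: "integrable lborel f" and s: "\<And>n. integrable lborel (s n)"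
    and h: "integrable lborel h" and k: "\<And>n. integrable lborel (k n)"
    and sk: "\<And>n. AE x in lborel. pv (s n) x = k n x"
    and sf: "(\<lambda>n. LINT x|lborel. norm (s n x - f x)) \<longlonglongrightarrow> 0"
    and kh: "(\<lambda>n. LINT x|lborel. norm (k n x - h x)) \<longlonglongrightarrow> 0"
  shows "AE x in lborel. pv f x = h x"
proof -
  have "AE x in lborel. dist (pv f x) (h x) \<le> e" if e: "0 < e" for e
  proof (rule AE_from_small_exceptional_sets)
    fix \<delta> :: real assume \<delta>: "0 < \<delta>"
    have "(\<lambda>n. 1280 * (LINT x|lborel. norm (s n x - f x)) / (e / 2)) \<longlonglongrightarrow> 1280 * 0 / (e / 2)"
      by (intro tendsto_intros sf) (use e in auto)
    then have "eventually (\<lambda>n. 1280 * (LINT x|lborel. norm (s n x - f x)) / (e / 2) < \<delta> / 2) sequentially"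
      using \<delta> by (intro order_tendstoD) auto
    moreover have "(\<lambda>n. (LINT x|lborel. norm (k n x - h x)) / (e / 2)) \<longlonglongrightarrow> 0 / (e / 2)"
      by (intro tendsto_intros kh) (use e in auto)
    then have "eventually (\<lambda>n. (LINT x|lborel. norm (k n x - h x)) / (e / 2) < \<delta> / 2) sequentially"
      using \<delta> by (intro order_tendstoD) auto
    ultimately have "eventually (\<lambda>n. 1280 * (LINT x|lborel. norm (s n x - f x)) / (e / 2) < \<delta> / 2 \<and>
        (LINT x|lborel. norm (k n x - h x)) / (e / 2) < \<delta> / 2) sequentially"
      by eventually_elim simp
    then obtain n where n: "1280 * (LINT x|lborel. norm (s n x - f x)) / (e / 2) < \<delta> / 2"
        "(LINT x|lborel. norm (k n x - h x)) / (e / 2) < \<delta> / 2"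
      by (auto simp: eventually_sequentially)
    have int: "integrable lborel (\<lambda>x. s n x - f x)" using s f by auto
    have intk: "integrable lborel (\<lambda>x. norm (k n x - h x))" using h k by auto
    have [measurable]: "k n \<in> borel_measurable borel" "h \<in> borel_measurable borel" using h k by auto
    define A where "A = {x. \<exists>\<epsilon>>0. e / 2 < norm (trunc \<epsilon> (\<lambda>x. s n x - f x) x)}"
    define B where "B = {x. e / 2 \<le> norm (k n x - h x)}"
    have Am[measurable]: "A \<in> sets borel" unfolding A_def by (rule borel_open[OF maximal_trunc_open[OF int]])
    have Bm[measurable]: "B \<in> sets borel" unfolding B_def by measurable
    have "emeasure lborel (A \<union> B) \<le> emeasure lborel A + emeasure lborel B"
      by (intro emeasure_subadditive) auto
    also have "\<dots> \<le> ennreal (\<delta> / 2) + ennreal (\<delta> / 2)"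
    proof (rule add_mono)
      show "emeasure lborel A \<le> ennreal (\<delta> / 2)"
        unfolding A_def
        by (rule order_trans[OF maximal_trunc_weak_type[OF int]]) (use e n(1) in \<open>auto intro!: ennreal_leI\<close>)
      have "emeasure lborel B \<le> ennreal ((LINT x|lborel. norm (k n x - h x)) / (e / 2))"
        using integral_Markov_inequality[OF intk, of "e / 2"] e unfolding B_def by (simp add: mult.commute)
      then show "emeasure lborel B \<le> ennreal (\<delta> / 2)"
        by (rule order_trans) (use n(2) in \<open>auto intro!: ennreal_leI\<close>)
    qed
    also have "\<dots> = ennreal \<delta>" using \<delta> by (subst ennreal_plus[symmetric]) auto
    finally have "emeasure lborel (A \<union> B) \<le> ennreal \<delta>" .
    moreover have "AE x in lborel. x \<notin> A \<union> B \<longrightarrow> dist (pv f x) (h x) \<le> e"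
      using pv_tendsto_AE[OF f] pv_tendsto_AE[OF s[of n]] sk[of n]
    proof eventually_elim
      fix x assume fx: "((\<lambda>\<epsilon>. trunc \<epsilon> f x) \<longlongrightarrow> pv f x) (at_right 0)"
        and sx: "((\<lambda>\<epsilon>. trunc \<epsilon> (s n) x) \<longlongrightarrow> pv (s n) x) (at_right 0)" and eq: "pv (s n) x = k n x"
      show "x \<notin> A \<union> B \<longrightarrow> dist (pv f x) (h x) \<le> e"
      proof
        assume x: "x \<notin> A \<union> B"
        have "norm (pv (s n) x - pv f x) \<le> e / 2"
        proof (rule tendsto_upperbound)
          show "((\<lambda>\<epsilon>. norm (trunc \<epsilon> (s n) x - trunc \<epsilon> f x)) \<longlongrightarrow> norm (pv (s n) x - pv f x)) (at_right 0)"
            using fx sx by (intro tendsto_intros)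
          have "norm (trunc a (s n) x - trunc a f x) \<le> e / 2" if "0 < a" for a
          proof (rule ccontr)
            assume "\<not> ?thesis"
            then have "x \<in> A" unfolding A_def using that f s[of n]
              by (auto simp: trunc_diff not_le intro!: exI[of _ a])
            then show False using x by simp
          qed
          then show "eventually (\<lambda>\<epsilon>. norm (trunc \<epsilon> (s n) x - trunc \<epsilon> f x) \<le> e / 2) (at_right 0)"
            by (auto simp: eventually_at_right_field intro!: exI[of _ 1])
        qed simp
        moreover have "norm (k n x - h x) \<le> e / 2" using x unfolding B_def by auto
        ultimately have "dist (pv f x) (k n x) \<le> e / 2" "dist (k n x) (h x) \<le> e / 2"
          using eq by (auto simp: dist_norm norm_minus_commute)
        then show "dist (pv f x) (h x) \<le> e" using dist_triangle[of "pv f x" "h x" "k n x"] by linarith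
      qed
    qed
    ultimately show "\<exists>A\<in>sets lborel. emeasure lborel A \<le> ennreal \<delta> \<and> (AE x in lborel. x \<notin> A \<longrightarrow> dist (pv f x) (h x) \<le> e)"
      by (intro bexI[of _ "A \<union> B"]) auto
  qed
  then have "AE x in lborel. \<forall>k. dist (pv f x) (h x) \<le> 1 / real (Suc k)" by (subst AE_all_countable) auto
  then show ?thesis
  proof eventually_elim
    fix x assume *: "\<forall>k. dist (pv f x) (h x) \<le> 1 / real (Suc k)"
    have "dist (pv f x) (h x) \<le> 0"
    proof (rule field_le_epsilon)
      fix e :: real assume "0 < e"
      then obtain k where "1 / real (Suc k) < e" using nat_approx_posE by blast
      then show "dist (pv f x) (h x) \<le> 0 + e" using *[rule_format, of k] by simp
    qed
    then show "pv f x = h x" by simp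
  qed
qed

section \<open>Averages of dilations\<close>

lemma borel_representative:
  fixes f :: "real \<Rightarrow> complex"
  assumes "f \<in> borel_measurable lebesgue"
  obtains g where "g \<in> borel_measurable borel" "AE x in lborel. f x = g x"
proof -
  have "(\<lambda>x. Re (f x)) \<in> borel_measurable lebesgue" "(\<lambda>x. Im (f x)) \<in> borel_measurable lebesgue"
    using assms by measurable
  then obtain u v where uv: "u \<in> borel_measurable lborel" "AE x in lborel. Re (f x) = u x"
      "v \<in> borel_measurable lborel" "AE x in lborel. Im (f x) = v x"
    by (metis completion_ex_borel_measurable_real)
  show thesis
  proof
    have [measurable]: "u \<in> borel_measurable borel" "v \<in> borel_measurable borel" using uv by auto
    show "(\<lambda>x. of_real (u x) + \<i> * of_real (v x)) \<in> borel_measurable borel" by measurable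
    show "AE x in lborel. f x = of_real (u x) + \<i> * of_real (v x)"
      using uv(2,4) by eventually_elim (simp add: complex_eq_iff)
  qed
qed

lemma measurable_lebesgue_cong_AE:
  assumes g: "g \<in> borel_measurable borel" and eq: "AE x in lborel. f x = g x"
  shows "f \<in> borel_measurable lebesgue"
proof (rule measurableI)
  fix A :: "'b set" assume A: "A \<in> sets borel"
  have gA: "g -` A \<in> sets lebesgue" using measurable_sets[OF g A] by simp
  show "f -` A \<inter> space lebesgue \<in> sets lebesgue"
  proof (rule completion.in_sets_AE)
    show "g -` A \<in> sets lebesgue" by (rule gA)
    show "AE x in lebesgue. (x \<in> g -` A) = (x \<in> f -` A \<inter> space lebesgue)"
      using AE_completion[OF eq] by eventually_elim simp
  qed simp
qed simp

lemma
  fixes f g :: "real \<Rightarrow> 'a::{banach, second_countable_topology}"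
  assumes g: "g \<in> borel_measurable borel" and eq: "AE x in lborel. f x = g x"
  shows lebesgue_integral_borel_rep: "(LINT x|lebesgue. f x) = (LINT x|lborel. g x)"
    and lebesgue_integrable_borel_rep: "integrable lebesgue f \<longleftrightarrow> integrable lborel g"
proof -
  have f: "f \<in> borel_measurable lebesgue" by (rule measurable_lebesgue_cong_AE[OF g eq])
  have g': "g \<in> borel_measurable lborel" using g by simp
  have g'': "g \<in> borel_measurable lebesgue" using g by (simp add: measurable_completion)
  have eq': "AE x in lebesgue. f x = g x" using eq by (rule AE_completion)
  have "(LINT x|lebesgue. f x) = (LINT x|lebesgue. g x)"
    by (rule integral_cong_AE[OF f g'' eq'])
  then show "(LINT x|lebesgue. f x) = (LINT x|lborel. g x)"
    using integral_completion[OF g'] by simp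
  have "integrable lebesgue f \<longleftrightarrow> integrable lebesgue g"
    by (rule integrable_cong_AE[OF f g'' eq'])
  then show "integrable lebesgue f \<longleftrightarrow> integrable lborel g"
    using integrable_completion[OF g'] by simp
qed

text \<open>
The map \<open>y \<mapsto> x/y\<close> is differentiable off 0 and hence preserves null sets. For \<open>x = 0\<close> the conclusion
would be a statement about the single value \<open>P 0\<close>.
\<close>

lemma AE_inverse_scale:
  assumes P: "AE y in lborel. P y" and x: "x \<noteq> 0"
  shows "AE t::real in lborel. t \<noteq> 0 \<longrightarrow> P (x / t)"
proof -
  from AE_E[OF P] obtain N where
    "{y \<in> space lborel. \<not> P y} \<subseteq> N" "emeasure lborel N = 0" "N \<in> sets lborel" .
  then have N: "N \<in> null_sets lborel" "{y. \<not> P y} \<subseteq> N" by (auto intro: null_setsI)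
  have neg: "negligible (N - {0})"
    using N(1) negligible_subset[of N "N - {0}"] by (simp add: negligible_iff_null_sets null_sets_completionI)
  have "negligible ((\<lambda>y. x / y) ` (N - {0}))"
  proof (rule negligible_differentiable_image_negligible[OF order_refl neg])
    show "(\<lambda>y. x / y) differentiable_on N - {0}"
      by (auto simp: differentiable_on_def intro!: derivative_intros differentiable_at_withinI)
  qed
  then have "AE t in lebesgue. t \<notin> (\<lambda>y. x / y) ` (N - {0})"
    by (intro AE_not_in) (simp add: negligible_iff_null_sets)
  then have "AE t in lborel. t \<notin> (\<lambda>y. x / y) ` (N - {0})" by (simp add: AE_completion_iff)
  then show ?thesis
  proof eventually_elim
    fix t assume t: "t \<notin> (\<lambda>y. x / y) ` (N - {0})"
    show "t \<noteq> 0 \<longrightarrow> P (x / t)"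
    proof (rule impI, rule ccontr)
      assume "t \<noteq> 0" "\<not> P (x / t)"
      then have "x / t \<in> N - {0}" "t = x / (x / t)" using N(2) x by auto
      with t show False by blast
    qed
  qed
qed

definition half_line_kernel :: "(real \<Rightarrow> real) \<Rightarrow> bool" where
  "half_line_kernel k \<longleftrightarrow> integrable lborel k \<and> (\<forall>t\<le>0. k t = 0)"

text \<open>
The Hausdorff operator in Borel form: joint measurability, and with it Fubini's theorem, requires
Borel representatives of the kernel and of the function.
\<close>

definition dilation_average :: "(real \<Rightarrow> real) \<Rightarrow> (real \<Rightarrow> complex) \<Rightarrow> real \<Rightarrow> complex" where
  "dilation_average k f x = (LINT t|lborel. k t *\<^sub>R dilate t f x)"

lemma half_line_kernelD:
  assumes "half_line_kernel k"
  shows "integrable lborel k" "k \<in> borel_measurable borel" "\<And>t. t \<le> 0 \<Longrightarrow> k t = 0"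
  using assms unfolding half_line_kernel_def by auto

lemma hausdorff_op_eq_dilation_average:
  assumes k: "k \<in> borel_measurable borel" "\<And>t. t \<le> 0 \<Longrightarrow> k t = 0"
    and pk: "AE t in lborel. 0 < t \<longrightarrow> \<phi> t = k t"
    and g: "g \<in> borel_measurable borel" and fg: "AE x in lborel. f x = g x"
    and x: "x \<noteq> 0"
  shows "hausdorff_op \<phi> f x = dilation_average k g x"
  unfolding hausdorff_op_def dilation_average_def set_lebesgue_integral_def
proof (rule lebesgue_integral_borel_rep)
  note [measurable] = k(1) g
  show "(\<lambda>t. k t *\<^sub>R dilate t g x) \<in> borel_measurable borel"
    unfolding dilate_def by measurable
  show "AE t in lborel. indicator {0<..} t *\<^sub>R (f (x / t) * of_real (\<phi> t / t)) = k t *\<^sub>R dilate t g x"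
    using pk AE_inverse_scale[OF fg x]
  proof eventually_elim
    fix t assume "0 < t \<longrightarrow> \<phi> t = k t" "t \<noteq> 0 \<longrightarrow> f (x / t) = g (x / t)"
    then show "indicator {0<..} t *\<^sub>R (f (x / t) * of_real (\<phi> t / t)) = k t *\<^sub>R dilate t g x"
      using k(2)[of t] by (cases "0 < t") (auto simp: dilate_def scaleR_conv_of_real field_simps)
  qed
qed

lemma nn_integral_dilate:
  fixes M :: "real \<Rightarrow> ennreal"
  assumes [measurable]: "M \<in> borel_measurable borel" and t: "0 < t"
  shows "(\<integral>\<^sup>+x. ennreal (1 / t) * M (x / t) \<partial>lborel) = (\<integral>\<^sup>+x. M x \<partial>lborel)"
proof -
  have "(\<integral>\<^sup>+x. ennreal (1 / t) * M (x / t) \<partial>lborel) = ennreal t * (\<integral>\<^sup>+x. ennreal (1 / t) * M x \<partial>lborel)"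
    using t by (subst nn_integral_real_affine[where c = t and t = 0]) auto
  also have "\<dots> = (ennreal t * ennreal (1 / t)) * (\<integral>\<^sup>+x. M x \<partial>lborel)"
    by (simp add: nn_integral_cmult mult.assoc)
  also have "ennreal t * ennreal (1 / t) = 1" using t by (simp flip: ennreal_mult)
  finally show ?thesis by simp
qed

lemma nn_integral_dilation_average:
  fixes M :: "real \<Rightarrow> ennreal"
  assumes k: "half_line_kernel k" and M[measurable]: "M \<in> borel_measurable borel"
  shows "(\<integral>\<^sup>+x. \<integral>\<^sup>+t. ennreal (\<bar>k t\<bar> / t) * M (x / t) \<partial>lborel \<partial>lborel)
    = (\<integral>\<^sup>+t. ennreal \<bar>k t\<bar> \<partial>lborel) * (\<integral>\<^sup>+x. M x \<partial>lborel)"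
proof -
  note [measurable] = half_line_kernelD(2)[OF k]
  have "(\<integral>\<^sup>+x. \<integral>\<^sup>+t. ennreal (\<bar>k t\<bar> / t) * M (x / t) \<partial>lborel \<partial>lborel)
      = (\<integral>\<^sup>+t. \<integral>\<^sup>+x. ennreal (\<bar>k t\<bar> / t) * M (x / t) \<partial>lborel \<partial>lborel)"
    by (rule lborel_pair.Fubini') measurable
  also have "\<dots> = (\<integral>\<^sup>+t. ennreal \<bar>k t\<bar> * (\<integral>\<^sup>+x. M x \<partial>lborel) \<partial>lborel)"
  proof (rule nn_integral_cong)
    fix t
    show "(\<integral>\<^sup>+x. ennreal (\<bar>k t\<bar> / t) * M (x / t) \<partial>lborel) = ennreal \<bar>k t\<bar> * (\<integral>\<^sup>+x. M x \<partial>lborel)"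
    proof (cases "0 < t")
      case True
      have "(\<integral>\<^sup>+x. ennreal (\<bar>k t\<bar> / t) * M (x / t) \<partial>lborel)
          = (\<integral>\<^sup>+x. ennreal \<bar>k t\<bar> * (ennreal (1 / t) * M (x / t)) \<partial>lborel)"
        using True by (intro nn_integral_cong) (simp flip: mult.assoc ennreal_mult)
      also have "\<dots> = ennreal \<bar>k t\<bar> * (\<integral>\<^sup>+x. ennreal (1 / t) * M (x / t) \<partial>lborel)"
        by (rule nn_integral_cmult) measurable
      finally show ?thesis using nn_integral_dilate[OF M True] by simp
    next
      case False
      then show ?thesis using half_line_kernelD(3)[OF k, of t] by simp
    qed
  qed
  also have "\<dots> = (\<integral>\<^sup>+t. ennreal \<bar>k t\<bar> \<partial>lborel) * (\<integral>\<^sup>+x. M x \<partial>lborel)"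
    by (rule nn_integral_multc) measurable
  finally show ?thesis .
qed

lemma norm_kernel_dilate:
  assumes "half_line_kernel k"
  shows "ennreal (norm (k t *\<^sub>R dilate t f x)) = ennreal (\<bar>k t\<bar> / t) * ennreal (norm (f (x / t)))"
proof (cases "0 < t")
  case True
  then show ?thesis by (simp add: dilate_def norm_divide flip: ennreal_mult)
next
  case False
  then show ?thesis using half_line_kernelD(3)[OF assms, of t] by simp
qed

lemma dilation_average_pair_integrable:
  assumes k: "half_line_kernel k" and f: "integrable lborel f"
    and g[measurable]: "g \<in> borel_measurable borel" and b: "\<And>x. norm (g x) \<le> C"
  shows "integrable (lborel \<Otimes>\<^sub>M lborel) (\<lambda>(x, t). (k t *\<^sub>R dilate t f x) * g x)"
proof (rule integrableI_bounded)
  note [measurable] = half_line_kernelD(2)[OF k]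
  have fm[measurable]: "f \<in> borel_measurable borel" using f by auto
  show "(\<lambda>(x, t). (k t *\<^sub>R dilate t f x) * g x) \<in> borel_measurable (lborel \<Otimes>\<^sub>M lborel)"
    unfolding dilate_def by measurable
  have m: "(\<lambda>x. ennreal (norm (f x))) \<in> borel_measurable borel" by measurable
  have m2[measurable]: "(\<lambda>(x, t). (k t *\<^sub>R dilate t f x)) \<in> borel_measurable (lborel \<Otimes>\<^sub>M lborel)"
    unfolding dilate_def by measurable
  have C0: "0 \<le> C" using b[of 0] norm_ge_zero order_trans by blast
  have "(\<integral>\<^sup>+p. ennreal (norm (case p of (x, t) \<Rightarrow> (k t *\<^sub>R dilate t f x) * g x)) \<partial>(lborel \<Otimes>\<^sub>M lborel))
      \<le> (\<integral>\<^sup>+p. ennreal C * ennreal (norm (case p of (x, t) \<Rightarrow> k t *\<^sub>R dilate t f x)) \<partial>(lborel \<Otimes>\<^sub>M lborel))"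
  proof (rule nn_integral_mono)
    fix p :: "real \<times> real"
    obtain x t where p: "p = (x, t)" by (cases p)
    have "norm ((k t *\<^sub>R dilate t f x) * g x) \<le> norm (k t *\<^sub>R dilate t f x) * C"
      unfolding norm_mult using b by (rule mult_left_mono) simp
    then show "ennreal (norm (case p of (x, t) \<Rightarrow> (k t *\<^sub>R dilate t f x) * g x))
        \<le> ennreal C * ennreal (norm (case p of (x, t) \<Rightarrow> k t *\<^sub>R dilate t f x))"
      using C0 unfolding p by (simp add: mult.commute flip: ennreal_mult)
  qed
  also have "\<dots> = ennreal C * (\<integral>\<^sup>+p. ennreal (norm (case p of (x, t) \<Rightarrow> k t *\<^sub>R dilate t f x)) \<partial>(lborel \<Otimes>\<^sub>M lborel))"
    by (rule nn_integral_cmult) measurable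
  also have "(\<integral>\<^sup>+p. ennreal (norm (case p of (x, t) \<Rightarrow> k t *\<^sub>R dilate t f x)) \<partial>(lborel \<Otimes>\<^sub>M lborel))
      = (\<integral>\<^sup>+x. \<integral>\<^sup>+t. ennreal (norm (k t *\<^sub>R dilate t f x)) \<partial>lborel \<partial>lborel)"
    by (subst lborel.nn_integral_fst[symmetric]) auto
  also have "\<dots> = (\<integral>\<^sup>+t. ennreal \<bar>k t\<bar> \<partial>lborel) * (\<integral>\<^sup>+x. ennreal (norm (f x)) \<partial>lborel)"
    unfolding norm_kernel_dilate[OF k] by (rule nn_integral_dilation_average[OF k m])
  also have "ennreal C * \<dots> < \<infinity>"
    using half_line_kernelD(1)[OF k] f
    by (simp add: ennreal_mult_less_top integrable_iff_bounded)
  finally show "(\<integral>\<^sup>+p. ennreal (norm (case p of (x, t) \<Rightarrow> (k t *\<^sub>R dilate t f x) * g x)) \<partial>(lborel \<Otimes>\<^sub>M lborel)) < \<infinity>" .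
qed

lemma
  assumes k: "half_line_kernel k" and f: "integrable lborel f"
  shows dilation_average_integrable: "integrable lborel (dilation_average k f)"
    and dilation_average_integrand_AE: "AE x in lborel. integrable lborel (\<lambda>t. k t *\<^sub>R dilate t f x)"
proof -
  have *: "integrable (lborel \<Otimes>\<^sub>M lborel) (\<lambda>(x, t). k t *\<^sub>R dilate t f x)"
    using dilation_average_pair_integrable[OF k f, of "\<lambda>_. 1" 1] by simp
  show "integrable lborel (dilation_average k f)"
    using lborel_pair.integrable_fst'[OF *] unfolding dilation_average_def by simp
  show "AE x in lborel. integrable lborel (\<lambda>t. k t *\<^sub>R dilate t f x)"
    using lborel_pair.AE_integrable_fst'[OF *] by simp
qed

lemma dilation_average_integral_bounded:
  assumes k: "half_line_kernel k" and f: "integrable lborel f"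
    and g: "g \<in> borel_measurable borel" and b: "\<And>x. norm (g x) \<le> C"
  shows "(LINT x|lborel. dilation_average k f x * g x) = (LINT t|lborel. k t *\<^sub>R (LINT x|lborel. dilate t f x * g x))"
    and "integrable lborel (\<lambda>t. k t *\<^sub>R (LINT x|lborel. dilate t f x * g x))"
proof -
  note * = dilation_average_pair_integrable[OF k f g b]
  have "(LINT x|lborel. dilation_average k f x * g x) = (LINT x|lborel. LINT t|lborel. (k t *\<^sub>R dilate t f x) * g x)"
    unfolding dilation_average_def by (simp only: integral_mult_left_zero)
  also have "\<dots> = (LINT t|lborel. LINT x|lborel. (k t *\<^sub>R dilate t f x) * g x)"
    using lborel_pair.Fubini_integral[OF *] by simp
  also have "\<dots> = (LINT t|lborel. k t *\<^sub>R (LINT x|lborel. dilate t f x * g x))" by simp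
  finally show "(LINT x|lborel. dilation_average k f x * g x) = (LINT t|lborel. k t *\<^sub>R (LINT x|lborel. dilate t f x * g x))" .
  have "integrable lborel (\<lambda>t. LINT x|lborel. (k t *\<^sub>R dilate t f x) * g x)"
    using lborel_pair.integrable_snd[OF *] by simp
  then show "integrable lborel (\<lambda>t. k t *\<^sub>R (LINT x|lborel. dilate t f x * g x))" by simp
qed

lemma norm_dilation_average_le:
  assumes k: "half_line_kernel k"
  shows "ennreal (norm (dilation_average k f x)) \<le> (\<integral>\<^sup>+t. ennreal (\<bar>k t\<bar> / t) * ennreal (norm (f (x / t))) \<partial>lborel)"
  unfolding dilation_average_def norm_kernel_dilate[OF k, symmetric]
proof (cases "integrable lborel (\<lambda>t. k t *\<^sub>R dilate t f x)")
  case True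
  then show "ennreal (norm (LINT t|lborel. k t *\<^sub>R dilate t f x)) \<le> (\<integral>\<^sup>+t. ennreal (norm (k t *\<^sub>R dilate t f x)) \<partial>lborel)"
    by (rule integral_norm_bound_ennreal)
qed (simp add: not_integrable_integral_eq)

lemma nn_integral_norm_dilation_average_le:
  assumes k: "half_line_kernel k" and f: "f \<in> borel_measurable borel"
  shows "(\<integral>\<^sup>+x. ennreal (norm (dilation_average k f x)) \<partial>lborel)
    \<le> (\<integral>\<^sup>+t. ennreal \<bar>k t\<bar> \<partial>lborel) * (\<integral>\<^sup>+x. ennreal (norm (f x)) \<partial>lborel)"
proof -
  have "(\<integral>\<^sup>+x. ennreal (norm (dilation_average k f x)) \<partial>lborel)
      \<le> (\<integral>\<^sup>+x. \<integral>\<^sup>+t. ennreal (\<bar>k t\<bar> / t) * ennreal (norm (f (x / t))) \<partial>lborel \<partial>lborel)"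
    by (intro nn_integral_mono norm_dilation_average_le k)
  also have "\<dots> = (\<integral>\<^sup>+t. ennreal \<bar>k t\<bar> \<partial>lborel) * (\<integral>\<^sup>+x. ennreal (norm (f x)) \<partial>lborel)"
    using f by (intro nn_integral_dilation_average k) measurable
  finally show ?thesis .
qed

section \<open>Maximal functions over an aperture\<close>

lemma integrable_inverse_1_plus_square: "integrable lborel (\<lambda>x::real. 1 / (1 + x\<^sup>2))"
proof (rule integrableI_bounded)
  have half: "(\<integral>\<^sup>+x. ennreal (1 / (1 + x\<^sup>2)) * indicator {0..} x \<partial>lborel) = ennreal (pi / 2 - arctan 0)"
  proof (rule nn_integral_FTC_atLeast)
    show "DERIV arctan x :> 1 / (1 + x\<^sup>2)" for x
      using DERIV_arctan[of x] by (simp add: inverse_eq_divide)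
  qed (auto intro: tendsto_arctan_at_top)
  have "(\<integral>\<^sup>+x. ennreal (norm (1 / (1 + (x::real)\<^sup>2))) \<partial>lborel)
      \<le> (\<integral>\<^sup>+x. ennreal (1 / (1 + x\<^sup>2)) * indicator {0..} x
            + ennreal (1 / (1 + (- x)\<^sup>2)) * indicator {0..} (- x) \<partial>lborel)"
    by (intro nn_integral_mono) (auto simp: indicator_def)
  also have "\<dots> = ennreal (pi / 2 - arctan 0)
      + (\<integral>\<^sup>+x. ennreal (1 / (1 + (- x)\<^sup>2)) * indicator {0..} (- x) \<partial>lborel)"
    by (subst nn_integral_add) (simp_all add: half)
  also have "(\<integral>\<^sup>+x. ennreal (1 / (1 + (- x)\<^sup>2)) * indicator {0..} (- x) \<partial>lborel)
      = (\<integral>\<^sup>+x. ennreal (1 / (1 + x\<^sup>2)) * indicator {0..} x \<partial>lborel)"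
    by (subst nn_integral_real_affine[where c = "-1" and t = 0]) auto
  finally show "(\<integral>\<^sup>+x. ennreal (norm (1 / (1 + (x::real)\<^sup>2))) \<partial>lborel) < \<infinity>"
    unfolding half by (rule le_less_trans) simp
qed measurable

text \<open>
Any odd Lipschitz function with compact support that is positive on \<open>(0,1)\<close> would serve.
\<close>

definition bump :: "real \<Rightarrow> real" where
  "bump x = x * max 0 (1 - \<bar>x\<bar>)"

abbreviation odd_bump :: "real \<Rightarrow> complex" where
  "odd_bump x \<equiv> of_real (bump x)"

lemma bump_zero: "1 \<le> \<bar>x\<bar> \<Longrightarrow> bump x = 0"
  unfolding bump_def by auto

lemma bump_le: "\<bar>bump x\<bar> \<le> 1"
proof (cases "\<bar>x\<bar> \<le> 1")
  case True
  then have "\<bar>x\<bar> * \<bar>max 0 (1 - \<bar>x\<bar>)\<bar> \<le> 1 * 1" by (intro mult_mono) auto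
  then show ?thesis by (simp add: bump_def abs_mult)
qed (simp add: bump_zero)

lemma bump_indicator: "\<bar>bump x\<bar> \<le> indicator {-1..1} x"
  using bump_le[of x] bump_zero[of x] by (auto simp: indicator_def)

lemma bump_measurable [measurable]: "bump \<in> borel_measurable borel"
  unfolding bump_def[abs_def] by measurable

lemma bump_continuous: "continuous_on UNIV bump"
  unfolding bump_def[abs_def] by (intro continuous_intros)

lemma bump_minus: "bump (- x) = - bump x"
  unfolding bump_def by simp

lemma bump_integrable: "integrable lborel bump"
proof (rule Bochner_Integration.integrable_bound)
  show "integrable lborel (indicator {-1..1::real} :: real \<Rightarrow> real)"
    by (intro integrable_real_indicator) auto
qed (use bump_indicator in auto)

lemma bump_integral: "(LINT x|lborel. bump x) = 0"
proof -
  have "(LINT x|lborel. bump x) = (LINT x|lborel. bump (- x))"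
    by (subst lborel_integral_real_affine[where c = "-1" and t = 0]) auto
  also have "\<dots> = - (LINT x|lborel. bump x)" by (simp add: bump_minus)
  finally show ?thesis by simp
qed

lemma bump_Lipschitz: "\<bar>bump x - bump y\<bar> \<le> 2 * \<bar>x - y\<bar>"
proof -
  have *: "\<bar>bump x - bump y\<bar> \<le> 2 * \<bar>x - y\<bar>" if "\<bar>y\<bar> \<le> 1" for x y
  proof -
    let ?m = "\<lambda>x::real. max 0 (1 - \<bar>x\<bar>)"
    have "bump x - bump y = (x - y) * ?m x + y * (?m x - ?m y)"
      unfolding bump_def by (simp add: algebra_simps)
    also have "\<bar>\<dots>\<bar> \<le> \<bar>(x - y) * ?m x\<bar> + \<bar>y * (?m x - ?m y)\<bar>" by (rule abs_triangle_ineq)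
    also have "\<dots> \<le> \<bar>x - y\<bar> * 1 + 1 * \<bar>x - y\<bar>"
      unfolding abs_mult using that by (intro add_mono mult_mono) auto
    finally show ?thesis by simp
  qed
  show ?thesis
  proof (cases "\<bar>y\<bar> \<le> 1")
    case True
    then show ?thesis by (rule *)
  next
    case y: False
    show ?thesis
    proof (cases "\<bar>x\<bar> \<le> 1")
      case True
      then show ?thesis using *[of x y] by (simp add: abs_minus_commute)
    qed (use y in \<open>simp add: bump_zero\<close>)
  qed
qed

text \<open>
The properties common to Schwartz functions and the Poisson kernel on which the maximal function
estimates rest.
\<close>

definition decaying_kernel :: "(real \<Rightarrow> complex) \<Rightarrow> bool" where
  "decaying_kernel \<psi> \<longleftrightarrow> (\<exists>C \<psi>'. \<forall>x. (\<psi> has_vector_derivative \<psi>' x) (at x) \<and>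
     norm (\<psi> x) \<le> C / (1 + x\<^sup>2) \<and> norm (\<psi>' x) \<le> C / (1 + x\<^sup>2))"

lemma decaying_kernelD:
  assumes "decaying_kernel \<psi>"
  shows "continuous_on UNIV \<psi>" "\<psi> \<in> borel_measurable borel" "integrable lborel \<psi>" "\<exists>C\<ge>0. \<forall>x. norm (\<psi> x) \<le> C"
proof -
  obtain C \<psi>' where C: "\<And>x. (\<psi> has_vector_derivative \<psi>' x) (at x)" "\<And>x. norm (\<psi> x) \<le> C / (1 + x\<^sup>2)"
    using assms unfolding decaying_kernel_def by blast
  have C0: "0 \<le> C" using order_trans[OF norm_ge_zero C(2)[of 0]] by simp
  show "continuous_on UNIV \<psi>"
    by (intro continuous_at_imp_continuous_on ballI has_vector_derivative_continuous[OF C(1)])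
  then show m: "\<psi> \<in> borel_measurable borel" by (rule borel_measurable_continuous_onI)
  show "integrable lborel \<psi>"
  proof (rule Bochner_Integration.integrable_bound)
    show "integrable lborel (\<lambda>x::real. C * (1 / (1 + x\<^sup>2)))"
      using integrable_inverse_1_plus_square by (rule integrable_mult_right)
    show "AE x in lborel. norm (\<psi> x) \<le> norm (C * (1 / (1 + x\<^sup>2)))"
      using C(2) C0 by (intro AE_I2) (auto intro: order_trans)
  qed (use m in simp)
  have "norm (\<psi> x) \<le> C" for x
  proof -
    have "C / (1 + x\<^sup>2) \<le> C / 1" using C0 by (intro divide_left_mono) (auto simp: add_pos_nonneg)
    then show ?thesis using C(2)[of x] by simp
  qed
  then show "\<exists>C\<ge>0. \<forall>x. norm (\<psi> x) \<le> C" using C0 by blast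
qed

definition smooth :: "(real \<Rightarrow> complex) \<Rightarrow> real \<Rightarrow> (real \<Rightarrow> complex) \<Rightarrow> real \<Rightarrow> complex" where
  "smooth \<psi> s f x = (LINT y|lborel. f y * dilate s \<psi> (x - y))"

lemma dilate_measurable [measurable]:
  assumes [measurable]: "\<psi> \<in> borel_measurable borel"
  shows "dilate s \<psi> \<in> borel_measurable borel"
  unfolding dilate_def[abs_def] by measurable

lemma dilate_bound:
  assumes "\<And>x. norm (\<psi> x) \<le> C" "0 < s"
  shows "norm (dilate s \<psi> x) \<le> C / s"
  using assms by (simp add: dilate_def norm_divide divide_right_mono)

lemma smooth_integrable:
  assumes \<psi>: "decaying_kernel \<psi>" and f: "integrable lborel f" and s: "0 < s" and d[measurable]: "d \<in> borel_measurable borel"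
  shows "integrable lborel (\<lambda>y. f y * dilate s \<psi> (d y))"
proof -
  note [measurable] = decaying_kernelD(2)[OF \<psi>]
  have [measurable]: "f \<in> borel_measurable borel" using f by auto
  obtain C where C: "0 \<le> C" "\<And>x. norm (\<psi> x) \<le> C" using decaying_kernelD(4)[OF \<psi>] by blast
  show ?thesis
  proof (rule Bochner_Integration.integrable_bound)
    show "integrable lborel (\<lambda>y. norm (f y) * (C / s))" using f by auto
    show "(\<lambda>y. f y * dilate s \<psi> (d y)) \<in> borel_measurable lborel" by measurable
    have "norm (f y * dilate s \<psi> (d y)) \<le> norm (f y) * (C / s)" for y
      unfolding norm_mult using C(2) s by (intro mult_left_mono dilate_bound) auto
    then show "AE y in lborel. norm (f y * dilate s \<psi> (d y)) \<le> norm (norm (f y) * (C / s))"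
      by (intro AE_I2) (metis abs_ge_self order_trans real_norm_def)
  qed
qed

lemma smooth_continuous:
  assumes \<psi>: "decaying_kernel \<psi>" and f: "integrable lborel f" and s: "0 < s"
  shows "continuous_on UNIV (smooth \<psi> s f)"
proof -
  note [measurable] = decaying_kernelD(2)[OF \<psi>]
  have [measurable]: "f \<in> borel_measurable borel" using f by auto
  obtain C where C: "0 \<le> C" "\<And>x. norm (\<psi> x) \<le> C" using decaying_kernelD(4)[OF \<psi>] by blast
  have "isCont (smooth \<psi> s f) x" for x
    unfolding continuous_at_sequentially
  proof (intro allI impI)
    fix X assume X: "X \<longlonglongrightarrow> x"
    show "(smooth \<psi> s f \<circ> X) \<longlonglongrightarrow> smooth \<psi> s f x"
      unfolding comp_def smooth_def
    proof (rule integral_dominated_convergence)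
      show "integrable lborel (\<lambda>y. norm (f y) * (C / s))" using f by auto
      show "AE y in lborel. norm (f y * dilate s \<psi> (X i - y)) \<le> norm (f y) * (C / s)" for i
        unfolding norm_mult using C(2) s by (intro AE_I2 mult_left_mono dilate_bound) auto
      show "AE y in lborel. (\<lambda>i. f y * dilate s \<psi> (X i - y)) \<longlonglongrightarrow> f y * dilate s \<psi> (x - y)"
      proof (rule AE_I2)
        fix y
        have "isCont \<psi> ((x - y) / s)"
          using decaying_kernelD(1)[OF \<psi>] by (simp add: continuous_on_eq_continuous_at)
        moreover have "(\<lambda>i. (X i - y) / s) \<longlonglongrightarrow> (x - y) / s"
          using X s by (intro tendsto_intros) auto
        ultimately have "(\<lambda>i. \<psi> ((X i - y) / s)) \<longlonglongrightarrow> \<psi> ((x - y) / s)" by (rule isCont_tendsto_compose)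
        then show "(\<lambda>i. f y * dilate s \<psi> (X i - y)) \<longlonglongrightarrow> f y * dilate s \<psi> (x - y)"
          unfolding dilate_def using s by (intro tendsto_intros) auto
      qed
    qed measurable
  qed
  then show ?thesis by (simp add: continuous_on_eq_continuous_at)
qed

lemma smooth_dilate:
  assumes "0 < t" "0 < s"
  shows "smooth \<psi> s (dilate t f) x = smooth \<psi> (s / t) f (x / t) / of_real t"
proof -
  have "smooth \<psi> s (dilate t f) x = t *\<^sub>R (LINT u|lborel. dilate t f (0 + t * u) * dilate s \<psi> (x - (0 + t * u)))"
    unfolding smooth_def using assms by (subst lborel_integral_real_affine[where c = t and t = 0]) auto
  also have "(\<lambda>u. dilate t f (0 + t * u) * dilate s \<psi> (x - (0 + t * u)))
      = (\<lambda>u. (f u * dilate (s / t) \<psi> (x / t - u)) / (of_real t)\<^sup>2)"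
  proof
    fix u
    have "(x - (0 + t * u)) / s = (x / t - u) / (s / t)" using assms by (simp add: field_simps)
    then show "dilate t f (0 + t * u) * dilate s \<psi> (x - (0 + t * u)) = (f u * dilate (s / t) \<psi> (x / t - u)) / (of_real t)\<^sup>2"
      using assms by (simp add: dilate_def power2_eq_square)
  qed
  also have "t *\<^sub>R (LINT u|lborel. (f u * dilate (s / t) \<psi> (x / t - u)) / (of_real t)\<^sup>2) = smooth \<psi> (s / t) f (x / t) / of_real t"
    unfolding smooth_def using assms by (simp add: scaleR_conv_of_real power2_eq_square)
  finally show ?thesis .
qed

definition cone_maximal ::
  "(real \<times> real) set \<Rightarrow> (real \<Rightarrow> complex) \<Rightarrow> (real \<Rightarrow> complex) \<Rightarrow> real \<Rightarrow> ennreal" where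
  "cone_maximal \<Gamma> \<psi> f x = (SUP (v, s)\<in>\<Gamma>. ennreal (norm (smooth \<psi> s f (x - v))))"

text \<open>
An aperture parametrises the pairs (displacement, scale) over which a maximal function takes its
supremum. Invariance under scaling makes the maximal function commute with dilations; the rays with
zero displacement give the smooth and the open unit cone the nontangential maximal function.
\<close>

definition aperture :: "(real \<times> real) set \<Rightarrow> bool" where
  "aperture \<Gamma> \<longleftrightarrow> (\<forall>s>0. (0, s) \<in> \<Gamma>) \<and> (\<forall>(v, s)\<in>\<Gamma>. \<bar>v\<bar> < s \<and> (\<forall>c>0. (v / c, s / c) \<in> \<Gamma>))"

lemma apertureD:
  assumes "aperture \<Gamma>"
  shows "0 < s \<Longrightarrow> (0, s) \<in> \<Gamma>" "(v, s) \<in> \<Gamma> \<Longrightarrow> \<bar>v\<bar> < s" "(v, s) \<in> \<Gamma> \<Longrightarrow> 0 < s"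
    "(v, s) \<in> \<Gamma> \<Longrightarrow> 0 < c \<Longrightarrow> (v / c, s / c) \<in> \<Gamma>"
proof -
  have a: "\<And>s. 0 < s \<Longrightarrow> (0, s) \<in> \<Gamma>"
    and b: "\<And>v s. (v, s) \<in> \<Gamma> \<Longrightarrow> \<bar>v\<bar> < s \<and> (\<forall>c>0. (v / c, s / c) \<in> \<Gamma>)"
    using assms unfolding aperture_def by blast+
  show "0 < s \<Longrightarrow> (0, s) \<in> \<Gamma>" by (rule a)
  show "(v, s) \<in> \<Gamma> \<Longrightarrow> \<bar>v\<bar> < s" "(v, s) \<in> \<Gamma> \<Longrightarrow> 0 < c \<Longrightarrow> (v / c, s / c) \<in> \<Gamma>"
    using b by blast+
  show "(v, s) \<in> \<Gamma> \<Longrightarrow> 0 < s" using b[of v s] by linarith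
qed

lemma cone_maximal_upper: "(v, s) \<in> \<Gamma> \<Longrightarrow> ennreal (norm (smooth \<psi> s f (x - v))) \<le> cone_maximal \<Gamma> \<psi> f x"
  unfolding cone_maximal_def by (rule SUP_upper2[where i = "(v, s)"]) auto

lemma cone_maximal_measurable:
  assumes \<psi>: "decaying_kernel \<psi>" and f: "integrable lborel f" and \<Gamma>: "aperture \<Gamma>"
  shows "cone_maximal \<Gamma> \<psi> f \<in> borel_measurable borel"
proof (rule borel_measurableI_greater)
  fix c
  have "{x. c < cone_maximal \<Gamma> \<psi> f x} = (\<Union>p\<in>\<Gamma>. {x. c < ennreal (norm (smooth \<psi> (snd p) f (x - fst p)))})"
    unfolding cone_maximal_def less_SUP_iff by (auto simp: case_prod_beta)
  also have "open \<dots>"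
  proof (rule open_UN, rule ballI)
    fix p assume "p \<in> \<Gamma>"
    then have "0 < snd p" using apertureD(3)[OF \<Gamma>, of "fst p" "snd p"] by simp
    then have "continuous_on UNIV (\<lambda>x. smooth \<psi> (snd p) f (x - fst p))"
      by (intro continuous_on_compose2[OF smooth_continuous[OF \<psi> f]] continuous_intros) auto
    then show "open {x. c < ennreal (norm (smooth \<psi> (snd p) f (x - fst p)))}"
      by (intro open_Collect_less continuous_intros continuous_on_ennreal)
  qed
  finally show "{x \<in> space borel. c < cone_maximal \<Gamma> \<psi> f x} \<in> sets borel" by (simp add: borel_open)
qed

lemma cone_maximal_dilation_average_le:
  assumes \<psi>: "decaying_kernel \<psi>" and f: "integrable lborel f" and \<Gamma>: "aperture \<Gamma>" and k: "half_line_kernel k"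
  shows "cone_maximal \<Gamma> \<psi> (dilation_average k f) x \<le> (\<integral>\<^sup>+t. ennreal (\<bar>k t\<bar> / t) * cone_maximal \<Gamma> \<psi> f (x / t) \<partial>lborel)"
  unfolding cone_maximal_def[of \<Gamma> \<psi> "dilation_average k f"]
proof (rule SUP_least, clarify)
  fix v s assume vs: "(v, s) \<in> \<Gamma>"
  have s: "0 < s" using apertureD(3)[OF \<Gamma> vs] .
  note [measurable] = decaying_kernelD(2)[OF \<psi>]
  obtain C where C: "0 \<le> C" "\<And>x. norm (\<psi> x) \<le> C" using decaying_kernelD(4)[OF \<psi>] by blast
  have m: "(\<lambda>y. dilate s \<psi> (x - v - y)) \<in> borel_measurable borel" by measurable
  have b: "norm (dilate s \<psi> (x - v - y)) \<le> C / s" for y using dilate_bound[OF C(2) s] .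
  note F = dilation_average_integral_bounded[OF k f m b]
  have eq: "smooth \<psi> s (dilation_average k f) (x - v) = (LINT t|lborel. k t *\<^sub>R smooth \<psi> s (dilate t f) (x - v))"
    unfolding smooth_def by (rule F(1))
  have int: "integrable lborel (\<lambda>t. k t *\<^sub>R smooth \<psi> s (dilate t f) (x - v))"
    unfolding smooth_def by (rule F(2))
  have "ennreal (norm (smooth \<psi> s (dilation_average k f) (x - v)))
      \<le> (\<integral>\<^sup>+t. ennreal (norm (k t *\<^sub>R smooth \<psi> s (dilate t f) (x - v))) \<partial>lborel)"
    unfolding eq by (rule integral_norm_bound_ennreal[OF int])
  also have "\<dots> \<le> (\<integral>\<^sup>+t. ennreal (\<bar>k t\<bar> / t) * cone_maximal \<Gamma> \<psi> f (x / t) \<partial>lborel)"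
  proof (rule nn_integral_mono)
    fix t
    show "ennreal (norm (k t *\<^sub>R smooth \<psi> s (dilate t f) (x - v))) \<le> ennreal (\<bar>k t\<bar> / t) * cone_maximal \<Gamma> \<psi> f (x / t)"
    proof (cases "0 < t")
      case True
      have "ennreal (norm (k t *\<^sub>R smooth \<psi> s (dilate t f) (x - v)))
          = ennreal (\<bar>k t\<bar> / t) * ennreal (norm (smooth \<psi> (s / t) f (x / t - v / t)))"
        using True s by (simp add: smooth_dilate norm_divide diff_divide_distrib flip: ennreal_mult)
      also have "\<dots> \<le> ennreal (\<bar>k t\<bar> / t) * cone_maximal \<Gamma> \<psi> f (x / t)"
        by (intro mult_left_mono cone_maximal_upper apertureD(4)[OF \<Gamma> vs True]) simp
      finally show ?thesis .
    next
      case False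
      then show ?thesis using half_line_kernelD(3)[OF k, of t] by simp
    qed
  qed
  finally show "ennreal (norm (smooth \<psi> s (dilation_average k f) (x - v)))
      \<le> (\<integral>\<^sup>+t. ennreal (\<bar>k t\<bar> / t) * cone_maximal \<Gamma> \<psi> f (x / t) \<partial>lborel)" .
qed

lemma cone_maximal_norm_dilation_average_le:
  assumes "decaying_kernel \<psi>" "integrable lborel f" "aperture \<Gamma>" "half_line_kernel k"
  shows "(\<integral>\<^sup>+x. cone_maximal \<Gamma> \<psi> (dilation_average k f) x \<partial>lborel)
    \<le> (\<integral>\<^sup>+t. ennreal \<bar>k t\<bar> \<partial>lborel) * (\<integral>\<^sup>+x. cone_maximal \<Gamma> \<psi> f x \<partial>lborel)"
proof -
  have "(\<integral>\<^sup>+x. cone_maximal \<Gamma> \<psi> (dilation_average k f) x \<partial>lborel)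
      \<le> (\<integral>\<^sup>+x. \<integral>\<^sup>+t. ennreal (\<bar>k t\<bar> / t) * cone_maximal \<Gamma> \<psi> f (x / t) \<partial>lborel \<partial>lborel)"
    by (intro nn_integral_mono cone_maximal_dilation_average_le assms)
  also have "\<dots> = (\<integral>\<^sup>+t. ennreal \<bar>k t\<bar> \<partial>lborel) * (\<integral>\<^sup>+x. cone_maximal \<Gamma> \<psi> f x \<partial>lborel)"
    by (intro nn_integral_dilation_average cone_maximal_measurable assms)
  finally show ?thesis .
qed

lemma smooth_add:
  assumes "decaying_kernel \<psi>" "integrable lborel f" "integrable lborel g" "0 < s"
  shows "smooth \<psi> s (\<lambda>x. f x + g x) x = smooth \<psi> s f x + smooth \<psi> s g x"
  unfolding smooth_def distrib_right
  using assms by (intro Bochner_Integration.integral_add smooth_integrable) auto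

lemma cone_maximal_add_le:
  assumes \<psi>: "decaying_kernel \<psi>" and f: "integrable lborel f" and g: "integrable lborel g" and \<Gamma>: "aperture \<Gamma>"
  shows "cone_maximal \<Gamma> \<psi> (\<lambda>x. f x + g x) x \<le> cone_maximal \<Gamma> \<psi> f x + cone_maximal \<Gamma> \<psi> g x"
  unfolding cone_maximal_def[of \<Gamma> \<psi> "\<lambda>x. f x + g x"]
proof (rule SUP_least, clarify)
  fix v s assume vs: "(v, s) \<in> \<Gamma>"
  have "ennreal (norm (smooth \<psi> s (\<lambda>x. f x + g x) (x - v)))
      \<le> ennreal (norm (smooth \<psi> s f (x - v))) + ennreal (norm (smooth \<psi> s g (x - v)))"
    using apertureD(3)[OF \<Gamma> vs] by (simp add: smooth_add[OF \<psi> f g] norm_triangle_ineq flip: ennreal_plus)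
  also have "\<dots> \<le> cone_maximal \<Gamma> \<psi> f x + cone_maximal \<Gamma> \<psi> g x"
    by (intro add_mono cone_maximal_upper vs)
  finally show "ennreal (norm (smooth \<psi> s (\<lambda>x. f x + g x) (x - v))) \<le> cone_maximal \<Gamma> \<psi> f x + cone_maximal \<Gamma> \<psi> g x" .
qed

lemma cone_maximal_cmult_le:
  "cone_maximal \<Gamma> \<psi> (\<lambda>x. c * f x) x \<le> ennreal (norm c) * cone_maximal \<Gamma> \<psi> f x"
  unfolding cone_maximal_def[of \<Gamma> \<psi> "\<lambda>x. c * f x"]
proof (rule SUP_least, clarify)
  fix v s assume vs: "(v, s) \<in> \<Gamma>"
  have "smooth \<psi> s (\<lambda>x. c * f x) (x - v) = c * smooth \<psi> s f (x - v)"
    unfolding smooth_def mult.assoc by simp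
  then have "ennreal (norm (smooth \<psi> s (\<lambda>x. c * f x) (x - v))) = ennreal (norm c) * ennreal (norm (smooth \<psi> s f (x - v)))"
    by (simp add: norm_mult ennreal_mult)
  also have "\<dots> \<le> ennreal (norm c) * cone_maximal \<Gamma> \<psi> f x"
    by (intro mult_left_mono cone_maximal_upper vs) simp
  finally show "ennreal (norm (smooth \<psi> s (\<lambda>x. c * f x) (x - v))) \<le> ennreal (norm c) * cone_maximal \<Gamma> \<psi> f x" .
qed

text \<open>
Along the vertical ray the mollifications converge to \<open>f(x) \<integral> \<psi>\<close>.
\<close>

lemma cone_maximal_ge:
  assumes \<psi>: "decaying_kernel \<psi>" and \<Gamma>: "aperture \<Gamma>"
    and f: "continuous_on UNIV f" "\<And>x. norm (f x) \<le> B"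
  shows "ennreal (norm (LINT x|lborel. \<psi> x)) * ennreal (norm (f x)) \<le> cone_maximal \<Gamma> \<psi> f x"
proof -
  note [measurable] = decaying_kernelD(2)[OF \<psi>] borel_measurable_continuous_onI[OF f(1)]
  define s where "s n = 1 / real (Suc n)" for n
  have s0: "0 < s n" for n unfolding s_def by simp
  have slim: "s \<longlonglongrightarrow> 0"
    using LIMSEQ_inverse_real_of_nat unfolding s_def by (simp add: inverse_eq_divide)
  have eq: "smooth \<psi> (s n) f x = (LINT u|lborel. f (x - s n * u) * \<psi> u)" for n
  proof -
    have "smooth \<psi> (s n) f x = s n *\<^sub>R (LINT u|lborel. f (x + (- s n) * u) * dilate (s n) \<psi> (x - (x + (- s n) * u)))"
      unfolding smooth_def using s0[of n] by (subst lborel_integral_real_affine[where c = "- s n" and t = x]) auto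
    also have "(\<lambda>u. f (x + (- s n) * u) * dilate (s n) \<psi> (x - (x + (- s n) * u))) = (\<lambda>u. f (x - s n * u) * \<psi> u / of_real (s n))"
      using s0[of n] by (auto simp: dilate_def)
    finally show ?thesis using s0[of n] by (simp add: scaleR_conv_of_real)
  qed
  have "(\<lambda>n. LINT u|lborel. f (x - s n * u) * \<psi> u) \<longlonglongrightarrow> (LINT u|lborel. f x * \<psi> u)"
  proof (rule integral_dominated_convergence)
    show "integrable lborel (\<lambda>u. B * norm (\<psi> u))" using decaying_kernelD(3)[OF \<psi>] by auto
    show "AE u in lborel. norm (f (x - s i * u) * \<psi> u) \<le> B * norm (\<psi> u)" for i
      using f(2) by (intro AE_I2) (simp add: norm_mult mult_right_mono)
    show "AE u in lborel. (\<lambda>i. f (x - s i * u) * \<psi> u) \<longlonglongrightarrow> f x * \<psi> u"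
    proof (rule AE_I2)
      fix u
      have "isCont f x" using f(1) by (simp add: continuous_on_eq_continuous_at)
      moreover have "(\<lambda>i. x - s i * u) \<longlonglongrightarrow> x - 0 * u" using slim by (intro tendsto_intros)
      ultimately have "(\<lambda>i. f (x - s i * u)) \<longlonglongrightarrow> f x" by (intro isCont_tendsto_compose[of x f]) auto
      then show "(\<lambda>i. f (x - s i * u) * \<psi> u) \<longlonglongrightarrow> f x * \<psi> u" by (intro tendsto_intros)
    qed
  qed measurable
  then have lim: "(\<lambda>n. ennreal (norm (smooth \<psi> (s n) f x))) \<longlonglongrightarrow> ennreal (norm (f x * (LINT u|lborel. \<psi> u)))"
    unfolding eq by (intro tendsto_ennrealI tendsto_norm) simp
  have "ennreal (norm (smooth \<psi> (s n) f x)) \<le> cone_maximal \<Gamma> \<psi> f x" for n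
    using cone_maximal_upper[OF apertureD(1)[OF \<Gamma> s0[of n]], of \<psi> f x] by simp
  then have "ennreal (norm (f x * (LINT u|lborel. \<psi> u))) \<le> cone_maximal \<Gamma> \<psi> f x"
    by (intro LIMSEQ_le_const2[OF lim]) blast
  then show ?thesis by (simp add: norm_mult mult.commute flip: ennreal_mult)
qed

lemma smooth_norm_le:
  assumes \<psi>: "decaying_kernel \<psi>" and f: "integrable lborel f" and s: "0 < s" and b: "\<And>y. norm (f y) \<le> 1"
  shows "norm (smooth \<psi> s f w) \<le> (LINT u|lborel. norm (\<psi> u))"
proof -
  note [measurable] = decaying_kernelD(2)[OF \<psi>]
  have eq: "(LINT y|lborel. norm (dilate s \<psi> (w - y))) = (LINT u|lborel. norm (\<psi> u))"
    and int: "integrable lborel (\<lambda>y. dilate s \<psi> (w - y))"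
  proof -
    have "integrable lborel (\<lambda>y. \<psi> (w / s + (- 1 / s) * y))"
      using decaying_kernelD(3)[OF \<psi>] s by (intro lborel_integrable_real_affine) auto
    moreover have "dilate s \<psi> (w - y) = \<psi> (w / s + (- 1 / s) * y) / of_real s" for y
      by (simp add: dilate_def diff_divide_distrib)
    ultimately show "integrable lborel (\<lambda>y. dilate s \<psi> (w - y))" by simp
    have "(LINT u|lborel. norm (\<psi> u)) = \<bar>- 1 / s\<bar> *\<^sub>R (LINT y|lborel. norm (\<psi> (w / s + (- 1 / s) * y)))"
      using s by (intro lborel_integral_real_affine) auto
    also have "\<dots> = (LINT y|lborel. norm (dilate s \<psi> (w - y)))"
      unfolding dilate_def using s by (simp add: norm_divide diff_divide_distrib)
    finally show "(LINT y|lborel. norm (dilate s \<psi> (w - y))) = (LINT u|lborel. norm (\<psi> u))" ..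
  qed
  have "norm (smooth \<psi> s f w) \<le> (LINT y|lborel. norm (f y * dilate s \<psi> (w - y)))"
    unfolding smooth_def by (rule integral_norm_bound)
  also have "\<dots> \<le> (LINT y|lborel. norm (dilate s \<psi> (w - y)))"
  proof (rule integral_mono)
    show "integrable lborel (\<lambda>y. norm (f y * dilate s \<psi> (w - y)))"
      by (intro integrable_norm smooth_integrable \<psi> f s) measurable
    show "integrable lborel (\<lambda>y. norm (dilate s \<psi> (w - y)))" using int by (rule integrable_norm)
    show "norm (f y * dilate s \<psi> (w - y)) \<le> norm (dilate s \<psi> (w - y))" for y
      using mult_right_mono[OF b[of y] norm_ge_zero, of "dilate s \<psi> (w - y)"] by (simp add: norm_mult)
  qed
  finally show ?thesis using eq by simp
qed

lemma dilate_derivative_bound: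
  assumes d: "\<And>x. (\<psi> has_vector_derivative \<psi>' x) (at x)" and b: "\<And>x. norm (\<psi>' x) \<le> C / (1 + x\<^sup>2)"
    and s: "0 < s"
  shows "(dilate s \<psi> has_vector_derivative (\<psi>' (u / s) /\<^sub>R s\<^sup>2)) (at u)"
    and "norm (\<psi>' (u / s) /\<^sub>R s\<^sup>2) \<le> C / (s\<^sup>2 + u\<^sup>2)"
proof -
  have "((\<lambda>u. u / s) has_vector_derivative 1 / s) (at u)"
    using s by (auto intro!: derivative_eq_intros simp flip: has_real_derivative_iff_has_vector_derivative)
  then have "(\<psi> \<circ> (\<lambda>u. u / s) has_vector_derivative (1 / s) *\<^sub>R \<psi>' (u / s)) (at u)"
    by (rule vector_diff_chain_at) (rule d)
  then have "((\<lambda>u. (1 / s) *\<^sub>R (\<psi> \<circ> (\<lambda>u. u / s)) u) has_vector_derivative (1 / s) *\<^sub>R ((1 / s) *\<^sub>R \<psi>' (u / s))) (at u)"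
    by (rule bounded_linear.has_vector_derivative[OF bounded_linear_scaleR_right])
  moreover have "(\<lambda>u. (1 / s) *\<^sub>R (\<psi> \<circ> (\<lambda>u. u / s)) u) = dilate s \<psi>"
    using s by (auto simp: fun_eq_iff dilate_def scaleR_conv_of_real)
  moreover have "(1 / s) *\<^sub>R ((1 / s) *\<^sub>R \<psi>' (u / s)) = \<psi>' (u / s) /\<^sub>R s\<^sup>2"
    by (simp add: power2_eq_square inverse_eq_divide)
  ultimately show "(dilate s \<psi> has_vector_derivative (\<psi>' (u / s) /\<^sub>R s\<^sup>2)) (at u)" by (simp only:)
  have "norm (\<psi>' (u / s) /\<^sub>R s\<^sup>2) = norm (\<psi>' (u / s)) / s\<^sup>2" by (simp add: divide_inverse mult.commute)
  also have "\<dots> \<le> (C / (1 + (u / s)\<^sup>2)) / s\<^sup>2" by (intro divide_right_mono b) simp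
  also have "\<dots> = C / ((1 + (u / s)\<^sup>2) * s\<^sup>2)" by simp
  also have "(1 + (u / s)\<^sup>2) * s\<^sup>2 = s\<^sup>2 + u\<^sup>2" using s by (simp add: power_divide algebra_simps)
  finally show "norm (\<psi>' (u / s) /\<^sub>R s\<^sup>2) \<le> C / (s\<^sup>2 + u\<^sup>2)" .
qed

lemma vector_derivative_norm_bound:
  fixes f :: "real \<Rightarrow> 'a::real_normed_vector"
  assumes "\<And>u. u \<in> {a..b} \<Longrightarrow> (f has_vector_derivative f' u) (at u)" "\<And>u. u \<in> {a..b} \<Longrightarrow> norm (f' u) \<le> B"
    "x \<in> {a..b}" "y \<in> {a..b}"
  shows "norm (f x - f y) \<le> B * \<bar>x - y\<bar>"
proof -
  have "norm (f x - f y) \<le> B * norm (x - y)"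
  proof (rule differentiable_bound[where S = "{a..b}" and f' = "\<lambda>u h. h *\<^sub>R f' u"])
    show "(f has_derivative (\<lambda>h. h *\<^sub>R f' u)) (at u within {a..b})" if "u \<in> {a..b}" for u
      using assms(1)[OF that] unfolding has_vector_derivative_def by (rule has_derivative_at_withinI)
    show "onorm (\<lambda>h. h *\<^sub>R f' u) \<le> B" if "u \<in> {a..b}" for u
    proof (rule onorm_bound)
      show "0 \<le> B" using assms(2)[OF that] norm_ge_zero order_trans by blast
      show "norm (h *\<^sub>R f' u) \<le> B * norm h" for h
        using mult_left_mono[OF assms(2)[OF that], of "\<bar>h\<bar>"] by (simp add: mult.commute)
    qed
  qed (use assms in auto)
  then show ?thesis by simp
qed

text \<open>
Near the origin the mollification is bounded by \<open>\<integral> \<bar>\<psi>\<bar>\<close>. Far away the vanishing mean of the bump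
allows to subtract a constant from the kernel, whose derivative at scale \<open>s\<close> is of size
\<open>1/(s\<^sup>2 + u\<^sup>2)\<close>; in the cone this is at most a multiple of \<open>1/x\<^sup>2\<close>.
\<close>

lemma smooth_bump_decay:
  assumes \<psi>: "decaying_kernel \<psi>"
  shows "\<exists>D\<ge>0. \<forall>x v s. \<bar>v\<bar> < s \<longrightarrow> norm (smooth \<psi> s odd_bump (x - v)) \<le> D * (1 / (1 + x\<^sup>2))"
proof -
  obtain C \<psi>' where C: "\<And>x. (\<psi> has_vector_derivative \<psi>' x) (at x)" "\<And>x. norm (\<psi> x) \<le> C / (1 + x\<^sup>2)"
      "\<And>x. norm (\<psi>' x) \<le> C / (1 + x\<^sup>2)"
    using \<psi> unfolding decaying_kernel_def by blast
  have C0: "0 \<le> C" using order_trans[OF norm_ge_zero C(2)[of 0]] by simp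
  have bi: "integrable lborel odd_bump" using bump_integrable by simp
  define J where "J = (LINT u|lborel. norm (\<psi> u))"
  have J0: "0 \<le> J" unfolding J_def by (rule integral_nonneg_AE) simp
  have "norm (smooth \<psi> s odd_bump (x - v)) \<le> (17 * J + 16 * C) * (1 / (1 + x\<^sup>2))" if vs: "\<bar>v\<bar> < s" for x v s
  proof -
    have s: "0 < s" using vs by linarith
    have x1: "0 < 1 + x\<^sup>2" by (simp add: add_pos_nonneg)
    show ?thesis
    proof (cases "4 \<le> \<bar>x\<bar>")
      case False
      have "norm (smooth \<psi> s odd_bump (x - v)) \<le> J"
        unfolding J_def by (rule smooth_norm_le[OF \<psi> bi s]) (simp add: bump_le)
      also have "\<dots> \<le> (17 * J) * (1 / (1 + x\<^sup>2))"
      proof -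
        have "x\<^sup>2 \<le> 4\<^sup>2" using False by (intro power2_le_iff_abs_le[THEN iffD2]) auto
        then have "1 + x\<^sup>2 \<le> 17" by simp
        then have "J * (1 + x\<^sup>2) \<le> J * 17" using J0 by (rule mult_left_mono)
        then show ?thesis using x1 by (simp add: field_simps)
      qed
      also have "\<dots> \<le> (17 * J + 16 * C) * (1 / (1 + x\<^sup>2))"
        using C0 x1 by (intro mult_right_mono) auto
      finally show ?thesis .
    next
      case True
      let ?w = "x - v"
      have x0: "0 < x\<^sup>2" using True by auto
      have diff: "norm (dilate s \<psi> (?w - y) - dilate s \<psi> ?w) \<le> 4 * C / x\<^sup>2" if y: "\<bar>y\<bar> \<le> 1" for y
      proof -
        have "norm (dilate s \<psi> (?w - y) - dilate s \<psi> ?w) \<le> (4 * C / x\<^sup>2) * \<bar>(?w - y) - ?w\<bar>"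
        proof (rule vector_derivative_norm_bound[where a = "?w - 1" and b = "?w + 1"])
          fix u assume u: "u \<in> {?w - 1..?w + 1}"
          show "(dilate s \<psi> has_vector_derivative (\<psi>' (u / s) /\<^sub>R s\<^sup>2)) (at u)"
            by (rule dilate_derivative_bound(1)[OF C(1,3) s])
          have "norm (\<psi>' (u / s) /\<^sub>R s\<^sup>2) \<le> C / (s\<^sup>2 + u\<^sup>2)"
            by (rule dilate_derivative_bound(2)[OF C(1,3) s])
          also have "\<dots> \<le> C / (x\<^sup>2 / 4)"
          proof (rule divide_left_mono)
            \<comment> \<open>The triangle inequality along \<open>x, x - v, u, 0\<close>; since \<open>\<bar>x\<bar> \<ge> 4\<close>, the 1 costs at most a quarter.\<close>
            have "\<bar>x\<bar> \<le> s + 1 + \<bar>u\<bar>" using u vs by (auto simp: abs_if split: if_splits)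
            then have "(3 / 4) * \<bar>x\<bar> \<le> s + \<bar>u\<bar>" using True by linarith
            then have "((3 / 4) * \<bar>x\<bar>)\<^sup>2 \<le> (s + \<bar>u\<bar>)\<^sup>2" by (intro power_mono) auto
            also have "(s + \<bar>u\<bar>)\<^sup>2 \<le> 2 * (s\<^sup>2 + u\<^sup>2)"
              using sum_squares_bound[of s "\<bar>u\<bar>"] by (simp add: power2_sum)
            finally have "(9 / 16) * x\<^sup>2 \<le> 2 * (s\<^sup>2 + u\<^sup>2)" by (simp add: power_mult_distrib power_divide)
            then have "(9 / 32) * x\<^sup>2 \<le> s\<^sup>2 + u\<^sup>2" by simp
            moreover have "x\<^sup>2 / 4 \<le> (9 / 32) * x\<^sup>2" using x0 by simp
            ultimately show "x\<^sup>2 / 4 \<le> s\<^sup>2 + u\<^sup>2" by (rule order_trans[rotated])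
            show "0 < (s\<^sup>2 + u\<^sup>2) * (x\<^sup>2 / 4)" using s x0 by (intro mult_pos_pos add_pos_nonneg) auto
          qed (rule C0)
          finally show "norm (\<psi>' (u / s) /\<^sub>R s\<^sup>2) \<le> 4 * C / x\<^sup>2" by (simp add: mult.commute)
        qed (use y in auto)
        also have "\<dots> \<le> (4 * C / x\<^sup>2) * 1" using y C0 by (intro mult_left_mono) auto
        finally show ?thesis by simp
      qed
      have b1: "integrable lborel (\<lambda>y. odd_bump y * dilate s \<psi> (?w - y))"
        by (intro smooth_integrable \<psi> bi s) measurable
      have b2: "integrable lborel (\<lambda>y. odd_bump y * dilate s \<psi> ?w)" using bi by (rule integrable_mult_left)
      have "smooth \<psi> s odd_bump ?w = (LINT y|lborel. odd_bump y * dilate s \<psi> (?w - y)) - (LINT y|lborel. odd_bump y * dilate s \<psi> ?w)"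
        unfolding smooth_def by (simp add: bump_integral)
      also have "\<dots> = (LINT y|lborel. odd_bump y * dilate s \<psi> (?w - y) - odd_bump y * dilate s \<psi> ?w)"
        by (rule Bochner_Integration.integral_diff[OF b1 b2, symmetric])
      finally have eq: "smooth \<psi> s odd_bump ?w = (LINT y|lborel. odd_bump y * dilate s \<psi> (?w - y) - odd_bump y * dilate s \<psi> ?w)" .
      have "norm (smooth \<psi> s odd_bump ?w) \<le> (LINT y|lborel. norm (odd_bump y * dilate s \<psi> (?w - y) - odd_bump y * dilate s \<psi> ?w))"
        unfolding eq by (rule integral_norm_bound)
      also have "\<dots> \<le> (LINT y|lborel. indicator {-1..1::real} y * (4 * C / x\<^sup>2))"
      proof (rule integral_mono)
        show "integrable lborel (\<lambda>y. norm (odd_bump y * dilate s \<psi> (?w - y) - odd_bump y * dilate s \<psi> ?w))"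
          using b1 b2 by auto
        show "integrable lborel (\<lambda>y. indicator {-1..1::real} y * (4 * C / x\<^sup>2))"
          by (intro integrable_mult_left integrable_real_indicator) auto
        fix y
        have "norm (odd_bump y * dilate s \<psi> (?w - y) - odd_bump y * dilate s \<psi> ?w) = \<bar>bump y\<bar> * norm (dilate s \<psi> (?w - y) - dilate s \<psi> ?w)"
          by (simp add: norm_mult flip: right_diff_distrib)
        also have "\<dots> \<le> indicator {-1..1} y * (4 * C / x\<^sup>2)"
        proof (cases "\<bar>y\<bar> \<le> 1")
          case True
          then show ?thesis using diff[OF True] C0 by (intro mult_mono bump_indicator) auto
        next
          case False
          then show ?thesis using C0 by (simp add: bump_zero)
        qed
        finally show "norm (odd_bump y * dilate s \<psi> (?w - y) - odd_bump y * dilate s \<psi> ?w) \<le> indicator {-1..1} y * (4 * C / x\<^sup>2)" .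
      qed
      also have "\<dots> = 8 * C / x\<^sup>2" by simp
      also have "\<dots> \<le> (16 * C) * (1 / (1 + x\<^sup>2))"
      proof -
        have "4\<^sup>2 \<le> \<bar>x\<bar>\<^sup>2" using True by (intro power_mono) auto
        then have "1 + x\<^sup>2 \<le> 2 * x\<^sup>2" by simp
        then have "1 / (2 * x\<^sup>2) \<le> 1 / (1 + x\<^sup>2)" using x1 x0 by (intro divide_left_mono) auto
        then have "(16 * C) * (1 / (2 * x\<^sup>2)) \<le> (16 * C) * (1 / (1 + x\<^sup>2))"
          using C0 by (intro mult_left_mono) auto
        then show ?thesis by simp
      qed
      also have "\<dots> \<le> (17 * J + 16 * C) * (1 / (1 + x\<^sup>2))"
        using J0 x1 by (intro mult_right_mono) auto
      finally show ?thesis .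
    qed
  qed
  moreover have "0 \<le> 17 * J + 16 * C" using J0 C0 by simp
  ultimately show ?thesis by blast
qed

lemma nn_integral_inverse_square_decay_finite:
  assumes "\<And>x. F x \<le> ennreal (D * (1 / (1 + x\<^sup>2)))"
  shows "(\<integral>\<^sup>+x. F x \<partial>lborel) < \<infinity>"
proof -
  have "(\<integral>\<^sup>+x. F x \<partial>lborel) \<le> (\<integral>\<^sup>+x. ennreal (D * (1 / (1 + x\<^sup>2))) \<partial>lborel)"
    using assms by (rule nn_integral_mono)
  also have "\<dots> \<le> (\<integral>\<^sup>+x. ennreal (norm (D * (1 / (1 + x\<^sup>2)))) \<partial>lborel)"
    unfolding real_norm_def by (intro nn_integral_mono ennreal_leI abs_ge_self)
  also have "\<dots> < \<infinity>"
    using integrable_mult_right[OF integrable_inverse_1_plus_square, of D] by (simp add: integrable_iff_bounded)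
  finally show ?thesis .
qed

lemma cone_maximal_norm_bump_finite:
  assumes \<psi>: "decaying_kernel \<psi>" and \<Gamma>: "aperture \<Gamma>"
  shows "(\<integral>\<^sup>+x. cone_maximal \<Gamma> \<psi> odd_bump x \<partial>lborel) < \<infinity>"
proof -
  obtain D where D: "0 \<le> D" "\<And>x v s. \<bar>v\<bar> < s \<Longrightarrow> norm (smooth \<psi> s odd_bump (x - v)) \<le> D * (1 / (1 + x\<^sup>2))"
    using smooth_bump_decay[OF \<psi>] by blast
  show ?thesis
  proof (rule nn_integral_inverse_square_decay_finite)
    fix x
    show "cone_maximal \<Gamma> \<psi> odd_bump x \<le> ennreal (D * (1 / (1 + x\<^sup>2)))"
      unfolding cone_maximal_def
    proof (rule SUP_least, clarify)
      fix v s assume "(v, s) \<in> \<Gamma>"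
      then have "\<bar>v\<bar> < s" by (rule apertureD(2)[OF \<Gamma>])
      then show "ennreal (norm (smooth \<psi> s odd_bump (x - v))) \<le> ennreal (D * (1 / (1 + x\<^sup>2)))"
        by (intro ennreal_leI D(2))
    qed
  qed
qed

lemma schwartz_decaying_kernel:
  assumes "schwartz \<psi>"
  shows "decaying_kernel \<psi>"
proof -
  have decay: "\<exists>C. \<forall>x. norm (nderiv n \<psi> x) \<le> C / (1 + x\<^sup>2)" for n
  proof -
    have "bounded (range (\<lambda>x. x ^ 0 *\<^sub>R nderiv n \<psi> x))" "bounded (range (\<lambda>x. x ^ 2 *\<^sub>R nderiv n \<psi> x))"
      using assms unfolding schwartz_def by blast+
    then obtain A B where A: "\<And>x. norm (x ^ 0 *\<^sub>R nderiv n \<psi> x) \<le> A" and B: "\<And>x. norm (x ^ 2 *\<^sub>R nderiv n \<psi> x) \<le> B"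
      unfolding bounded_iff by auto
    have "norm (nderiv n \<psi> x) \<le> (A + B) / (1 + x\<^sup>2)" for x
    proof -
      have "norm (nderiv n \<psi> x) * (1 + x\<^sup>2) \<le> A + B"
        using A[of x] B[of x] by (simp add: algebra_simps)
      moreover have "0 < 1 + x\<^sup>2" by (simp add: add_pos_nonneg)
      ultimately show ?thesis by (simp add: field_simps)
    qed
    then show ?thesis by blast
  qed
  obtain A B where A: "\<And>x. norm (nderiv 0 \<psi> x) \<le> A / (1 + x\<^sup>2)" and B: "\<And>x. norm (nderiv 1 \<psi> x) \<le> B / (1 + x\<^sup>2)"
    using decay[of 0] decay[of 1] by blast
  have deriv: "(\<psi> has_vector_derivative nderiv 1 \<psi> x) (at x)" for x
  proof -
    have "nderiv 0 \<psi> differentiable (at x)" using assms unfolding schwartz_def by blast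
    then show ?thesis unfolding nderiv_def by (simp add: vector_derivative_works)
  qed
  have "max A B / (1 + x\<^sup>2) \<ge> A / (1 + x\<^sup>2)" "max A B / (1 + x\<^sup>2) \<ge> B / (1 + x\<^sup>2)" for x
    by (auto intro!: divide_right_mono)
  moreover have "nderiv 0 \<psi> = \<psi>" unfolding nderiv_def by simp
  ultimately have "norm (\<psi> x) \<le> max A B / (1 + x\<^sup>2)" "norm (nderiv 1 \<psi> x) \<le> max A B / (1 + x\<^sup>2)" for x
    using A[of x] B[of x] by (metis order_trans)+
  then show ?thesis unfolding decaying_kernel_def using deriv by blast
qed

lemma poisson_decaying_kernel: "decaying_kernel poisson_kernel"
  unfolding decaying_kernel_def
proof (intro exI allI conjI)
  fix x :: real
  have p: "0 < x\<^sup>2 + 1" by (simp add: add_nonneg_pos)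
  have "((\<lambda>x. 1 / (x\<^sup>2 + 1)) has_real_derivative (- (2 * x) / (x\<^sup>2 + 1)\<^sup>2)) (at x)"
    using p by (auto intro!: derivative_eq_intros simp: power2_eq_square)
  then have "((\<lambda>x. complex_of_real (1 / (x\<^sup>2 + 1))) has_vector_derivative complex_of_real (- (2 * x) / (x\<^sup>2 + 1)\<^sup>2)) (at x)"
    by (rule has_vector_derivative_of_real)
  then show "(poisson_kernel has_vector_derivative complex_of_real (- (2 * x) / (x\<^sup>2 + 1)\<^sup>2)) (at x)"
    by (simp add: poisson_kernel_def[abs_def])
  show "norm (poisson_kernel x) \<le> 1 / (1 + x\<^sup>2)"
    using p by (simp add: poisson_kernel_def norm_divide add.commute del: of_real_add of_real_power of_real_divide)
  have "2 * \<bar>x\<bar> \<le> x\<^sup>2 + 1" using sum_squares_bound[of "\<bar>x\<bar>" 1] by simp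
  then have "2 * \<bar>x\<bar> / (x\<^sup>2 + 1)\<^sup>2 \<le> (x\<^sup>2 + 1) / (x\<^sup>2 + 1)\<^sup>2" by (rule divide_right_mono) simp
  then show "norm (complex_of_real (- (2 * x) / (x\<^sup>2 + 1)\<^sup>2)) \<le> 1 / (1 + x\<^sup>2)"
    unfolding norm_of_real using p by (simp add: abs_mult power2_eq_square add.commute)
qed

lemma poisson_integral_nonzero: "(LINT x|lborel. poisson_kernel x) \<noteq> 0"
proof -
  have int: "integrable lborel (\<lambda>x::real. 1 / (x\<^sup>2 + 1))"
    using integrable_inverse_1_plus_square by (simp add: add.commute)
  have p: "0 < x\<^sup>2 + (1::real)" for x :: real by (simp add: add_nonneg_pos)
  have "(LINT x::real|lborel. 1 / (x\<^sup>2 + 1)) \<noteq> 0"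
  proof
    assume "(LINT x::real|lborel. 1 / (x\<^sup>2 + 1)) = 0"
    then have "AE x::real in lborel. 1 / (x\<^sup>2 + 1) = 0"
      using p by (subst (asm) integral_nonneg_eq_0_iff_AE[OF int]) (auto intro!: AE_I2 simp: less_imp_le)
    moreover have "1 / (x\<^sup>2 + 1) \<noteq> 0" for x :: real using p[of x] by simp
    ultimately have "AE x::real in lborel. False" by simp
    then have "emeasure lborel (UNIV :: real set) = 0" by (simp add: AE_iff_measurable[of UNIV])
    then show False by simp
  qed
  then show ?thesis unfolding poisson_kernel_def using int by (subst integral_of_real) auto
qed

section \<open>The atomic norm\<close>

lemma double_series_sums:
  fixes u :: "nat \<Rightarrow> nat \<Rightarrow> complex"
  assumes abs: "summable (\<lambda>n. norm (case prod_decode n of (j, k) \<Rightarrow> u j k))"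
    and row: "\<And>j. u j sums F j" and col: "F sums S"
  shows "(\<lambda>n. case prod_decode n of (j, k) \<Rightarrow> u j k) sums S"
proof -
  let ?v = "\<lambda>(j, k). u j k"
  have bij: "bij_betw prod_decode UNIV (UNIV \<times> UNIV :: (nat \<times> nat) set)"
    using bij_prod_decode by simp
  have hs: "((\<lambda>n. ?v (prod_decode n)) has_sum (\<Sum>n. ?v (prod_decode n))) UNIV"
    by (rule norm_summable_imp_has_sum[OF abs summable_sums[OF summable_norm_cancel[OF abs]]])
  then have hv: "(?v has_sum (\<Sum>n. ?v (prod_decode n))) (UNIV \<times> UNIV)"
    using has_sum_reindex_bij_betw[OF bij, of ?v] by simp
  have sv: "?v summable_on (Sigma UNIV (\<lambda>_. UNIV))" using hv by (auto simp: summable_on_def)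
  have rows: "(u j) summable_on UNIV" for j
  proof -
    have "?v summable_on (Pair j ` UNIV)" by (rule summable_on_subset_banach[OF sv]) auto
    then have "(?v \<circ> Pair j) summable_on UNIV" by (subst (asm) summable_on_reindex) (auto simp: inj_on_def)
    then show ?thesis by (simp add: o_def)
  qed
  have "infsum (u j) UNIV = F j" for j
    using has_sum_imp_sums[OF has_sum_infsum[OF rows[of j]]] row[of j] sums_unique2 by blast
  then have eq: "infsum F UNIV = (\<Sum>n. ?v (prod_decode n))" and sF: "F summable_on UNIV"
    using infsum_Sigma_banach[OF sv] infsumI[OF hv] summable_on_Sigma_banach[OF sv] by auto
  have "infsum F UNIV = S"
    using has_sum_imp_sums[OF has_sum_infsum[OF sF]] col sums_unique2 by blast
  then show ?thesis using has_sum_imp_sums[OF hs] eq by simp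
qed

lemma L1_norm_lborel: "L1_norm f = (\<integral>\<^sup>+x. ennreal (norm (f x)) \<partial>lborel)"
  unfolding L1_norm_def by (rule nn_integral_completion)

lemma L1_norm_cong_AE: "(AE x in lborel. f x = g x) \<Longrightarrow> L1_norm f = L1_norm g"
  unfolding L1_norm_lborel by (intro nn_integral_cong_AE) (auto elim!: eventually_mono)

lemma L1_norm_add_le:
  assumes [measurable]: "f \<in> borel_measurable lebesgue" "g \<in> borel_measurable lebesgue"
  shows "L1_norm (\<lambda>x. f x + g x) \<le> L1_norm f + L1_norm g"
proof -
  have "L1_norm (\<lambda>x. f x + g x) \<le> (\<integral>\<^sup>+x. ennreal (norm (f x)) + ennreal (norm (g x)) \<partial>lebesgue)"
    unfolding L1_norm_def by (intro nn_integral_mono) (simp add: norm_triangle_ineq flip: ennreal_plus)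
  also have "\<dots> = L1_norm f + L1_norm g"
    unfolding L1_norm_def by (intro nn_integral_add) measurable
  finally show ?thesis .
qed

lemma L1_norm_cmult: 
  assumes "f \<in> borel_measurable lebesgue"
  shows "L1_norm (\<lambda>x. c * f x) = ennreal (norm c) * L1_norm f"
  unfolding L1_norm_def using assms
  by (subst nn_integral_cmult[symmetric]) (auto simp: norm_mult ennreal_mult)

lemma L1_norm_minus: "L1_norm (\<lambda>x. f x - g x) = L1_norm (\<lambda>x. g x - f x)"
  unfolding L1_norm_def by (simp add: norm_minus_commute)

lemma L1_norm_eq_0D:
  assumes "f \<in> borel_measurable lebesgue" "L1_norm f = 0"
  shows "AE x in lborel. f x = 0"
proof -
  have "AE x in lebesgue. ennreal (norm (f x)) = 0"
    using assms unfolding L1_norm_def by (subst (asm) nn_integral_0_iff_AE) auto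
  then show ?thesis by (simp add: AE_completion_iff)
qed

lemma L1_series_AE_summable:
  assumes g: "\<And>n. g n \<in> borel_measurable lebesgue"
    and c: "\<And>n::nat. L1_norm (g n) \<le> ennreal (c n)" "\<And>n. 0 \<le> c n" "summable c"
  shows "AE x in lborel. summable (\<lambda>n. norm (g n x :: complex))"
proof -
  have "(\<integral>\<^sup>+x. (\<Sum>n. ennreal (norm (g n x))) \<partial>lebesgue) = (\<Sum>n. L1_norm (g n))"
    unfolding L1_norm_def using g by (intro nn_integral_suminf) measurable
  also have "\<dots> \<le> (\<Sum>n. ennreal (c n))" using c by (intro suminf_le) auto
  also have "\<dots> < \<infinity>" using ennreal_suminf_neq_top[OF c(3,2)] by (simp add: less_top)
  finally have "(\<integral>\<^sup>+x. (\<Sum>n. ennreal (norm (g n x))) \<partial>lebesgue) \<noteq> \<infinity>" by simp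
  then have "AE x in lebesgue. (\<Sum>n. ennreal (norm (g n x))) \<noteq> \<infinity>"
    using g by (intro nn_integral_PInf_AE) measurable
  then have "AE x in lborel. (\<Sum>n. ennreal (norm (g n x))) \<noteq> \<infinity>" by (simp add: AE_completion_iff)
  then show ?thesis by eventually_elim (auto intro: summable_suminf_not_top)
qed

text \<open>
Convergence in \<open>L\<^sup>1\<close> of a series with summable norms is the same as pointwise convergence almost
everywhere; this lemma and \<open>L1_series_sums_AE\<close> are the two directions. Pointwise, rearranging
absolutely convergent double series is elementary.
\<close>

lemma L1_series_tendsto:
  assumes g: "\<And>n. g n \<in> borel_measurable lebesgue"
    and c: "\<And>n::nat. L1_norm (g n) \<le> ennreal (c n)" "\<And>n. 0 \<le> c n" "summable c"
    and f: "AE x in lborel. (\<lambda>n. g n x) sums (f x :: complex)"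
  shows "(\<lambda>n. L1_norm (\<lambda>x. f x - (\<Sum>j<n. g j x))) \<longlonglongrightarrow> 0"
proof -
  have le: "L1_norm (\<lambda>x. f x - (\<Sum>j<n. g j x)) \<le> ennreal (suminf c - (\<Sum>j<n. c j))" for n
  proof -
    have "L1_norm (\<lambda>x. f x - (\<Sum>j<n. g j x)) \<le> (\<integral>\<^sup>+x. (\<Sum>j. ennreal (norm (g (j + n) x))) \<partial>lborel)"
      unfolding L1_norm_lborel
    proof (rule nn_integral_mono_AE)
      show "AE x in lborel. ennreal (norm (f x - (\<Sum>j<n. g j x))) \<le> (\<Sum>j. ennreal (norm (g (j + n) x)))"
        using f L1_series_AE_summable[OF g c]
      proof eventually_elim
        fix x assume fx: "(\<lambda>n. g n x) sums f x" and sx: "summable (\<lambda>n. norm (g n x))"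
        have "f x - (\<Sum>j<n. g j x) = (\<Sum>j. g (j + n) x)"
          using suminf_minus_initial_segment[of "\<lambda>n. g n x" n] fx by (auto simp: sums_iff)
        moreover have s': "summable (\<lambda>j. norm (g (j + n) x))" using sx by (subst summable_iff_shift)
        ultimately have "norm (f x - (\<Sum>j<n. g j x)) \<le> (\<Sum>j. norm (g (j + n) x))"
          using summable_norm[OF s'] by simp
        then show "ennreal (norm (f x - (\<Sum>j<n. g j x))) \<le> (\<Sum>j. ennreal (norm (g (j + n) x)))"
          using s' by (subst suminf_ennreal2) (auto intro: ennreal_leI)
      qed
    qed
    also have "\<dots> = (\<integral>\<^sup>+x. (\<Sum>j. ennreal (norm (g (j + n) x))) \<partial>lebesgue)"
      by (rule nn_integral_completion[symmetric])
    also have "\<dots> = (\<Sum>j. L1_norm (g (j + n)))"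
      unfolding L1_norm_def using g by (intro nn_integral_suminf) measurable
    also have "\<dots> \<le> (\<Sum>j. ennreal (c (j + n)))" using c by (intro suminf_le) auto
    also have "\<dots> = ennreal (\<Sum>j. c (j + n))"
      using c by (intro suminf_ennreal2) (auto simp: summable_iff_shift)
    also have "(\<Sum>j. c (j + n)) = suminf c - (\<Sum>j<n. c j)"
      by (rule suminf_minus_initial_segment[OF c(3)])
    finally show ?thesis .
  qed
  have "(\<lambda>n. suminf c - (\<Sum>j<n. c j)) \<longlonglongrightarrow> suminf c - suminf c"
    by (intro tendsto_intros summable_LIMSEQ c(3))
  then have "(\<lambda>n. ennreal (suminf c - (\<Sum>j<n. c j))) \<longlonglongrightarrow> ennreal (suminf c - suminf c)"
    by (rule tendsto_ennrealI)
  then have lim: "(\<lambda>n. ennreal (suminf c - (\<Sum>j<n. c j))) \<longlonglongrightarrow> 0" by simp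
  show ?thesis
    by (rule tendsto_sandwich[OF _ _ tendsto_const lim]) (use le in \<open>auto intro!: always_eventually\<close>)
qed

lemma L1_series_sums_AE:
  assumes g: "\<And>n. g n \<in> borel_measurable lebesgue"
    and c: "\<And>n::nat. L1_norm (g n) \<le> ennreal (c n)" "\<And>n. 0 \<le> c n" "summable c"
    and f: "f \<in> borel_measurable lebesgue" "(\<lambda>n. L1_norm (\<lambda>x. f x - (\<Sum>j<n. g j x))) \<longlonglongrightarrow> 0"
  shows "AE x in lborel. (\<lambda>n. g n x) sums (f x :: complex)"
proof -
  define F where "F x = (\<Sum>n. g n x)" for x
  have sF: "AE x in lborel. (\<lambda>n. g n x) sums F x"
    using L1_series_AE_summable[OF g c] unfolding F_def
    by eventually_elim (rule summable_sums[OF summable_norm_cancel])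
  have F: "(\<lambda>n. L1_norm (\<lambda>x. F x - (\<Sum>j<n. g j x))) \<longlonglongrightarrow> 0"
    by (rule L1_series_tendsto[OF g c sF])
  have Fm: "F \<in> borel_measurable lebesgue" unfolding F_def using g by measurable
  have "L1_norm (\<lambda>x. f x - F x) \<le> 0"
  proof (rule LIMSEQ_le_const)
    show "(\<lambda>n. L1_norm (\<lambda>x. f x - (\<Sum>j<n. g j x)) + L1_norm (\<lambda>x. F x - (\<Sum>j<n. g j x))) \<longlonglongrightarrow> 0"
      using tendsto_add[OF f(2) F] by simp
    have "L1_norm (\<lambda>x. f x - F x) \<le> L1_norm (\<lambda>x. f x - (\<Sum>j<n. g j x)) + L1_norm (\<lambda>x. F x - (\<Sum>j<n. g j x))" for n
    proof -
      have "L1_norm (\<lambda>x. (f x - (\<Sum>j<n. g j x)) + ((\<Sum>j<n. g j x) - F x))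
          \<le> L1_norm (\<lambda>x. f x - (\<Sum>j<n. g j x)) + L1_norm (\<lambda>x. (\<Sum>j<n. g j x) - F x)"
        using f Fm g by (intro L1_norm_add_le borel_measurable_diff borel_measurable_sum) auto
      then show ?thesis using L1_norm_minus[of F "\<lambda>x. \<Sum>j<n. g j x"] by simp
    qed
    then show "\<exists>N. \<forall>n\<ge>N. L1_norm (\<lambda>x. f x - F x) \<le> L1_norm (\<lambda>x. f x - (\<Sum>j<n. g j x)) + L1_norm (\<lambda>x. F x - (\<Sum>j<n. g j x))"
      by blast
  qed
  then have "AE x in lborel. f x - F x = 0"
    using f Fm by (intro L1_norm_eq_0D) auto
  with sF show ?thesis by eventually_elim simp
qed

text \<open>
A bounded interval may contain its end points or not; only its convex hull matters.
\<close>

lemma bounded_interval_between: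
  fixes B :: "real set"
  assumes "is_interval B" "bounded B" "0 < measure lebesgue B"
  obtains \<alpha> \<beta> where "\<alpha> < \<beta>" "B \<subseteq> {\<alpha>..\<beta>}" "measure lebesgue B = \<beta> - \<alpha>"
    "emeasure lebesgue B = ennreal (measure lebesgue B)" "B \<in> sets lebesgue"
proof -
  have lm: "B \<in> lmeasurable" using assms by (intro measurable_convex) (auto simp: is_interval_convex)
  have ne: "B \<noteq> {}" using assms(3) by auto
  have bd: "bdd_below B" "bdd_above B" using assms(2) by (auto simp: bounded_imp_bdd_below bounded_imp_bdd_above)
  have sub: "B \<subseteq> {Inf B..Sup B}" using bd by (auto intro: cInf_lower cSup_upper)
  have sup: "{Inf B<..<Sup B} \<subseteq> B"
  proof
    fix x assume "x \<in> {Inf B<..<Sup B}"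
    then obtain a b where "a \<in> B" "a < x" "b \<in> B" "x < b"
      using cInf_less_iff[OF ne bd(1)] less_cSup_iff[OF ne bd(2)] by auto
    then show "x \<in> B" using assms(1) unfolding is_interval_1 by (meson less_imp_le)
  qed
  have "Inf B \<le> Sup B" using ne sub by force
  then have "measure lebesgue {Inf B..Sup B} = Sup B - Inf B" "measure lebesgue {Inf B<..<Sup B} = Sup B - Inf B" by auto
  moreover have "measure lebesgue B \<le> measure lebesgue {Inf B..Sup B}"
    using sub lm by (intro measure_mono_fmeasurable) auto
  moreover have "measure lebesgue {Inf B<..<Sup B} \<le> measure lebesgue B"
    using sup lm by (intro measure_mono_fmeasurable) auto
  ultimately have m: "measure lebesgue B = Sup B - Inf B" by simp
  show thesis
    by (rule that[of "Inf B" "Sup B"]) (use sub m assms(3) lm emeasure_eq_measure2[OF lm] in auto)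
qed

lemma H1_atom_L1_norm_le:
  assumes "H1_atom B a"
  shows "L1_norm a \<le> 1"
proof -
  obtain \<alpha> \<beta> where B: "emeasure lebesgue B = ennreal (measure lebesgue B)" "B \<in> sets lebesgue"
    using assms bounded_interval_between[of B] unfolding H1_atom_def by metis
  have pos: "0 < measure lebesgue B" using assms unfolding H1_atom_def by simp
  have "L1_norm a \<le> (\<integral>\<^sup>+x. ennreal (1 / measure lebesgue B) * indicator B x \<partial>lebesgue)"
    unfolding L1_norm_def
  proof (rule nn_integral_mono_AE)
    have "AE x in lebesgue. x \<notin> B \<longrightarrow> a x = 0" "AE x in lebesgue. norm (a x) \<le> 1 / measure lebesgue B"
      using assms unfolding H1_atom_def by auto
    then show "AE x in lebesgue. ennreal (norm (a x)) \<le> ennreal (1 / measure lebesgue B) * indicator B x"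
      by eventually_elim (auto simp: indicator_def intro!: ennreal_leI)
  qed
  also have "\<dots> = ennreal (1 / measure lebesgue B) * emeasure lebesgue B"
    using B by (simp add: nn_integral_cmult_indicator)
  also have "\<dots> = 1" using pos unfolding B(1) by (simp flip: ennreal_mult)
  finally show ?thesis .
qed

lemma zero_atom: "H1_atom {0..1} (\<lambda>_. 0)"
  unfolding H1_atom_def by (auto simp: is_interval_cc)

lemma atomic_decompD:
  assumes "atomic_decomp c a f"
  shows "\<And>j. a j \<in> borel_measurable lebesgue" "\<And>j. L1_norm (\<lambda>x. c j * a j x) \<le> ennreal (norm (c j))"
    "summable (\<lambda>j. norm (c j))"
proof -
  show m: "a j \<in> borel_measurable lebesgue" for j
    using assms unfolding atomic_decomp_def H1_atom_def by blast
  show "L1_norm (\<lambda>x. c j * a j x) \<le> ennreal (norm (c j))" for j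
  proof -
    have "L1_norm (a j) \<le> 1" using assms H1_atom_L1_norm_le unfolding atomic_decomp_def by blast
    then have "ennreal (norm (c j)) * L1_norm (a j) \<le> ennreal (norm (c j)) * 1" by (rule mult_left_mono) simp
    then show ?thesis using L1_norm_cmult[OF m, of "c j" j] by simp
  qed
  show "summable (\<lambda>j. norm (c j))" using assms unfolding atomic_decomp_def by blast
qed

lemma atomic_decomp_sums_AE:
  assumes d: "atomic_decomp c a f" and f: "f \<in> borel_measurable lebesgue"
  shows "AE x in lborel. (\<lambda>j. c j * a j x) sums f x"
proof (rule L1_series_sums_AE[OF _ atomic_decompD(2)[OF d] _ atomic_decompD(3)[OF d] f])
  show "(\<lambda>x. c n * a n x) \<in> borel_measurable lebesgue" for n
    using atomic_decompD(1)[OF d, of n] by simp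
  show "(\<lambda>n. L1_norm (\<lambda>x. f x - (\<Sum>j<n. c j * a j x))) \<longlonglongrightarrow> 0"
    using d unfolding atomic_decomp_def by blast
qed simp

lemma atomic_decompI:
  assumes a: "\<And>j. \<exists>B. H1_atom B (a j)" and c: "summable (\<lambda>j. norm (c j))"
    and s: "AE x in lborel. (\<lambda>j. c j * a j x) sums f x"
  shows "atomic_decomp c a f"
  unfolding atomic_decomp_def
proof (intro conjI allI a c)
  have m: "a j \<in> borel_measurable lebesgue" for j using a[of j] unfolding H1_atom_def by blast
  show "(\<lambda>n. L1_norm (\<lambda>x. f x - (\<Sum>j<n. c j * a j x))) \<longlonglongrightarrow> 0"
  proof (rule L1_series_tendsto[where c = "\<lambda>j. norm (c j)"])
    show "(\<lambda>x. c n * a n x) \<in> borel_measurable lebesgue" for n using m[of n] by simp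
    show "L1_norm (\<lambda>x. c n * a n x) \<le> ennreal (norm (c n))" for n
    proof -
      have "L1_norm (a n) \<le> 1" using a[of n] H1_atom_L1_norm_le by blast
      then have "ennreal (norm (c n)) * L1_norm (a n) \<le> ennreal (norm (c n)) * 1" by (rule mult_left_mono) simp
      then show ?thesis using L1_norm_cmult[OF m, of "c n" n] by simp
    qed
  qed (use c s in auto)
qed

lemma atomic_norm_le: "atomic_decomp c a f \<Longrightarrow> atomic_norm f \<le> ennreal (\<Sum>j. norm (c j))"
  unfolding atomic_norm_def by (rule Inf_lower) blast

lemma atomic_norm_cong_AE:
  assumes "AE x in lborel. f x = g x"
  shows "atomic_norm f = atomic_norm g"
proof -
  have "L1_norm (\<lambda>x. f x - (\<Sum>j<n. c j * a j x)) = L1_norm (\<lambda>x. g x - (\<Sum>j<n. c j * a j x))" for n :: nat and c a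
    using assms by (intro L1_norm_cong_AE) (auto elim!: eventually_mono)
  then have "atomic_decomp c a f = atomic_decomp c a g" for c a
    unfolding atomic_decomp_def by simp
  then show ?thesis unfolding atomic_norm_def by simp
qed

text \<open>
Nearly optimal decompositions of the summands, with excess \<open>\<epsilon>/2\<^sup>j\<^sup>+\<^sup>1\<close> in the \<open>j\<close>-th one, are merged
into a single sequence along the pairing function.
\<close>

lemma atomic_norm_countable_subadditive:
  fixes F :: "nat \<Rightarrow> real \<Rightarrow> complex"
  assumes F: "\<And>j. F j \<in> borel_measurable lebesgue" and f: "f \<in> borel_measurable lebesgue"
    and b: "\<And>j. atomic_norm (F j) \<le> ennreal (b j)" "\<And>j. 0 \<le> b j" "summable b"
    and lim: "(\<lambda>n. L1_norm (\<lambda>x. f x - (\<Sum>j<n. F j x))) \<longlonglongrightarrow> 0"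
  shows "atomic_norm f \<le> ennreal (suminf b)"
proof (rule ennreal_le_epsilon)
  fix \<epsilon> :: real assume \<epsilon>: "0 < \<epsilon>"
  define b' where "b' j = b j + \<epsilon> * (1/2) ^ Suc j" for j
  have geo: "(\<lambda>j. \<epsilon> * (1/2::real) ^ Suc j) sums (\<epsilon> * 1)"
    using power_half_series by (intro sums_mult)
  have b': "b' sums (suminf b + \<epsilon>)" "\<And>j. 0 \<le> b' j" "\<And>j. b j < b' j"
    unfolding b'_def using sums_add[OF summable_sums[OF b(3)] geo] b(2) \<epsilon> by auto
  have "\<exists>c a. atomic_decomp c a (F j) \<and> (\<Sum>k. norm (c k)) < b' j" for j
  proof -
    have "atomic_norm (F j) < ennreal (b' j)"
      using b(1)[of j] b'(3)[of j] b(2)[of j] by (auto intro: le_less_trans simp: ennreal_lessI)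
    then obtain v where "v \<in> {ennreal (\<Sum>k. norm (c k)) | c a. atomic_decomp c a (F j)}" "v < ennreal (b' j)"
      unfolding atomic_norm_def Inf_less_iff by blast
    then obtain c a where ca: "atomic_decomp c a (F j)" "ennreal (\<Sum>k. norm (c k)) < ennreal (b' j)" by blast
    have "0 \<le> (\<Sum>k. norm (c k))" using atomic_decompD(3)[OF ca(1)] by (intro suminf_nonneg) auto
    with ca show ?thesis by (auto simp: ennreal_less_iff)
  qed
  then have "\<forall>j. \<exists>p. atomic_decomp (fst p) (snd p) (F j) \<and> (\<Sum>k. norm (fst p k)) < b' j"
    by (simp add: split_paired_Ex)
  from choice[OF this] obtain p where
    p: "\<forall>j. atomic_decomp (fst (p j)) (snd (p j)) (F j) \<and> (\<Sum>k. norm (fst (p j) k)) < b' j" ..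
  define c where "c j = fst (p j)" for j
  define a where "a j = snd (p j)" for j
  have ca: "\<And>j. atomic_decomp (c j) (a j) (F j)" "\<And>j. (\<Sum>k. norm (c j k)) < b' j"
    using p unfolding c_def a_def by blast+
  define C where "C n = (case prod_decode n of (j, k) \<Rightarrow> c j k)" for n
  define A where "A n = (case prod_decode n of (j, k) \<Rightarrow> a j k)" for n
  have Cn: "ennreal (norm (C n)) = (case prod_decode n of (j, k) \<Rightarrow> ennreal (norm (c j k)))" for n
    unfolding C_def by (cases "prod_decode n") simp
  have "(\<Sum>n. ennreal (norm (C n))) = (\<Sum>j. \<Sum>k. ennreal (norm (c j k)))"
    unfolding Cn by (rule suminf_ennreal_2dimen) simp
  also have "\<dots> \<le> (\<Sum>j. ennreal (b' j))"
  proof (intro suminf_le)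
    fix j
    have "(\<Sum>k. ennreal (norm (c j k))) = ennreal (\<Sum>k. norm (c j k))"
      using atomic_decompD(3)[OF ca(1)[of j]] by (intro suminf_ennreal2) auto
    then show "(\<Sum>k. ennreal (norm (c j k))) \<le> ennreal (b' j)" using ca(2)[of j] by (simp add: ennreal_leI)
  qed auto
  also have "\<dots> = ennreal (suminf b + \<epsilon>)"
    using b' by (subst suminf_ennreal2) (auto simp: sums_iff)
  finally have tot: "(\<Sum>n. ennreal (norm (C n))) \<le> ennreal (suminf b + \<epsilon>)" .
  then have sC: "summable (\<lambda>n. norm (C n))"
    by (intro summable_suminf_not_top) (auto simp: top_unique)
  have atoms: "\<exists>B. H1_atom B (A n)" for n
    using ca(1) unfolding A_def atomic_decomp_def by (cases "prod_decode n") simp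
  have Am: "A n \<in> borel_measurable lebesgue" for n using atoms[of n] unfolding H1_atom_def by blast
  have Cm: "(\<lambda>x. C n * A n x) \<in> borel_measurable lebesgue" for n using Am[of n] by simp
  have CA: "L1_norm (\<lambda>x. C n * A n x) \<le> ennreal (norm (C n))" for n
    using atomic_decompD(2)[OF ca(1)] unfolding C_def A_def by (cases "prod_decode n") simp
  have FL: "L1_norm (F j) \<le> ennreal (b' j)" for j
  proof -
    let ?S = "\<lambda>n x. \<Sum>k<n. c j k * a j k x"
    have Sm: "(\<lambda>x. ?S n x) \<in> borel_measurable lebesgue" for n
      using atomic_decompD(1)[OF ca(1)[of j]]
      by (intro borel_measurable_sum borel_measurable_times borel_measurable_const)
    have "L1_norm (\<lambda>x. ?S n x) \<le> ennreal (b' j)" for n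
    proof -
      have "L1_norm (\<lambda>x. ?S n x) \<le> ennreal (\<Sum>k<n. norm (c j k))"
      proof (induction n)
        case (Suc n)
        have "L1_norm (\<lambda>x. ?S (Suc n) x) \<le> L1_norm (\<lambda>x. ?S n x) + L1_norm (\<lambda>x. c j n * a j n x)"
          using Sm[of n] atomic_decompD(1)[OF ca(1)[of j], of n] by (simp add: L1_norm_add_le)
        also have "\<dots> \<le> ennreal (\<Sum>k<n. norm (c j k)) + ennreal (norm (c j n))"
          by (intro add_mono Suc atomic_decompD(2)[OF ca(1)])
        also have "\<dots> = ennreal (\<Sum>k<Suc n. norm (c j k))" by (simp add: sum_nonneg)
        finally show ?case .
      qed (simp add: L1_norm_def)
      also have "\<dots> \<le> ennreal (b' j)"
        using ca(2)[of j] sum_le_suminf[OF atomic_decompD(3)[OF ca(1)[of j]], of "{..<n}"]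
        by (intro ennreal_leI) auto
      finally show ?thesis .
    qed
    then have le: "L1_norm (F j) \<le> L1_norm (\<lambda>x. F j x - ?S n x) + ennreal (b' j)" for n
    proof -
      have "L1_norm (\<lambda>x. (F j x - ?S n x) + ?S n x) \<le> L1_norm (\<lambda>x. F j x - ?S n x) + L1_norm (\<lambda>x. ?S n x)"
        using F[of j] Sm[of n] by (intro L1_norm_add_le borel_measurable_diff)
      then show ?thesis using \<open>L1_norm (\<lambda>x. ?S n x) \<le> ennreal (b' j)\<close> by (auto intro: order_trans add_left_mono)
    qed
    have "(\<lambda>n. L1_norm (\<lambda>x. F j x - ?S n x) + ennreal (b' j)) \<longlonglongrightarrow> 0 + ennreal (b' j)"
      using ca(1)[of j] unfolding atomic_decomp_def by (intro tendsto_intros) auto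
    then show ?thesis using le by (intro LIMSEQ_le_const) auto
  qed
  have "AE x in lborel. (\<lambda>j. F j x) sums f x"
    by (rule L1_series_sums_AE[OF F FL b'(2) sums_summable[OF b'(1)] f lim])
  moreover have "AE x in lborel. \<forall>j. (\<lambda>k. c j k * a j k x) sums F j x"
    unfolding AE_all_countable using atomic_decomp_sums_AE[OF ca(1) F] by blast
  moreover have "AE x in lborel. summable (\<lambda>n. norm (C n * A n x))"
    by (rule L1_series_AE_summable[OF Cm CA _ sC]) simp
  ultimately have "AE x in lborel. (\<lambda>n. C n * A n x) sums f x"
  proof eventually_elim
    fix x assume 1: "(\<lambda>j. F j x) sums f x" and 2: "\<forall>j. (\<lambda>k. c j k * a j k x) sums F j x"
      and 3: "summable (\<lambda>n. norm (C n * A n x))"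
    have eq: "C n * A n x = (case prod_decode n of (j, k) \<Rightarrow> c j k * a j k x)" for n
      unfolding C_def A_def by (cases "prod_decode n") simp
    from double_series_sums[of "\<lambda>j k. c j k * a j k x" "\<lambda>j. F j x" "f x"] 1 2 3
    show "(\<lambda>n. C n * A n x) sums f x" unfolding eq by blast
  qed
  then have "atomic_decomp C A f" by (rule atomic_decompI[OF atoms sC])
  then have "atomic_norm f \<le> ennreal (\<Sum>n. norm (C n))" by (rule atomic_norm_le)
  also have "\<dots> = (\<Sum>n. ennreal (norm (C n)))" using sC by (intro suminf_ennreal2[symmetric]) auto
  also note tot
  also have "ennreal (suminf b + \<epsilon>) = ennreal (suminf b) + ennreal \<epsilon>"
    using \<epsilon> b by (simp add: suminf_nonneg)
  finally show "atomic_norm f \<le> ennreal (suminf b) + ennreal \<epsilon>" .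
qed

lemma atomic_norm_zero_AE:
  assumes "AE x in lborel. f x = 0"
  shows "atomic_norm f = 0"
proof -
  have "atomic_decomp (\<lambda>_. 0) (\<lambda>_ _. 0) f"
    using assms zero_atom by (intro atomic_decompI) (auto elim!: eventually_mono)
  from atomic_norm_le[OF this] show ?thesis by simp
qed

lemma atomic_norm_bounded_mean_zero:
  assumes g: "g \<in> borel_measurable lebesgue" and ab: "\<alpha> < \<beta>" and M: "0 \<le> M"
    and supp: "AE x in lborel. x \<notin> {\<alpha>..\<beta>} \<longrightarrow> g x = 0" and bound: "AE x in lborel. norm (g x) \<le> M"
    and mean: "(LINT x|lebesgue. g x) = 0"
  shows "atomic_norm g \<le> ennreal (M * (\<beta> - \<alpha>))"
proof (cases "M = 0")
  case True
  then have "AE x in lborel. g x = 0" using bound by (auto elim!: eventually_mono)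
  then show ?thesis by (simp add: atomic_norm_zero_AE)
next
  case False
  define K where "K = M * (\<beta> - \<alpha>)"
  have K: "0 < K" using False M ab unfolding K_def by simp
  define c :: "nat \<Rightarrow> complex" where "c j = (if j = 0 then of_real K else 0)" for j
  define a where "a j = (if j = (0::nat) then (\<lambda>x. g x / of_real K) else (\<lambda>_. 0))" for j
  have "H1_atom {\<alpha>..\<beta>} (\<lambda>x. g x / of_real K)"
    unfolding H1_atom_def
  proof (intro conjI)
    show "AE x in lebesgue. x \<notin> {\<alpha>..\<beta>} \<longrightarrow> g x / of_real K = 0"
      using AE_completion[OF supp] by eventually_elim simp
    show "AE x in lebesgue. norm (g x / of_real K) \<le> 1 / measure lebesgue {\<alpha>..\<beta>}"
      using AE_completion[OF bound]
    proof eventually_elim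
      fix x assume "norm (g x) \<le> M"
      then have "norm (g x / of_real K) \<le> M / K" using K by (simp add: norm_divide divide_right_mono)
      also have "\<dots> = 1 / (\<beta> - \<alpha>)" unfolding K_def using False by simp
      finally show "norm (g x / of_real K) \<le> 1 / measure lebesgue {\<alpha>..\<beta>}" using ab by simp
    qed
    show "(LINT x|lebesgue. g x / of_real K) = 0" using mean by simp
    show "(\<lambda>x. g x / of_real K) \<in> borel_measurable lebesgue" using g by simp
  qed (use ab in \<open>auto simp: is_interval_cc\<close>)
  then have atoms: "\<exists>B. H1_atom B (a j)" for j unfolding a_def using zero_atom by auto
  have cs: "(\<lambda>j. norm (c j)) sums K"
  proof -
    have "(\<lambda>j. norm (c j)) = (\<lambda>j. if j = 0 then K else 0)" unfolding c_def using K by auto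
    then show ?thesis using sums_single[of 0 "\<lambda>_. K"] by simp
  qed
  have "(\<lambda>j. c j * a j x) sums g x" for x
  proof -
    have "(\<lambda>j. c j * a j x) = (\<lambda>j. if j = 0 then g x else 0)" unfolding c_def a_def using K by auto
    then show ?thesis using sums_single[of 0 "\<lambda>_. g x"] by simp
  qed
  then have "atomic_decomp c a g" by (intro atomic_decompI atoms sums_summable[OF cs]) auto
  from atomic_norm_le[OF this] show ?thesis using sums_unique[OF cs] unfolding K_def by simp
qed

lemma L1_norm_sum_le:
  fixes n :: nat
  assumes "\<And>j. j < n \<Longrightarrow> g j \<in> borel_measurable lebesgue"
  shows "L1_norm (\<lambda>x. \<Sum>j<n. g j x) \<le> (\<Sum>j<n. L1_norm (g j))"
  using assms
proof (induction n)
  case (Suc n)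
  have m: "(\<lambda>x. \<Sum>j<n. g j x) \<in> borel_measurable lebesgue"
    using Suc.prems by (intro borel_measurable_sum) auto
  have "L1_norm (\<lambda>x. \<Sum>j<Suc n. g j x) \<le> L1_norm (\<lambda>x. \<Sum>j<n. g j x) + L1_norm (g n)"
    using L1_norm_add_le[OF m Suc.prems[of n]] by simp
  also have "\<dots> \<le> (\<Sum>j<n. L1_norm (g j)) + L1_norm (g n)"
    using Suc by (intro add_mono) auto
  finally show ?case by simp
qed (simp add: L1_norm_def)

lemma L1_norm_le_atomic_norm:
  assumes f: "f \<in> borel_measurable lebesgue"
  shows "L1_norm f \<le> atomic_norm f"
  unfolding atomic_norm_def
proof (rule Inf_greatest)
  fix v assume "v \<in> {ennreal (\<Sum>j. norm (c j)) | c a. atomic_decomp c a f}"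
  then obtain c a where v: "v = ennreal (\<Sum>j. norm (c j))" and d: "atomic_decomp c a f" by auto
  let ?S = "\<lambda>n x. \<Sum>j<n. c j * a j x"
  have t: "(\<lambda>x. c j * a j x) \<in> borel_measurable lebesgue" for j using atomic_decompD(1)[OF d, of j] by simp
  have m: "?S n \<in> borel_measurable lebesgue" for n by (intro borel_measurable_sum t)
  have "L1_norm f \<le> L1_norm (\<lambda>x. f x - ?S n x) + v" for n
  proof -
    have "L1_norm (\<lambda>x. (f x - ?S n x) + ?S n x) \<le> L1_norm (\<lambda>x. f x - ?S n x) + L1_norm (?S n)"
      by (intro L1_norm_add_le borel_measurable_diff f m)
    also have "L1_norm (?S n) \<le> (\<Sum>j<n. L1_norm (\<lambda>x. c j * a j x))" by (rule L1_norm_sum_le[OF t])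
    also have "\<dots> \<le> (\<Sum>j<n. ennreal (norm (c j)))" by (intro sum_mono atomic_decompD(2)[OF d])
    also have "\<dots> \<le> v"
      using atomic_decompD(3)[OF d] unfolding v by (auto intro!: ennreal_leI sum_le_suminf)
    finally show ?thesis by (simp add: add_left_mono)
  qed
  moreover have "(\<lambda>n. L1_norm (\<lambda>x. f x - ?S n x) + v) \<longlonglongrightarrow> 0 + v"
    using d unfolding atomic_decomp_def by (intro tendsto_intros) auto
  ultimately show "L1_norm f \<le> v" by (intro LIMSEQ_le_const) auto
qed

lemma atomic_norm_add_le:
  assumes f: "f \<in> borel_measurable lebesgue" and g: "g \<in> borel_measurable lebesgue"
  shows "atomic_norm (\<lambda>x. f x + g x) \<le> atomic_norm f + atomic_norm g"
proof (cases "atomic_norm f = \<infinity> \<or> atomic_norm g = \<infinity>")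
  case False
  then obtain u v where u: "atomic_norm f = ennreal u" "0 \<le> u" and v: "atomic_norm g = ennreal v" "0 \<le> v"
    by (metis ennreal_cases infinity_ennreal_def)
  define F where "F j = (if j = (0::nat) then f else if j = 1 then g else (\<lambda>_. 0))" for j
  define b where "b j = (if j = (0::nat) then u else if j = 1 then v else 0)" for j
  have bs: "b sums (u + v)"
    using sums_finite[of "{0, 1::nat}" b] unfolding b_def by auto
  have "atomic_norm (\<lambda>x. f x + g x) \<le> ennreal (suminf b)"
  proof (rule atomic_norm_countable_subadditive)
    show "F j \<in> borel_measurable lebesgue" for j unfolding F_def using f g by auto
    show "(\<lambda>x. f x + g x) \<in> borel_measurable lebesgue" using f g by auto
    show "atomic_norm (F j) \<le> ennreal (b j)" for j
      unfolding F_def b_def using u v by (auto simp: atomic_norm_zero_AE)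
    show "0 \<le> b j" for j unfolding b_def using u v by auto
    show "summable b" using bs by (rule sums_summable)
    have "L1_norm (\<lambda>x. f x + g x - (\<Sum>j<n. F j x)) = 0" if "2 \<le> n" for n
    proof -
      have "(\<Sum>j<n. F j x) = (\<Sum>j\<in>{0, 1}. F j x)" for x
        using that by (intro sum.mono_neutral_right) (auto simp: F_def)
      then show ?thesis by (simp add: F_def L1_norm_def)
    qed
    then have "eventually (\<lambda>n. L1_norm (\<lambda>x. f x + g x - (\<Sum>j<n. F j x)) = 0) sequentially"
      unfolding eventually_sequentially by blast
    then show "(\<lambda>n. L1_norm (\<lambda>x. f x + g x - (\<Sum>j<n. F j x))) \<longlonglongrightarrow> 0" by (rule tendsto_eventually)
  qed
  moreover have "suminf b = u + v" using sums_unique[OF bs] by simp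
  ultimately show ?thesis using u v by simp
qed auto

lemma atomic_norm_cmult_le:
  assumes f: "f \<in> borel_measurable lebesgue"
  shows "atomic_norm (\<lambda>x. z * f x) \<le> ennreal (norm z) * atomic_norm f"
proof (cases "z = 0")
  case True
  then show ?thesis by (simp add: atomic_norm_zero_AE)
next
  case False
  have "atomic_norm (\<lambda>x. z * f x) / ennreal (norm z) \<le> atomic_norm f"
    unfolding atomic_norm_def[of f]
  proof (rule Inf_greatest)
    fix v assume "v \<in> {ennreal (\<Sum>j. norm (c j)) | c a. atomic_decomp c a f}"
    then obtain c a where v: "v = ennreal (\<Sum>j. norm (c j))" and d: "atomic_decomp c a f" by auto
    have "atomic_decomp (\<lambda>j. z * c j) a (\<lambda>x. z * f x)"
    proof (rule atomic_decompI)
      show "\<exists>B. H1_atom B (a j)" for j using d unfolding atomic_decomp_def by blast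
      show "summable (\<lambda>j. norm (z * c j))"
        unfolding norm_mult by (intro summable_mult atomic_decompD(3)[OF d])
      show "AE x in lborel. (\<lambda>j. z * c j * a j x) sums (z * f x)"
        using atomic_decomp_sums_AE[OF d f] by eventually_elim (simp add: sums_mult mult.assoc)
    qed
    then have "atomic_norm (\<lambda>x. z * f x) \<le> ennreal (\<Sum>j. norm (z * c j))" by (rule atomic_norm_le)
    also have "(\<Sum>j. norm (z * c j)) = norm z * (\<Sum>j. norm (c j))"
      unfolding norm_mult by (intro suminf_mult atomic_decompD(3)[OF d])
    also have "ennreal \<dots> = v * ennreal (norm z)"
      unfolding v by (simp add: ennreal_mult mult.commute suminf_nonneg atomic_decompD(3)[OF d])
    finally show "atomic_norm (\<lambda>x. z * f x) / ennreal (norm z) \<le> v"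
      using False by (simp add: divide_le_posI_ennreal mult.commute)
  qed
  then have "ennreal (norm z) * (atomic_norm (\<lambda>x. z * f x) / ennreal (norm z)) \<le> ennreal (norm z) * atomic_norm f"
    by (rule mult_left_mono) simp
  moreover have "ennreal (norm z) * (atomic_norm (\<lambda>x. z * f x) / ennreal (norm z)) = atomic_norm (\<lambda>x. z * f x)"
    using False by (simp add: ennreal_times_divide mult.commute[of "ennreal (norm z)"] mult_divide_eq_ennreal)
  ultimately show ?thesis by simp
qed

lemma bump_atomic_norm_finite: "atomic_norm odd_bump < \<infinity>"
proof -
  have "atomic_norm odd_bump \<le> ennreal (1 * (1 - (- 1)))"
  proof (rule atomic_norm_bounded_mean_zero)
    show "odd_bump \<in> borel_measurable lebesgue" by (intro measurable_completion) measurable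
    show "(LINT x|lebesgue. odd_bump x) = 0"
      using bump_integral by (subst integral_completion) auto
  qed (auto simp: bump_zero bump_le intro!: AE_I2)
  then show ?thesis by (rule le_less_trans) simp
qed

lemma dilation_average_diff_kernel_AE:
  assumes "half_line_kernel k" "half_line_kernel l" "integrable lborel f"
  shows "AE x in lborel. dilation_average (\<lambda>t. k t - l t) f x = dilation_average k f x - dilation_average l f x"
  using dilation_average_integrand_AE[OF assms(1,3)] dilation_average_integrand_AE[OF assms(2,3)]
  unfolding dilation_average_def scaleR_diff_left
  by eventually_elim (rule Bochner_Integration.integral_diff)

lemma dilate_sum_scaled: "dilate t (\<lambda>x. \<Sum>j\<in>J. c j * f j x) x = (\<Sum>j\<in>J. c j * dilate t (f j) x)"
  unfolding dilate_def by (simp add: sum_divide_distrib)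

lemma dilation_average_diff_sum_AE:
  assumes k: "half_line_kernel k" and f: "integrable lborel f" and J: "finite J"
    and a: "\<And>j. j \<in> J \<Longrightarrow> integrable lborel (a j)"
  shows "AE x in lborel. dilation_average k (\<lambda>x. f x - (\<Sum>j\<in>J. c j * a j x)) x
    = dilation_average k f x - (\<Sum>j\<in>J. c j * dilation_average k (a j) x)"
proof -
  have "AE x in lborel. \<forall>j\<in>J. integrable lborel (\<lambda>t. k t *\<^sub>R dilate t (a j) x)"
    using J dilation_average_integrand_AE[OF k a] by (simp add: AE_finite_all)
  with dilation_average_integrand_AE[OF k f] show ?thesis
  proof eventually_elim
    fix x assume f: "integrable lborel (\<lambda>t. k t *\<^sub>R dilate t f x)"
      and a: "\<forall>j\<in>J. integrable lborel (\<lambda>t. k t *\<^sub>R dilate t (a j) x)"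
    have "k t *\<^sub>R dilate t (\<lambda>x. f x - (\<Sum>j\<in>J. c j * a j x)) x
        = k t *\<^sub>R dilate t f x - (\<Sum>j\<in>J. c j * (k t *\<^sub>R dilate t (a j) x))" for t
      using dilate_sum_scaled[of t c a J x]
      by (simp add: dilate_def diff_divide_distrib scaleR_diff_right scaleR_sum_right)
    then have "dilation_average k (\<lambda>x. f x - (\<Sum>j\<in>J. c j * a j x)) x
        = (LINT t|lborel. k t *\<^sub>R dilate t f x - (\<Sum>j\<in>J. c j * (k t *\<^sub>R dilate t (a j) x)))"
      unfolding dilation_average_def by (simp only:)
    also have "\<dots> = (LINT t|lborel. k t *\<^sub>R dilate t f x) - (LINT t|lborel. (\<Sum>j\<in>J. c j * (k t *\<^sub>R dilate t (a j) x)))"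
      using f a by (intro Bochner_Integration.integral_diff Bochner_Integration.integrable_sum integrable_mult_right) auto
    also have "(LINT t|lborel. (\<Sum>j\<in>J. c j * (k t *\<^sub>R dilate t (a j) x)))
        = (\<Sum>j\<in>J. LINT t|lborel. c j * (k t *\<^sub>R dilate t (a j) x))"
      using a by (intro Bochner_Integration.integral_sum integrable_mult_right) auto
    finally show "dilation_average k (\<lambda>x. f x - (\<Sum>j\<in>J. c j * a j x)) x
        = dilation_average k f x - (\<Sum>j\<in>J. c j * dilation_average k (a j) x)"
      unfolding dilation_average_def by (simp only: integral_mult_right_zero)
  qed
qed

lemma dilation_average_integral_zero:
  assumes k: "half_line_kernel k" and a: "integrable lborel a" and mean: "(LINT x|lborel. a x) = 0"
  shows "(LINT x|lborel. dilation_average k a x) = 0"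
proof -
  have zero: "k t *\<^sub>R (LINT x|lborel. dilate t a x * 1) = 0" for t
    proof (cases "0 < t")
      case True
      have "(LINT x|lborel. a (x / t)) = t *\<^sub>R (LINT x|lborel. a ((0 + t * x) / t))"
        using True by (subst lborel_integral_real_affine[where c = t and t = 0]) auto
      then have "(LINT x|lborel. a (x / t)) = 0" using True mean by simp
      then show ?thesis by (simp add: dilate_def)
    next
      case False
      then show ?thesis using half_line_kernelD(3)[OF k, of t] by simp
    qed
  have "(LINT x|lborel. dilation_average k a x * 1) = (LINT t|lborel. k t *\<^sub>R (LINT x|lborel. dilate t a x * 1))"
    by (rule dilation_average_integral_bounded(1)[OF k a, of "\<lambda>_. 1" 1]) auto
  then show ?thesis unfolding zero by simp
qed

lemma half_line_kernel_bound:
  assumes k: "half_line_kernel k" and l: "l \<in> borel_measurable borel" and le: "\<And>t. \<bar>l t\<bar> \<le> \<bar>k t\<bar>"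
  shows "half_line_kernel l"
  unfolding half_line_kernel_def
proof (intro conjI allI impI)
  show "integrable lborel l"
    by (rule Bochner_Integration.integrable_bound[OF half_line_kernelD(1)[OF k]]) (use l le in auto)
  show "l t = 0" if "t \<le> 0" for t using le[of t] half_line_kernelD(3)[OF k that] by simp
qed

lemma dilation_average_kernel_diff_sum_AE:
  assumes k: "half_line_kernel k" and l: "\<And>n. n \<in> J \<Longrightarrow> half_line_kernel (l n)" and J: "finite J" and f: "integrable lborel f"
  shows "AE x in lborel. dilation_average (\<lambda>t. k t - (\<Sum>n\<in>J. l n t)) f x
    = dilation_average k f x - (\<Sum>n\<in>J. dilation_average (l n) f x)"
proof -
  have "AE x in lborel. \<forall>n\<in>J. integrable lborel (\<lambda>t. l n t *\<^sub>R dilate t f x)"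
    using J dilation_average_integrand_AE[OF l f] by (simp add: AE_finite_all)
  with dilation_average_integrand_AE[OF k f] show ?thesis
  proof eventually_elim
    fix x assume k: "integrable lborel (\<lambda>t. k t *\<^sub>R dilate t f x)"
      and l: "\<forall>n\<in>J. integrable lborel (\<lambda>t. l n t *\<^sub>R dilate t f x)"
    have "dilation_average (\<lambda>t. k t - (\<Sum>n\<in>J. l n t)) f x
        = (LINT t|lborel. k t *\<^sub>R dilate t f x - (\<Sum>n\<in>J. l n t *\<^sub>R dilate t f x))"
      unfolding dilation_average_def by (simp add: scaleR_diff_left scaleR_sum_left)
    also have "\<dots> = (LINT t|lborel. k t *\<^sub>R dilate t f x) - (LINT t|lborel. (\<Sum>n\<in>J. l n t *\<^sub>R dilate t f x))"
      using k l by (intro Bochner_Integration.integral_diff Bochner_Integration.integrable_sum) auto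
    also have "(LINT t|lborel. (\<Sum>n\<in>J. l n t *\<^sub>R dilate t f x)) = (\<Sum>n\<in>J. LINT t|lborel. l n t *\<^sub>R dilate t f x)"
      using l by (intro Bochner_Integration.integral_sum) auto
    finally show "dilation_average (\<lambda>t. k t - (\<Sum>n\<in>J. l n t)) f x
        = dilation_average k f x - (\<Sum>n\<in>J. dilation_average (l n) f x)"
      unfolding dilation_average_def .
  qed
qed

lemma L1_norm_dilation_average_le:
  assumes k: "half_line_kernel k" and f: "f \<in> borel_measurable borel"
  shows "L1_norm (dilation_average k f) \<le> ennreal (LINT t|lborel. \<bar>k t\<bar>) * L1_norm f"
  using nn_integral_norm_dilation_average_le[OF k f] half_line_kernelD(1)[OF k]
  unfolding L1_norm_lborel by (simp add: nn_integral_eq_integral)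

lemma dilation_average_lebesgue_measurable:
  "half_line_kernel k \<Longrightarrow> integrable lborel f \<Longrightarrow> dilation_average k f \<in> borel_measurable lebesgue"
  using dilation_average_integrable[of k f] by (intro measurable_completion) auto

lemma atom_integrable:
  assumes "H1_atom B a" "a \<in> borel_measurable borel"
  shows "integrable lborel a" "(LINT x|lborel. a x) = 0"
proof -
  show "integrable lborel a"
  proof (rule integrableI_bounded)
    show "(\<integral>\<^sup>+x. ennreal (norm (a x)) \<partial>lborel) < \<infinity>"
      using H1_atom_L1_norm_le[OF assms(1)] unfolding L1_norm_lborel by (rule le_less_trans) simp
  qed (use assms in simp)
  show "(LINT x|lborel. a x) = 0"
    using assms integral_completion[of a lborel] unfolding H1_atom_def by simp
qed

text \<open>
For a kernel that lives on \<open>[s, r s]\<close> all dilates of the atom are supported in one interval, whose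
length exceeds \<open>s (\<beta> - \<alpha>)\<close> only by a multiple of \<open>r - 1\<close>, and they are bounded by
\<open>1/(s (\<beta> - \<alpha>))\<close>. The position of the interval enters through \<open>M\<close>: an interval far from the origin
is displaced a lot by a dilation, so that the admissible ratio depends on the atom.
\<close>

lemma atomic_norm_short_block_le:
  assumes k: "half_line_kernel k" and a: "H1_atom B a" and am: "a \<in> borel_measurable borel"
    and ab: "\<alpha> < \<beta>" "B \<subseteq> {\<alpha>..\<beta>}" "measure lebesgue B = \<beta> - \<alpha>"
    and M: "\<bar>\<alpha>\<bar> \<le> M" "\<bar>\<beta>\<bar> \<le> M" and s: "0 < s" and r: "1 \<le> r"
    and kb: "\<And>t. k t \<noteq> 0 \<Longrightarrow> s \<le> t \<and> t \<le> r * s"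
  shows "atomic_norm (dilation_average k a) \<le> ennreal ((LINT t|lborel. \<bar>k t\<bar>) * (1 + 2 * (r - 1) * M / (\<beta> - \<alpha>)))"
proof -
  note ai = atom_integrable[OF a am]
  define K where "K = (LINT t|lborel. \<bar>k t\<bar>)"
  have K0: "0 \<le> K" unfolding K_def by (rule integral_nonneg_AE) simp
  define \<alpha>' where "\<alpha>' = s * (\<alpha> - (r - 1) * M)"
  define \<beta>' where "\<beta>' = s * (\<beta> + (r - 1) * M)"
  have M0: "0 \<le> M" using M(1) by linarith
  have rM: "0 \<le> (r - 1) * M" using r M0 by simp
  have ab': "\<alpha>' < \<beta>'" 
  proof -
    have "\<alpha> - (r - 1) * M < \<beta> + (r - 1) * M" using ab(1) rM by linarith
    then show ?thesis unfolding \<alpha>'_def \<beta>'_def using s by (rule mult_strict_left_mono)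
  qed
  have supp: "AE y in lborel. y \<notin> B \<longrightarrow> a y = 0" and bound: "AE y in lborel. norm (a y) \<le> 1 / (\<beta> - \<alpha>)"
    using a ab(3) unfolding H1_atom_def by (auto simp: AE_completion_iff)
  have ne: "AE x::real in lborel. x \<noteq> 0" using AE_lborel_not_in_finite[of "{0}"] by simp
  have inB: "x \<in> {\<alpha>'..\<beta>'}" if t: "s \<le> t" "t \<le> r * s" and y: "x / t \<in> B" for x t
  proof -
    define y where "y = x / t"
    define u where "u = t / s"
    have u: "1 \<le> u" "u \<le> r" using t s unfolding u_def by (simp_all add: field_simps)
    have x: "x = s * (y + (u - 1) * y)" using t s unfolding y_def u_def by (simp add: field_simps)
    have yab: "\<alpha> \<le> y" "y \<le> \<beta>" using y ab(2) unfolding y_def by auto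
    then have "\<bar>y\<bar> \<le> M" using M by linarith
    then have "\<bar>(u - 1) * y\<bar> \<le> (r - 1) * M" unfolding abs_mult using u by (intro mult_mono) auto
    then have "\<alpha> - (r - 1) * M \<le> y + (u - 1) * y" "y + (u - 1) * y \<le> \<beta> + (r - 1) * M"
      using yab by linarith+
    then show ?thesis unfolding x \<alpha>'_def \<beta>'_def using s by simp
  qed
  have "atomic_norm (dilation_average k a) \<le> ennreal (K * (1 / (s * (\<beta> - \<alpha>))) * (\<beta>' - \<alpha>'))"
  proof (rule atomic_norm_bounded_mean_zero)
    show "dilation_average k a \<in> borel_measurable lebesgue"
      by (rule dilation_average_lebesgue_measurable[OF k ai(1)])
    show "0 \<le> K * (1 / (s * (\<beta> - \<alpha>)))" using K0 s ab(1) by simp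
    show "AE x in lborel. x \<notin> {\<alpha>'..\<beta>'} \<longrightarrow> dilation_average k a x = 0"
      using ne
    proof eventually_elim
      fix x :: real assume x0: "x \<noteq> 0"
      show "x \<notin> {\<alpha>'..\<beta>'} \<longrightarrow> dilation_average k a x = 0"
      proof
      assume "x \<notin> {\<alpha>'..\<beta>'}"
      with x0 have x: "x \<noteq> 0" "x \<notin> {\<alpha>'..\<beta>'}" by auto
      have "AE t in lborel. k t *\<^sub>R dilate t a x = 0"
        using AE_inverse_scale[OF supp x(1)]
      proof eventually_elim
        fix t assume *: "t \<noteq> 0 \<longrightarrow> x / t \<notin> B \<longrightarrow> a (x / t) = 0"
        show "k t *\<^sub>R dilate t a x = 0"
        proof (cases "k t = 0")
          case False
          then have t: "s \<le> t" "t \<le> r * s" using kb[of t] by auto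
          then have "x / t \<notin> B" using inB[OF t] x(2) by blast
          then show ?thesis using * t s by (simp add: dilate_def)
        qed simp
      qed
      then show "dilation_average k a x = 0" unfolding dilation_average_def by (rule integral_eq_zero_AE)
      qed
    qed
    show "AE x in lborel. norm (dilation_average k a x) \<le> K * (1 / (s * (\<beta> - \<alpha>)))"
      using ne
    proof eventually_elim
      fix x :: real assume x: "x \<noteq> 0"
      note [measurable] = half_line_kernelD(2)[OF k]
      have "ennreal (norm (dilation_average k a x)) \<le> (\<integral>\<^sup>+t. ennreal (\<bar>k t\<bar> / t) * ennreal (norm (a (x / t))) \<partial>lborel)"
        by (rule norm_dilation_average_le[OF k])
      also have "\<dots> \<le> (\<integral>\<^sup>+t. ennreal (1 / (s * (\<beta> - \<alpha>))) * ennreal \<bar>k t\<bar> \<partial>lborel)"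
      proof (rule nn_integral_mono_AE)
        show "AE t in lborel. ennreal (\<bar>k t\<bar> / t) * ennreal (norm (a (x / t))) \<le> ennreal (1 / (s * (\<beta> - \<alpha>))) * ennreal \<bar>k t\<bar>"
          using AE_inverse_scale[OF bound x]
        proof eventually_elim
          fix t assume *: "t \<noteq> 0 \<longrightarrow> norm (a (x / t)) \<le> 1 / (\<beta> - \<alpha>)"
          show "ennreal (\<bar>k t\<bar> / t) * ennreal (norm (a (x / t))) \<le> ennreal (1 / (s * (\<beta> - \<alpha>))) * ennreal \<bar>k t\<bar>"
          proof (cases "k t = 0")
            case False
            then have t: "s \<le> t" using kb[of t] by auto
            have "\<bar>k t\<bar> / t * norm (a (x / t)) \<le> \<bar>k t\<bar> / s * (1 / (\<beta> - \<alpha>))"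
              using t s * by (intro mult_mono divide_left_mono) auto
            also have "\<dots> = 1 / (s * (\<beta> - \<alpha>)) * \<bar>k t\<bar>" by simp
            finally show ?thesis using t s ab(1) by (simp add: ennreal_leI flip: ennreal_mult)
          qed simp
        qed
      qed
      also have "\<dots> = ennreal (1 / (s * (\<beta> - \<alpha>))) * (\<integral>\<^sup>+t. ennreal \<bar>k t\<bar> \<partial>lborel)"
        by (rule nn_integral_cmult) measurable
      also have "(\<integral>\<^sup>+t. ennreal \<bar>k t\<bar> \<partial>lborel) = ennreal K"
        unfolding K_def using half_line_kernelD(1)[OF k] by (intro nn_integral_eq_integral) auto
      finally show "norm (dilation_average k a x) \<le> K * (1 / (s * (\<beta> - \<alpha>)))"
        using K0 s ab(1) by (simp add: mult.commute flip: ennreal_mult)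
    qed
    show "(LINT x|lebesgue. dilation_average k a x) = 0"
      using dilation_average_integral_zero[OF k ai] dilation_average_integrable[OF k ai(1)]
      by (subst integral_completion) auto
  qed (rule ab')
  also have "K * (1 / (s * (\<beta> - \<alpha>))) * (\<beta>' - \<alpha>') = K * (1 + 2 * (r - 1) * M / (\<beta> - \<alpha>))"
    unfolding \<alpha>'_def \<beta>'_def using s ab(1) by (simp add: field_simps)
  finally show ?thesis unfolding K_def .
qed

lemma atomic_norm_dilation_average_atom_le:
  assumes k: "half_line_kernel k" and a: "H1_atom B a" and am: "a \<in> borel_measurable borel"
  shows "atomic_norm (dilation_average k a) \<le> ennreal (LINT t|lborel. \<bar>k t\<bar>)"
proof -
  note ai = atom_integrable[OF a am]
  note km[measurable] = half_line_kernelD(2)[OF k]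
  define K where "K = (LINT t|lborel. \<bar>k t\<bar>)"
  have K0: "0 \<le> K" unfolding K_def by (rule integral_nonneg_AE) simp
  obtain \<alpha> \<beta> where ab: "\<alpha> < \<beta>" "B \<subseteq> {\<alpha>..\<beta>}" "measure lebesgue B = \<beta> - \<alpha>"
    using a bounded_interval_between[of B] unfolding H1_atom_def by metis
  define M where "M = max \<bar>\<alpha>\<bar> \<bar>\<beta>\<bar>"
  have M: "\<bar>\<alpha>\<bar> \<le> M" "\<bar>\<beta>\<bar> \<le> M" "0 < M" unfolding M_def using ab(1) by auto
  have main: "atomic_norm (dilation_average k a) \<le> ennreal (K * (1 + \<epsilon>))" if \<epsilon>: "0 < \<epsilon>" for \<epsilon>
  proof -
    \<comment> \<open>The ratio for which the excess of a block is exactly the factor \<open>1 + \<epsilon>\<close>.\<close>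
    define r where "r = 1 + \<epsilon> * (\<beta> - \<alpha>) / (2 * M)"
    have r: "1 < r" unfolding r_def using \<epsilon> ab(1) M(3) by simp
    have rM: "2 * (r - 1) * M / (\<beta> - \<alpha>) = \<epsilon>" unfolding r_def using ab(1) M(3) by (simp add: field_simps)
    define \<delta> where "\<delta> = ln r"
    have \<delta>: "0 < \<delta>" unfolding \<delta>_def using r by simp
    \<comment> \<open>The blocks \<open>[r\<^sup>i, r\<^sup>i\<^sup>+\<^sup>1)\<close>, with i ranging over the integers, enumerated by the natural numbers.\<close>
    define kb where "kb n t = (if 0 < t \<and> \<lfloor>ln t / \<delta>\<rfloor> = int_decode n then k t else 0)" for n t
    have kbm[measurable]: "kb n \<in> borel_measurable borel" for n
      unfolding kb_def[abs_def] by measurable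
    have kb: "half_line_kernel (kb n)" for n
      by (rule half_line_kernel_bound[OF k kbm]) (simp add: kb_def)
    have sum_kb: "(\<Sum>n<N. kb n t) = (if 0 < t \<and> int_encode \<lfloor>ln t / \<delta>\<rfloor> < N then k t else 0)" for N t
    proof (cases "0 < t")
      case True
      have "(\<Sum>n<N. kb n t) = (\<Sum>n<N. if n = int_encode \<lfloor>ln t / \<delta>\<rfloor> then k t else 0)"
        using True unfolding kb_def by (intro sum.cong) auto
      then show ?thesis using True by simp
    qed (simp add: kb_def)
    have abs_kb: "(\<Sum>n<N. \<bar>kb n t\<bar>) \<le> \<bar>k t\<bar>" for N t
    proof -
      have "(\<Sum>n<N. \<bar>kb n t\<bar>) = \<bar>\<Sum>n<N. kb n t\<bar>"
      proof (cases "0 \<le> k t")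
        case True
        then have "0 \<le> kb n t" for n unfolding kb_def by auto
        then show ?thesis by (simp add: sum_nonneg)
      next
        case False
        then have "kb n t \<le> 0" for n unfolding kb_def by auto
        then show ?thesis by (simp add: sum_nonpos sum_negf)
      qed
      then show ?thesis unfolding sum_kb by simp
    qed
    define b where "b n = (LINT t|lborel. \<bar>kb n t\<bar>) * (1 + \<epsilon>)" for n
    have b0: "0 \<le> b n" for n unfolding b_def using \<epsilon> by (intro mult_nonneg_nonneg integral_nonneg_AE) auto
    have partial: "(\<Sum>n<N. b n) \<le> K * (1 + \<epsilon>)" for N
    proof -
      have "(\<Sum>n<N. LINT t|lborel. \<bar>kb n t\<bar>) = (LINT t|lborel. (\<Sum>n<N. \<bar>kb n t\<bar>))"
        using half_line_kernelD(1)[OF kb] by (intro Bochner_Integration.integral_sum[symmetric]) auto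
      also have "\<dots> \<le> K"
        unfolding K_def using half_line_kernelD(1)[OF kb] half_line_kernelD(1)[OF k] abs_kb
        by (intro integral_mono) auto
      finally show ?thesis unfolding b_def using \<epsilon> by (simp add: mult_right_mono flip: sum_distrib_right)
    qed
    have sb: "summable b"
      by (rule summableI_nonneg_bounded[OF b0 partial])
    have "atomic_norm (dilation_average k a) \<le> ennreal (suminf b)"
    proof (rule atomic_norm_countable_subadditive)
      show "dilation_average (kb n) a \<in> borel_measurable lebesgue" for n
        by (rule dilation_average_lebesgue_measurable[OF kb ai(1)])
      show "dilation_average k a \<in> borel_measurable lebesgue"
        by (rule dilation_average_lebesgue_measurable[OF k ai(1)])
      show "0 \<le> b n" for n by (rule b0)
      show "summable b" by (rule sb)
      show "atomic_norm (dilation_average (kb n) a) \<le> ennreal (b n)" for n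
      proof -
        define s where "s = exp (\<delta> * of_int (int_decode n))"
        have "s \<le> t \<and> t \<le> r * s" if "kb n t \<noteq> 0" for t
        proof -
          have t: "0 < t" "\<lfloor>ln t / \<delta>\<rfloor> = int_decode n" using that unfolding kb_def by (auto split: if_splits)
          then have "of_int (int_decode n) \<le> ln t / \<delta>" "ln t / \<delta> \<le> of_int (int_decode n) + 1" by linarith+
          then have "\<delta> * of_int (int_decode n) \<le> ln t" "ln t \<le> \<delta> + \<delta> * of_int (int_decode n)"
            using \<delta> by (simp_all add: field_simps)
          then have "exp (\<delta> * of_int (int_decode n)) \<le> exp (ln t)" "exp (ln t) \<le> exp (\<delta> + \<delta> * of_int (int_decode n))"
            by simp_all
          then show ?thesis using t(1) r unfolding s_def \<delta>_def by (simp add: exp_add)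
        qed
        then have "atomic_norm (dilation_average (kb n) a) \<le> ennreal ((LINT t|lborel. \<bar>kb n t\<bar>) * (1 + 2 * (r - 1) * M / (\<beta> - \<alpha>)))"
          using r by (intro atomic_norm_short_block_le[OF kb a am ab M(1,2), of s]) (auto simp: s_def)
        then show ?thesis unfolding rM b_def .
      qed
      show "(\<lambda>N. L1_norm (\<lambda>x. dilation_average k a x - (\<Sum>n<N. dilation_average (kb n) a x))) \<longlonglongrightarrow> 0"
      proof -
        let ?d = "\<lambda>N t. k t - (\<Sum>n<N. kb n t)"
        have d: "half_line_kernel (?d N)" for N
          by (rule half_line_kernel_bound[OF k]) (auto simp: sum_kb)
        have le: "L1_norm (\<lambda>x. dilation_average k a x - (\<Sum>n<N. dilation_average (kb n) a x))
            \<le> ennreal (LINT t|lborel. norm ((\<Sum>n<N. kb n t) - k t)) * L1_norm a" for N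
        proof -
          have "L1_norm (\<lambda>x. dilation_average k a x - (\<Sum>n<N. dilation_average (kb n) a x)) = L1_norm (dilation_average (?d N) a)"
            using dilation_average_kernel_diff_sum_AE[OF k kb _ ai(1), of "{..<N}" "\<lambda>n. n"]
            by (intro L1_norm_cong_AE) (auto elim!: eventually_mono)
          also have "\<dots> \<le> ennreal (LINT t|lborel. \<bar>?d N t\<bar>) * L1_norm a"
            by (rule L1_norm_dilation_average_le[OF d am])
          finally show ?thesis by (simp add: abs_minus_commute)
        qed
        have "(\<lambda>N. LINT t|lborel. norm ((\<Sum>n<N. kb n t) - k t)) \<longlonglongrightarrow> 0"
        proof (rule L1_tendsto_by_dominated_convergence[where w = "\<lambda>t. \<bar>k t\<bar>"])
          show "AE t in lborel. (\<lambda>N. \<Sum>n<N. kb n t) \<longlonglongrightarrow> k t"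
          proof (rule AE_I2)
            fix t
            have "(\<Sum>n<N. kb n t) = k t" if "Suc (int_encode \<lfloor>ln t / \<delta>\<rfloor>) \<le> N" for N
              unfolding sum_kb using that half_line_kernelD(3)[OF k, of t] by auto
            then have "eventually (\<lambda>N. (\<Sum>n<N. kb n t) = k t) sequentially"
              unfolding eventually_sequentially by blast
            then show "(\<lambda>N. \<Sum>n<N. kb n t) \<longlonglongrightarrow> k t" by (rule tendsto_eventually)
          qed
          show "integrable lborel (\<lambda>t. \<bar>k t\<bar>)" using half_line_kernelD(1)[OF k] by simp
          show "AE t in lborel. norm ((\<Sum>n<N. kb n t) - k t) \<le> \<bar>k t\<bar>" for N
            unfolding sum_kb by (auto intro!: AE_I2)
        qed measurable
        then have "(\<lambda>N. ennreal (LINT t|lborel. norm ((\<Sum>n<N. kb n t) - k t)) * L1_norm a) \<longlonglongrightarrow> L1_norm a * ennreal 0"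
          unfolding mult.commute[of _ "L1_norm a"]
          using le_less_trans[OF H1_atom_L1_norm_le[OF a], of top]
          by (intro ennreal_tendsto_cmult tendsto_ennrealI) auto
        then have lim: "(\<lambda>N. ennreal (LINT t|lborel. norm ((\<Sum>n<N. kb n t) - k t)) * L1_norm a) \<longlonglongrightarrow> 0" by simp
        show ?thesis
          by (rule tendsto_sandwich[OF _ _ tendsto_const lim]) (use le in \<open>auto intro!: always_eventually\<close>)
      qed
    qed
    also have "\<dots> \<le> ennreal (K * (1 + \<epsilon>))"
      using suminf_le_const[OF sb partial] by (rule ennreal_leI)
    finally show ?thesis .
  qed
  have "atomic_norm (dilation_average k a) \<le> ennreal K"
  proof (rule ennreal_le_epsilon)
    fix e :: real assume e: "0 < e"
    have "atomic_norm (dilation_average k a) \<le> ennreal (K * (1 + e / (K + 1)))"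
      using e K0 by (intro main) (simp add: add_nonneg_pos)
    also have "\<dots> \<le> ennreal (K + e)"
    proof (rule ennreal_leI)
      have "K * e \<le> (K + 1) * e" using e by simp
      then have "K * (e / (K + 1)) \<le> e" using K0 by (simp add: field_simps)
      then show "K * (1 + e / (K + 1)) \<le> K + e" by (simp add: algebra_simps)
    qed
    also have "\<dots> = ennreal K + ennreal e" using K0 e by simp
    finally show "atomic_norm (dilation_average k a) \<le> ennreal K + ennreal e" .
  qed
  then show ?thesis unfolding K_def .
qed

theorem atomic_norm_dilation_average_le:
  assumes k: "half_line_kernel k" and f: "integrable lborel f"
  shows "atomic_norm (dilation_average k f) \<le> ennreal (LINT t|lborel. \<bar>k t\<bar>) * atomic_norm f"
proof (cases "{ennreal (\<Sum>j. norm (c j)) | c a. atomic_decomp c a f} = {}")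
  case True
  then have "atomic_norm f = \<infinity>" unfolding atomic_norm_def by (simp only: Inf_empty infinity_ennreal_def)
  show ?thesis
  proof (cases "(LINT t|lborel. \<bar>k t\<bar>) = 0")
    case True
    have "L1_norm (dilation_average k f) \<le> 0 * L1_norm f"
      using L1_norm_dilation_average_le[OF k, of f] f True by auto
    then have "AE x in lborel. dilation_average k f x = 0"
      by (intro L1_norm_eq_0D dilation_average_lebesgue_measurable k f) simp
    then show ?thesis by (simp add: atomic_norm_zero_AE)
  next
    case False
    moreover have "0 \<le> (LINT t|lborel. \<bar>k t\<bar>)" by (rule integral_nonneg_AE) simp
    ultimately show ?thesis using \<open>atomic_norm f = \<infinity>\<close> by (simp add: ennreal_mult_top)
  qed
next
  case False
  define K where "K = (LINT t|lborel. \<bar>k t\<bar>)"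
  have K0: "0 \<le> K" unfolding K_def by (rule integral_nonneg_AE) simp
  have fm: "f \<in> borel_measurable borel" using f by auto
  have step: "atomic_norm (dilation_average k f) \<le> ennreal (K * (\<Sum>j. norm (c j)))" if d: "atomic_decomp c a f" for c a
  proof -
    have "\<exists>g. g \<in> borel_measurable borel \<and> (AE x in lborel. a j x = g x)" for j
      using borel_representative[OF atomic_decompD(1)[OF d, of j]] by metis
    then obtain g where g: "\<And>j. g j \<in> borel_measurable borel" "\<And>j. AE x in lborel. a j x = g j x"
      by metis
    have atom: "\<exists>B. H1_atom B (g j)" for j
    proof -
      obtain B where B: "H1_atom B (a j)" using d unfolding atomic_decomp_def by blast
      have "H1_atom B (g j)"
        unfolding H1_atom_def
      proof (intro conjI)
        have 1: "AE x in lebesgue. x \<notin> B \<longrightarrow> a j x = 0" "AE x in lebesgue. norm (a j x) \<le> 1 / measure lebesgue B"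
          using B unfolding H1_atom_def by auto
        show "AE x in lebesgue. x \<notin> B \<longrightarrow> g j x = 0" "AE x in lebesgue. norm (g j x) \<le> 1 / measure lebesgue B"
          using 1(1) AE_completion[OF g(2)[of j]] apply eventually_elim apply simp
          using 1(2) AE_completion[OF g(2)[of j]] apply eventually_elim apply simp
          done
        show "g j \<in> borel_measurable lebesgue" using g(1)[of j] by (intro measurable_completion) simp
        have "(LINT x|lborel. g j x) = 0"
          using lebesgue_integral_borel_rep[OF g(1) g(2), of j] B unfolding H1_atom_def by simp
        then show "(LINT x|lebesgue. g j x) = 0"
          using integral_completion[of "g j" lborel] g(1)[of j] by simp
      qed (use B in \<open>auto simp: H1_atom_def\<close>)
      then show ?thesis ..
    qed
    have gi: "integrable lborel (g j)" for j using atom[of j] atom_integrable(1) g(1) by blast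
    have gk: "atomic_norm (\<lambda>x. c j * dilation_average k (g j) x) \<le> ennreal (norm (c j) * K)" for j
    proof -
      have "atomic_norm (\<lambda>x. c j * dilation_average k (g j) x) \<le> ennreal (norm (c j)) * atomic_norm (dilation_average k (g j))"
        by (intro atomic_norm_cmult_le dilation_average_lebesgue_measurable k gi)
      also have "\<dots> \<le> ennreal (norm (c j)) * ennreal K"
        using atom[of j] atomic_norm_dilation_average_atom_le[OF k _ g(1)] unfolding K_def
        by (intro mult_left_mono) auto
      finally show ?thesis using K0 by (simp add: ennreal_mult)
    qed
    have sc: "summable (\<lambda>j. norm (c j) * K)" by (intro summable_mult2 atomic_decompD(3)[OF d])
    have "atomic_norm (dilation_average k f) \<le> ennreal (\<Sum>j. norm (c j) * K)"
    proof (rule atomic_norm_countable_subadditive[OF _ _ gk _ sc])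
      show "(\<lambda>x. c j * dilation_average k (g j) x) \<in> borel_measurable lebesgue" for j
        by (intro borel_measurable_times borel_measurable_const dilation_average_lebesgue_measurable k gi)
      show "dilation_average k f \<in> borel_measurable lebesgue" by (rule dilation_average_lebesgue_measurable[OF k f])
      show "0 \<le> norm (c j) * K" for j using K0 by simp
      have le: "L1_norm (\<lambda>x. dilation_average k f x - (\<Sum>j<n. c j * dilation_average k (g j) x))
          \<le> ennreal K * L1_norm (\<lambda>x. f x - (\<Sum>j<n. c j * a j x))" for n
      proof -
        have "L1_norm (\<lambda>x. dilation_average k f x - (\<Sum>j<n. c j * dilation_average k (g j) x))
            = L1_norm (dilation_average k (\<lambda>x. f x - (\<Sum>j<n. c j * g j x)))"
          using dilation_average_diff_sum_AE[OF k f _ gi, of "{..<n}" c "\<lambda>j. j"]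
          by (intro L1_norm_cong_AE) (auto elim!: eventually_mono)
        also have "\<dots> \<le> ennreal K * L1_norm (\<lambda>x. f x - (\<Sum>j<n. c j * g j x))"
          unfolding K_def by (rule L1_norm_dilation_average_le[OF k])
            (intro borel_measurable_diff fm borel_measurable_sum borel_measurable_times borel_measurable_const g(1))
        also have "L1_norm (\<lambda>x. f x - (\<Sum>j<n. c j * g j x)) = L1_norm (\<lambda>x. f x - (\<Sum>j<n. c j * a j x))"
        proof (rule L1_norm_cong_AE)
          have "AE x in lborel. \<forall>j. a j x = g j x" unfolding AE_all_countable using g(2) by blast
          then show "AE x in lborel. f x - (\<Sum>j<n. c j * g j x) = f x - (\<Sum>j<n. c j * a j x)"
            by eventually_elim simp
        qed
        finally show ?thesis .
      qed
      have "(\<lambda>n. ennreal K * L1_norm (\<lambda>x. f x - (\<Sum>j<n. c j * a j x))) \<longlonglongrightarrow> ennreal K * 0"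
        using d unfolding atomic_decomp_def by (intro ennreal_tendsto_cmult) auto
      then have lim: "(\<lambda>n. ennreal K * L1_norm (\<lambda>x. f x - (\<Sum>j<n. c j * a j x))) \<longlonglongrightarrow> 0" by simp
      show "(\<lambda>n. L1_norm (\<lambda>x. dilation_average k f x - (\<Sum>j<n. c j * dilation_average k (g j) x))) \<longlonglongrightarrow> 0"
        by (rule tendsto_sandwich[OF _ _ tendsto_const lim]) (use le in \<open>auto intro!: always_eventually\<close>)
    qed
    also have "(\<Sum>j. norm (c j) * K) = K * (\<Sum>j. norm (c j))"
      using suminf_mult2[OF atomic_decompD(3)[OF d], of K] by (simp add: mult.commute)
    finally show ?thesis .
  qed
  show ?thesis
  proof (cases "K = 0")
    case True
    obtain c a where "atomic_decomp c a f" using False by blast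
    from step[OF this] True show ?thesis by (simp add: K_def)
  next
    case K: False
    have "atomic_norm (dilation_average k f) / ennreal K \<le> atomic_norm f"
      unfolding atomic_norm_def[of f]
    proof (rule Inf_greatest)
      fix v assume "v \<in> {ennreal (\<Sum>j. norm (c j)) | c a. atomic_decomp c a f}"
      then obtain c a where v: "v = ennreal (\<Sum>j. norm (c j))" and d: "atomic_decomp c a f" by auto
      have "atomic_norm (dilation_average k f) \<le> v * ennreal K"
        using step[OF d] K0 unfolding v
        by (simp add: ennreal_mult suminf_nonneg atomic_decompD(3)[OF d] mult.commute)
      then show "atomic_norm (dilation_average k f) / ennreal K \<le> v"
        using K K0 by (simp add: divide_le_posI_ennreal mult.commute)
    qed
    then have "ennreal K * (atomic_norm (dilation_average k f) / ennreal K) \<le> ennreal K * atomic_norm f"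
      by (rule mult_left_mono) simp
    moreover have "ennreal K * (atomic_norm (dilation_average k f) / ennreal K) = atomic_norm (dilation_average k f)"
      using K K0 by (simp add: ennreal_times_divide mult.commute[of "ennreal K"] mult_divide_eq_ennreal)
    ultimately show ?thesis unfolding K_def by simp
  qed
qed

section \<open>The Hilbert transform norm\<close>

lemma AE_affine:
  fixes c :: real
  assumes P: "AE y in lborel. P y" and c: "c \<noteq> 0"
  shows "AE x in lborel. P (b + c * x)"
proof -
  from AE_E[OF P] obtain N where
    N: "{y \<in> space lborel. \<not> P y} \<subseteq> N" "emeasure lborel N = 0" "N \<in> sets lborel" .
  then have "AE y in lborel. y \<notin> N" by (intro AE_not_in null_setsI)
  then have "AE x in lborel. b + c * x \<notin> N"
    using N(3) by (intro AE_borel_affine[OF c]) auto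
  then show ?thesis by eventually_elim (use N(1) in auto)
qed

text \<open>
The identity holds for every truncation and every point, so that also the values at points where the
limit does not exist agree.
\<close>

lemma truncated_integral_eq_trunc:
  fixes f g :: "real \<Rightarrow> complex"
  assumes g[measurable]: "g \<in> borel_measurable borel" and fg: "AE x in lborel. f x = g x"
  shows "(LINT y:{y. \<epsilon> < \<bar>y\<bar>}|lebesgue. f (x - y) / of_real y) = trunc \<epsilon> g x"
proof -
  have "(LINT y:{y. \<epsilon> < \<bar>y\<bar>}|lebesgue. f (x - y) / of_real y) = (LINT y|lborel. inv_cut \<epsilon> y *\<^sub>R g (x - y))"
    unfolding set_lebesgue_integral_def
  proof (rule lebesgue_integral_borel_rep)
    show "(\<lambda>y. inv_cut \<epsilon> y *\<^sub>R g (x - y)) \<in> borel_measurable borel" by measurable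
    have "AE y in lborel. f (x + (- 1) * y) = g (x + (- 1) * y)" by (rule AE_affine[OF fg]) simp
    then show "AE y in lborel. indicator {y. \<epsilon> < \<bar>y\<bar>} y *\<^sub>R (f (x - y) / of_real y) = inv_cut \<epsilon> y *\<^sub>R g (x - y)"
      by eventually_elim (simp add: inv_cut_def indicator_def scaleR_conv_of_real)
  qed
  also have "\<dots> = trunc \<epsilon> g x"
    unfolding trunc_def by (subst lborel_integral_real_affine[where c = "- 1" and t = x]) auto
  finally show ?thesis .
qed

lemma hilbert_transform_eq_pv:
  assumes "g \<in> borel_measurable borel" "AE x in lborel. f x = g x"
  shows "hilbert_transform f x = of_real (1 / pi) * pv g x"
  unfolding hilbert_transform_def pv_def truncated_integral_eq_trunc[OF assms] ..

lemma pv_lebesgue_measurable: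
  assumes f: "integrable lborel f"
  shows "pv f \<in> borel_measurable lebesgue"
proof -
  define F where "F x = lim (\<lambda>n. trunc (inverse (real (Suc n))) f x)" for x
  have "trunc \<epsilon> f \<in> borel_measurable borel" if "0 < \<epsilon>" for \<epsilon>
    by (rule borel_measurable_continuous_onI[OF trunc_continuous[OF f that]])
  then have "F \<in> borel_measurable borel" unfolding F_def[abs_def] by (intro borel_measurable_lim_metric) auto
  moreover have "AE x in lborel. pv f x = F x"
    using pv_tendsto_AE[OF f]
  proof eventually_elim
    fix x assume *: "((\<lambda>\<epsilon>. trunc \<epsilon> f x) \<longlongrightarrow> pv f x) (at_right 0)"
    have "filterlim (\<lambda>n. inverse (real (Suc n))) (at_right 0) sequentially"
      unfolding filterlim_at using LIMSEQ_inverse_real_of_nat by (auto intro!: always_eventually)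
    then have "(\<lambda>n. trunc (inverse (real (Suc n))) f x) \<longlonglongrightarrow> pv f x"
      by (rule filterlim_compose[OF *])
    then show "pv f x = F x" unfolding F_def by (simp add: limI)
  qed
  ultimately show ?thesis by (rule measurable_lebesgue_cong_AE)
qed

lemma dilate_integrable:
  assumes f: "integrable lborel f" and t: "0 < t"
  shows "integrable lborel (dilate t f)" "(LINT x|lborel. norm (dilate t f x)) = (LINT x|lborel. norm (f x))"
proof -
  have "integrable lborel (\<lambda>x. f (0 + (1 / t) * x))" using f t by (intro lborel_integrable_real_affine) auto
  then show "integrable lborel (dilate t f)" unfolding dilate_def[abs_def] by simp
  have "(LINT x|lborel. norm (f x)) = \<bar>1 / t\<bar> *\<^sub>R (LINT x|lborel. norm (f (0 + (1 / t) * x)))"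
    using t by (intro lborel_integral_real_affine) auto
  then show "(LINT x|lborel. norm (dilate t f x)) = (LINT x|lborel. norm (f x))"
    unfolding dilate_def using t by (simp add: norm_divide)
qed

lemma trunc_dilate:
  assumes t: "0 < t"
  shows "trunc \<epsilon> (dilate t f) x = trunc (\<epsilon> / t) f (x / t) / of_real t"
proof -
  have "trunc \<epsilon> (dilate t f) x = t *\<^sub>R (LINT z|lborel. inv_cut \<epsilon> (x - (0 + t * z)) *\<^sub>R dilate t f (0 + t * z))"
    unfolding trunc_def using t by (subst lborel_integral_real_affine[where c = t and t = 0]) auto
  also have "(\<lambda>z. inv_cut \<epsilon> (x - (0 + t * z)) *\<^sub>R dilate t f (0 + t * z)) = (\<lambda>z. (1 / t\<^sup>2) *\<^sub>R (inv_cut (\<epsilon> / t) (x / t - z) *\<^sub>R f z))"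
  proof
    fix z
    have "x - (0 + t * z) = t * (x / t - z)" using t by (simp add: field_simps)
    moreover have "inv_cut \<epsilon> (t * u) = inv_cut (\<epsilon> / t) u / t" for u
      unfolding inv_cut_def using t by (auto simp: abs_mult field_simps)
    ultimately show "inv_cut \<epsilon> (x - (0 + t * z)) *\<^sub>R dilate t f (0 + t * z) = (1 / t\<^sup>2) *\<^sub>R (inv_cut (\<epsilon> / t) (x / t - z) *\<^sub>R f z)"
      using t by (simp add: dilate_def scaleR_conv_of_real power2_eq_square)
  qed
  also have "t *\<^sub>R (LINT z|lborel. (1 / t\<^sup>2) *\<^sub>R (inv_cut (\<epsilon> / t) (x / t - z) *\<^sub>R f z)) = trunc (\<epsilon> / t) f (x / t) / of_real t"
    unfolding trunc_def using t by (simp add: scaleR_conv_of_real power2_eq_square)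
  finally show ?thesis .
qed

lemma pv_dilate_AE:
  assumes f: "integrable lborel f" and t: "0 < t"
  shows "AE x in lborel. pv (dilate t f) x = dilate t (pv f) x"
proof -
  have "AE x in lborel. ((\<lambda>\<epsilon>. trunc \<epsilon> f (0 + (1 / t) * x)) \<longlongrightarrow> pv f (0 + (1 / t) * x)) (at_right 0)"
    using t by (intro AE_affine[OF pv_tendsto_AE[OF f]]) auto
  then show ?thesis
  proof eventually_elim
    fix x assume "((\<lambda>\<epsilon>. trunc \<epsilon> f (0 + (1 / t) * x)) \<longlongrightarrow> pv f (0 + (1 / t) * x)) (at_right 0)"
    then have *: "((\<lambda>\<epsilon>. trunc \<epsilon> f (x / t)) \<longlongrightarrow> pv f (x / t)) (at_right 0)" by simp
    have "filterlim (\<lambda>\<epsilon>. \<epsilon> / t) (at_right 0) (at_right 0)"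
      unfolding filterlim_at using t
      by (auto simp: eventually_at_right_field intro!: tendsto_eq_intros exI[of _ 1])
    then have "((\<lambda>\<epsilon>. trunc (\<epsilon> / t) f (x / t)) \<longlongrightarrow> pv f (x / t)) (at_right 0)"
      by (rule filterlim_compose[OF *])
    then have "((\<lambda>\<epsilon>. trunc \<epsilon> (dilate t f) x) \<longlongrightarrow> pv f (x / t) / of_real t) (at_right 0)"
      unfolding trunc_dilate[OF t] using t by (intro tendsto_intros) auto
    then show "pv (dilate t f) x = dilate t (pv f) x"
      unfolding pv_def[of "dilate t f"] dilate_def[of t "pv f"] by (intro tendsto_Lim) auto
  qed
qed

lemma pv_cmult_AE:
  assumes f: "integrable lborel f"
  shows "AE x in lborel. pv (\<lambda>x. c * f x) x = c * pv f x"
  using pv_tendsto_AE[OF f]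
proof eventually_elim
  fix x assume "((\<lambda>\<epsilon>. trunc \<epsilon> f x) \<longlongrightarrow> pv f x) (at_right 0)"
  then have "((\<lambda>\<epsilon>. c * trunc \<epsilon> f x) \<longlongrightarrow> c * pv f x) (at_right 0)" by (intro tendsto_intros)
  moreover have "eventually (\<lambda>\<epsilon>. c * trunc \<epsilon> f x = trunc \<epsilon> (\<lambda>x. c * f x) x) (at_right 0)"
    using trunc_bounded_linear[OF f _ bounded_linear_mult_right[of c]]
    by (auto simp: eventually_at_right_field intro!: exI[of _ 1])
  ultimately have "((\<lambda>\<epsilon>. trunc \<epsilon> (\<lambda>x. c * f x) x) \<longlongrightarrow> c * pv f x) (at_right 0)"
    by (rule Lim_transform_eventually)
  then show "pv (\<lambda>x. c * f x) x = c * pv f x"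
    unfolding pv_def[of "\<lambda>x. c * f x"] by (intro tendsto_Lim) auto
qed

lemma pv_zero: "pv (\<lambda>_. 0) x = 0"
proof -
  have "((\<lambda>\<epsilon>. trunc \<epsilon> (\<lambda>_. 0::complex) x) \<longlongrightarrow> 0) (at_right 0)" unfolding trunc_def by simp
  then show ?thesis unfolding pv_def by (intro tendsto_Lim) auto
qed

lemma pv_sum_dilates_AE:
  assumes f: "integrable lborel f" and S: "finite S" "\<And>s. s \<in> S \<Longrightarrow> 0 < s"
    and h: "AE x in lborel. pv f x = h x"
  shows "AE x in lborel. pv (\<lambda>x. \<Sum>s\<in>S. c s * dilate s f x) x = (\<Sum>s\<in>S. c s * dilate s h x)"
  using S
proof (induction S rule: finite_induct)
  case empty
  then show ?case by (simp add: pv_zero)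
next
  case (insert s S)
  have s: "0 < s" using insert.prems by simp
  have i1: "integrable lborel (dilate s f)" by (rule dilate_integrable(1)[OF f s])
  have i2: "integrable lborel (\<lambda>x. \<Sum>s\<in>S. c s * dilate s f x)"
    using insert.prems by (intro Bochner_Integration.integrable_sum integrable_mult_right dilate_integrable(1) f) auto
  have i3: "integrable lborel (\<lambda>x. c s * dilate s f x)" using i1 by (rule integrable_mult_right)
  have "AE x in lborel. pv f (0 + (1 / s) * x) = h (0 + (1 / s) * x)"
    using s by (intro AE_affine[OF h]) auto
  then have h': "AE x in lborel. dilate s (pv f) x = dilate s h x"
    by eventually_elim (simp add: dilate_def)
  have IH: "AE x in lborel. pv (\<lambda>x. \<Sum>s\<in>S. c s * dilate s f x) x = (\<Sum>s\<in>S. c s * dilate s h x)"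
    by (rule insert.IH) (use insert.prems in auto)
  show ?case
    using pv_linear_AE[OF i3 i2] pv_cmult_AE[OF i1, of "c s"] pv_dilate_AE[OF f s] h' IH
    by eventually_elim (use insert.hyps in simp)
qed

lemma norm_dilate_interval_bound:
  assumes "T / 2 < s" "s < 2 * T"
  shows "norm (dilate s (\<lambda>x. indicator {a<..b} x *\<^sub>R c) x)
    \<le> norm (indicator {- (2 * T * max \<bar>a\<bar> \<bar>b\<bar>)..2 * T * max \<bar>a\<bar> \<bar>b\<bar>} x *\<^sub>R (of_real (2 / T) * c))"
proof (cases "x / s \<in> {a<..b}")
  case True
  have s: "0 < s" "0 < T" using assms by linarith+
  define y where "y = x / s"
  have "\<bar>y\<bar> \<le> max \<bar>a\<bar> \<bar>b\<bar>" using True unfolding y_def[symmetric] by auto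
  then have "s * \<bar>y\<bar> \<le> (2 * T) * max \<bar>a\<bar> \<bar>b\<bar>" using s assms by (intro mult_mono) auto
  moreover have "\<bar>x\<bar> = s * \<bar>y\<bar>" unfolding y_def using s by (simp add: abs_divide)
  ultimately have x: "x \<in> {- (2 * T * max \<bar>a\<bar> \<bar>b\<bar>)..2 * T * max \<bar>a\<bar> \<bar>b\<bar>}" by auto
  have "norm c / s \<le> norm c / (T / 2)" using s assms by (intro divide_left_mono) auto
  then show ?thesis using True x s by (simp add: dilate_def norm_divide norm_mult mult.commute)
qed (simp add: dilate_def)

text \<open>
For an indicator of an interval this is dominated convergence; the general case follows because
dilations are isometries of \<open>L\<^sup>1\<close>.
\<close>

lemma dilate_L1_continuous:
  assumes "integrable lborel f"
  shows "\<forall>X T. 0 < T \<longrightarrow> (\<forall>n. 0 < X n) \<longrightarrow> X \<longlonglongrightarrow> T \<longrightarrow>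
    (\<lambda>n. LINT x|lborel. norm (dilate (X n) f x - dilate T f x)) \<longlonglongrightarrow> 0"
  using assms
proof (induct rule: L1_interval_induct)
  case (interval a b c)
  let ?f = "\<lambda>x. indicator {a<..b} x *\<^sub>R c"
  show ?case
  proof (intro allI impI)
    fix X :: "nat \<Rightarrow> real" and T :: real assume T: "0 < T" and X0: "\<forall>n. 0 < X n" and X: "X \<longlonglongrightarrow> T"
    let ?R = "2 * T * max \<bar>a\<bar> \<bar>b\<bar>"
    let ?w = "\<lambda>x. indicator {- ?R..?R} x *\<^sub>R (of_real (2 / T) * c)"
    have fm: "?f \<in> borel_measurable borel" by measurable
    have "eventually (\<lambda>n. T / 2 < X n \<and> X n < 2 * T) sequentially"
      using order_tendstoD(1)[OF X, of "T / 2"] order_tendstoD(2)[OF X, of "2 * T"] T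
      by (intro eventually_conj) auto
    then obtain N where N: "\<And>n. N \<le> n \<Longrightarrow> T / 2 < X n \<and> X n < 2 * T" by (auto simp: eventually_sequentially)
    have "(\<lambda>n. LINT x|lborel. norm (dilate (X (n + N)) ?f x - dilate T ?f x)) \<longlonglongrightarrow> 0"
    proof (rule L1_tendsto_by_dominated_convergence[where w = "\<lambda>x. 2 * norm (?w x)"])
      show "integrable lborel (\<lambda>x. 2 * norm (?w x))"
        using T by (intro integrable_mult_right integrable_norm integrable_scaleR_left integrable_real_indicator)
          (auto simp: emeasure_lborel_Icc_eq)
      show "dilate T ?f \<in> borel_measurable lborel" "dilate (X (n + N)) ?f \<in> borel_measurable lborel" for n
        using dilate_measurable[OF fm] by simp_all
      show "AE x in lborel. norm (dilate (X (n + N)) ?f x - dilate T ?f x) \<le> 2 * norm (?w x)" for n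
      proof (rule AE_I2)
        fix x
        have "norm (dilate (X (n + N)) ?f x) \<le> norm (?w x)" "norm (dilate T ?f x) \<le> norm (?w x)"
          using N[of "n + N"] T by (intro norm_dilate_interval_bound; simp)+
        then show "norm (dilate (X (n + N)) ?f x - dilate T ?f x) \<le> 2 * norm (?w x)"
          using norm_triangle_ineq4[of "dilate (X (n + N)) ?f x" "dilate T ?f x"] by linarith
      qed
      have "AE x in lborel. x \<notin> {T * a, T * b}" by (rule AE_lborel_not_in_finite) simp
      then show "AE x in lborel. (\<lambda>n. dilate (X (n + N)) ?f x) \<longlonglongrightarrow> dilate T ?f x"
      proof eventually_elim
        fix x assume x: "x \<notin> {T * a, T * b}"
        have XN: "(\<lambda>n. X (n + N)) \<longlonglongrightarrow> T" using X by (rule LIMSEQ_ignore_initial_segment)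
        have lim: "(\<lambda>n. x / X (n + N)) \<longlonglongrightarrow> x / T" using XN T by (intro tendsto_intros) auto
        have ne: "x / T \<noteq> a" "x / T \<noteq> b" using x T by (auto simp: field_simps)
        have "eventually (\<lambda>n. (x / X (n + N) \<in> {a<..b}) = (x / T \<in> {a<..b})) sequentially"
        proof -
          have A: "eventually (\<lambda>n. (a < x / X (n + N)) = (a < x / T)) sequentially"
          proof (cases "a < x / T")
            case True
            from order_tendstoD(1)[OF lim True] show ?thesis by eventually_elim (use True in simp)
          next
            case False
            then have "x / T < a" using ne by simp
            from order_tendstoD(2)[OF lim this] show ?thesis by eventually_elim (use False in simp)
          qed
          have B: "eventually (\<lambda>n. (x / X (n + N) \<le> b) = (x / T \<le> b)) sequentially"
          proof (cases "b < x / T")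
            case True
            from order_tendstoD(1)[OF lim True] show ?thesis by eventually_elim (use True in simp)
          next
            case False
            then have "x / T < b" using ne by simp
            from order_tendstoD(2)[OF lim this] show ?thesis by eventually_elim (use False in simp)
          qed
          from A B show ?thesis by eventually_elim simp
        qed
        then have "eventually (\<lambda>n. ?f (x / T) / of_real (X (n + N)) = dilate (X (n + N)) ?f x) sequentially"
          by eventually_elim (simp add: dilate_def indicator_def)
        moreover have "(\<lambda>n. ?f (x / T) / of_real (X (n + N))) \<longlonglongrightarrow> dilate T ?f x"
          unfolding dilate_def using XN T by (intro tendsto_intros) auto
        ultimately show "(\<lambda>n. dilate (X (n + N)) ?f x) \<longlonglongrightarrow> dilate T ?f x"
          by (blast intro: Lim_transform_eventually)
      qed
    qed
    then show "(\<lambda>n. LINT x|lborel. norm (dilate (X n) ?f x - dilate T ?f x)) \<longlonglongrightarrow> 0"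
      by (rule LIMSEQ_offset)
  qed
next
  case (add f g)
  show ?case
  proof (intro allI impI)
    fix X :: "nat \<Rightarrow> real" and T :: real assume T: "0 < T" and X0: "\<forall>n. 0 < X n" and X: "X \<longlonglongrightarrow> T"
    have lim: "(\<lambda>n. (LINT x|lborel. norm (dilate (X n) f x - dilate T f x)) + (LINT x|lborel. norm (dilate (X n) g x - dilate T g x))) \<longlonglongrightarrow> 0 + 0"
      using add(3,4) T X0 X by (intro tendsto_add) blast+
    have le: "(LINT x|lborel. norm (dilate (X n) (\<lambda>x. f x + g x) x - dilate T (\<lambda>x. f x + g x) x))
        \<le> (LINT x|lborel. norm (dilate (X n) f x - dilate T f x)) + (LINT x|lborel. norm (dilate (X n) g x - dilate T g x))" for n
    proof -
      have i: "integrable lborel (\<lambda>x. dilate (X n) u x - dilate T u x)" if "integrable lborel u" for u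
        using that X0 T by (intro Bochner_Integration.integrable_diff dilate_integrable(1)) auto
      have "(LINT x|lborel. norm (dilate (X n) (\<lambda>x. f x + g x) x - dilate T (\<lambda>x. f x + g x) x))
          = (LINT x|lborel. norm ((dilate (X n) f x - dilate T f x) + (dilate (X n) g x - dilate T g x)))"
        by (simp add: dilate_def add_divide_distrib algebra_simps)
      also have "\<dots> \<le> (LINT x|lborel. norm (dilate (X n) f x - dilate T f x) + norm (dilate (X n) g x - dilate T g x))"
        using i[OF add(1)] i[OF add(2)] by (intro integral_mono norm_triangle_ineq) auto
      also have "\<dots> = (LINT x|lborel. norm (dilate (X n) f x - dilate T f x)) + (LINT x|lborel. norm (dilate (X n) g x - dilate T g x))"
        using i[OF add(1)] i[OF add(2)] by (intro Bochner_Integration.integral_add) auto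
      finally show ?thesis .
    qed
    show "(\<lambda>n. LINT x|lborel. norm (dilate (X n) (\<lambda>x. f x + g x) x - dilate T (\<lambda>x. f x + g x) x)) \<longlonglongrightarrow> 0"
      by (rule tendsto_sandwich[OF _ _ tendsto_const lim[simplified]]) (use le in \<open>auto intro!: always_eventually\<close>)
  qed
next
  case (lim f s)
  show ?case
  proof (intro allI impI)
    fix X :: "nat \<Rightarrow> real" and T :: real assume T: "0 < T" and X0: "\<forall>n. 0 < X n" and X: "X \<longlonglongrightarrow> T"
    show "(\<lambda>n. LINT x|lborel. norm (dilate (X n) f x - dilate T f x)) \<longlonglongrightarrow> 0"
    proof (rule LIMSEQ_I)
      fix e :: real assume e: "0 < e"
      obtain m where m: "(LINT x|lborel. norm (s m x - f x)) < e / 3"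
        using order_tendstoD(2)[OF lim(4), of "e / 3"] e by (auto simp: eventually_sequentially)
      have "(\<lambda>n. LINT x|lborel. norm (dilate (X n) (s m) x - dilate T (s m) x)) \<longlonglongrightarrow> 0"
        using lim(3) T X0 X by blast
      from order_tendstoD(2)[OF this, of "e / 3"] e obtain N where
        N: "\<And>n. N \<le> n \<Longrightarrow> (LINT x|lborel. norm (dilate (X n) (s m) x - dilate T (s m) x)) < e / 3"
        by (auto simp: eventually_sequentially)
      have ds: "integrable lborel (\<lambda>x. s m x - f x)" using lim by auto
      have "(LINT x|lborel. norm (dilate (X n) f x - dilate T f x)) < e" if n: "N \<le> n" for n
      proof -
        have Xn: "0 < X n" using X0 by simp
        have i1: "integrable lborel (\<lambda>x. norm (dilate (X n) (\<lambda>x. s m x - f x) x))"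
          and i2: "integrable lborel (\<lambda>x. norm (dilate T (\<lambda>x. s m x - f x) x))"
          using dilate_integrable(1)[OF ds] Xn T by auto
        have i3: "integrable lborel (\<lambda>x. norm (dilate (X n) (s m) x - dilate T (s m) x))"
          using dilate_integrable(1)[OF lim(2)[of m]] Xn T by auto
        have i4: "integrable lborel (\<lambda>x. norm (dilate (X n) f x - dilate T f x))"
          using dilate_integrable(1)[OF lim(1)] Xn T by auto
        have "(LINT x|lborel. norm (dilate (X n) f x - dilate T f x))
            \<le> (LINT x|lborel. norm (dilate (X n) (\<lambda>x. s m x - f x) x) + norm (dilate (X n) (s m) x - dilate T (s m) x)
                 + norm (dilate T (\<lambda>x. s m x - f x) x))"
        proof (rule integral_mono[OF i4])
          show "integrable lborel (\<lambda>x. norm (dilate (X n) (\<lambda>x. s m x - f x) x) + norm (dilate (X n) (s m) x - dilate T (s m) x)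
                 + norm (dilate T (\<lambda>x. s m x - f x) x))"
            by (intro Bochner_Integration.integrable_add i1 i2 i3)
          fix x
          have "dilate (X n) f x - dilate T f x = - dilate (X n) (\<lambda>x. s m x - f x) x
              + (dilate (X n) (s m) x - dilate T (s m) x) + dilate T (\<lambda>x. s m x - f x) x"
            by (simp add: dilate_def diff_divide_distrib)
          also have "norm \<dots> \<le> norm (- dilate (X n) (\<lambda>x. s m x - f x) x
              + (dilate (X n) (s m) x - dilate T (s m) x)) + norm (dilate T (\<lambda>x. s m x - f x) x)"
            by (rule norm_triangle_ineq)
          also have "\<dots> \<le> norm (- dilate (X n) (\<lambda>x. s m x - f x) x)
              + norm (dilate (X n) (s m) x - dilate T (s m) x) + norm (dilate T (\<lambda>x. s m x - f x) x)"
            by (intro add_right_mono norm_triangle_ineq)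
          finally show "norm (dilate (X n) f x - dilate T f x) \<le> norm (dilate (X n) (\<lambda>x. s m x - f x) x)
              + norm (dilate (X n) (s m) x - dilate T (s m) x) + norm (dilate T (\<lambda>x. s m x - f x) x)" by simp
        qed
        also have "\<dots> = (LINT x|lborel. norm (s m x - f x)) + (LINT x|lborel. norm (dilate (X n) (s m) x - dilate T (s m) x))
            + (LINT x|lborel. norm (s m x - f x))"
          using i1 i2 i3 dilate_integrable(2)[OF ds Xn] dilate_integrable(2)[OF ds T]
          by (simp add: Bochner_Integration.integral_add)
        also have "\<dots> < e / 3 + e / 3 + e / 3" using m N[OF n] by linarith
        finally show ?thesis by simp
      qed
      moreover have "0 \<le> (LINT x|lborel. norm (dilate (X n) f x - dilate T f x))" for n
        by (rule integral_nonneg_AE) simp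
      ultimately show "\<exists>N. \<forall>n\<ge>N. norm ((LINT x|lborel. norm (dilate (X n) f x - dilate T f x)) - 0) < e"
        by auto
    qed
  qed
qed

text \<open>
The dilation parameter \<open>t\<close> is rounded up to a multiple of \<open>1/n\<close> and cut off near \<open>n\<close>. One and the
same sequence of finite sums works for all functions; this is used for a function and its
Hilbert transform simultaneously.
\<close>

lemma dilation_average_discretised:
  assumes k: "half_line_kernel k"
  obtains c :: "nat \<Rightarrow> real \<Rightarrow> real" and S :: "nat \<Rightarrow> real set"
  where "\<And>n. finite (S n)" "\<And>n s. s \<in> S n \<Longrightarrow> 0 < s"
    "\<And>f. integrable lborel f \<Longrightarrow>
      (\<lambda>n. LINT x|lborel. norm ((\<Sum>s\<in>S n. of_real (c n s) * dilate s f x) - dilation_average k f x)) \<longlonglongrightarrow> 0"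
proof -
  note [measurable] = half_line_kernelD(2)[OF k]
  define m where "m n = real (Suc n)" for n
  have m0: "0 < m n" for n unfolding m_def by simp
  \<comment> \<open>The summand 1 keeps the rounded parameter positive.\<close>
  define d where "d n t = (of_int \<lfloor>m n * t\<rfloor> + 1) / m n" for n t
  have dm[measurable]: "d n \<in> borel_measurable borel" for n unfolding d_def by measurable
  define S where "S n = (\<lambda>j. (of_int j + 1) / m n) ` {0..(int (Suc n))\<^sup>2}" for n
  have finS: "finite (S n)" for n unfolding S_def by simp
  have S0: "0 < s" if "s \<in> S n" for n s using that m0[of n] unfolding S_def by auto
  define c where "c n s = (LINT t|lborel. k t * indicator {t. d n t = s} t)" for n s
  have ci: "integrable lborel (\<lambda>t. k t * indicator {t. d n t = s} t)" for n s
    by (rule Bochner_Integration.integrable_bound[OF half_line_kernelD(1)[OF k]]) (auto simp: indicator_def)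
  have dlim: "(\<lambda>n. d n t) \<longlonglongrightarrow> t" for t
  proof -
    have "(\<lambda>n. of_int \<lfloor>real (Suc n) * t\<rfloor> / real (Suc n) + inverse (real (Suc n))) \<longlonglongrightarrow> t + 0"
      by (intro tendsto_add floor_discretisation_tendsto LIMSEQ_inverse_real_of_nat)
    then show ?thesis unfolding d_def m_def by (simp add: add_divide_distrib inverse_eq_divide)
  qed
  have dS: "eventually (\<lambda>n. d n t \<in> S n) sequentially" if t: "0 < t" for t
  proof -
    obtain N :: nat where N: "t \<le> real N" using real_arch_simple by blast
    have "d n t \<in> S n" if "N \<le> n" for n
    proof -
      have "t \<le> m n" using N that unfolding m_def by simp
      then have "m n * t \<le> m n * m n" using m0[of n] by (intro mult_left_mono) auto
      then have "of_int \<lfloor>m n * t\<rfloor> \<le> (m n)\<^sup>2" unfolding power2_eq_square by linarith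
      then have "real_of_int \<lfloor>m n * t\<rfloor> \<le> real_of_int ((int (Suc n))\<^sup>2)" unfolding m_def by simp
      then have "\<lfloor>m n * t\<rfloor> \<le> (int (Suc n))\<^sup>2" by (simp only: of_int_le_iff)
      moreover have "0 \<le> \<lfloor>m n * t\<rfloor>" using t m0[of n] by simp
      ultimately show ?thesis unfolding S_def d_def by (intro imageI) simp
    qed
    then show ?thesis by (auto simp: eventually_sequentially)
  qed
  have main: "(\<lambda>n. LINT x|lborel. norm ((\<Sum>s\<in>S n. of_real (c n s) * dilate s f x) - dilation_average k f x)) \<longlonglongrightarrow> 0"
    if f: "integrable lborel f" for f
  proof -
    have fm[measurable]: "f \<in> borel_measurable borel" using f by auto
    have Sm[measurable]: "S n \<in> sets borel" for n using finS by (simp add: borel_closed finite_imp_closed)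
    define D where "D n t x = (if d n t \<in> S n then dilate (d n t) f x else 0)" for n t x
    have Dm[measurable]: "(\<lambda>(x, t). D n t x) \<in> borel_measurable (borel \<Otimes>\<^sub>M borel)" for n
      unfolding D_def dilate_def by measurable
    have fin: "(\<Sum>s\<in>S n. of_real (c n s) * dilate s f x) = (LINT t|lborel. k t *\<^sub>R D n t x)"
      and finI: "integrable lborel (\<lambda>t. k t *\<^sub>R D n t x)" for n x
    proof -
      have eq: "k t *\<^sub>R D n t x = (\<Sum>s\<in>S n. (k t * indicator {t. d n t = s} t) *\<^sub>R dilate s f x)" for t
      proof -
        have "(\<Sum>s\<in>S n. (k t * indicator {t. d n t = s} t) *\<^sub>R dilate s f x)
            = (\<Sum>s\<in>S n. if s = d n t then k t *\<^sub>R dilate (d n t) f x else 0)"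
          by (intro sum.cong) (auto simp: indicator_def)
        then show ?thesis unfolding D_def using finS[of n] by simp
      qed
      show "integrable lborel (\<lambda>t. k t *\<^sub>R D n t x)"
        unfolding eq by (intro Bochner_Integration.integrable_sum integrable_scaleR_left ci)
      have "(LINT t|lborel. k t *\<^sub>R D n t x) = (\<Sum>s\<in>S n. c n s *\<^sub>R dilate s f x)"
        unfolding eq c_def using ci by (subst Bochner_Integration.integral_sum) auto
      then show "(\<Sum>s\<in>S n. of_real (c n s) * dilate s f x) = (LINT t|lborel. k t *\<^sub>R D n t x)"
        by (simp add: scaleR_conv_of_real)
    qed
    define \<omega> where "\<omega> n t = (\<integral>\<^sup>+x. ennreal (norm (D n t x - dilate t f x)) \<partial>lborel)" for n t
    have dfm[measurable]: "(\<lambda>(x, t). dilate t f x) \<in> borel_measurable (borel \<Otimes>\<^sub>M borel)"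
      unfolding dilate_def by measurable
    have \<omega>m[measurable]: "\<omega> n \<in> borel_measurable borel" for n
      unfolding \<omega>_def[abs_def] by measurable
    have \<omega>_eq: "\<omega> n t = ennreal (LINT x|lborel. norm (D n t x - dilate t f x))" if "0 < t" for n t
      unfolding \<omega>_def
    proof (rule nn_integral_eq_integral)
      have "integrable lborel (D n t)"
        unfolding D_def[abs_def] using dilate_integrable(1)[OF f S0] by (cases "d n t \<in> S n") auto
      then show "integrable lborel (\<lambda>x. norm (D n t x - dilate t f x))"
        using dilate_integrable(1)[OF f that] by auto
    qed simp
    have \<omega>_le: "\<omega> n t \<le> ennreal (2 * (LINT x|lborel. norm (f x)))" if t: "0 < t" for n t
    proof -
      have i1: "integrable lborel (D n t)" "(LINT x|lborel. norm (D n t x)) \<le> (LINT x|lborel. norm (f x))"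
        unfolding D_def[abs_def] using dilate_integrable[OF f S0, of "d n t" n]
        by (cases "d n t \<in> S n"; simp)+
      note i2 = dilate_integrable[OF f t]
      have "(LINT x|lborel. norm (D n t x - dilate t f x)) \<le> (LINT x|lborel. norm (D n t x) + norm (dilate t f x))"
        using i1 i2 by (intro integral_mono norm_triangle_ineq4) auto
      also have "\<dots> = (LINT x|lborel. norm (D n t x)) + (LINT x|lborel. norm (dilate t f x))"
        using i1 i2 by (intro Bochner_Integration.integral_add) auto
      also have "\<dots> \<le> 2 * (LINT x|lborel. norm (f x))" using i1 i2 by simp
      finally show ?thesis unfolding \<omega>_eq[OF t] by (rule ennreal_leI)
    qed
    have \<omega>_lim: "(\<lambda>n. \<omega> n t) \<longlonglongrightarrow> 0" if t: "0 < t" for t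
    proof -
      from dS[OF t] obtain N where N: "\<And>n. N \<le> n \<Longrightarrow> d n t \<in> S n" by (auto simp: eventually_sequentially)
      have "(\<lambda>n. LINT x|lborel. norm (dilate (d (n + N) t) f x - dilate t f x)) \<longlonglongrightarrow> 0"
        using dilate_L1_continuous[OF f, rule_format, of t "\<lambda>n. d (n + N) t"] t S0[OF N]
          LIMSEQ_ignore_initial_segment[OF dlim[of t], of N] by simp
      then have "(\<lambda>n. ennreal (LINT x|lborel. norm (dilate (d (n + N) t) f x - dilate t f x))) \<longlonglongrightarrow> ennreal 0"
        by (rule tendsto_ennrealI)
      then have "(\<lambda>n. \<omega> (n + N) t) \<longlonglongrightarrow> 0"
        unfolding \<omega>_eq[OF t] D_def using N by simp
      then show ?thesis by (rule LIMSEQ_offset)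
    qed
    have le: "ennreal (LINT x|lborel. norm ((\<Sum>s\<in>S n. of_real (c n s) * dilate s f x) - dilation_average k f x))
        \<le> (\<integral>\<^sup>+t. ennreal \<bar>k t\<bar> * \<omega> n t \<partial>lborel)" for n
    proof -
      have i1: "integrable lborel (\<lambda>x. \<Sum>s\<in>S n. of_real (c n s) * dilate s f x)"
        using S0 by (intro Bochner_Integration.integrable_sum integrable_mult_right dilate_integrable(1) f) auto
      have "ennreal (LINT x|lborel. norm ((\<Sum>s\<in>S n. of_real (c n s) * dilate s f x) - dilation_average k f x))
          = (\<integral>\<^sup>+x. ennreal (norm ((\<Sum>s\<in>S n. of_real (c n s) * dilate s f x) - dilation_average k f x)) \<partial>lborel)"
        using i1 dilation_average_integrable[OF k f] by (intro nn_integral_eq_integral[symmetric]) auto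
      also have "\<dots> \<le> (\<integral>\<^sup>+x. \<integral>\<^sup>+t. ennreal \<bar>k t\<bar> * ennreal (norm (D n t x - dilate t f x)) \<partial>lborel \<partial>lborel)"
      proof (rule nn_integral_mono_AE)
        show "AE x in lborel. ennreal (norm ((\<Sum>s\<in>S n. of_real (c n s) * dilate s f x) - dilation_average k f x))
            \<le> (\<integral>\<^sup>+t. ennreal \<bar>k t\<bar> * ennreal (norm (D n t x - dilate t f x)) \<partial>lborel)"
          using dilation_average_integrand_AE[OF k f]
        proof eventually_elim
          fix x assume i: "integrable lborel (\<lambda>t. k t *\<^sub>R dilate t f x)"
          have "(\<Sum>s\<in>S n. of_real (c n s) * dilate s f x) - dilation_average k f x
              = (LINT t|lborel. k t *\<^sub>R D n t x - k t *\<^sub>R dilate t f x)"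
            unfolding fin dilation_average_def by (rule Bochner_Integration.integral_diff[OF finI i, symmetric])
          then have "ennreal (norm ((\<Sum>s\<in>S n. of_real (c n s) * dilate s f x) - dilation_average k f x))
              \<le> (\<integral>\<^sup>+t. ennreal (norm (k t *\<^sub>R D n t x - k t *\<^sub>R dilate t f x)) \<partial>lborel)"
            using integral_norm_bound_ennreal[OF Bochner_Integration.integrable_diff[OF finI[of n x] i]] by simp
          also have "\<dots> = (\<integral>\<^sup>+t. ennreal \<bar>k t\<bar> * ennreal (norm (D n t x - dilate t f x)) \<partial>lborel)"
            by (intro nn_integral_cong) (simp flip: scaleR_diff_right ennreal_mult)
          finally show "ennreal (norm ((\<Sum>s\<in>S n. of_real (c n s) * dilate s f x) - dilation_average k f x))
              \<le> (\<integral>\<^sup>+t. ennreal \<bar>k t\<bar> * ennreal (norm (D n t x - dilate t f x)) \<partial>lborel)" .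
        qed
      qed
      also have "\<dots> = (\<integral>\<^sup>+t. \<integral>\<^sup>+x. ennreal \<bar>k t\<bar> * ennreal (norm (D n t x - dilate t f x)) \<partial>lborel \<partial>lborel)"
        by (rule lborel_pair.Fubini') measurable
      also have "\<dots> = (\<integral>\<^sup>+t. ennreal \<bar>k t\<bar> * \<omega> n t \<partial>lborel)"
        unfolding \<omega>_def by (intro nn_integral_cong nn_integral_cmult) measurable
      finally show ?thesis .
    qed
    have "(\<lambda>n. \<integral>\<^sup>+t. ennreal \<bar>k t\<bar> * \<omega> n t \<partial>lborel) \<longlonglongrightarrow> (\<integral>\<^sup>+t. 0 \<partial>(lborel :: real measure))"
    proof (rule nn_integral_dominated_convergence[where w = "\<lambda>t. ennreal \<bar>k t\<bar> * ennreal (2 * (LINT x|lborel. norm (f x)))"])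
      show "(\<integral>\<^sup>+t. ennreal \<bar>k t\<bar> * ennreal (2 * (LINT x|lborel. norm (f x))) \<partial>lborel) < \<infinity>"
        using half_line_kernelD(1)[OF k]
        by (subst nn_integral_multc) (auto simp: integrable_iff_bounded ennreal_mult_less_top)
      show "AE t in lborel. ennreal \<bar>k t\<bar> * \<omega> n t \<le> ennreal \<bar>k t\<bar> * ennreal (2 * (LINT x|lborel. norm (f x)))" for n
      proof (rule AE_I2)
        fix t
        show "ennreal \<bar>k t\<bar> * \<omega> n t \<le> ennreal \<bar>k t\<bar> * ennreal (2 * (LINT x|lborel. norm (f x)))"
          using half_line_kernelD(3)[OF k, of t] by (cases "0 < t") (auto intro!: mult_left_mono \<omega>_le)
      qed
      show "AE t in lborel. (\<lambda>n. ennreal \<bar>k t\<bar> * \<omega> n t) \<longlonglongrightarrow> 0"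
      proof (rule AE_I2)
        fix t
        show "(\<lambda>n. ennreal \<bar>k t\<bar> * \<omega> n t) \<longlonglongrightarrow> 0"
        proof (cases "0 < t")
          case True
          have "(\<lambda>n. ennreal \<bar>k t\<bar> * \<omega> n t) \<longlonglongrightarrow> ennreal \<bar>k t\<bar> * 0"
            by (intro ennreal_tendsto_cmult \<omega>_lim True) simp
          then show ?thesis by simp
        next
          case False
          then show ?thesis using half_line_kernelD(3)[OF k, of t] by simp
        qed
      qed
    qed measurable
    then have lim: "(\<lambda>n. \<integral>\<^sup>+t. ennreal \<bar>k t\<bar> * \<omega> n t \<partial>lborel) \<longlonglongrightarrow> 0" by simp
    have "(\<lambda>n. ennreal (LINT x|lborel. norm ((\<Sum>s\<in>S n. of_real (c n s) * dilate s f x) - dilation_average k f x))) \<longlonglongrightarrow> ennreal 0"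
      using tendsto_sandwich[OF _ _ tendsto_const lim,
          of "\<lambda>n. ennreal (LINT x|lborel. norm ((\<Sum>s\<in>S n. of_real (c n s) * dilate s f x) - dilation_average k f x))"] le
      by (simp add: always_eventually)
    then show ?thesis
      by (subst (asm) tendsto_ennreal_iff) (auto intro!: always_eventually integral_nonneg_AE)
  qed
  from finS S0 main show thesis by (rule that)
qed

theorem pv_dilation_average_AE:
  assumes k: "half_line_kernel k" and f: "integrable lborel f" and h: "integrable lborel h"
    and fh: "AE x in lborel. pv f x = h x"
  shows "AE x in lborel. pv (dilation_average k f) x = dilation_average k h x"
proof (rule dilation_average_discretised[OF k])
  fix c :: "nat \<Rightarrow> real \<Rightarrow> real" and S :: "nat \<Rightarrow> real set"
  assume S: "\<And>n. finite (S n)" "\<And>n s. s \<in> S n \<Longrightarrow> 0 < s"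
    and lim: "\<And>f. integrable lborel f \<Longrightarrow>
      (\<lambda>n. LINT x|lborel. norm ((\<Sum>s\<in>S n. of_real (c n s) * dilate s f x) - dilation_average k f x)) \<longlonglongrightarrow> 0"
  have i: "integrable lborel (\<lambda>x. \<Sum>s\<in>S n. of_real (c n s) * dilate s u x)" if "integrable lborel u" for n u
    using S(2) that by (intro Bochner_Integration.integrable_sum integrable_mult_right dilate_integrable(1)) auto
  show ?thesis
  proof (rule pv_eq_AE_of_L1_limit[where s = "\<lambda>n x. \<Sum>s\<in>S n. of_real (c n s) * dilate s f x"
        and k = "\<lambda>n x. \<Sum>s\<in>S n. of_real (c n s) * dilate s h x"])
    show "integrable lborel (dilation_average k f)" by (rule dilation_average_integrable[OF k f])
    show "integrable lborel (dilation_average k h)" by (rule dilation_average_integrable[OF k h])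
    show "integrable lborel (\<lambda>x. \<Sum>s\<in>S n. of_real (c n s) * dilate s f x)" for n by (rule i[OF f])
    show "integrable lborel (\<lambda>x. \<Sum>s\<in>S n. of_real (c n s) * dilate s h x)" for n by (rule i[OF h])
    show "AE x in lborel. pv (\<lambda>x. \<Sum>s\<in>S n. of_real (c n s) * dilate s f x) x = (\<Sum>s\<in>S n. of_real (c n s) * dilate s h x)" for n
      by (rule pv_sum_dilates_AE[OF f S(1) S(2) fh])
  qed (rule lim[OF f], rule lim[OF h])
qed

text \<open>
Near the origin the oddness of the kernel permits to subtract \<open>bump x\<close>, and the Lipschitz bound
cancels the singularity. Far away the vanishing mean permits to subtract \<open>1/x\<close> from the kernel.
\<close>

lemma trunc_bump_decay:
  assumes e: "0 < \<epsilon>" "\<epsilon> < 1"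
  shows "\<bar>trunc \<epsilon> bump x\<bar> \<le> 60 * (1 / (1 + x\<^sup>2))"
proof (cases "2 \<le> \<bar>x\<bar>")
  case True
  have x0: "0 < x\<^sup>2" using True by auto
  have i1: "integrable lborel (\<lambda>z. inv_cut \<epsilon> (x - z) *\<^sub>R bump z)"
    by (rule inv_cut_scaleR_integrable[OF bump_integrable e(1)]) measurable
  have i2: "integrable lborel (\<lambda>z. (1 / x) * bump z)" using bump_integrable by (rule integrable_mult_right)
  have "trunc \<epsilon> bump x = (LINT z|lborel. inv_cut \<epsilon> (x - z) *\<^sub>R bump z) - (LINT z|lborel. (1 / x) * bump z)"
    unfolding trunc_def by (simp add: bump_integral)
  also have "\<dots> = (LINT z|lborel. inv_cut \<epsilon> (x - z) *\<^sub>R bump z - (1 / x) * bump z)"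
    by (rule Bochner_Integration.integral_diff[OF i1 i2, symmetric])
  finally have eq: "trunc \<epsilon> bump x = (LINT z|lborel. inv_cut \<epsilon> (x - z) *\<^sub>R bump z - (1 / x) * bump z)" .
  have "norm (trunc \<epsilon> bump x) \<le> (LINT z|lborel. norm (inv_cut \<epsilon> (x - z) *\<^sub>R bump z - (1 / x) * bump z))"
    unfolding eq by (rule integral_norm_bound)
  also have "\<dots> \<le> (LINT z|lborel. indicator {-1..1::real} z * (2 / x\<^sup>2))"
  proof (rule integral_mono)
    show "integrable lborel (\<lambda>z. norm (inv_cut \<epsilon> (x - z) *\<^sub>R bump z - (1 / x) * bump z))" using i1 i2 by auto
    show "integrable lborel (\<lambda>z. indicator {-1..1::real} z * (2 / x\<^sup>2))"
      by (intro integrable_mult_left integrable_real_indicator) auto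
    fix z :: real
    show "norm (inv_cut \<epsilon> (x - z) *\<^sub>R bump z - (1 / x) * bump z) \<le> indicator {-1..1::real} z * (2 / x\<^sup>2)"
    proof (cases "\<bar>z\<bar> \<le> 1")
      case z: True
      have xz: "\<bar>x\<bar> / 2 \<le> \<bar>x - z\<bar>" using True z by linarith
      then have "\<epsilon> < \<bar>x - z\<bar>" using e True by linarith
      then have "inv_cut \<epsilon> (x - z) *\<^sub>R bump z - (1 / x) * bump z = bump z * (z / ((x - z) * x))"
      proof -
        have ne: "x - z \<noteq> 0" "x \<noteq> 0" using xz True by auto
        then have "1 / (x - z) - 1 / x = z / ((x - z) * x)" by (simp add: diff_frac_eq)
        moreover have "inv_cut \<epsilon> (x - z) *\<^sub>R bump z - (1 / x) * bump z = bump z * (1 / (x - z) - 1 / x)"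
          using \<open>\<epsilon> < \<bar>x - z\<bar>\<close> by (simp add: inv_cut_def algebra_simps)
        ultimately show ?thesis by simp
      qed
      also have "norm \<dots> \<le> 1 * (1 / ((\<bar>x\<bar> / 2) * \<bar>x\<bar>))"
      proof -
        have "\<bar>z\<bar> / (\<bar>x - z\<bar> * \<bar>x\<bar>) \<le> 1 / ((\<bar>x\<bar> / 2) * \<bar>x\<bar>)"
        proof (rule frac_le)
          show "0 < (\<bar>x\<bar> / 2) * \<bar>x\<bar>" using True by (intro mult_pos_pos) auto
          show "(\<bar>x\<bar> / 2) * \<bar>x\<bar> \<le> \<bar>x - z\<bar> * \<bar>x\<bar>" using xz by (rule mult_right_mono) simp
        qed (use z in auto)
        then show ?thesis unfolding real_norm_def abs_mult abs_divide using bump_le[of z] by (intro mult_mono) auto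
      qed
      also have "\<dots> = 2 / x\<^sup>2" by (simp add: power2_eq_square abs_mult_self_eq mult.assoc)
      finally show ?thesis using z by (auto simp: indicator_def abs_le_iff)
    qed (simp add: bump_zero)
  qed
  also have "\<dots> = 4 / x\<^sup>2" by simp
  also have "\<dots> \<le> 60 * (1 / (1 + x\<^sup>2))"
  proof -
    have "1 \<le> x\<^sup>2" using True power_mono[of 1 "\<bar>x\<bar>" 2] by simp
    then have "1 / (2 * x\<^sup>2) \<le> 1 / (1 + x\<^sup>2)" using x0
      by (intro divide_left_mono mult_pos_pos) (auto simp: add_pos_nonneg)
    then have "8 * (1 / (2 * x\<^sup>2)) \<le> 60 * (1 / (1 + x\<^sup>2))" by (intro mult_mono) auto
    then show ?thesis by simp
  qed
  finally show ?thesis by simp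
next
  case False
  define g where "g z = (if \<bar>x - z\<bar> \<le> 3 then bump x else 0)" for z
  have gi: "integrable lborel g"
  proof -
    have "integrable lborel (\<lambda>z. indicator {x - 3..x + 3} z * bump x)"
      by (intro integrable_mult_left integrable_real_indicator) auto
    moreover have "(\<lambda>z. indicator {x - 3..x + 3} z * bump x) = g"
      by (auto simp: g_def fun_eq_iff indicator_def abs_le_iff)
    ultimately show ?thesis by simp
  qed
  have "trunc \<epsilon> g x = - trunc \<epsilon> (\<lambda>z. g (2 * x - z)) x"
  proof -
    have "trunc \<epsilon> g x = (LINT z|lborel. inv_cut \<epsilon> (x - (2 * x - z)) *\<^sub>R g (2 * x - z))"
      unfolding trunc_def by (subst lborel_integral_real_affine[where c = "-1" and t = "2 * x"]) auto
    also have "\<dots> = (LINT z|lborel. - (inv_cut \<epsilon> (x - z) *\<^sub>R g (2 * x - z)))"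
    proof (rule Bochner_Integration.integral_cong)
      fix z
      have "x - (2 * x - z) = - (x - z)" by simp
      then show "inv_cut \<epsilon> (x - (2 * x - z)) *\<^sub>R g (2 * x - z) = - (inv_cut \<epsilon> (x - z) *\<^sub>R g (2 * x - z))"
        by (simp only: inv_cut_minus scaleR_minus_left)
    qed simp
    finally show ?thesis unfolding trunc_def by simp
  qed
  moreover have "(\<lambda>z. g (2 * x - z)) = g" unfolding g_def by (auto simp: fun_eq_iff abs_minus_commute)
  ultimately have "trunc \<epsilon> g x = 0" by simp
  then have eq: "trunc \<epsilon> bump x = (LINT z|lborel. inv_cut \<epsilon> (x - z) *\<^sub>R (bump z - g z))"
    using trunc_diff[OF bump_integrable gi e(1), of x] unfolding trunc_def by simp
  have "norm (trunc \<epsilon> bump x) \<le> (LINT z|lborel. norm (inv_cut \<epsilon> (x - z) *\<^sub>R (bump z - g z)))"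
    unfolding eq by (rule integral_norm_bound)
  also have "\<dots> \<le> (LINT z|lborel. indicator {x - 3..x + 3} z * 2)"
  proof (rule integral_mono)
    show "integrable lborel (\<lambda>z. norm (inv_cut \<epsilon> (x - z) *\<^sub>R (bump z - g z)))"
      using bump_integrable gi e by (intro integrable_norm inv_cut_scaleR_integrable Bochner_Integration.integrable_diff) auto
    show "integrable lborel (\<lambda>z. indicator {x - 3..x + 3} z * 2 :: real)"
      by (intro integrable_mult_left integrable_real_indicator) auto
    fix z
    show "norm (inv_cut \<epsilon> (x - z) *\<^sub>R (bump z - g z)) \<le> indicator {x - 3..x + 3} z * 2"
    proof (cases "\<bar>x - z\<bar> \<le> 3")
      case True
      have "\<bar>inv_cut \<epsilon> (x - z)\<bar> * \<bar>bump z - bump x\<bar> \<le> 2"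
      proof (cases "\<epsilon> < \<bar>x - z\<bar>")
        case e': True
        have "\<bar>bump z - bump x\<bar> \<le> 2 * \<bar>x - z\<bar>" using bump_Lipschitz[of z x] by (simp add: abs_minus_commute)
        then show ?thesis using e' e by (simp add: inv_cut_def abs_divide pos_divide_le_eq)
      qed (simp add: inv_cut_def)
      then show ?thesis using True by (auto simp: g_def abs_mult indicator_def abs_le_iff)
    next
      case out: False
      then have "1 \<le> \<bar>z\<bar>" using False by linarith
      then show ?thesis using out by (simp add: g_def bump_zero)
    qed
  qed
  also have "\<dots> = 12" by simp
  also have "\<dots> \<le> 60 * (1 / (1 + x\<^sup>2))"
  proof -
    have "x\<^sup>2 \<le> 2\<^sup>2" using False by (intro power2_le_iff_abs_le[THEN iffD2]) auto
    then have "60 * (1 / 5) \<le> 60 * (1 / (1 + x\<^sup>2))"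
      by (intro mult_left_mono divide_left_mono) (auto simp: add_pos_nonneg)
    then show ?thesis by simp
  qed
  finally show ?thesis by simp
qed

lemma hilbert_norm_eq:
  assumes "g \<in> borel_measurable borel" "AE x in lborel. f x = g x"
  shows "hilbert_norm f = L1_norm g + L1_norm (\<lambda>x. of_real (1 / pi) * pv g x)"
proof -
  have "hilbert_transform f = (\<lambda>x. of_real (1 / pi) * pv g x)"
    using hilbert_transform_eq_pv[OF assms] by auto
  then show ?thesis unfolding hilbert_norm_def using L1_norm_cong_AE[OF assms(2)] by simp
qed

lemma hilbert_norm_add_le:
  assumes f: "integrable lborel f" and g: "integrable lborel g"
  shows "hilbert_norm (\<lambda>x. f x + g x) \<le> hilbert_norm f + hilbert_norm g"
proof -
  have [measurable]: "f \<in> borel_measurable borel" "g \<in> borel_measurable borel" using f g by auto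
  note eq = hilbert_norm_eq[OF _ AE_I2[OF refl]]
  have fl: "f \<in> borel_measurable lebesgue" "g \<in> borel_measurable lebesgue"
    by (intro measurable_completion; simp)+
  have pm: "(\<lambda>x. of_real (1 / pi) * pv f x) \<in> borel_measurable lebesgue" "(\<lambda>x. of_real (1 / pi) * pv g x) \<in> borel_measurable lebesgue"
    by (intro borel_measurable_times borel_measurable_const pv_lebesgue_measurable f g)+
  have "L1_norm (\<lambda>x. of_real (1 / pi) * pv (\<lambda>x. f x + g x) x) = L1_norm (\<lambda>x. of_real (1 / pi) * pv f x + of_real (1 / pi) * pv g x)"
  proof (rule L1_norm_cong_AE)
    show "AE x in lborel. of_real (1 / pi) * pv (\<lambda>x. f x + g x) x = of_real (1 / pi) * pv f x + of_real (1 / pi) * pv g x"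
      using pv_linear_AE[OF f g] by eventually_elim (simp only: distrib_left)
  qed
  also have "\<dots> \<le> L1_norm (\<lambda>x. of_real (1 / pi) * pv f x) + L1_norm (\<lambda>x. of_real (1 / pi) * pv g x)"
    by (rule L1_norm_add_le[OF pm])
  finally have "hilbert_norm (\<lambda>x. f x + g x) \<le> (L1_norm f + L1_norm g)
      + (L1_norm (\<lambda>x. of_real (1 / pi) * pv f x) + L1_norm (\<lambda>x. of_real (1 / pi) * pv g x))"
    by (subst eq) (auto intro!: add_mono L1_norm_add_le fl)
  also have "\<dots> = hilbert_norm f + hilbert_norm g" by (simp add: eq ac_simps)
  finally show ?thesis .
qed

lemma hilbert_norm_cmult_le:
  assumes f: "integrable lborel f"
  shows "hilbert_norm (\<lambda>x. c * f x) \<le> ennreal (norm c) * hilbert_norm f"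
proof -
  have [measurable]: "f \<in> borel_measurable borel" using f by auto
  note eq = hilbert_norm_eq[OF _ AE_I2[OF refl]]
  have fl: "f \<in> borel_measurable lebesgue" by (intro measurable_completion) simp
  have pm: "(\<lambda>x. of_real (1 / pi) * pv f x) \<in> borel_measurable lebesgue"
    by (intro borel_measurable_times borel_measurable_const pv_lebesgue_measurable f)
  have "L1_norm (\<lambda>x. of_real (1 / pi) * pv (\<lambda>x. c * f x) x) = L1_norm (\<lambda>x. c * (of_real (1 / pi) * pv f x))"
  proof (rule L1_norm_cong_AE)
    show "AE x in lborel. of_real (1 / pi) * pv (\<lambda>x. c * f x) x = c * (of_real (1 / pi) * pv f x)"
      using pv_cmult_AE[OF f, of c] by eventually_elim (simp only: mult.left_commute)
  qed
  also have "\<dots> = ennreal (norm c) * L1_norm (\<lambda>x. of_real (1 / pi) * pv f x)" by (rule L1_norm_cmult[OF pm])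
  finally have e2: "L1_norm (\<lambda>x. of_real (1 / pi) * pv (\<lambda>x. c * f x) x) = ennreal (norm c) * L1_norm (\<lambda>x. of_real (1 / pi) * pv f x)" .
  have "hilbert_norm (\<lambda>x. c * f x) = ennreal (norm c) * L1_norm f + ennreal (norm c) * L1_norm (\<lambda>x. of_real (1 / pi) * pv f x)"
    unfolding e2[symmetric] L1_norm_cmult[OF fl, symmetric] by (rule eq) simp
  also have "\<dots> = ennreal (norm c) * hilbert_norm f" by (simp add: eq distrib_left)
  finally show ?thesis by simp
qed

text \<open>
Finiteness of the norm makes the principal value of \<open>f\<close> integrable, which is what the commutation
relation requires.
\<close>

theorem hilbert_norm_dilation_average_le:
  assumes k: "half_line_kernel k" and f: "integrable lborel f" and fin: "hilbert_norm f < \<infinity>"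
  shows "hilbert_norm (dilation_average k f) \<le> ennreal (LINT t|lborel. \<bar>k t\<bar>) * hilbert_norm f"
proof -
  define K where "K = ennreal (LINT t|lborel. \<bar>k t\<bar>)"
  have fm: "f \<in> borel_measurable borel" using f by auto
  have dm: "dilation_average k f \<in> borel_measurable borel" using dilation_average_integrable[OF k f] by auto
  note eq = hilbert_norm_eq[OF _ AE_I2[OF refl]]
  have pm: "pv f \<in> borel_measurable lebesgue" by (rule pv_lebesgue_measurable[OF f])
  obtain h where h: "h \<in> borel_measurable borel" "AE x in lborel. pv f x = h x"
    by (rule borel_representative[OF pm])
  have hl: "h \<in> borel_measurable lebesgue" using h(1) by (intro measurable_completion) simp
  have ph: "L1_norm (\<lambda>x. of_real (1 / pi) * pv f x) = ennreal (1 / pi) * L1_norm h"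
    using L1_norm_cmult[OF pm, of "of_real (1 / pi)"] L1_norm_cong_AE[OF h(2)] by (simp add: norm_divide)
  have "ennreal (1 / pi) * L1_norm h < \<infinity>"
    using fin unfolding eq[OF fm] ph by (auto simp: less_top)
  then have "L1_norm h < \<infinity>" by (auto simp: ennreal_mult_less_top)
  then have hi: "integrable lborel h" using h(1) unfolding L1_norm_lborel by (intro integrableI_bounded) auto
  have dl: "dilation_average k h \<in> borel_measurable lebesgue" by (rule dilation_average_lebesgue_measurable[OF k hi])
  have "L1_norm (\<lambda>x. of_real (1 / pi) * pv (dilation_average k f) x) = L1_norm (\<lambda>x. of_real (1 / pi) * dilation_average k h x)"
    using pv_dilation_average_AE[OF k f hi h(2)] by (intro L1_norm_cong_AE) (auto elim!: eventually_mono)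
  also have "\<dots> = ennreal (1 / pi) * L1_norm (dilation_average k h)"
    using L1_norm_cmult[OF dl, of "of_real (1 / pi)"] by (simp add: norm_divide)
  also have "\<dots> \<le> ennreal (1 / pi) * (K * L1_norm h)"
    unfolding K_def by (intro mult_left_mono L1_norm_dilation_average_le k h(1)) simp
  also have "\<dots> = K * L1_norm (\<lambda>x. of_real (1 / pi) * pv f x)" unfolding ph by (simp only: mult.left_commute)
  finally have "hilbert_norm (dilation_average k f) \<le> K * L1_norm f + K * L1_norm (\<lambda>x. of_real (1 / pi) * pv f x)"
    unfolding eq[OF dm] K_def by (intro add_mono L1_norm_dilation_average_le k fm)
  also have "\<dots> = K * hilbert_norm f" unfolding eq[OF fm] by (simp only: distrib_left)
  finally show ?thesis unfolding K_def .
qed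

lemma bump_hilbert_norm_finite: "hilbert_norm odd_bump < \<infinity>"
proof -
  have bi: "integrable lborel odd_bump" using bump_integrable by simp
  have bm: "odd_bump \<in> borel_measurable borel" by measurable
  have "AE x in lborel. norm (pv odd_bump x) \<le> 60 * (1 / (1 + x\<^sup>2))"
    using pv_tendsto_AE[OF bi]
  proof eventually_elim
    fix x assume lim: "((\<lambda>\<epsilon>. trunc \<epsilon> odd_bump x) \<longlongrightarrow> pv odd_bump x) (at_right 0)"
    show "norm (pv odd_bump x) \<le> 60 * (1 / (1 + x\<^sup>2))"
    proof (rule tendsto_upperbound[OF tendsto_norm[OF lim]])
      have "norm (trunc \<epsilon> odd_bump x) \<le> 60 * (1 / (1 + x\<^sup>2))" if "0 < \<epsilon>" "\<epsilon> < 1" for \<epsilon>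
        using trunc_bump_decay[OF that, of x]
          trunc_bounded_linear[where T = complex_of_real, OF bump_integrable that(1) bounded_linear_of_real, of x]
        by simp
      then show "eventually (\<lambda>\<epsilon>. norm (trunc \<epsilon> odd_bump x) \<le> 60 * (1 / (1 + x\<^sup>2))) (at_right 0)"
        unfolding eventually_at_right_field by (intro exI[of _ 1]) auto
    qed simp
  qed
  then have "L1_norm (\<lambda>x. of_real (1 / pi) * pv odd_bump x) \<le> (\<integral>\<^sup>+x. ennreal (60 * (1 / (1 + x\<^sup>2))) \<partial>lborel)"
    unfolding L1_norm_lborel
  proof (intro nn_integral_mono_AE, eventually_elim)
    fix x assume *: "norm (pv odd_bump x) \<le> 60 * (1 / (1 + x\<^sup>2))"
    have "1 / pi \<le> 1" using pi_gt3 by simp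
    then have "(1 / pi) * norm (pv odd_bump x) \<le> 1 * norm (pv odd_bump x)" by (intro mult_right_mono) auto
    with * show "ennreal (norm (of_real (1 / pi) * pv odd_bump x)) \<le> ennreal (60 * (1 / (1 + x\<^sup>2)))"
      by (intro ennreal_leI) (simp add: norm_mult norm_divide)
  qed
  also have "\<dots> < \<infinity>" by (rule nn_integral_inverse_square_decay_finite) (rule order_refl)
  finally have "L1_norm (\<lambda>x. of_real (1 / pi) * pv odd_bump x) < \<infinity>" .
  moreover have "L1_norm odd_bump < \<infinity>"
    using bi unfolding L1_norm_lborel integrable_iff_bounded by simp
  ultimately show ?thesis unfolding hilbert_norm_eq[OF bm AE_I2[OF refl]] by simp
qed

section \<open>Almost dilation-invariant functions\<close>

text \<open>
Convolution on the multiplicative group of positive reals.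
\<close>

definition mult_conv :: "(real \<Rightarrow> real) \<Rightarrow> (real \<Rightarrow> real) \<Rightarrow> real \<Rightarrow> real" where
  "mult_conv k l t = (LINT s|lborel. k s * l (t / s) / s)"

text \<open>
The uniform distribution, with respect to the Haar measure \<open>dt/t\<close>, on \<open>[1,T]\<close>.
\<close>

definition log_window :: "real \<Rightarrow> real \<Rightarrow> real" where
  "log_window T t = indicator {1..T} t / t"

lemma nn_integral_inverse_Icc:
  assumes "0 < a" "a \<le> b"
  shows "(\<integral>\<^sup>+t. ennreal (indicator {a..b} t / t) \<partial>lborel) = ennreal (ln (b / a))"
proof -
  have "(\<integral>\<^sup>+t. ennreal (indicator {a..b} t / t) \<partial>lborel) = (\<integral>\<^sup>+t. ennreal (1 / t) * indicator {a..b} t \<partial>lborel)"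
    by (intro nn_integral_cong) (auto simp: indicator_def)
  also have "\<dots> = ennreal (ln b - ln a)"
    using assms by (intro nn_integral_FTC_Icc) (auto intro!: derivative_eq_intros)
  finally show ?thesis using assms by (simp add: ln_div)
qed

lemma log_window_measurable [measurable]: "log_window T \<in> borel_measurable borel"
  unfolding log_window_def[abs_def] by measurable

lemma log_window_nonneg: "0 \<le> log_window T t"
  unfolding log_window_def by (auto simp: indicator_def)

lemma
  assumes "1 \<le> T"
  shows log_window_kernel: "half_line_kernel (log_window T)"
    and log_window_integral: "(LINT t|lborel. log_window T t) = ln T"
proof -
  have nn: "(\<integral>\<^sup>+t. ennreal (log_window T t) \<partial>lborel) = ennreal (ln T)"
    unfolding log_window_def using nn_integral_inverse_Icc[of 1 T] assms by simp
  have "integrable lborel (log_window T)"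
    using nn log_window_nonneg by (intro integrableI_nonneg) auto
  then show "half_line_kernel (log_window T)"
    unfolding half_line_kernel_def by (auto simp: log_window_def)
  show "(LINT t|lborel. log_window T t) = ln T"
    using nn assms log_window_nonneg by (intro integral_eq_nn_integral[THEN trans]) auto
qed

lemma abs_diff_divide_le:
  fixes t :: real
  assumes "0 < t" "\<bar>u - v\<bar> \<le> x + y"
  shows "\<bar>u / t - v / t\<bar> \<le> x / t + y / t"
proof -
  have "\<bar>u / t - v / t\<bar> = \<bar>u - v\<bar> / t" using assms(1) by (simp add: abs_divide flip: diff_divide_distrib)
  also have "\<dots> \<le> (x + y) / t" using assms by (intro divide_right_mono) auto
  finally show ?thesis by (simp add: add_divide_distrib)
qed

text \<open>
A window moved by the factor \<open>s\<close> differs from the original one in two intervals of logarithmic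
length \<open>\<bar>ln s\<bar>\<close>, and the total mass of the two windows is \<open>2 ln T\<close>.
\<close>

lemma log_window_shift_bound:
  assumes T: "1 \<le> T" and s: "0 < s"
  shows "(\<integral>\<^sup>+t. ennreal \<bar>log_window T (t / s) / s - log_window T t\<bar> \<partial>lborel) \<le> ennreal (min (2 * \<bar>ln s\<bar>) (2 * ln T))"
proof -
  have eq: "log_window T (t / s) / s = indicator {s..s * T} t / t" for t
    unfolding log_window_def using s by (cases "t = 0") (auto simp: indicator_def field_simps)
  have pos: "0 < T" "s \<le> s * T" using T s by auto
  have "(\<integral>\<^sup>+t. ennreal \<bar>log_window T (t / s) / s - log_window T t\<bar> \<partial>lborel)
      \<le> (\<integral>\<^sup>+t. ennreal (indicator {s..s * T} t / t) + ennreal (indicator {1..T} t / t) \<partial>lborel)"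
    unfolding eq unfolding log_window_def
    using s by (intro nn_integral_mono) (auto simp: indicator_def simp flip: ennreal_plus intro!: ennreal_leI)
  also have "\<dots> = ennreal (ln T) + ennreal (ln T)"
    using nn_integral_inverse_Icc[of s "s * T"] nn_integral_inverse_Icc[of 1 T] s T pos
    by (subst nn_integral_add) auto
  also have "\<dots> = ennreal (2 * ln T)" using T by (simp flip: ennreal_plus)
  finally have 1: "(\<integral>\<^sup>+t. ennreal \<bar>log_window T (t / s) / s - log_window T t\<bar> \<partial>lborel) \<le> ennreal (2 * ln T)" .
  define a where "a = min 1 s"
  define b where "b = max 1 s"
  have ab: "0 < a" "a \<le> b" "ln (b / a) = \<bar>ln s\<bar>"
    using s unfolding a_def b_def by (auto simp: min_def max_def ln_div)
  have "(\<integral>\<^sup>+t. ennreal \<bar>log_window T (t / s) / s - log_window T t\<bar> \<partial>lborel)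
      \<le> (\<integral>\<^sup>+t. ennreal (indicator {a..b} t / t) + ennreal (indicator {a * T..b * T} t / t) \<partial>lborel)"
  proof (rule nn_integral_mono)
    fix t
    have "\<bar>indicator {s..s * T} t - indicator {1..T} t\<bar> \<le> (indicator {a..b} t + indicator {a * T..b * T} t :: real)"
    proof (cases "1 \<le> s")
      case True
      have "\<bar>indicator {s..u} t - indicator {1..T} t\<bar> \<le> (indicator {1..s} t + indicator {T..u} t :: real)" if "T \<le> u" for u
        using True that by (auto simp: indicator_def)
      from this[of "s * T"] show ?thesis using True pos(1) unfolding a_def b_def by simp
    next
      case False
      have "\<bar>indicator {s..u} t - indicator {1..T} t\<bar> \<le> (indicator {s..1} t + indicator {u..T} t :: real)" if "u \<le> T" for u
        using False that by (auto simp: indicator_def)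
      from this[of "s * T"] show ?thesis using False pos(1) unfolding a_def b_def by simp
    qed
    note m = this
    have "\<bar>indicator {s..s * T} t / t - indicator {1..T} t / t\<bar> \<le> indicator {a..b} t / t + indicator {a * T..b * T} t / t"
    proof (cases "0 < t")
      case True
      then show ?thesis using m by (rule abs_diff_divide_le)
    next
      case False
      have "0 < a * T" using ab(1) pos(1) by simp
      then have "t \<notin> {s..s * T}" "t \<notin> {1..T}" "t \<notin> {a..b}" "t \<notin> {a * T..b * T}"
        using False s ab(1) by auto
      then show ?thesis by simp
    qed
    moreover have "0 \<le> indicator {c..d} t / t" if "0 < c" for c d
      using that by (auto simp: indicator_def)
    then have "0 \<le> indicator {a..b} t / t" "0 \<le> indicator {a * T..b * T} t / t"
      using ab(1) pos(1) by (meson mult_pos_pos)+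
    ultimately show "ennreal \<bar>log_window T (t / s) / s - log_window T t\<bar>
        \<le> ennreal (indicator {a..b} t / t) + ennreal (indicator {a * T..b * T} t / t)"
      unfolding eq unfolding log_window_def by (simp add: ennreal_leI flip: ennreal_plus)
  qed
  also have "\<dots> = ennreal \<bar>ln s\<bar> + ennreal \<bar>ln s\<bar>"
    using nn_integral_inverse_Icc[of a b] nn_integral_inverse_Icc[of "a * T" "b * T"] ab pos(1)
    by (subst nn_integral_add) (auto simp: mult_right_mono)
  also have "\<dots> = ennreal (2 * \<bar>ln s\<bar>)" by (simp flip: ennreal_plus)
  finally have 2: "(\<integral>\<^sup>+t. ennreal \<bar>log_window T (t / s) / s - log_window T t\<bar> \<partial>lborel) \<le> ennreal (2 * \<bar>ln s\<bar>)" .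
  from 1 2 show ?thesis by (simp add: min_def)
qed

lemma
  assumes k: "half_line_kernel k" and l: "half_line_kernel l"
  shows mult_conv_pair_integrable: "integrable (lborel \<Otimes>\<^sub>M lborel) (\<lambda>(t, s). k s * l (t / s) / s)"
    and mult_conv_kernel: "half_line_kernel (mult_conv k l)"
proof -
  note [measurable] = half_line_kernelD(2)[OF k] half_line_kernelD(2)[OF l]
  have lm: "(\<lambda>t. ennreal \<bar>l t\<bar>) \<in> borel_measurable borel" by measurable
  show *: "integrable (lborel \<Otimes>\<^sub>M lborel) (\<lambda>(t, s). k s * l (t / s) / s)"
  proof (rule integrableI_bounded)
    have "(\<integral>\<^sup>+p. ennreal (norm (case p of (t, s) \<Rightarrow> k s * l (t / s) / s)) \<partial>(lborel \<Otimes>\<^sub>M lborel))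
        = (\<integral>\<^sup>+t. \<integral>\<^sup>+s. ennreal (norm (k s * l (t / s) / s)) \<partial>lborel \<partial>lborel)"
      by (subst lborel.nn_integral_fst[symmetric]) auto
    also have "\<dots> = (\<integral>\<^sup>+t. \<integral>\<^sup>+s. ennreal (\<bar>k s\<bar> / s) * ennreal \<bar>l (t / s)\<bar> \<partial>lborel \<partial>lborel)"
    proof (intro nn_integral_cong)
      fix t s :: real
      show "ennreal (norm (k s * l (t / s) / s)) = ennreal (\<bar>k s\<bar> / s) * ennreal \<bar>l (t / s)\<bar>"
        using half_line_kernelD(3)[OF k, of s]
        by (cases "0 < s") (auto simp: abs_mult abs_divide simp flip: ennreal_mult)
    qed
    also have "\<dots> = (\<integral>\<^sup>+t. ennreal \<bar>k t\<bar> \<partial>lborel) * (\<integral>\<^sup>+x. ennreal \<bar>l x\<bar> \<partial>lborel)"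
      by (rule nn_integral_dilation_average[OF k lm])
    also have "\<dots> < \<infinity>"
      using half_line_kernelD(1)[OF k] half_line_kernelD(1)[OF l] by (simp add: ennreal_mult_less_top integrable_iff_bounded)
    finally show "(\<integral>\<^sup>+p. ennreal (norm (case p of (t, s) \<Rightarrow> k s * l (t / s) / s)) \<partial>(lborel \<Otimes>\<^sub>M lborel)) < \<infinity>" .
  qed measurable
  show "half_line_kernel (mult_conv k l)"
    unfolding half_line_kernel_def
  proof (intro conjI allI impI)
    show "integrable lborel (mult_conv k l)"
      using lborel_pair.integrable_fst'[OF *] unfolding mult_conv_def[abs_def] by simp
    fix t :: real assume t: "t \<le> 0"
    have zero: "k s * l (t / s) / s = 0" for s
      using half_line_kernelD(3)[OF k, of s] half_line_kernelD(3)[OF l, of "t / s"] t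
      by (cases "0 < s") (auto simp: divide_nonpos_pos)
    show "mult_conv k l t = 0" unfolding mult_conv_def zero by simp
  qed
qed

lemma integral_scaleR_left_zero:
  fixes c :: complex
  shows "(LINT x|M. f x *\<^sub>R c) = (LINT x|M. f x) *\<^sub>R c"
proof (cases "c = 0")
  case c: False
  show ?thesis
  proof (cases "integrable M f")
    case False
    have "\<not> integrable M (\<lambda>x. f x *\<^sub>R c)"
    proof
      assume "integrable M (\<lambda>x. f x *\<^sub>R c)"
      then have "integrable M (\<lambda>x. Re ((f x *\<^sub>R c) * inverse c))"
        by (intro integrable_Re integrable_mult_left)
      moreover have eq: "(f x *\<^sub>R c) * inverse c = of_real (f x)" for x
        using c by (simp add: scaleR_conv_of_real mult.assoc)
      ultimately show False using False unfolding eq by simp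
    qed
    with False show ?thesis by (simp add: not_integrable_integral_eq)
  qed simp
qed simp

lemma dilate_bump_bound:
  assumes "0 < t" "x \<noteq> 0"
  shows "norm (dilate t odd_bump x) \<le> 1 / \<bar>x\<bar>"
proof (cases "\<bar>x\<bar> \<le> t")
  case True
  have "\<bar>bump (x / t)\<bar> / t \<le> 1 / \<bar>x\<bar>" using bump_le[of "x / t"] True assms by (intro frac_le) auto
  then show ?thesis using assms by (simp add: dilate_def norm_divide)
next
  case False
  then have "1 \<le> \<bar>x / t\<bar>" using assms by (simp add: abs_divide)
  then show ?thesis by (simp add: dilate_def bump_zero)
qed

text \<open>
Averaging twice is averaging with the multiplicative convolution of the kernels. For the bump this
holds at every \<open>x \<noteq> 0\<close>, since its dilates at \<open>x\<close> are bounded in the dilation parameter.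
\<close>

lemma dilation_average_assoc_bump:
  assumes k: "half_line_kernel k" and l: "half_line_kernel l" and x: "x \<noteq> 0"
  shows "dilation_average k (dilation_average l odd_bump) x = dilation_average (mult_conv k l) odd_bump x"
proof -
  note [measurable] = half_line_kernelD(2)[OF k] half_line_kernelD(2)[OF l]
  have bm[measurable]: "odd_bump \<in> borel_measurable borel" by measurable
  have int: "integrable (lborel \<Otimes>\<^sub>M lborel) (\<lambda>(t, s). (k s * l (t / s) / s) *\<^sub>R dilate t odd_bump x)"
  proof (rule Bochner_Integration.integrable_bound)
    show "integrable (lborel \<Otimes>\<^sub>M lborel) (\<lambda>p. (1 / \<bar>x\<bar>) * (case p of (t, s) \<Rightarrow> k s * l (t / s) / s))"
      by (intro integrable_mult_right mult_conv_pair_integrable k l)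
    show "(\<lambda>(t, s). (k s * l (t / s) / s) *\<^sub>R dilate t odd_bump x) \<in> borel_measurable (lborel \<Otimes>\<^sub>M lborel)"
      unfolding dilate_def by measurable
    show "AE p in lborel \<Otimes>\<^sub>M lborel. norm (case p of (t, s) \<Rightarrow> (k s * l (t / s) / s) *\<^sub>R dilate t odd_bump x)
        \<le> norm ((1 / \<bar>x\<bar>) * (case p of (t, s) \<Rightarrow> k s * l (t / s) / s))"
    proof (rule AE_I2)
      fix p :: "real \<times> real"
      obtain t s where p: "p = (t, s)" by (cases p)
      have "\<bar>k s * l (t / s) / s\<bar> * norm (dilate t odd_bump x) \<le> \<bar>k s * l (t / s) / s\<bar> * (1 / \<bar>x\<bar>)"
      proof (cases "0 < t")
        case True
        then show ?thesis by (intro mult_left_mono dilate_bump_bound x) auto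
      next
        case False
        then have "k s * l (t / s) / s = 0"
          using half_line_kernelD(3)[OF k, of s] half_line_kernelD(3)[OF l, of "t / s"]
          by (cases "0 < s") (auto simp: divide_nonpos_pos)
        then show ?thesis by (simp only: abs_zero mult_zero_left order_refl)
      qed
      then show "norm (case p of (t, s) \<Rightarrow> (k s * l (t / s) / s) *\<^sub>R dilate t odd_bump x)
        \<le> norm ((1 / \<bar>x\<bar>) * (case p of (t, s) \<Rightarrow> k s * l (t / s) / s))"
        unfolding p by (simp add: abs_mult mult.commute)
    qed
  qed
  have "dilation_average (mult_conv k l) odd_bump x = (LINT t|lborel. LINT s|lborel. (k s * l (t / s) / s) *\<^sub>R dilate t odd_bump x)"
    unfolding dilation_average_def mult_conv_def by (simp only: integral_scaleR_left_zero)
  also have "\<dots> = (LINT s|lborel. LINT t|lborel. (k s * l (t / s) / s) *\<^sub>R dilate t odd_bump x)"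
    by (rule lborel_pair.Fubini_integral[symmetric]) (rule int)
  also have "\<dots> = (LINT s|lborel. k s *\<^sub>R dilate s (dilation_average l odd_bump) x)"
  proof (rule Bochner_Integration.integral_cong)
    fix s
    show "(LINT t|lborel. (k s * l (t / s) / s) *\<^sub>R dilate t odd_bump x) = k s *\<^sub>R dilate s (dilation_average l odd_bump) x"
    proof (cases "0 < s")
      case True
      have "(LINT t|lborel. (k s * l (t / s) / s) *\<^sub>R dilate t odd_bump x)
          = s *\<^sub>R (LINT t|lborel. (k s * l ((0 + s * t) / s) / s) *\<^sub>R dilate (0 + s * t) odd_bump x)"
        using True by (subst lborel_integral_real_affine[where c = s and t = 0]) auto
      also have "\<dots> = s *\<^sub>R (LINT t|lborel. (k s / s) *\<^sub>R ((l t *\<^sub>R dilate t odd_bump (x / s)) / of_real s))"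
        using True by (intro arg_cong[where f = "\<lambda>z. s *\<^sub>R z"] Bochner_Integration.integral_cong)
          (auto simp: dilate_def field_simps scaleR_conv_of_real)
      also have "\<dots> = k s *\<^sub>R dilate s (dilation_average l odd_bump) x"
        unfolding dilation_average_def dilate_def[of s] using True by simp
      finally show ?thesis .
    next
      case False
      then show ?thesis using half_line_kernelD(3)[OF k, of s] by simp
    qed
  qed simp
  finally show ?thesis unfolding dilation_average_def[of k] by simp
qed

text \<open>
The kernel \<open>w\<close> is the defect of dilation invariance of the window, averaged over \<open>k\<close>.
\<close>

lemma kernel_average_eq_log_window_defect:
  assumes k: "half_line_kernel k" and T: "1 \<le> T"
  defines "w \<equiv> \<lambda>t. mult_conv k (log_window T) t - (LINT s|lborel. k s) * log_window T t"
  shows "half_line_kernel w"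
    and "(LINT t|lborel. \<bar>w t\<bar>) \<le> (LINT s|lborel. \<bar>k s\<bar> * min (2 * \<bar>ln s\<bar>) (2 * ln T))"
proof -
  note [measurable] = half_line_kernelD(2)[OF k]
  note lw = log_window_kernel[OF T]
  define l where "l = log_window T"
  have lm[measurable]: "l \<in> borel_measurable borel" unfolding l_def by measurable
  define m where "m s = min (2 * \<bar>ln s\<bar>) (2 * ln T)" for s
  have mm[measurable]: "m \<in> borel_measurable borel" unfolding m_def[abs_def] by measurable
  have m0: "0 \<le> m s" for s unfolding m_def using T by simp
  note mk = mult_conv_kernel[OF k lw]
  show w: "half_line_kernel w"
    unfolding half_line_kernel_def
  proof (intro conjI allI impI)
    show "integrable lborel w"
      unfolding w_def using half_line_kernelD(1)[OF mk] half_line_kernelD(1)[OF lw] by auto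
    show "w t = 0" if "t \<le> 0" for t
      unfolding w_def using half_line_kernelD(3)[OF mk that] half_line_kernelD(3)[OF lw that] by simp
  qed
  have mi: "integrable lborel (\<lambda>s. \<bar>k s\<bar> * m s)"
  proof (rule Bochner_Integration.integrable_bound)
    show "integrable lborel (\<lambda>s. \<bar>k s\<bar> * (2 * ln T))" using half_line_kernelD(1)[OF k] by auto
    show "AE s in lborel. norm (\<bar>k s\<bar> * m s) \<le> norm (\<bar>k s\<bar> * (2 * ln T))"
      using T m0 by (intro AE_I2) (auto simp: abs_mult m_def intro!: mult_left_mono)
  qed measurable
  have "AE t in lborel. integrable lborel (\<lambda>s. k s * l (t / s) / s)"
    using lborel_pair.AE_integrable_fst'[OF mult_conv_pair_integrable[OF k lw]] unfolding l_def by simp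
  then have "AE t in lborel. ennreal \<bar>w t\<bar> \<le> (\<integral>\<^sup>+s. ennreal \<bar>k s\<bar> * ennreal \<bar>l (t / s) / s - l t\<bar> \<partial>lborel)"
  proof eventually_elim
    fix t assume i: "integrable lborel (\<lambda>s. k s * l (t / s) / s)"
    have i2: "integrable lborel (\<lambda>s. k s * l t)" using half_line_kernelD(1)[OF k] by simp
    have i3: "integrable lborel (\<lambda>s. k s * l (t / s) / s - k s * l t)" using i i2 by (rule Bochner_Integration.integrable_diff)
    have "w t = (LINT s|lborel. k s * l (t / s) / s - k s * l t)"
      unfolding w_def mult_conv_def using i i2 by (simp add: l_def)
    then have "ennreal \<bar>w t\<bar> \<le> (\<integral>\<^sup>+s. ennreal (norm (k s * l (t / s) / s - k s * l t)) \<partial>lborel)"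
      using integral_norm_bound_ennreal[OF i3] by simp
    also have "\<dots> = (\<integral>\<^sup>+s. ennreal \<bar>k s\<bar> * ennreal \<bar>l (t / s) / s - l t\<bar> \<partial>lborel)"
    proof (intro nn_integral_cong)
      fix s
      have "k s * l (t / s) / s - k s * l t = k s * (l (t / s) / s - l t)" by (simp add: algebra_simps)
      then show "ennreal (norm (k s * l (t / s) / s - k s * l t)) = ennreal \<bar>k s\<bar> * ennreal \<bar>l (t / s) / s - l t\<bar>"
        by (simp add: abs_mult ennreal_mult)
    qed
    finally show "ennreal \<bar>w t\<bar> \<le> (\<integral>\<^sup>+s. ennreal \<bar>k s\<bar> * ennreal \<bar>l (t / s) / s - l t\<bar> \<partial>lborel)" .
  qed
  then have "(\<integral>\<^sup>+t. ennreal \<bar>w t\<bar> \<partial>lborel) \<le> (\<integral>\<^sup>+t. \<integral>\<^sup>+s. ennreal \<bar>k s\<bar> * ennreal \<bar>l (t / s) / s - l t\<bar> \<partial>lborel \<partial>lborel)"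
    by (rule nn_integral_mono_AE)
  also have "\<dots> = (\<integral>\<^sup>+s. \<integral>\<^sup>+t. ennreal \<bar>k s\<bar> * ennreal \<bar>l (t / s) / s - l t\<bar> \<partial>lborel \<partial>lborel)"
    by (rule lborel_pair.Fubini') measurable
  also have "\<dots> \<le> (\<integral>\<^sup>+s. ennreal (\<bar>k s\<bar> * m s) \<partial>lborel)"
  proof (rule nn_integral_mono)
    fix s
    have "(\<integral>\<^sup>+t. ennreal \<bar>k s\<bar> * ennreal \<bar>l (t / s) / s - l t\<bar> \<partial>lborel) = ennreal \<bar>k s\<bar> * (\<integral>\<^sup>+t. ennreal \<bar>l (t / s) / s - l t\<bar> \<partial>lborel)"
      by (rule nn_integral_cmult) measurable
    also have "\<dots> \<le> ennreal (\<bar>k s\<bar> * m s)"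
    proof (cases "0 < s")
      case True
      then have "ennreal \<bar>k s\<bar> * (\<integral>\<^sup>+t. ennreal \<bar>l (t / s) / s - l t\<bar> \<partial>lborel) \<le> ennreal \<bar>k s\<bar> * ennreal (m s)"
        unfolding l_def m_def by (intro mult_left_mono log_window_shift_bound T) auto
      then show ?thesis using m0 by (simp add: ennreal_mult)
    next
      case False
      then show ?thesis using half_line_kernelD(3)[OF k, of s] by simp
    qed
    finally show "(\<integral>\<^sup>+t. ennreal \<bar>k s\<bar> * ennreal \<bar>l (t / s) / s - l t\<bar> \<partial>lborel) \<le> ennreal (\<bar>k s\<bar> * m s)" .
  qed
  also have "\<dots> = ennreal (LINT s|lborel. \<bar>k s\<bar> * m s)"
    using mi m0 by (intro nn_integral_eq_integral) auto
  also have "(\<integral>\<^sup>+t. ennreal \<bar>w t\<bar> \<partial>lborel) = ennreal (LINT t|lborel. \<bar>w t\<bar>)"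
    using half_line_kernelD(1)[OF w] by (intro nn_integral_eq_integral) auto
  finally have "ennreal (LINT t|lborel. \<bar>w t\<bar>) \<le> ennreal (LINT s|lborel. \<bar>k s\<bar> * m s)" .
  moreover have "0 \<le> (LINT s|lborel. \<bar>k s\<bar> * m s)" using m0 by (intro integral_nonneg_AE) auto
  ultimately show "(LINT t|lborel. \<bar>w t\<bar>) \<le> (LINT s|lborel. \<bar>k s\<bar> * min (2 * \<bar>ln s\<bar>) (2 * ln T))"
    unfolding m_def by simp
qed

text \<open>
Relative to the length \<open>ln T\<close> of the window the defect tends to 0; here \<open>ln T = n + 1\<close>.
\<close>

lemma log_window_defect_negligible:
  assumes k: "half_line_kernel k"
  shows "(\<lambda>n. (LINT s|lborel. \<bar>k s\<bar> * min (2 * \<bar>ln s\<bar>) (2 * real (Suc n))) / real (Suc n)) \<longlonglongrightarrow> 0"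
proof -
  note [measurable] = half_line_kernelD(2)[OF k]
  have eq: "(LINT s|lborel. \<bar>k s\<bar> * min (2 * \<bar>ln s\<bar>) (2 * real (Suc n))) / real (Suc n)
      = (LINT s|lborel. \<bar>k s\<bar> * min (2 * \<bar>ln s\<bar> / real (Suc n)) 2)" for n
  proof -
    have "\<bar>k s\<bar> * min (2 * \<bar>ln s\<bar>) (2 * real (Suc n)) / real (Suc n) = \<bar>k s\<bar> * min (2 * \<bar>ln s\<bar> / real (Suc n)) 2" for s
    proof -
      have "min a (2 * m) / m = min (a / m) 2" if "0 < m" for a m :: real
        using that by (auto simp: min_def field_simps)
      from this[of "real (Suc n)" "2 * \<bar>ln s\<bar>"] show ?thesis by (simp only: times_divide_eq_right[symmetric])
    qed
    then show ?thesis by (simp only: integral_divide_zero[symmetric])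
  qed
  have "(\<lambda>n. LINT s|lborel. \<bar>k s\<bar> * min (2 * \<bar>ln s\<bar> / real (Suc n)) 2) \<longlonglongrightarrow> (LINT s::real|lborel. 0)"
  proof (rule integral_dominated_convergence)
    show "integrable lborel (\<lambda>s. \<bar>k s\<bar> * 2)" using half_line_kernelD(1)[OF k] by auto
    show "AE s in lborel. norm (\<bar>k s\<bar> * min (2 * \<bar>ln s\<bar> / real (Suc n)) 2) \<le> \<bar>k s\<bar> * 2" for n
      by (intro AE_I2) (auto simp: abs_mult intro!: mult_left_mono simp del: of_nat_Suc)
    show "AE s in lborel. (\<lambda>n. \<bar>k s\<bar> * min (2 * \<bar>ln s\<bar> / real (Suc n)) 2) \<longlonglongrightarrow> 0"
    proof (rule AE_I2)
      fix s
      have "(\<lambda>n. 2 * \<bar>ln s\<bar> * inverse (real (Suc n))) \<longlonglongrightarrow> 2 * \<bar>ln s\<bar> * 0"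
        by (intro tendsto_intros LIMSEQ_inverse_real_of_nat)
      then have "(\<lambda>n. \<bar>k s\<bar> * min (2 * \<bar>ln s\<bar> * inverse (real (Suc n))) 2) \<longlonglongrightarrow> \<bar>k s\<bar> * min (2 * \<bar>ln s\<bar> * 0) 2"
        by (rule tendsto_mult_left[OF tendsto_min[OF _ tendsto_const]])
      then have "(\<lambda>n. \<bar>k s\<bar> * min (2 * \<bar>ln s\<bar> / real (Suc n)) 2) \<longlonglongrightarrow> \<bar>k s\<bar> * min (2 * \<bar>ln s\<bar> * 0) 2"
        by (simp only: divide_inverse)
      then show "(\<lambda>n. \<bar>k s\<bar> * min (2 * \<bar>ln s\<bar> / real (Suc n)) 2) \<longlonglongrightarrow> 0" by simp
    qed
  qed measurable
  then show ?thesis unfolding eq by simp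
qed

lemma norm_dilate_bump_le: "1 \<le> t \<Longrightarrow> norm (dilate t odd_bump x) \<le> 1"
  using frac_le[of 1 "\<bar>bump (x / t)\<bar>" 1 t] bump_le[of "x / t"] by (simp add: dilate_def norm_divide)

lemma norm_log_window_dilate_bump_le: "norm (log_window T t *\<^sub>R dilate t odd_bump x) \<le> log_window T t"
proof (cases "1 \<le> t")
  case True
  then show ?thesis
    using mult_left_mono[OF norm_dilate_bump_le[OF True], of "log_window T t" x] log_window_nonneg[of T t] by simp
qed (simp add: log_window_def)

text \<open>
The sign function is invariant under dilations. Integrated against it, the average of the bump
therefore gives \<open>ln T\<close> times \<open>\<integral> \<bar>bump\<bar>\<close>, and this integral is at least \<open>1/32\<close>.
\<close>

lemma
  assumes T: "1 \<le> T"
  shows log_window_average_continuous: "continuous_on UNIV (dilation_average (log_window T) odd_bump)"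
    and log_window_average_bounded: "norm (dilation_average (log_window T) odd_bump x) \<le> ln T"
    and log_window_average_L1: "ennreal (ln T / 32) \<le> L1_norm (dilation_average (log_window T) odd_bump)"
proof -
  let ?l = "log_window T"
  note l = log_window_kernel[OF T]
  note li = half_line_kernelD(1)[OF l]
  have bm[measurable]: "odd_bump \<in> borel_measurable borel" by measurable
  have bi: "integrable lborel odd_bump" using bump_integrable by simp
  have dm[measurable]: "(\<lambda>t. dilate t odd_bump x) \<in> borel_measurable borel" for x unfolding dilate_def by measurable
  have "isCont (dilation_average ?l odd_bump) x" for x
    unfolding continuous_at_sequentially
  proof (intro allI impI)
    fix X assume X: "X \<longlonglongrightarrow> x"
    show "(dilation_average ?l odd_bump \<circ> X) \<longlonglongrightarrow> dilation_average ?l odd_bump x"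
      unfolding comp_def dilation_average_def
    proof (rule integral_dominated_convergence[OF _ _ li])
      show "AE t in lborel. norm (?l t *\<^sub>R dilate t odd_bump (X n)) \<le> ?l t" for n
        by (intro AE_I2 norm_log_window_dilate_bump_le)
      show "AE t in lborel. (\<lambda>n. ?l t *\<^sub>R dilate t odd_bump (X n)) \<longlonglongrightarrow> ?l t *\<^sub>R dilate t odd_bump x"
      proof (rule AE_I2)
        fix t
        show "(\<lambda>n. ?l t *\<^sub>R dilate t odd_bump (X n)) \<longlonglongrightarrow> ?l t *\<^sub>R dilate t odd_bump x"
        proof (cases "1 \<le> t")
          case True
          have "isCont bump (x / t)" using bump_continuous by (simp add: continuous_on_eq_continuous_at)
          moreover have "(\<lambda>n. X n / t) \<longlonglongrightarrow> x / t" using X True by (intro tendsto_intros) auto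
          ultimately have "(\<lambda>n. bump (X n / t)) \<longlonglongrightarrow> bump (x / t)" by (rule isCont_tendsto_compose)
          then show ?thesis unfolding dilate_def using True by (intro tendsto_intros) auto
        qed (simp add: log_window_def)
      qed
    qed measurable
  qed
  then show "continuous_on UNIV (dilation_average ?l odd_bump)" by (simp add: continuous_on_eq_continuous_at)
  have "norm (dilation_average ?l odd_bump x) \<le> (LINT t|lborel. norm (?l t *\<^sub>R dilate t odd_bump x))"
    unfolding dilation_average_def by (rule integral_norm_bound)
  also have "\<dots> \<le> (LINT t|lborel. ?l t)"
  proof (rule integral_mono[OF _ li])
    have "integrable lborel (\<lambda>t. ?l t *\<^sub>R dilate t odd_bump x)"
      by (rule Bochner_Integration.integrable_bound[OF li])
        (use norm_log_window_dilate_bump_le[of T _ x] log_window_nonneg in \<open>auto intro!: AE_I2\<close>)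
    then show "integrable lborel (\<lambda>t. norm (?l t *\<^sub>R dilate t odd_bump x))" by (rule integrable_norm)
  qed (rule norm_log_window_dilate_bump_le)
  finally show "norm (dilation_average ?l odd_bump x) \<le> ln T" using log_window_integral[OF T] by simp
  let ?s = "\<lambda>x. complex_of_real (sgn x)"
  define \<kappa> where "\<kappa> = (LINT x|lborel. bump x * sgn x)"
  have sb: "norm (?s x) \<le> 1" for x by (auto simp: sgn_if)
  have sm[measurable]: "?s \<in> borel_measurable borel" by measurable
  have ki: "integrable lborel (\<lambda>x. bump x * sgn x)"
    by (rule Bochner_Integration.integrable_bound[OF bump_integrable]) (auto simp: abs_mult sgn_if)
  have \<kappa>: "1 / 32 \<le> \<kappa>"
  proof -
    have "(LINT x|lborel. indicator {1/4..1/2::real} x * (1/8)) \<le> \<kappa>"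
      unfolding \<kappa>_def
    proof (rule integral_mono[OF _ ki])
      show "integrable lborel (\<lambda>x. indicator {1/4..1/2::real} x * (1/8::real))"
        by (intro integrable_mult_left integrable_real_indicator) auto
      fix x :: real
      show "indicator {1/4..1/2} x * (1/8) \<le> bump x * sgn x"
      proof (cases "x \<in> {1/4..1/2}")
        case True
        then have "(1/4) * (1/2) \<le> x * (1 - x)" by (intro mult_mono) auto
        with True show ?thesis by (simp add: bump_def)
      next
        case False
        have "0 \<le> bump x * sgn x" unfolding bump_def by (auto simp: sgn_if mult_nonpos_nonneg)
        with False show ?thesis by simp
      qed
    qed
    then show ?thesis by simp
  qed
  have dil: "(LINT x|lborel. dilate t odd_bump x * ?s x) = of_real \<kappa>" if t: "0 < t" for t
  proof -
    have "(LINT x|lborel. dilate t odd_bump x * ?s x) = t *\<^sub>R (LINT x|lborel. dilate t odd_bump (0 + t * x) * ?s (0 + t * x))"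
      using t by (subst lborel_integral_real_affine[where c = t and t = 0]) auto
    also have "(\<lambda>x. dilate t odd_bump (0 + t * x) * ?s (0 + t * x)) = (\<lambda>x. of_real (bump x * sgn x) / of_real t)"
      using t by (auto simp: dilate_def fun_eq_iff sgn_mult)
    also have "t *\<^sub>R (LINT x|lborel. complex_of_real (bump x * sgn x) / of_real t) = of_real \<kappa>"
      unfolding \<kappa>_def integral_divide_zero integral_of_real[OF ki] using t by (simp add: scaleR_conv_of_real)
    finally show ?thesis .
  qed
  have gi: "integrable lborel (dilation_average ?l odd_bump)" by (rule dilation_average_integrable[OF l bi])
  have "(LINT x|lborel. dilation_average ?l odd_bump x * ?s x) = (LINT t|lborel. ?l t *\<^sub>R (LINT x|lborel. dilate t odd_bump x * ?s x))"
    by (rule dilation_average_integral_bounded(1)[OF l bi sm sb])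
  also have "\<dots> = (LINT t|lborel. ?l t *\<^sub>R complex_of_real \<kappa>)"
  proof (rule Bochner_Integration.integral_cong)
    show "?l t *\<^sub>R (LINT x|lborel. dilate t odd_bump x * ?s x) = ?l t *\<^sub>R complex_of_real \<kappa>" for t
      using dil[of t] half_line_kernelD(3)[OF l, of t] by (cases "0 < t") auto
  qed simp
  also have "\<dots> = of_real (ln T * \<kappa>)"
    by (simp add: integral_scaleR_left_zero log_window_integral[OF T] scaleR_conv_of_real)
  finally have I: "(LINT x|lborel. dilation_average ?l odd_bump x * ?s x) = of_real (ln T * \<kappa>)" .
  have "ln T / 32 \<le> ln T * \<kappa>" using mult_left_mono[OF \<kappa>, of "ln T"] T by simp
  also have "\<dots> \<le> norm (LINT x|lborel. dilation_average ?l odd_bump x * ?s x)" unfolding I by (simp only: norm_of_real abs_ge_self)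
  also have "\<dots> \<le> (LINT x|lborel. norm (dilation_average ?l odd_bump x * ?s x))" by (rule integral_norm_bound)
  also have "\<dots> \<le> (LINT x|lborel. norm (dilation_average ?l odd_bump x))"
  proof (rule integral_mono)
    show le: "norm (dilation_average ?l odd_bump x * ?s x) \<le> norm (dilation_average ?l odd_bump x)" for x
      using mult_left_mono[OF sb[of x] norm_ge_zero[of "dilation_average ?l odd_bump x"]] by (simp add: norm_mult)
    have "integrable lborel (\<lambda>x. dilation_average ?l odd_bump x * ?s x)"
      by (rule Bochner_Integration.integrable_bound[OF gi]) (use gi le in auto)
    then show "integrable lborel (\<lambda>x. norm (dilation_average ?l odd_bump x * ?s x))" by (rule integrable_norm)
  qed (use gi in simp)
  finally have "ennreal (ln T / 32) \<le> ennreal (LINT x|lborel. norm (dilation_average ?l odd_bump x))" by (rule ennreal_leI)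
  also have "\<dots> = L1_norm (dilation_average ?l odd_bump)"
    unfolding L1_norm_lborel using gi by (intro nn_integral_eq_integral[symmetric]) auto
  finally show "ennreal (ln T / 32) \<le> L1_norm (dilation_average ?l odd_bump)" .
qed

lemma dilation_average_cmult: "dilation_average k (\<lambda>x. c * f x) x = c * dilation_average k f x"
  unfolding dilation_average_def
  by (subst integral_mult_right_zero[symmetric], intro Bochner_Integration.integral_cong) (simp_all add: dilate_def)

section \<open>The operator norm for an abstract norm\<close>

lemma hausdorff_kernel_representative:
  assumes \<phi>: "set_integrable lebesgue {0<..} \<phi>" and nn: "AE t in lebesgue. 0 < t \<longrightarrow> 0 \<le> \<phi> t"
  obtains k where "half_line_kernel k" "\<And>t. 0 \<le> k t" "AE t in lborel. 0 < t \<longrightarrow> \<phi> t = k t"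
    "(LINT t:{0<..}|lebesgue. \<phi> t) = (LINT t|lborel. k t)"
proof -
  have "(\<lambda>t. indicator {0<..} t *\<^sub>R \<phi> t) \<in> borel_measurable lebesgue" using \<phi> unfolding set_integrable_def by auto
  from completion_ex_borel_measurable_real[OF this] obtain k0 where
    k0: "k0 \<in> borel_measurable lborel" "AE t in lborel. indicator {0<..} t *\<^sub>R \<phi> t = k0 t" by blast
  define k where "k t = (if 0 < t then max 0 (k0 t) else 0)" for t
  have [measurable]: "k0 \<in> borel_measurable borel" using k0(1) by simp
  have km: "k \<in> borel_measurable borel" unfolding k_def[abs_def] by measurable
  have nn': "AE t in lborel. 0 < t \<longrightarrow> 0 \<le> \<phi> t" using nn by (simp add: AE_completion_iff)
  have eq: "AE t in lborel. indicator {0<..} t *\<^sub>R \<phi> t = k t"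
    using k0(2) nn' by eventually_elim (auto simp: k_def)
  have ki: "integrable lborel k"
    using \<phi> lebesgue_integrable_borel_rep[OF km eq] unfolding set_integrable_def by simp
  show thesis
  proof
    show "half_line_kernel k" unfolding half_line_kernel_def using ki by (auto simp: k_def)
    show "0 \<le> k t" for t unfolding k_def by simp
    show "AE t in lborel. 0 < t \<longrightarrow> \<phi> t = k t" using eq by eventually_elim auto
    show "(LINT t:{0<..}|lebesgue. \<phi> t) = (LINT t|lborel. k t)"
      unfolding set_lebesgue_integral_def by (rule lebesgue_integral_borel_rep[OF km eq])
  qed
qed

lemma hausdorff_op_AE:
  assumes k: "half_line_kernel k" "AE t in lborel. 0 < t \<longrightarrow> \<phi> t = k t"
    and g: "g \<in> borel_measurable borel" "AE x in lborel. f x = g x"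
  shows "AE x in lborel. hausdorff_op \<phi> f x = dilation_average k g x"
proof -
  have "AE x::real in lborel. x \<noteq> 0" using AE_lborel_not_in_finite[of "{0}"] by simp
  then show ?thesis
    by eventually_elim (rule hausdorff_op_eq_dilation_average[OF half_line_kernelD(2,3)[OF k(1)] k(2) g])
qed

text \<open>
Let \<open>A = \<integral> \<phi>\<close> and let \<open>S\<close> be the operator norm. With the window average \<open>g\<close> of the bump one has
\<open>A g = H g - W\<close>, where \<open>W\<close> is the average of dilations of the bump with the defect kernel. Taking
norms, \<open>A \<nu> \<le> S \<nu> + \<delta> \<beta>\<close> with \<open>\<nu>\<close> and \<open>\<beta>\<close> the norms of \<open>g\<close> and of the bump; as \<open>\<nu>\<close> is at least a
constant times \<open>ln T\<close> and \<open>\<delta> = o(ln T)\<close>, this gives \<open>A \<le> S\<close>.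
\<close>

theorem operator_norm_hausdorff_op:
  fixes N :: "(real \<Rightarrow> complex) \<Rightarrow> ennreal" and X :: "(real \<Rightarrow> complex) set"
  assumes \<phi>: "set_integrable lebesgue {0<..} \<phi>" "AE t in lebesgue. 0 < t \<longrightarrow> 0 \<le> \<phi> t"
    and X: "\<And>f. f \<in> X \<Longrightarrow> integrable lebesgue f"
    and X_average: "\<And>k c. half_line_kernel k \<Longrightarrow> (\<lambda>x. c * dilation_average k odd_bump x) \<in> X"
    and average: "\<And>k f. half_line_kernel k \<Longrightarrow> integrable lborel f \<Longrightarrow> N f < \<infinity> \<Longrightarrow>
        N (dilation_average k f) \<le> ennreal (LINT t|lborel. \<bar>k t\<bar>) * N f"
    and add: "\<And>f g. integrable lborel f \<Longrightarrow> integrable lborel g \<Longrightarrow> N (\<lambda>x. f x + g x) \<le> N f + N g"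
    and cmult: "\<And>c f. integrable lborel f \<Longrightarrow> N (\<lambda>x. c * f x) \<le> ennreal (norm c) * N f"
    and cong: "\<And>f g. g \<in> borel_measurable borel \<Longrightarrow> AE x in lborel. f x = g x \<Longrightarrow> N f = N g"
    and bump: "N odd_bump < \<infinity>"
    and C: "0 < C" and lower: "\<And>f B. integrable lborel f \<Longrightarrow> continuous_on UNIV f \<Longrightarrow> (\<And>x. norm (f x) \<le> B) \<Longrightarrow>
        ennreal C * L1_norm f \<le> N f"
  shows "operator_norm X N (hausdorff_op \<phi>) = ennreal (LINT t:{0<..}|lebesgue. \<phi> t)"
proof -
  obtain k where k: "half_line_kernel k" "\<And>t. 0 \<le> k t" "AE t in lborel. 0 < t \<longrightarrow> \<phi> t = k t"
    "(LINT t:{0<..}|lebesgue. \<phi> t) = (LINT t|lborel. k t)"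
    using hausdorff_kernel_representative[OF \<phi>] by blast
  define A where "A = (LINT t|lborel. k t)"
  have A0: "0 \<le> A" unfolding A_def using k(2) by (intro integral_nonneg_AE) auto
  have Aabs: "(LINT t|lborel. \<bar>k t\<bar>) = A" unfolding A_def using k(2) by simp
  have H: "N (hausdorff_op \<phi> f) = N (dilation_average k g)"
    if "integrable lborel g" "AE x in lborel. f x = g x" for f g
  proof (rule cong)
    show "dilation_average k g \<in> borel_measurable borel" using dilation_average_integrable[OF k(1) that(1)] by auto
    show "AE x in lborel. hausdorff_op \<phi> f x = dilation_average k g x"
      using that by (intro hausdorff_op_AE[OF k(1,3)]) auto
  qed
  define S where "S = operator_norm X N (hausdorff_op \<phi>)"
  have upper: "S \<le> ennreal A"
    unfolding S_def operator_norm_def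
  proof (rule SUP_least, clarify)
    fix f assume f: "f \<in> X" "N f \<le> 1"
    have fi: "integrable lebesgue f" by (rule X[OF f(1)])
    obtain g where g: "g \<in> borel_measurable borel" "AE x in lborel. f x = g x"
      by (rule borel_representative[OF borel_measurable_integrable[OF fi]])
    have gi: "integrable lborel g" using lebesgue_integrable_borel_rep[OF g] fi by simp
    have Ng: "N g \<le> 1" using cong[OF g] f(2) by simp
    have "N (hausdorff_op \<phi> f) = N (dilation_average k g)" by (rule H[OF gi g(2)])
    also have "\<dots> \<le> ennreal A * N g"
      using average[OF k(1) gi] Ng unfolding Aabs by (simp add: le_less_trans)
    also have "\<dots> \<le> ennreal A * 1" using Ng by (rule mult_left_mono) simp
    finally show "N (hausdorff_op \<phi> f) \<le> ennreal A" by simp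
  qed
  obtain S' where S': "S = ennreal S'" "0 \<le> S'" using upper by (cases S) (auto simp: top_unique)
  obtain \<beta> where \<beta>: "N odd_bump = ennreal \<beta>" "0 \<le> \<beta>" using bump by (cases "N odd_bump") auto
  have bi: "integrable lborel odd_bump" using bump_integrable by simp
  have main: "A \<le> S' + (32 * \<beta> / C) * ((LINT s|lborel. \<bar>k s\<bar> * min (2 * \<bar>ln s\<bar>) (2 * real (Suc n))) / real (Suc n))" for n
  proof -
    \<comment> \<open>Only the logarithm of the window length matters, so it is taken to be an integer.\<close>
    define T where "T = exp (real (Suc n))"
    have T: "1 \<le> T" "ln T = real (Suc n)" unfolding T_def by auto
    define lT where "lT = real (Suc n)"
    have lT: "0 < lT" "ln T = lT" unfolding lT_def using T by auto
    define \<delta> where "\<delta> = (LINT s|lborel. \<bar>k s\<bar> * min (2 * \<bar>ln s\<bar>) (2 * real (Suc n)))"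
    define g where "g = dilation_average (log_window T) odd_bump"
    note lw = log_window_kernel[OF T(1)]
    have gi: "integrable lborel g" unfolding g_def by (rule dilation_average_integrable[OF lw bi])
    have gm: "g \<in> borel_measurable borel" using gi by auto
    have "N g \<le> ennreal (LINT t|lborel. \<bar>log_window T t\<bar>) * N odd_bump"
      unfolding g_def by (rule average[OF lw bi bump])
    also have "\<dots> < \<infinity>" using bump by (simp add: ennreal_mult_less_top)
    finally have Ng_fin: "N g < \<infinity>" .
    then obtain \<nu> where \<nu>: "N g = ennreal \<nu>" "0 \<le> \<nu>" by (cases "N g") auto
    have \<nu>_ge: "C * (lT / 32) \<le> \<nu>"
    proof -
      have "ennreal C * ennreal (lT / 32) \<le> ennreal C * L1_norm g"
        using log_window_average_L1[OF T(1)] unfolding g_def lT(2) by (rule mult_left_mono) simp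
      also have "\<dots> \<le> N g"
        unfolding g_def
        by (rule lower[OF _ log_window_average_continuous[OF T(1)] log_window_average_bounded[OF T(1)]])
          (use gi in \<open>simp add: g_def\<close>)
      finally show ?thesis using C lT \<nu> by (simp flip: ennreal_mult)
    qed
    have "0 < C * (lT / 32)" using C lT(1) by simp
    then have \<nu>0: "0 < \<nu>" using \<nu>_ge by linarith
    define w where "w t = mult_conv k (log_window T) t - A * log_window T t" for t
    have w: "half_line_kernel w" "(LINT t|lborel. \<bar>w t\<bar>) \<le> \<delta>"
      using kernel_average_eq_log_window_defect[OF k(1) T(1)] unfolding w_def A_def \<delta>_def T(2) by auto
    have wi: "integrable lborel (dilation_average w odd_bump)" by (rule dilation_average_integrable[OF w(1) bi])
    have kgi: "integrable lborel (dilation_average k g)" by (rule dilation_average_integrable[OF k(1) gi])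
    have Ag: "AE x in lborel. of_real A * g x = dilation_average k g x + (- 1) * dilation_average w odd_bump x"
    proof -
      have Al: "half_line_kernel (\<lambda>t. A * log_window T t)"
        using lw unfolding half_line_kernel_def by auto
      have 1: "AE x in lborel. dilation_average w odd_bump x = dilation_average (mult_conv k (log_window T)) odd_bump x
          - dilation_average (\<lambda>t. A * log_window T t) odd_bump x"
        unfolding w_def by (rule dilation_average_diff_kernel_AE[OF mult_conv_kernel[OF k(1) lw] Al bi])
      have 2: "dilation_average (\<lambda>t. A * log_window T t) odd_bump x = of_real A * g x" for x
        unfolding g_def dilation_average_def
        by (subst integral_mult_right_zero[symmetric], intro Bochner_Integration.integral_cong)
          (simp_all add: scaleR_conv_of_real mult.assoc)
      have 3: "AE x::real in lborel. x \<noteq> 0" using AE_lborel_not_in_finite[of "{0}"] by simp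
      from 1 3 show ?thesis
      proof eventually_elim
        fix x :: real assume "dilation_average w odd_bump x = dilation_average (mult_conv k (log_window T)) odd_bump x
            - dilation_average (\<lambda>t. A * log_window T t) odd_bump x" "x \<noteq> 0"
        then show "of_real A * g x = dilation_average k g x + (- 1) * dilation_average w odd_bump x"
          using dilation_average_assoc_bump[OF k(1) lw, of x] 2[of x] unfolding g_def by simp
      qed
    qed
    have Nw: "N (\<lambda>x. (- 1) * dilation_average w odd_bump x) \<le> ennreal (\<delta> * \<beta>)"
    proof -
      have "N (\<lambda>x. (- 1) * dilation_average w odd_bump x) \<le> ennreal (norm (- 1 :: complex)) * N (dilation_average w odd_bump)"
        by (rule cmult[OF wi])
      also have "\<dots> \<le> 1 * (ennreal (LINT t|lborel. \<bar>w t\<bar>) * N odd_bump)"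
        using average[OF w(1) bi bump] by (intro mult_mono) auto
      also have "\<dots> \<le> ennreal \<delta> * ennreal \<beta>"
        unfolding \<beta>(1) using w(2) by (simp add: ennreal_leI mult_right_mono)
      finally show ?thesis using \<beta>(2) by (simp add: ennreal_mult'')
    qed
    have wabs: "0 \<le> (LINT t|lborel. \<bar>w t\<bar>)" by (rule integral_nonneg_AE) simp
    then have \<delta>0: "0 \<le> \<delta>" using w(2) by linarith
    have NAg: "ennreal (A * \<nu>) \<le> N (\<lambda>x. of_real A * g x)"
    proof (cases "A = 0")
      case False
      have "ennreal \<nu> = N (\<lambda>x. of_real (1 / A) * (of_real A * g x))" using False \<nu>(1) by (simp add: mult.assoc[symmetric])
      also have "\<dots> \<le> ennreal (norm (of_real (1 / A) :: complex)) * N (\<lambda>x. of_real A * g x)"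
        using gi by (intro cmult) simp
      finally have "ennreal \<nu> \<le> ennreal (1 / A) * N (\<lambda>x. of_real A * g x)" using A0 by (simp add: norm_divide)
      then have "ennreal A * ennreal \<nu> \<le> ennreal A * (ennreal (1 / A) * N (\<lambda>x. of_real A * g x))" by (rule mult_left_mono) simp
      also have "\<dots> = (ennreal A * ennreal (1 / A)) * N (\<lambda>x. of_real A * g x)" by (simp only: mult.assoc)
      also have "ennreal A * ennreal (1 / A) = 1" using A0 False by (simp flip: ennreal_mult)
      finally show ?thesis using A0 \<nu>(2) by (simp add: ennreal_mult)
    qed simp
    also have "N (\<lambda>x. of_real A * g x) = N (\<lambda>x. dilation_average k g x + (- 1) * dilation_average w odd_bump x)"
    proof (rule cong[OF _ Ag])
      have [measurable]: "dilation_average k g \<in> borel_measurable borel" "dilation_average w odd_bump \<in> borel_measurable borel"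
        using kgi wi by auto
      show "(\<lambda>x. dilation_average k g x + (- 1) * dilation_average w odd_bump x) \<in> borel_measurable borel" by measurable
    qed
    also have "\<dots> \<le> N (dilation_average k g) + N (\<lambda>x. (- 1) * dilation_average w odd_bump x)"
      using wi by (intro add kgi) simp
    also have "\<dots> \<le> ennreal (\<nu> * S') + ennreal (\<delta> * \<beta>)"
    proof (rule add_mono[OF _ Nw])
      define u where "u x = of_real (1 / \<nu>) * g x" for x
      have uX: "u \<in> X" unfolding u_def[abs_def] g_def by (rule X_average[OF lw])
      have ui: "integrable lborel u" unfolding u_def[abs_def] using gi by simp
      have "N u \<le> ennreal (norm (of_real (1 / \<nu>) :: complex)) * N g" unfolding u_def[abs_def] by (rule cmult[OF gi])
      also have "\<dots> = 1" using \<nu> \<nu>0 by (simp add: norm_divide flip: ennreal_mult)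
      finally have Nu: "N u \<le> 1" .
      have "N (hausdorff_op \<phi> u) \<le> S"
        unfolding S_def operator_norm_def by (rule SUP_upper) (use uX Nu in simp)
      then have "N (dilation_average k u) \<le> ennreal S'" using H[OF ui AE_I2[OF refl]] S' by simp
      moreover have "dilation_average k g = (\<lambda>x. of_real \<nu> * dilation_average k u x)"
        unfolding u_def[abs_def] dilation_average_cmult using \<nu>0 by (auto simp: fun_eq_iff)
      moreover have "N (\<lambda>x. of_real \<nu> * dilation_average k u x) \<le> ennreal (norm (of_real \<nu> :: complex)) * N (dilation_average k u)"
        by (intro cmult dilation_average_integrable k ui)
      ultimately have "N (dilation_average k g) \<le> ennreal \<nu> * N (dilation_average k u)" using \<nu>(2) by simp
      also have "\<dots> \<le> ennreal \<nu> * ennreal S'" using \<open>N (dilation_average k u) \<le> ennreal S'\<close> by (rule mult_left_mono) simp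
      finally show "N (dilation_average k g) \<le> ennreal (\<nu> * S')" using \<nu>(2) S'(2) by (simp add: ennreal_mult)
    qed
    also have "\<dots> = ennreal (\<nu> * S' + \<delta> * \<beta>)" using \<nu>(2) S'(2) \<delta>0 \<beta>(2) by simp
    finally have "A * \<nu> \<le> \<nu> * S' + \<delta> * \<beta>"
      using \<nu>(2) S'(2) \<delta>0 \<beta>(2) by (subst (asm) ennreal_le_iff) auto
    then have "A \<le> S' + \<delta> * \<beta> / \<nu>" using \<nu>0 by (simp add: field_simps)
    also have "\<delta> * \<beta> / \<nu> \<le> \<delta> * \<beta> / (C * (lT / 32))"
      using \<nu>_ge C lT \<delta>0 \<beta>(2) by (intro divide_left_mono) (auto intro!: mult_pos_pos \<nu>0)
    also have "\<delta> * \<beta> / (C * (lT / 32)) = (32 * \<beta> / C) * (\<delta> / lT)" by simp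
    finally show ?thesis unfolding \<delta>_def lT_def by simp
  qed
  have "A \<le> S'"
  proof (rule LIMSEQ_le_const)
    show "(\<lambda>n. S' + (32 * \<beta> / C) * ((LINT s|lborel. \<bar>k s\<bar> * min (2 * \<bar>ln s\<bar>) (2 * real (Suc n))) / real (Suc n))) \<longlonglongrightarrow> S'"
      using tendsto_add[OF tendsto_const tendsto_mult_right_zero[OF log_window_defect_negligible[OF k(1)]], of S' "32 * \<beta> / C"] by simp
  qed (use main in blast)
  then have "S = ennreal A" using upper S' by (intro antisym) (auto intro: ennreal_leI)
  then show ?thesis unfolding S_def k(4) A_def .
qed

section \<open>The four norms\<close>

abbreviation vertical_rays :: "(real \<times> real) set" where
  "vertical_rays \<equiv> {0} \<times> {0<..}"

abbreviation unit_cone :: "(real \<times> real) set" where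
  "unit_cone \<equiv> {(v, s). \<bar>v\<bar> < s}"

lemma aperture_vertical_rays: "aperture vertical_rays"
  unfolding aperture_def by auto

lemma aperture_unit_cone: "aperture unit_cone"
  unfolding aperture_def by (auto simp: abs_divide divide_strict_right_mono)

text \<open>
The two orders of the factors in the convolution occur because the two maximal functions are written
with different ones.
\<close>

lemma conv_eq_smooth:
  assumes \<psi>: "decaying_kernel \<psi>" and g: "g \<in> borel_measurable borel" and fg: "AE x in lborel. f x = g x"
  shows "conv f (dilate s \<psi>) x = smooth \<psi> s g x"
    and "conv (dilate s \<psi>) f x = smooth \<psi> s g x"
proof -
  note [measurable] = decaying_kernelD(2)[OF \<psi>] g
  show "conv f (dilate s \<psi>) x = smooth \<psi> s g x"
    unfolding conv_def smooth_def
    by (rule lebesgue_integral_borel_rep) (measurable, use fg in \<open>auto elim!: eventually_mono\<close>)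
  have "AE y in lborel. f (x + (- 1) * y) = g (x + (- 1) * y)" by (rule AE_affine[OF fg]) simp
  then have "conv (dilate s \<psi>) f x = (LINT y|lborel. dilate s \<psi> y * g (x - y))"
    unfolding conv_def by (intro lebesgue_integral_borel_rep) (measurable, auto elim!: eventually_mono)
  also have "\<dots> = smooth \<psi> s g x"
    unfolding smooth_def by (subst lborel_integral_real_affine[where c = "- 1" and t = x]) (auto simp: mult.commute)
  finally show "conv (dilate s \<psi>) f x = smooth \<psi> s g x" .
qed

lemma smooth_maximal_norm_eq:
  assumes "decaying_kernel \<psi>" "g \<in> borel_measurable borel" "AE x in lborel. f x = g x"
  shows "smooth_maximal_norm \<psi> f = (\<integral>\<^sup>+x. cone_maximal vertical_rays \<psi> g x \<partial>lborel)"
proof -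
  have "smooth_maximal \<psi> f x = cone_maximal vertical_rays \<psi> g x" for x
  proof -
    have "vertical_rays = Pair 0 ` {0<..}" by auto
    then show ?thesis
      unfolding smooth_maximal_def cone_maximal_def conv_eq_smooth(1)[OF assms] by (simp add: image_image)
  qed
  then have "smooth_maximal \<psi> f = cone_maximal vertical_rays \<psi> g" by (rule ext)
  then show ?thesis unfolding smooth_maximal_norm_def by (simp add: nn_integral_completion)
qed

lemma nontangential_maximal_norm_eq:
  assumes "decaying_kernel \<psi>" "g \<in> borel_measurable borel" "AE x in lborel. f x = g x"
  shows "nontangential_maximal_norm \<psi> f = (\<integral>\<^sup>+x. cone_maximal unit_cone \<psi> g x \<partial>lborel)"
proof -
  have "nontangential_maximal \<psi> f x = cone_maximal unit_cone \<psi> g x" for x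
  proof -
    have "{(y, t). \<bar>x - y\<bar> < t} = (\<lambda>(v, s). (x - v, s)) ` unit_cone"
    proof (intro set_eqI iffI)
      fix p assume "p \<in> {(y, t). \<bar>x - y\<bar> < t}"
      then show "p \<in> (\<lambda>(v, s). (x - v, s)) ` unit_cone"
        by (intro image_eqI[where x = "(x - fst p, snd p)"]) auto
    qed auto
    then show ?thesis
      unfolding nontangential_maximal_def cone_maximal_def conv_eq_smooth(2)[OF assms]
      by (simp add: image_image case_prod_beta)
  qed
  then have "nontangential_maximal \<psi> f = cone_maximal unit_cone \<psi> g" by (rule ext)
  then show ?thesis unfolding nontangential_maximal_norm_def by (simp add: nn_integral_completion)
qed

lemma hardy_H1_iff:
  assumes "decaying_kernel \<Phi>" "g \<in> borel_measurable borel" "AE x in lborel. f x = g x"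
  shows "f \<in> hardy_H1 \<Phi> \<longleftrightarrow> integrable lborel g \<and> (\<integral>\<^sup>+x. cone_maximal vertical_rays \<Phi> g x \<partial>lborel) < \<infinity>"
  unfolding hardy_H1_def using smooth_maximal_norm_eq[OF assms] lebesgue_integrable_borel_rep[OF assms(2,3)] by simp

lemma hausdorff_op_hardy_H1:
  assumes \<phi>: "set_integrable lebesgue {0<..} \<phi>" "AE t in lebesgue. 0 < t \<longrightarrow> 0 \<le> \<phi> t"
    and \<Phi>: "decaying_kernel \<Phi>" and f: "f \<in> hardy_H1 \<Phi>"
  shows "hausdorff_op \<phi> f \<in> hardy_H1 \<Phi>"
proof -
  obtain k where k: "half_line_kernel k" "\<And>t. 0 \<le> k t" "AE t in lborel. 0 < t \<longrightarrow> \<phi> t = k t"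
    "(LINT t:{0<..}|lebesgue. \<phi> t) = (LINT t|lborel. k t)"
    using hausdorff_kernel_representative[OF \<phi>] by blast
  have fi: "integrable lebesgue f" using f unfolding hardy_H1_def by simp
  obtain g where g: "g \<in> borel_measurable borel" "AE x in lborel. f x = g x"
    by (rule borel_representative[OF borel_measurable_integrable[OF fi]])
  have gH: "integrable lborel g" "(\<integral>\<^sup>+x. cone_maximal vertical_rays \<Phi> g x \<partial>lborel) < \<infinity>"
    using f hardy_H1_iff[OF \<Phi> g] by auto
  have di: "integrable lborel (dilation_average k g)" by (rule dilation_average_integrable[OF k(1) gH(1)])
  have "(\<integral>\<^sup>+x. cone_maximal vertical_rays \<Phi> (dilation_average k g) x \<partial>lborel)
      \<le> (\<integral>\<^sup>+t. ennreal \<bar>k t\<bar> \<partial>lborel) * (\<integral>\<^sup>+x. cone_maximal vertical_rays \<Phi> g x \<partial>lborel)"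
    by (rule cone_maximal_norm_dilation_average_le[OF \<Phi> gH(1) aperture_vertical_rays k(1)])
  also have "\<dots> < \<infinity>"
    using gH(2) half_line_kernelD(1)[OF k(1)] by (simp add: ennreal_mult_less_top integrable_iff_bounded)
  finally show ?thesis
    using hardy_H1_iff[OF \<Phi> _ hausdorff_op_AE[OF k(1,3) g]] di by auto
qed

lemma average_in_hardy_H1:
  assumes \<Phi>: "decaying_kernel \<Phi>" and k: "half_line_kernel k"
  shows "(\<lambda>x. c * dilation_average k odd_bump x) \<in> hardy_H1 \<Phi>"
proof -
  have bi: "integrable lborel odd_bump" using bump_integrable by simp
  have di: "integrable lborel (dilation_average k odd_bump)" by (rule dilation_average_integrable[OF k bi])
  then have ci: "integrable lborel (\<lambda>x. c * dilation_average k odd_bump x)" by simp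
  have "(\<integral>\<^sup>+x. cone_maximal vertical_rays \<Phi> (\<lambda>x. c * dilation_average k odd_bump x) x \<partial>lborel)
      \<le> (\<integral>\<^sup>+x. ennreal (norm c) * cone_maximal vertical_rays \<Phi> (dilation_average k odd_bump) x \<partial>lborel)"
    by (intro nn_integral_mono cone_maximal_cmult_le)
  also have "\<dots> = ennreal (norm c) * (\<integral>\<^sup>+x. cone_maximal vertical_rays \<Phi> (dilation_average k odd_bump) x \<partial>lborel)"
    using cone_maximal_measurable[OF \<Phi> di aperture_vertical_rays] by (intro nn_integral_cmult) simp
  also have "\<dots> \<le> ennreal (norm c) * ((\<integral>\<^sup>+t. ennreal \<bar>k t\<bar> \<partial>lborel) * (\<integral>\<^sup>+x. cone_maximal vertical_rays \<Phi> odd_bump x \<partial>lborel))"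
    by (intro mult_left_mono cone_maximal_norm_dilation_average_le \<Phi> bi aperture_vertical_rays k) simp
  also have "\<dots> < \<infinity>"
    using cone_maximal_norm_bump_finite[OF \<Phi> aperture_vertical_rays] half_line_kernelD(1)[OF k]
    by (simp add: ennreal_mult_less_top integrable_iff_bounded)
  finally show ?thesis
    using hardy_H1_iff[OF \<Phi> _ AE_I2[OF refl], of "\<lambda>x. c * dilation_average k odd_bump x"] ci by auto
qed

lemma maximal_operator_norm_hausdorff_op:
  assumes \<phi>: "set_integrable lebesgue {0<..} \<phi>" "AE t in lebesgue. 0 < t \<longrightarrow> 0 \<le> \<phi> t"
    and \<Phi>: "decaying_kernel \<Phi>" and \<psi>: "decaying_kernel \<psi>" "(LINT x|lborel. \<psi> x) \<noteq> 0" and \<Gamma>: "aperture \<Gamma>"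
    and N: "\<And>f g. g \<in> borel_measurable borel \<Longrightarrow> AE x in lborel. f x = g x \<Longrightarrow>
        N f = (\<integral>\<^sup>+x. cone_maximal \<Gamma> \<psi> g x \<partial>lborel)"
  shows "operator_norm (hardy_H1 \<Phi>) N (hausdorff_op \<phi>) = ennreal (LINT t:{0<..}|lebesgue. \<phi> t)"
proof (rule operator_norm_hausdorff_op[OF \<phi>])
  have Nb: "N f = (\<integral>\<^sup>+x. cone_maximal \<Gamma> \<psi> f x \<partial>lborel)" if "integrable lborel f" for f
    using N[OF _ AE_I2[OF refl], of f] that by auto
  have cm: "cone_maximal \<Gamma> \<psi> f \<in> borel_measurable lborel" if "integrable lborel f" for f
    using cone_maximal_measurable[OF \<psi>(1) that \<Gamma>] by simp
  have bi: "integrable lborel odd_bump" using bump_integrable by simp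
  show "integrable lebesgue f" if "f \<in> hardy_H1 \<Phi>" for f using that unfolding hardy_H1_def by simp
  show "(\<lambda>x. c * dilation_average k odd_bump x) \<in> hardy_H1 \<Phi>" if "half_line_kernel k" for k c
    by (rule average_in_hardy_H1[OF \<Phi> that])
  show "N (dilation_average k f) \<le> ennreal (LINT t|lborel. \<bar>k t\<bar>) * N f" if "half_line_kernel k" "integrable lborel f" for k f
    using cone_maximal_norm_dilation_average_le[OF \<psi>(1) that(2) \<Gamma> that(1)] half_line_kernelD(1)[OF that(1)]
    unfolding Nb[OF that(2)] Nb[OF dilation_average_integrable[OF that]] by (simp add: nn_integral_eq_integral)
  show "N (\<lambda>x. f x + g x) \<le> N f + N g" if f: "integrable lborel f" and g: "integrable lborel g" for f g
  proof -
    have "N (\<lambda>x. f x + g x) \<le> (\<integral>\<^sup>+x. cone_maximal \<Gamma> \<psi> f x + cone_maximal \<Gamma> \<psi> g x \<partial>lborel)"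
      using f g by (subst Nb) (auto intro!: nn_integral_mono cone_maximal_add_le \<psi> \<Gamma>)
    also have "\<dots> = N f + N g" unfolding Nb[OF f] Nb[OF g] by (intro nn_integral_add cm f g)
    finally show ?thesis .
  qed
  show "N (\<lambda>x. c * f x) \<le> ennreal (norm c) * N f" if f: "integrable lborel f" for c f
  proof -
    have "N (\<lambda>x. c * f x) \<le> (\<integral>\<^sup>+x. ennreal (norm c) * cone_maximal \<Gamma> \<psi> f x \<partial>lborel)"
      using f by (subst Nb) (auto intro!: nn_integral_mono cone_maximal_cmult_le)
    also have "\<dots> = ennreal (norm c) * N f" unfolding Nb[OF f] by (intro nn_integral_cmult cm f)
    finally show ?thesis .
  qed
  show "N f = N g" if "g \<in> borel_measurable borel" "AE x in lborel. f x = g x" for f g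
    using N[OF that] N[OF that(1) AE_I2[OF refl]] by simp
  show "N odd_bump < \<infinity>" unfolding Nb[OF bi] by (rule cone_maximal_norm_bump_finite[OF \<psi>(1) \<Gamma>])
  show "0 < norm (LINT x|lborel. \<psi> x)" using \<psi>(2) by simp
  show "ennreal (norm (LINT x|lborel. \<psi> x)) * L1_norm f \<le> N f"
    if "integrable lborel f" "continuous_on UNIV f" "\<And>x. norm (f x) \<le> B" for f B
  proof -
    have [measurable]: "f \<in> borel_measurable borel" using that(1) by auto
    have "ennreal (norm (LINT x|lborel. \<psi> x)) * L1_norm f = (\<integral>\<^sup>+x. ennreal (norm (LINT x|lborel. \<psi> x)) * ennreal (norm (f x)) \<partial>lborel)"
      unfolding L1_norm_lborel by (rule nn_integral_cmult[symmetric]) measurable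
    also have "\<dots> \<le> N f"
      unfolding Nb[OF that(1)] by (intro nn_integral_mono cone_maximal_ge[OF \<psi>(1) \<Gamma> that(2,3)])
    finally show ?thesis .
  qed
qed

lemma atomic_operator_norm_hausdorff_op:
  assumes \<phi>: "set_integrable lebesgue {0<..} \<phi>" "AE t in lebesgue. 0 < t \<longrightarrow> 0 \<le> \<phi> t" and \<Phi>: "decaying_kernel \<Phi>"
  shows "operator_norm (hardy_H1 \<Phi>) atomic_norm (hausdorff_op \<phi>) = ennreal (LINT t:{0<..}|lebesgue. \<phi> t)"
proof (rule operator_norm_hausdorff_op[OF \<phi>])
  have m: "f \<in> borel_measurable lebesgue" if "integrable lborel f" for f :: "real \<Rightarrow> complex"
    using that by (intro measurable_completion) auto
  show "integrable lebesgue f" if "f \<in> hardy_H1 \<Phi>" for f using that unfolding hardy_H1_def by simp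
  show "(\<lambda>x. c * dilation_average k odd_bump x) \<in> hardy_H1 \<Phi>" if "half_line_kernel k" for k c
    by (rule average_in_hardy_H1[OF \<Phi> that])
  show "atomic_norm (dilation_average k f) \<le> ennreal (LINT t|lborel. \<bar>k t\<bar>) * atomic_norm f"
    if "half_line_kernel k" "integrable lborel f" for k f
    by (rule atomic_norm_dilation_average_le[OF that])
  show "atomic_norm (\<lambda>x. f x + g x) \<le> atomic_norm f + atomic_norm g" if "integrable lborel f" "integrable lborel g" for f g
    by (intro atomic_norm_add_le m that)
  show "atomic_norm (\<lambda>x. c * f x) \<le> ennreal (norm c) * atomic_norm f" if "integrable lborel f" for c f
    by (intro atomic_norm_cmult_le m that)
  show "atomic_norm f = atomic_norm g" if "AE x in lborel. f x = g x" for f g by (rule atomic_norm_cong_AE[OF that])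
  show "atomic_norm odd_bump < \<infinity>" by (rule bump_atomic_norm_finite)
  show "ennreal 1 * L1_norm f \<le> atomic_norm f" if "integrable lborel f" for f
    using L1_norm_le_atomic_norm[OF m[OF that]] by simp
qed simp

lemma hilbert_operator_norm_hausdorff_op:
  assumes \<phi>: "set_integrable lebesgue {0<..} \<phi>" "AE t in lebesgue. 0 < t \<longrightarrow> 0 \<le> \<phi> t" and \<Phi>: "decaying_kernel \<Phi>"
  shows "operator_norm (hardy_H1 \<Phi>) hilbert_norm (hausdorff_op \<phi>) = ennreal (LINT t:{0<..}|lebesgue. \<phi> t)"
proof (rule operator_norm_hausdorff_op[OF \<phi>])
  show "integrable lebesgue f" if "f \<in> hardy_H1 \<Phi>" for f using that unfolding hardy_H1_def by simp
  show "(\<lambda>x. c * dilation_average k odd_bump x) \<in> hardy_H1 \<Phi>" if "half_line_kernel k" for k c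
    by (rule average_in_hardy_H1[OF \<Phi> that])
  show "hilbert_norm (dilation_average k f) \<le> ennreal (LINT t|lborel. \<bar>k t\<bar>) * hilbert_norm f"
    if "half_line_kernel k" "integrable lborel f" "hilbert_norm f < \<infinity>" for k f
    by (rule hilbert_norm_dilation_average_le[OF that])
  show "hilbert_norm (\<lambda>x. f x + g x) \<le> hilbert_norm f + hilbert_norm g" if "integrable lborel f" "integrable lborel g" for f g
    by (rule hilbert_norm_add_le[OF that])
  show "hilbert_norm (\<lambda>x. c * f x) \<le> ennreal (norm c) * hilbert_norm f" if "integrable lborel f" for c f
    by (rule hilbert_norm_cmult_le[OF that])
  show "hilbert_norm f = hilbert_norm g" if "g \<in> borel_measurable borel" "AE x in lborel. f x = g x" for f g
    using hilbert_norm_eq[OF that] hilbert_norm_eq[OF that(1) AE_I2[OF refl]] by simp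
  show "hilbert_norm odd_bump < \<infinity>" by (rule bump_hilbert_norm_finite)
  show "ennreal 1 * L1_norm f \<le> hilbert_norm f" for f unfolding hilbert_norm_def by simp
qed simp

theorem theorem3p2:
  fixes \<phi> :: "real \<Rightarrow> real"
    and \<Phi> \<psi> :: "real \<Rightarrow> complex"
    and N :: "(real \<Rightarrow> complex) \<Rightarrow> ennreal"
  assumes "set_integrable lebesgue {0<..} \<phi>"
    and "AE t in lebesgue. 0 < t \<longrightarrow> 0 \<le> \<phi> t"
    and "schwartz \<Phi>" and "(LINT x|lebesgue. \<Phi> x) \<noteq> 0"
    and "schwartz \<psi> \<and> (LINT x|lebesgue. \<psi> x) \<noteq> 0 \<or> \<psi> = poisson_kernel"
    and "N = smooth_maximal_norm \<Phi> \<or> N = nontangential_maximal_norm \<psi> \<or>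
         N = atomic_norm \<or> N = hilbert_norm"
  shows "hausdorff_op \<phi> \<in> hardy_H1 \<Phi> \<rightarrow> hardy_H1 \<Phi> \<and>
         operator_norm (hardy_H1 \<Phi>) N (hausdorff_op \<phi>) = ennreal (LINT t:{0<..}|lebesgue. \<phi> t)"
proof
  have \<Phi>: "decaying_kernel \<Phi>" by (rule schwartz_decaying_kernel[OF assms(3)])
  have \<psi>: "decaying_kernel \<psi>" using assms(5) schwartz_decaying_kernel poisson_decaying_kernel by blast
  have lebesgue: "(LINT x|lebesgue. \<eta> x) = (LINT x|lborel. \<eta> x)" if "decaying_kernel \<eta>" for \<eta>
    by (rule lebesgue_integral_borel_rep[OF decaying_kernelD(2)[OF that]]) simp
  have \<Phi>0: "(LINT x|lborel. \<Phi> x) \<noteq> 0" using assms(4) lebesgue[OF \<Phi>] by simp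
  have \<psi>0: "(LINT x|lborel. \<psi> x) \<noteq> 0" using assms(5) lebesgue[OF \<psi>] poisson_integral_nonzero by auto
  show "hausdorff_op \<phi> \<in> hardy_H1 \<Phi> \<rightarrow> hardy_H1 \<Phi>"
    using hausdorff_op_hardy_H1[OF assms(1,2) \<Phi>] by blast
  from assms(6) show "operator_norm (hardy_H1 \<Phi>) N (hausdorff_op \<phi>) = ennreal (LINT t:{0<..}|lebesgue. \<phi> t)"
  proof (elim disjE)
    assume N: "N = smooth_maximal_norm \<Phi>"
    show ?thesis
      unfolding N using smooth_maximal_norm_eq[OF \<Phi>]
      by (rule maximal_operator_norm_hausdorff_op[OF assms(1,2) \<Phi> \<Phi> \<Phi>0 aperture_vertical_rays])
  next
    assume N: "N = nontangential_maximal_norm \<psi>"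
    show ?thesis
      unfolding N using nontangential_maximal_norm_eq[OF \<psi>]
      by (rule maximal_operator_norm_hausdorff_op[OF assms(1,2) \<Phi> \<psi> \<psi>0 aperture_unit_cone])
  next
    assume "N = atomic_norm"
    then show ?thesis using atomic_operator_norm_hausdorff_op[OF assms(1,2) \<Phi>] by simp
  next
    assume "N = hilbert_norm"
    then show ?thesis using hilbert_operator_norm_hausdorff_op[OF assms(1,2) \<Phi>] by simp
  qed
qed

end
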